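(* For each $m\ge2$, the $\Sigma^1_1$-definable (equivalently, the $\Sigma^B_1$-definable) functions of $V^0(m)$ are precisely the functions in $\mathrm{FAC}^0(m)$, and the $\Sigma^1_1$-definable (equivalently $\Sigma^B_1$-definable) functions of $V\!ACC$ are precisely the functions in $\mathrm{FACC}$.
   Context: Two-sorted logic with number and string variables (strings intended as finite subsets of $\mathbb N$), vocabulary $\mathcal L^2_A=\{0,1,+,\cdot,|\cdot|,\in,\le,=_1,=_2\}$, $|X|$ intended as $1+\max X$. $\Sigma^B_0$: no string quantifiers, bounded number quantifiers; $\Sigma^B_1$ / $\Sigma^1_1$: $\Sigma^B_0$ preceded by bounded / unbounded existential string quantifiers. $V^0$: basic axioms B1–B12 for $0,1,+,\cdot,\le$ (including $x\ne0\supset\exists y<x(y+1=x)$), L1 $X(y)\supset y<|X|$, L2 $y+1=|X|\supset X(y)$, extensionality $X=Y\leftrightarrow[|X|=|Y|\wedge\forall z<|X|(X(z)\leftrightarrow Y(z))]$, $\Sigma^B_0$-comprehension $\exists X\le a\forall z<a(X(z)\leftrightarrow\varphi(z))$. Pairing $\langle x,y\rangle=(x+y)(x+y+1)+2y$, $Y(z,y)$ means $Y(\langle z,y\rangle)$. For $m\ge2$ (as a numeral), $\varphi(y\bmod m)$ abbreviates $\exists r<m\exists q\le y(y=qm+r\wedge\varphi(r))$, and $\varphi_{\mathrm{MOD}_m}(X,Y)$ is $[\forall z\le|X|\exists!y<m\,Y(z,y)]\wedge Y(0,0)\wedge\forall z<|X|\forall y<m(Y(z,y)\supset[(X(z)\supset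 Y(z+1,y+1\bmod m))\wedge(\neg X(z)\supset Y(z+1,y))])$. $\mathrm{MOD}_m$ is $\forall X\exists Y\varphi_{\mathrm{MOD}_m}(X,Y)$; $V^0(m)=V^0\cup\{\mathrm{MOD}_m\}$; $V\!ACC=V^0\cup\{\mathrm{MOD}_m:m\ge2\}$. A function $F$ is $\Phi$-definable in $T$ if for some $\Phi$ formula $\varphi$, $Y=F(\vec x,\vec X)\leftrightarrow\varphi(\vec x,\vec X,Y)$ (intended interpretation) and $T\vdash\forall\vec x\forall\vec X\exists!Y\varphi$. $\mathrm{mod}_m(z,X)=|\{x\in X:x<z\}|\bmod m$; $\mathrm{AC}^0(m)$ is the class of relations $\mathrm{AC}^0$-reducible to $\mathrm{mod}_m$ (i.e. represented by a $\Sigma^B_0$ formula over $\mathrm{mod}_m$ and a finite chain of p-bounded string functions each with bit graph $\Sigma^B_0$-definable from $\mathrm{mod}_m$ and the earlier ones); $\mathrm{FAC}^0(m)$ is the class of p-bounded number functions with graph in $\mathrm{AC}^0(m)$ and p-bounded string functions with bit graph in $\mathrm{AC}^0(m)$; $\mathrm{FACC}=\bigcup_{m\ge2}\mathrm{FAC}^0(m)$. *)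

theory Defs
  imports Main
begin

text \<open>Number terms and string terms.  NFun and SFun are extra function symbols
(used only for the languages of AC0(m)-reductions); the pure L2A terms contain none.\<close>

datatype nterm = NVar nat | Zero | One | Plus nterm nterm | Times nterm nterm
  | Len sterm | NFun nat "nterm list" "sterm list"
and sterm = SVar nat | SFun nat "nterm list" "sterm list"

datatype form = Bot | Eq1 nterm nterm | Le nterm nterm | Mem nterm sterm | Eq2 sterm sterm
  | Imp form form | AllN nat form | AllS nat form

definition Not :: "form \<Rightarrow> form" where "Not \<phi> = Imp \<phi> Bot"
definition Or :: "form \<Rightarrow> form \<Rightarrow> form" where "Or \<phi> \<psi> = Imp (Not \<phi>) \<psi>"
definition And :: "form \<Rightarrow> form \<Rightarrow> form" where "And \<phi> \<psi> = Not (Imp \<phi> (Not \<psi>))"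
definition Iff :: "form \<Rightarrow> form \<Rightarrow> form" where "Iff \<phi> \<psi> = And (Imp \<phi> \<psi>) (Imp \<psi> \<phi>)"
definition ExN :: "nat \<Rightarrow> form \<Rightarrow> form" where "ExN x \<phi> = Not (AllN x (Not \<phi>))"
definition ExS :: "nat \<Rightarrow> form \<Rightarrow> form" where "ExS X \<phi> = Not (AllS X (Not \<phi>))"
definition Lt :: "nterm \<Rightarrow> nterm \<Rightarrow> form" where "Lt s t = And (Le s t) (Not (Eq1 s t))"

text \<open>Bounded number quantifiers (x must not occur in t for the Sigma-B-0 class).\<close>
definition AllLe :: "nat \<Rightarrow> nterm \<Rightarrow> form \<Rightarrow> form" where
  "AllLe x t \<phi> = AllN x (Imp (Le (NVar x) t) \<phi>)"
definition ExLe :: "nat \<Rightarrow> nterm \<Rightarrow> form \<Rightarrow> form" where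
  "ExLe x t \<phi> = Not (AllLe x t (Not \<phi>))"
definition AllLt :: "nat \<Rightarrow> nterm \<Rightarrow> form \<Rightarrow> form" where
  "AllLt x t \<phi> = AllLe x t (Imp (Not (Eq1 (NVar x) t)) \<phi>)"
definition ExLt :: "nat \<Rightarrow> nterm \<Rightarrow> form \<Rightarrow> form" where
  "ExLt x t \<phi> = Not (AllLt x t (Not \<phi>))"
definition ExSb :: "nat \<Rightarrow> nterm \<Rightarrow> form \<Rightarrow> form" where
  "ExSb X t \<phi> = ExS X (And (Le (Len (SVar X)) t) \<phi>)"

primrec fvNn :: "nterm \<Rightarrow> nat set" and fvNs :: "sterm \<Rightarrow> nat set" where
  "fvNn (NVar x) = {x}"
| "fvNn Zero = {}"
| "fvNn One = {}"
| "fvNn (Plus s t) = fvNn s \<union> fvNn t"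
| "fvNn (Times s t) = fvNn s \<union> fvNn t"
| "fvNn (Len T) = fvNs T"
| "fvNn (NFun f ts Ss) = \<Union>(set (map fvNn ts)) \<union> \<Union>(set (map fvNs Ss))"
| "fvNs (SVar X) = {}"
| "fvNs (SFun f ts Ss) = \<Union>(set (map fvNn ts)) \<union> \<Union>(set (map fvNs Ss))"

primrec fvSn :: "nterm \<Rightarrow> nat set" and fvSs :: "sterm \<Rightarrow> nat set" where
  "fvSn (NVar x) = {}"
| "fvSn Zero = {}"
| "fvSn One = {}"
| "fvSn (Plus s t) = fvSn s \<union> fvSn t"
| "fvSn (Times s t) = fvSn s \<union> fvSn t"
| "fvSn (Len T) = fvSs T"
| "fvSn (NFun f ts Ss) = \<Union>(set (map fvSn ts)) \<union> \<Union>(set (map fvSs Ss))"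
| "fvSs (SVar X) = {X}"
| "fvSs (SFun f ts Ss) = \<Union>(set (map fvSn ts)) \<union> \<Union>(set (map fvSs Ss))"

primrec pureN :: "nterm \<Rightarrow> bool" and pureS :: "sterm \<Rightarrow> bool" where
  "pureN (NVar x) = True"
| "pureN Zero = True"
| "pureN One = True"
| "pureN (Plus s t) = (pureN s \<and> pureN t)"
| "pureN (Times s t) = (pureN s \<and> pureN t)"
| "pureN (Len T) = pureS T"
| "pureN (NFun f ts Ss) = False"
| "pureS (SVar X) = True"
| "pureS (SFun f ts Ss) = False"

primrec sbNn :: "nat \<Rightarrow> nterm \<Rightarrow> nterm \<Rightarrow> nterm" and sbNs :: "nat \<Rightarrow> nterm \<Rightarrow> sterm \<Rightarrow> sterm" where
  "sbNn x u (NVar y) = (if y = x then u else NVar y)"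
| "sbNn x u Zero = Zero"
| "sbNn x u One = One"
| "sbNn x u (Plus s t) = Plus (sbNn x u s) (sbNn x u t)"
| "sbNn x u (Times s t) = Times (sbNn x u s) (sbNn x u t)"
| "sbNn x u (Len T) = Len (sbNs x u T)"
| "sbNn x u (NFun f ts Ss) = NFun f (map (sbNn x u) ts) (map (sbNs x u) Ss)"
| "sbNs x u (SVar X) = SVar X"
| "sbNs x u (SFun f ts Ss) = SFun f (map (sbNn x u) ts) (map (sbNs x u) Ss)"

primrec sbSn :: "nat \<Rightarrow> nat \<Rightarrow> nterm \<Rightarrow> nterm" and sbSs :: "nat \<Rightarrow> nat \<Rightarrow> sterm \<Rightarrow> sterm" where
  "sbSn X Y (NVar y) = NVar y"
| "sbSn X Y Zero = Zero"
| "sbSn X Y One = One"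
| "sbSn X Y (Plus s t) = Plus (sbSn X Y s) (sbSn X Y t)"
| "sbSn X Y (Times s t) = Times (sbSn X Y s) (sbSn X Y t)"
| "sbSn X Y (Len T) = Len (sbSs X Y T)"
| "sbSn X Y (NFun f ts Ss) = NFun f (map (sbSn X Y) ts) (map (sbSs X Y) Ss)"
| "sbSs X Y (SVar Z) = (if Z = X then SVar Y else SVar Z)"
| "sbSs X Y (SFun f ts Ss) = SFun f (map (sbSn X Y) ts) (map (sbSs X Y) Ss)"

primrec fvN :: "form \<Rightarrow> nat set" where
  "fvN Bot = {}"
| "fvN (Eq1 s t) = fvNn s \<union> fvNn t"
| "fvN (Le s t) = fvNn s \<union> fvNn t"
| "fvN (Mem t T) = fvNn t \<union> fvNs T"
| "fvN (Eq2 S T) = fvNs S \<union> fvNs T"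
| "fvN (Imp \<phi> \<psi>) = fvN \<phi> \<union> fvN \<psi>"
| "fvN (AllN x \<phi>) = fvN \<phi> - {x}"
| "fvN (AllS X \<phi>) = fvN \<phi>"

primrec fvS :: "form \<Rightarrow> nat set" where
  "fvS Bot = {}"
| "fvS (Eq1 s t) = fvSn s \<union> fvSn t"
| "fvS (Le s t) = fvSn s \<union> fvSn t"
| "fvS (Mem t T) = fvSn t \<union> fvSs T"
| "fvS (Eq2 S T) = fvSs S \<union> fvSs T"
| "fvS (Imp \<phi> \<psi>) = fvS \<phi> \<union> fvS \<psi>"
| "fvS (AllN x \<phi>) = fvS \<phi>"
| "fvS (AllS X \<phi>) = fvS \<phi> - {X}"

primrec allN :: "form \<Rightarrow> nat set" where
  "allN Bot = {}"
| "allN (Eq1 s t) = fvNn s \<union> fvNn t"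
| "allN (Le s t) = fvNn s \<union> fvNn t"
| "allN (Mem t T) = fvNn t \<union> fvNs T"
| "allN (Eq2 S T) = fvNs S \<union> fvNs T"
| "allN (Imp \<phi> \<psi>) = allN \<phi> \<union> allN \<psi>"
| "allN (AllN x \<phi>) = insert x (allN \<phi>)"
| "allN (AllS X \<phi>) = allN \<phi>"

primrec allS :: "form \<Rightarrow> nat set" where
  "allS Bot = {}"
| "allS (Eq1 s t) = fvSn s \<union> fvSn t"
| "allS (Le s t) = fvSn s \<union> fvSn t"
| "allS (Mem t T) = fvSn t \<union> fvSs T"
| "allS (Eq2 S T) = fvSs S \<union> fvSs T"
| "allS (Imp \<phi> \<psi>) = allS \<phi> \<union> allS \<psi>"
| "allS (AllN x \<phi>) = allS \<phi>"
| "allS (AllS X \<phi>) = insert X (allS \<phi>)"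

primrec pureF :: "form \<Rightarrow> bool" where
  "pureF Bot = True"
| "pureF (Eq1 s t) = (pureN s \<and> pureN t)"
| "pureF (Le s t) = (pureN s \<and> pureN t)"
| "pureF (Mem t T) = (pureN t \<and> pureS T)"
| "pureF (Eq2 S T) = (pureS S \<and> pureS T)"
| "pureF (Imp \<phi> \<psi>) = (pureF \<phi> \<and> pureF \<psi>)"
| "pureF (AllN x \<phi>) = pureF \<phi>"
| "pureF (AllS X \<phi>) = pureF \<phi>"

primrec sbN :: "nat \<Rightarrow> nterm \<Rightarrow> form \<Rightarrow> form" where
  "sbN x u Bot = Bot"
| "sbN x u (Eq1 s t) = Eq1 (sbNn x u s) (sbNn x u t)"
| "sbN x u (Le s t) = Le (sbNn x u s) (sbNn x u t)"
| "sbN x u (Mem t T) = Mem (sbNn x u t) (sbNs x u T)"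
| "sbN x u (Eq2 S T) = Eq2 (sbNs x u S) (sbNs x u T)"
| "sbN x u (Imp \<phi> \<psi>) = Imp (sbN x u \<phi>) (sbN x u \<psi>)"
| "sbN x u (AllN y \<phi>) = (if y = x then AllN y \<phi> else AllN y (sbN x u \<phi>))"
| "sbN x u (AllS Y \<phi>) = AllS Y (sbN x u \<phi>)"

primrec sbS :: "nat \<Rightarrow> nat \<Rightarrow> form \<Rightarrow> form" where
  "sbS X Y Bot = Bot"
| "sbS X Y (Eq1 s t) = Eq1 (sbSn X Y s) (sbSn X Y t)"
| "sbS X Y (Le s t) = Le (sbSn X Y s) (sbSn X Y t)"
| "sbS X Y (Mem t T) = Mem (sbSn X Y t) (sbSs X Y T)"
| "sbS X Y (Eq2 S T) = Eq2 (sbSs X Y S) (sbSs X Y T)"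
| "sbS X Y (Imp \<phi> \<psi>) = Imp (sbS X Y \<phi>) (sbS X Y \<psi>)"
| "sbS X Y (AllN y \<phi>) = AllN y (sbS X Y \<phi>)"
| "sbS X Y (AllS Z \<phi>) = (if Z = X then AllS Z \<phi> else AllS Z (sbS X Y \<phi>))"

primrec freeN :: "nterm \<Rightarrow> nat \<Rightarrow> form \<Rightarrow> bool" where
  "freeN u x Bot = True"
| "freeN u x (Eq1 s t) = True"
| "freeN u x (Le s t) = True"
| "freeN u x (Mem t T) = True"
| "freeN u x (Eq2 S T) = True"
| "freeN u x (Imp \<phi> \<psi>) = (freeN u x \<phi> \<and> freeN u x \<psi>)"
| "freeN u x (AllN y \<phi>) = (x \<notin> fvN (AllN y \<phi>) \<or> (y \<notin> fvNn u \<and> freeN u x \<phi>))"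
| "freeN u x (AllS Y \<phi>) = (x \<notin> fvN (AllS Y \<phi>) \<or> (Y \<notin> fvSn u \<and> freeN u x \<phi>))"

primrec freeS :: "nat \<Rightarrow> nat \<Rightarrow> form \<Rightarrow> bool" where
  "freeS Y X Bot = True"
| "freeS Y X (Eq1 s t) = True"
| "freeS Y X (Le s t) = True"
| "freeS Y X (Mem t T) = True"
| "freeS Y X (Eq2 S T) = True"
| "freeS Y X (Imp \<phi> \<psi>) = (freeS Y X \<phi> \<and> freeS Y X \<psi>)"
| "freeS Y X (AllN y \<phi>) = freeS Y X \<phi>"
| "freeS Y X (AllS Z \<phi>) = (X \<notin> fvS (AllS Z \<phi>) \<or> (Z \<noteq> Y \<and> freeS Y X \<phi>))"

definition slen :: "nat set \<Rightarrow> nat" where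
  "slen A = (if A = {} then 0 else Suc (Max A))"

type_synonym interp =
  "(nat \<Rightarrow> nat list \<Rightarrow> nat set list \<Rightarrow> nat) \<times> (nat \<Rightarrow> nat list \<Rightarrow> nat set list \<Rightarrow> nat set)"

primrec evn :: "interp \<Rightarrow> (nat \<Rightarrow> nat) \<Rightarrow> (nat \<Rightarrow> nat set) \<Rightarrow> nterm \<Rightarrow> nat"
  and evs :: "interp \<Rightarrow> (nat \<Rightarrow> nat) \<Rightarrow> (nat \<Rightarrow> nat set) \<Rightarrow> sterm \<Rightarrow> nat set" where
  "evn I na sa (NVar x) = na x"
| "evn I na sa Zero = 0"
| "evn I na sa One = 1"
| "evn I na sa (Plus s t) = evn I na sa s + evn I na sa t"
| "evn I na sa (Times s t) = evn I na sa s * evn I na sa t"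
| "evn I na sa (Len T) = slen (evs I na sa T)"
| "evn I na sa (NFun f ts Ss) = fst I f (map (evn I na sa) ts) (map (evs I na sa) Ss)"
| "evs I na sa (SVar X) = sa X"
| "evs I na sa (SFun f ts Ss) = snd I f (map (evn I na sa) ts) (map (evs I na sa) Ss)"

primrec evf :: "interp \<Rightarrow> (nat \<Rightarrow> nat) \<Rightarrow> (nat \<Rightarrow> nat set) \<Rightarrow> form \<Rightarrow> bool" where
  "evf I na sa Bot = False"
| "evf I na sa (Eq1 s t) = (evn I na sa s = evn I na sa t)"
| "evf I na sa (Le s t) = (evn I na sa s \<le> evn I na sa t)"
| "evf I na sa (Mem t T) = (evn I na sa t \<in> evs I na sa T)"
| "evf I na sa (Eq2 S T) = (evs I na sa S = evs I na sa T)"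
| "evf I na sa (Imp \<phi> \<psi>) = (evf I na sa \<phi> \<longrightarrow> evf I na sa \<psi>)"
| "evf I na sa (AllN x \<phi>) = (\<forall>n. evf I (na(x := n)) sa \<phi>)"
| "evf I na sa (AllS X \<phi>) = (\<forall>A. finite A \<longrightarrow> evf I na (sa(X := A)) \<phi>)"

text \<open>Interpretation for pure L2A formulas (function symbols do not occur).\<close>
definition I0 :: interp where "I0 = (\<lambda>_ _ _. 0, \<lambda>_ _ _. {})"

definition nenv :: "nat list \<Rightarrow> nat \<Rightarrow> nat" where
  "nenv xs i = (if i < length xs then xs ! i else 0)"
definition senv :: "nat set list \<Rightarrow> nat \<Rightarrow> nat set" where
  "senv Xs i = (if i < length Xs then Xs ! i else {})"

inductive sigB0 :: "form \<Rightarrow> bool" where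
  "sigB0 Bot"
| "sigB0 (Eq1 s t)"
| "sigB0 (Le s t)"
| "sigB0 (Mem t T)"
| "sigB0 (Eq2 S T)"
| "sigB0 \<phi> \<Longrightarrow> sigB0 \<psi> \<Longrightarrow> sigB0 (Imp \<phi> \<psi>)"
| "sigB0 \<phi> \<Longrightarrow> x \<notin> fvNn t \<Longrightarrow> sigB0 (AllLe x t \<phi>)"

inductive sigB1 :: "form \<Rightarrow> bool" where
  "sigB0 \<phi> \<Longrightarrow> sigB1 \<phi>"
| "sigB1 \<phi> \<Longrightarrow> X \<notin> fvSn t \<Longrightarrow> sigB1 (ExSb X t \<phi>)"

inductive sig11 :: "form \<Rightarrow> bool" where
  "sigB0 \<phi> \<Longrightarrow> sig11 \<phi>"
| "sig11 \<phi> \<Longrightarrow> sig11 (ExS X \<phi>)"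

text \<open>Members of a theory are read as their universal closures (generalization is unrestricted).\<close>
inductive prv :: "form set \<Rightarrow> form \<Rightarrow> bool" for T :: "form set" where
  Ax: "\<phi> \<in> T \<Longrightarrow> prv T \<phi>"
| A1: "pureF \<phi> \<Longrightarrow> pureF \<psi> \<Longrightarrow> prv T (Imp \<phi> (Imp \<psi> \<phi>))"
| A2: "pureF \<phi> \<Longrightarrow> pureF \<psi> \<Longrightarrow> pureF \<chi> \<Longrightarrow>
       prv T (Imp (Imp \<phi> (Imp \<psi> \<chi>)) (Imp (Imp \<phi> \<psi>) (Imp \<phi> \<chi>)))"
| A3: "pureF \<phi> \<Longrightarrow> prv T (Imp (Imp (Imp \<phi> Bot) Bot) \<phi>)"
| Q1N: "pureF \<phi> \<Longrightarrow> pureN u \<Longrightarrow> freeN u x \<phi> \<Longrightarrow> prv T (Imp (AllN x \<phi>) (sbN x u \<phi>))"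
| Q1S: "pureF \<phi> \<Longrightarrow> freeS Y X \<phi> \<Longrightarrow> prv T (Imp (AllS X \<phi>) (sbS X Y \<phi>))"
| Q2N: "pureF \<phi> \<Longrightarrow> pureF \<psi> \<Longrightarrow> x \<notin> fvN \<phi> \<Longrightarrow>
       prv T (Imp (AllN x (Imp \<phi> \<psi>)) (Imp \<phi> (AllN x \<psi>)))"
| Q2S: "pureF \<phi> \<Longrightarrow> pureF \<psi> \<Longrightarrow> X \<notin> fvS \<phi> \<Longrightarrow>
       prv T (Imp (AllS X (Imp \<phi> \<psi>)) (Imp \<phi> (AllS X \<psi>)))"
| E1N: "prv T (Eq1 (NVar x) (NVar x))"
| E1S: "prv T (Eq2 (SVar X) (SVar X))"
| E2N: "pureF \<phi> \<Longrightarrow> freeN (NVar y) x \<phi> \<Longrightarrow>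
       prv T (Imp (Eq1 (NVar x) (NVar y)) (Imp \<phi> (sbN x (NVar y) \<phi>)))"
| E2S: "pureF \<phi> \<Longrightarrow> freeS Y X \<phi> \<Longrightarrow>
       prv T (Imp (Eq2 (SVar X) (SVar Y)) (Imp \<phi> (sbS X Y \<phi>)))"
| MP: "prv T (Imp \<phi> \<psi>) \<Longrightarrow> prv T \<phi> \<Longrightarrow> prv T \<psi>"
| GenN: "prv T \<phi> \<Longrightarrow> prv T (AllN x \<phi>)"
| GenS: "prv T \<phi> \<Longrightarrow> prv T (AllS X \<phi>)"

abbreviation "vx \<equiv> NVar 0"
abbreviation "vy \<equiv> NVar 1"
abbreviation "vz \<equiv> NVar 2"
abbreviation "vX \<equiv> SVar 0"
abbreviation "vY \<equiv> SVar 1"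

definition basic_axioms :: "form set" where
  "basic_axioms = {
     Not (Eq1 (Plus vx One) Zero),
     Imp (Eq1 (Plus vx One) (Plus vy One)) (Eq1 vx vy),
     Eq1 (Plus vx Zero) vx,
     Eq1 (Plus vx (Plus vy One)) (Plus (Plus vx vy) One),
     Eq1 (Times vx Zero) Zero,
     Eq1 (Times vx (Plus vy One)) (Plus (Times vx vy) vx),
     Imp (And (Le vx vy) (Le vy vx)) (Eq1 vx vy),
     Le vx (Plus vx vy),
     Le Zero vx,
     Or (Le vx vy) (Le vy vx),
     Iff (Le vx vy) (Lt vx (Plus vy One)),
     Imp (Not (Eq1 vx Zero)) (ExLt 1 vx (Eq1 (Plus vy One) vx)),
     Imp (Mem vy vX) (Lt vy (Len vX)),
     Imp (Eq1 (Plus vy One) (Len vX)) (Mem vy vX),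
     Iff (Eq2 vX vY) (And (Eq1 (Len vX) (Len vY))
          (AllLt 2 (Len vX) (Iff (Mem vz vX) (Mem vz vY))))}"

definition comp_axioms :: "form set" where
  "comp_axioms = {ExSb X (NVar a) (AllLt z (NVar a) (Iff (Mem (NVar z) (SVar X)) \<phi>)) | X a z \<phi>.
      sigB0 \<phi> \<and> pureF \<phi> \<and> X \<notin> fvS \<phi> \<and> z \<noteq> a}"

definition V0 :: "form set" where "V0 = basic_axioms \<union> comp_axioms"

primrec numeral_t :: "nat \<Rightarrow> nterm" where
  "numeral_t 0 = Zero"
| "numeral_t (Suc n) = Plus (numeral_t n) One"

definition pairt :: "nterm \<Rightarrow> nterm \<Rightarrow> nterm" where
  "pairt s t = Plus (Times (Plus s t) (Plus (Plus s t) One)) (Plus t t)"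

definition Ymem :: "nterm \<Rightarrow> nterm \<Rightarrow> form" where
  "Ymem s t = Mem (pairt s t) vY"

definition phiMOD :: "nat \<Rightarrow> form" where
  "phiMOD m = (let z = NVar 0; y = NVar 1; y' = NVar 2; r = NVar 3; q = NVar 4; mm = numeral_t m;
     exu = And (ExLt 1 mm (Ymem z y))
               (AllLt 1 mm (AllLt 2 mm (Imp (And (Ymem z y) (Ymem z y')) (Eq1 y y'))));
     succmod = ExLt 3 mm (ExLe 4 (Plus y One)
                 (And (Eq1 (Plus y One) (Plus (Times q mm) r)) (Ymem (Plus z One) r)))
   in And (AllLe 0 (Len vX) exu)
       (And (Ymem Zero Zero)
         (AllLt 0 (Len vX) (AllLt 1 mm
            (Imp (Ymem z y)
               (And (Imp (Mem z vX) succmod)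
                    (Imp (Not (Mem z vX)) (Ymem (Plus z One) y))))))))"

definition MODax :: "nat \<Rightarrow> form" where
  "MODax m = AllS 0 (ExS 1 (phiMOD m))"

definition V0m :: "nat \<Rightarrow> form set" where "V0m m = V0 \<union> {MODax m}"

definition VACC :: "form set" where "VACC = V0 \<union> {MODax m | m. m \<ge> 2}"

definition closeN :: "nat \<Rightarrow> form \<Rightarrow> form" where
  "closeN k \<phi> = foldr AllN [0..<k] \<phi>"
definition closeS :: "nat \<Rightarrow> form \<Rightarrow> form" where
  "closeS l \<phi> = foldr AllS [0..<l] \<phi>"

definition ExUS :: "nat \<Rightarrow> form \<Rightarrow> form" where
  "ExUS Y \<phi> = (let Z = Suc (Max (insert Y (allS \<phi>))) in
     And (ExS Y \<phi>) (AllS Y (AllS Z (Imp (And \<phi> (sbS Y Z \<phi>)) (Eq2 (SVar Y) (SVar Z))))))"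
definition ExUN :: "nat \<Rightarrow> form \<Rightarrow> form" where
  "ExUN y \<phi> = (let z = Suc (Max (insert y (allN \<phi>))) in
     And (ExN y \<phi>) (AllN y (AllN z (Imp (And \<phi> (sbN y (NVar z) \<phi>)) (Eq1 (NVar y) (NVar z))))))"

text \<open>A string function F with k number and l string arguments is cls-definable in T:
  number args are number vars 0..k-1, string args are string vars 0..l-1, output Y is string var l.\<close>
definition definableS :: "(form \<Rightarrow> bool) \<Rightarrow> form set \<Rightarrow> nat \<Rightarrow> nat \<Rightarrow>
    (nat list \<Rightarrow> nat set list \<Rightarrow> nat set) \<Rightarrow> bool" where
  "definableS cls T k l F = (\<exists>\<phi>. cls \<phi> \<and> pureF \<phi> \<and> fvN \<phi> \<subseteq> {..<k} \<and> fvS \<phi> \<subseteq> {..<Suc l} \<and>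
     (\<forall>xs Xs Y. length xs = k \<longrightarrow> length Xs = l \<longrightarrow> (\<forall>X\<in>set Xs. finite X) \<longrightarrow> finite Y \<longrightarrow>
        (Y = F xs Xs \<longleftrightarrow> evf I0 (nenv xs) (senv (Xs @ [Y])) \<phi>)) \<and>
     prv T (closeN k (closeS l (ExUS l \<phi>))))"

definition definableN :: "(form \<Rightarrow> bool) \<Rightarrow> form set \<Rightarrow> nat \<Rightarrow> nat \<Rightarrow>
    (nat list \<Rightarrow> nat set list \<Rightarrow> nat) \<Rightarrow> bool" where
  "definableN cls T k l f = (\<exists>\<phi>. cls \<phi> \<and> pureF \<phi> \<and> fvN \<phi> \<subseteq> {..<Suc k} \<and> fvS \<phi> \<subseteq> {..<l} \<and>
     (\<forall>xs Xs y. length xs = k \<longrightarrow> length Xs = l \<longrightarrow> (\<forall>X\<in>set Xs. finite X) \<longrightarrow>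
        (y = f xs Xs \<longleftrightarrow> evf I0 (nenv (xs @ [y])) (senv Xs) \<phi>)) \<and>
     prv T (closeN k (closeS l (ExUN k \<phi>))))"

definition mod_fn :: "nat \<Rightarrow> nat \<Rightarrow> nat set \<Rightarrow> nat" where
  "mod_fn m z X = card {x \<in> X. x < z} mod m"

fun polyterm :: "nterm \<Rightarrow> bool" where
  "polyterm (NVar x) = True"
| "polyterm Zero = True"
| "polyterm One = True"
| "polyterm (Plus s t) = (polyterm s \<and> polyterm t)"
| "polyterm (Times s t) = (polyterm s \<and> polyterm t)"
| "polyterm (Len T) = False"
| "polyterm (NFun f ts Ss) = False"

definition pbS :: "nat \<Rightarrow> nat \<Rightarrow> (nat list \<Rightarrow> nat set list \<Rightarrow> nat set) \<Rightarrow> bool" where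
  "pbS k l F = (\<exists>t. polyterm t \<and>
     (\<forall>xs Xs. length xs = k \<longrightarrow> length Xs = l \<longrightarrow> (\<forall>X\<in>set Xs. finite X) \<longrightarrow>
        finite (F xs Xs) \<and> slen (F xs Xs) \<le> evn I0 (nenv (xs @ map slen Xs)) (senv []) t))"

definition pbN :: "nat \<Rightarrow> nat \<Rightarrow> (nat list \<Rightarrow> nat set list \<Rightarrow> nat) \<Rightarrow> bool" where
  "pbN k l f = (\<exists>t. polyterm t \<and>
     (\<forall>xs Xs. length xs = k \<longrightarrow> length Xs = l \<longrightarrow> (\<forall>X\<in>set Xs. finite X) \<longrightarrow>
        f xs Xs \<le> evn I0 (nenv (xs @ map slen Xs)) (senv []) t))"

type_synonym sfun = "nat \<times> nat \<times> (nat list \<Rightarrow> nat set list \<Rightarrow> nat set)"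

text \<open>Well-formedness w.r.t. the signature {mod_m} plus string function symbols 0..n-1 with given sym_arities:
  the only number function symbol is NFun 0 = mod_m(z,X).\<close>
primrec wfn :: "(nat \<times> nat) list \<Rightarrow> nterm \<Rightarrow> bool" and wfs :: "(nat \<times> nat) list \<Rightarrow> sterm \<Rightarrow> bool" where
  "wfn ar (NVar x) = True"
| "wfn ar Zero = True"
| "wfn ar One = True"
| "wfn ar (Plus s t) = (wfn ar s \<and> wfn ar t)"
| "wfn ar (Times s t) = (wfn ar s \<and> wfn ar t)"
| "wfn ar (Len T) = wfs ar T"
| "wfn ar (NFun f ts Ss) = (f = 0 \<and> length ts = 1 \<and> length Ss = 1 \<and>
      list_all (wfn ar) ts \<and> list_all (wfs ar) Ss)"
| "wfs ar (SVar X) = True"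
| "wfs ar (SFun i ts Ss) = (i < length ar \<and> length ts = fst (ar ! i) \<and> length Ss = snd (ar ! i) \<and>
      list_all (wfn ar) ts \<and> list_all (wfs ar) Ss)"

primrec wff :: "(nat \<times> nat) list \<Rightarrow> form \<Rightarrow> bool" where
  "wff ar Bot = True"
| "wff ar (Eq1 s t) = (wfn ar s \<and> wfn ar t)"
| "wff ar (Le s t) = (wfn ar s \<and> wfn ar t)"
| "wff ar (Mem t T) = (wfn ar t \<and> wfs ar T)"
| "wff ar (Eq2 S T) = (wfs ar S \<and> wfs ar T)"
| "wff ar (Imp \<phi> \<psi>) = (wff ar \<phi> \<and> wff ar \<psi>)"
| "wff ar (AllN x \<phi>) = wff ar \<phi>"
| "wff ar (AllS X \<phi>) = wff ar \<phi>"

definition sym_arities :: "sfun list \<Rightarrow> (nat \<times> nat) list" where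
  "sym_arities Fs = map (\<lambda>(k, l, F). (k, l)) Fs"

definition Imod :: "nat \<Rightarrow> sfun list \<Rightarrow> interp" where
  "Imod m Fs = (\<lambda>f ns Ss. mod_fn m (hd ns) (hd Ss), \<lambda>i ns Ss. (case Fs ! i of (k, l, F) \<Rightarrow> F ns Ss))"

definition represents :: "nat \<Rightarrow> sfun list \<Rightarrow> nat \<Rightarrow> nat \<Rightarrow> (nat list \<Rightarrow> nat set list \<Rightarrow> bool) \<Rightarrow> bool" where
  "represents m Fs k l R = (\<exists>\<phi>. sigB0 \<phi> \<and> wff (sym_arities Fs) \<phi> \<and> fvN \<phi> \<subseteq> {..<k} \<and> fvS \<phi> \<subseteq> {..<l} \<and>
     (\<forall>xs Xs. length xs = k \<longrightarrow> length Xs = l \<longrightarrow> (\<forall>X\<in>set Xs. finite X) \<longrightarrow>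
        (R xs Xs \<longleftrightarrow> evf (Imod m Fs) (nenv xs) (senv Xs) \<phi>)))"

definition chain_ok :: "nat \<Rightarrow> sfun list \<Rightarrow> bool" where
  "chain_ok m Fs = (\<forall>i < length Fs. case Fs ! i of (k, l, F) \<Rightarrow>
     pbS k l F \<and> represents m (take i Fs) (Suc k) l (\<lambda>ys Xs. last ys \<in> F (butlast ys) Xs))"

definition AC0m :: "nat \<Rightarrow> nat \<Rightarrow> nat \<Rightarrow> (nat list \<Rightarrow> nat set list \<Rightarrow> bool) \<Rightarrow> bool" where
  "AC0m m k l R = (\<exists>Fs. chain_ok m Fs \<and> represents m Fs k l R)"

definition FAC0N :: "nat \<Rightarrow> nat \<Rightarrow> nat \<Rightarrow> (nat list \<Rightarrow> nat set list \<Rightarrow> nat) \<Rightarrow> bool" where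
  "FAC0N m k l f = (pbN k l f \<and> AC0m m (Suc k) l (\<lambda>ys Xs. last ys = f (butlast ys) Xs))"
definition FAC0S :: "nat \<Rightarrow> nat \<Rightarrow> nat \<Rightarrow> (nat list \<Rightarrow> nat set list \<Rightarrow> nat set) \<Rightarrow> bool" where
  "FAC0S m k l F = (pbS k l F \<and> AC0m m (Suc k) l (\<lambda>ys Xs. last ys \<in> F (butlast ys) Xs))"

definition FACCN :: "nat \<Rightarrow> nat \<Rightarrow> (nat list \<Rightarrow> nat set list \<Rightarrow> nat) \<Rightarrow> bool" where
  "FACCN k l f = (\<exists>m\<ge>2. FAC0N m k l f)"
definition FACCS :: "nat \<Rightarrow> nat \<Rightarrow> (nat list \<Rightarrow> nat set list \<Rightarrow> nat set) \<Rightarrow> bool" where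
  "FACCS k l F = (\<exists>m\<ge>2. FAC0S m k l F)"

end

(* A function of FAC^0(m) is computed by a straight-line program whose steps alternate a Sigma^B_0
comprehension with the counting table of the set just formed. In every model of V^0(m) each step has exactly
one solution, so "there is a run of the program with output Y" is a Sigma^B_1 definition, and its
unique existence is provable by completeness of the calculus.

Conversely, let the theory prove that phi defines a function. For an ultrafilter U on the assignments of
standard arguments, the ultrapower of the standard structure restricted to functions from FAC^0(m) is
a model of V^0(m): Los' theorem holds for bounded formulas because a least counterexample below a bound
is again in the class. The witness of phi at the generic arguments is then a function of the class
that is correct on a set of U, itself decidable in the class. By compactness finitely many such witnesses
cover all arguments, and definition by cases patches them together.

A proof in VACC uses finitely many axioms MOD_p, and counting modulo p reduces to counting modulo any
multiple of p. *)

theory Submission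
  imports Defs "HOL-Library.Countable" "HOL-Library.Countable_Set"
begin

text \<open>Derivations inside the theories are never written out: completeness is applied to
  V^0(m), soundness to the ultrapower. Two obstacles shape the rest. AC^0(m) is given by chains of
  functions, which are awkward for induction; they are replaced by the class \<open>MR\<close> of
  bounded formulas with a modular counting quantifier, which has an induction rule and is closed
  under composition, bounded search and case distinction. And a counting table gives the prefix
  counts of one set, whereas a counting quantifier below other quantifiers needs a count for every
  value of its parameters. All these sets are packed into one, in disjoint intervals, which is why
  programs are built for parameters below an explicit bound. For the ultrapower, Los' theorem for
  Sigma^B_0 formulas is enough, because every axiom becomes Sigma^B_0 and true pointwise once its
  existential string quantifier, if any, receives a value computed separately at each assignment.
  The class is only meaningful on finite strings, so the ultrafilters considered contain the set of
  all assignments with finite strings.\<close>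

instance sterm :: countable by countable_datatype
instance nterm :: countable by countable_datatype
instance form :: countable by countable_datatype

section \<open>Syntax and the intended interpretation\<close>

lemma finite_fv_term [simp]: "finite (fvNn t)" "finite (fvNs T)" "finite (fvSn t)" "finite (fvSs T)"
proof -
  show "finite (fvNn t)" "finite (fvNs T)"
    by (induction t and T rule: nterm.induct sterm.induct) auto
  show "finite (fvSn t)" "finite (fvSs T)"
    by (induction t and T rule: nterm.induct sterm.induct) auto
qed

lemma finite_vars [simp]: "finite (fvN \<phi>)" "finite (fvS \<phi>)" "finite (allN \<phi>)" "finite (allS \<phi>)"
  by (induction \<phi>) auto

lemma fv_subset_all: "fvN \<phi> \<subseteq> allN \<phi>" "fvS \<phi> \<subseteq> allS \<phi>"
  by (induction \<phi>) auto

section \<open>Derived connectives and dependence on free variables\<close>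

lemmas conn_defs = Not_def Or_def And_def Iff_def ExN_def ExS_def Lt_def AllLe_def ExLe_def
  AllLt_def ExLt_def ExSb_def

lemma pureF_conn [simp]:
  "pureF (Not a) = pureF a" "pureF (Or a b) = (pureF a \<and> pureF b)" "pureF (And a b) = (pureF a \<and> pureF b)"
  "pureF (Iff a b) = (pureF a \<and> pureF b)" "pureF (ExN x a) = pureF a" "pureF (ExS X a) = pureF a"
  "pureF (Lt s t) = (pureN s \<and> pureN t)" "pureF (AllLe x t a) = (pureN t \<and> pureF a)"
  "pureF (ExLe x t a) = (pureN t \<and> pureF a)" "pureF (AllLt x t a) = (pureN t \<and> pureF a)"
  "pureF (ExLt x t a) = (pureN t \<and> pureF a)" "pureF (ExSb X t a) = (pureN t \<and> pureF a)"
  by (auto simp: conn_defs)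

lemma wff_conn [simp]:
  "wff ar (Not a) = wff ar a" "wff ar (Or a b) = (wff ar a \<and> wff ar b)" "wff ar (And a b) = (wff ar a \<and> wff ar b)"
  "wff ar (Iff a b) = (wff ar a \<and> wff ar b)"
  "wff ar (Lt s t) = (wfn ar s \<and> wfn ar t)" "wff ar (AllLe x t a) = (wfn ar t \<and> wff ar a)"
  "wff ar (ExLe x t a) = (wfn ar t \<and> wff ar a)" "wff ar (AllLt x t a) = (wfn ar t \<and> wff ar a)"
  "wff ar (ExLt x t a) = (wfn ar t \<and> wff ar a)"
  by (auto simp: conn_defs)

lemma fvN_conn [simp]:
  "fvN (Not a) = fvN a" "fvN (Or a b) = fvN a \<union> fvN b" "fvN (And a b) = fvN a \<union> fvN b"
  "fvN (Iff a b) = fvN a \<union> fvN b" "fvN (ExN x a) = fvN a - {x}" "fvN (ExS X a) = fvN a"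
  "fvN (Lt s t) = fvNn s \<union> fvNn t" "fvN (AllLe x t a) = fvNn t \<union> fvN a - {x}"
  "fvN (ExLe x t a) = fvNn t \<union> fvN a - {x}" "fvN (AllLt x t a) = fvNn t \<union> fvN a - {x}"
  "fvN (ExLt x t a) = fvNn t \<union> fvN a - {x}" "fvN (ExSb X t a) = fvNn t \<union> fvN a"
  by (auto simp: conn_defs)

lemma fvS_conn [simp]:
  "fvS (Not a) = fvS a" "fvS (Or a b) = fvS a \<union> fvS b" "fvS (And a b) = fvS a \<union> fvS b"
  "fvS (Iff a b) = fvS a \<union> fvS b" "fvS (ExN x a) = fvS a" "fvS (ExS X a) = fvS a - {X}"
  "fvS (Lt s t) = fvSn s \<union> fvSn t" "fvS (AllLe x t a) = fvSn t \<union> fvS a"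
  "fvS (ExLe x t a) = fvSn t \<union> fvS a" "fvS (AllLt x t a) = fvSn t \<union> fvS a"
  "fvS (ExLt x t a) = fvSn t \<union> fvS a" "fvS (ExSb X t a) = fvSn t \<union> fvS a - {X}"
  by (auto simp: conn_defs)

lemma sigB0_conn [intro, simp]:
  "sigB0 Bot" "sigB0 (Eq1 s t)" "sigB0 (Le s t)" "sigB0 (Mem t T)" "sigB0 (Eq2 S T)" "sigB0 (Lt s t)"
  "sigB0 a \<Longrightarrow> sigB0 (Not a)" "sigB0 a \<Longrightarrow> sigB0 b \<Longrightarrow> sigB0 (Imp a b)" "sigB0 a \<Longrightarrow> sigB0 b \<Longrightarrow> sigB0 (Or a b)"
  "sigB0 a \<Longrightarrow> sigB0 b \<Longrightarrow> sigB0 (And a b)" "sigB0 a \<Longrightarrow> sigB0 b \<Longrightarrow> sigB0 (Iff a b)"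
  "sigB0 a \<Longrightarrow> x \<notin> fvNn t \<Longrightarrow> sigB0 (AllLe x t a)" "sigB0 a \<Longrightarrow> x \<notin> fvNn t \<Longrightarrow> sigB0 (ExLe x t a)"
  "sigB0 a \<Longrightarrow> x \<notin> fvNn t \<Longrightarrow> sigB0 (AllLt x t a)" "sigB0 a \<Longrightarrow> x \<notin> fvNn t \<Longrightarrow> sigB0 (ExLt x t a)"
  by (auto simp: Not_def Or_def And_def Iff_def Lt_def ExLe_def AllLt_def ExLt_def intro!: sigB0.intros)

lemma ev_coinc:
  "\<forall>x\<in>fvNn t. na x = na' x \<Longrightarrow> \<forall>X\<in>fvSn t. sa X = sa' X \<Longrightarrow> evn I na sa t = evn I na' sa' t"
  "\<forall>x\<in>fvNs T. na x = na' x \<Longrightarrow> \<forall>X\<in>fvSs T. sa X = sa' X \<Longrightarrow> evs I na sa T = evs I na' sa' T"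
proof (induction t and T rule: nterm.induct sterm.induct)
  case (NFun f ts Ss)
  have "evn I na sa t = evn I na' sa' t" if "t \<in> set ts" for t
    by (rule NFun.IH(1)[OF that]) (use that NFun.prems in auto)
  moreover have "evs I na sa t = evs I na' sa' t" if "t \<in> set Ss" for t
    by (rule NFun.IH(2)[OF that]) (use that NFun.prems in auto)
  ultimately have "map (evn I na sa) ts = map (evn I na' sa') ts" "map (evs I na sa) Ss = map (evs I na' sa') Ss"
    by auto
  then show ?case by (simp only: evn.simps evs.simps)
next
  case (SFun f ts Ss)
  have "evn I na sa t = evn I na' sa' t" if "t \<in> set ts" for t
    by (rule SFun.IH(1)[OF that]) (use that SFun.prems in auto)
  moreover have "evs I na sa t = evs I na' sa' t" if "t \<in> set Ss" for t
    by (rule SFun.IH(2)[OF that]) (use that SFun.prems in auto)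
  ultimately have "map (evn I na sa) ts = map (evn I na' sa') ts" "map (evs I na sa) Ss = map (evs I na' sa') Ss"
    by auto
  then show ?case by (simp only: evn.simps evs.simps)
qed auto

lemma evf_coinc:
  "\<forall>x\<in>fvN \<phi>. na x = na' x \<Longrightarrow> \<forall>X\<in>fvS \<phi>. sa X = sa' X \<Longrightarrow> evf I na sa \<phi> = evf I na' sa' \<phi>"
proof (induction \<phi> arbitrary: na na' sa sa')
  case (Eq1 s t) then show ?case using ev_coinc(1)[of s na na' sa sa' I] ev_coinc(1)[of t na na' sa sa' I] by auto
next
  case (Le s t) then show ?case using ev_coinc(1)[of s na na' sa sa' I] ev_coinc(1)[of t na na' sa sa' I] by auto
next
  case (Mem s t) then show ?case using ev_coinc(1)[of s na na' sa sa' I] ev_coinc(2)[of t na na' sa sa' I] by auto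
next
  case (Eq2 s t) then show ?case using ev_coinc(2)[of s na na' sa sa' I] ev_coinc(2)[of t na na' sa sa' I] by auto
next
  case (Imp a b) then show ?case by (metis UnCI evf.simps(6) fvN.simps(6) fvS.simps(6))
next
  case (AllN x a)
  have "evf I (na(x:=n)) sa a = evf I (na'(x:=n)) sa' a" for n
    by (rule AllN.IH) (use AllN.prems in auto)
  then show ?case by simp
next
  case (AllS x a)
  have "evf I na (sa(x:=n)) a = evf I na' (sa'(x:=n)) a" for n
    by (rule AllS.IH) (use AllS.prems in auto)
  then show ?case by simp
qed simp

lemma evf_conn [simp]:
  "evf I na sa (Not a) = (\<not> evf I na sa a)" "evf I na sa (Or a b) = (evf I na sa a \<or> evf I na sa b)"
  "evf I na sa (And a b) = (evf I na sa a \<and> evf I na sa b)" "evf I na sa (Iff a b) = (evf I na sa a \<longleftrightarrow> evf I na sa b)"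
  "evf I na sa (ExN x a) = (\<exists>n. evf I (na(x:=n)) sa a)" "evf I na sa (ExS X a) = (\<exists>A. finite A \<and> evf I na (sa(X:=A)) a)"
  "evf I na sa (Lt s t) = (evn I na sa s < evn I na sa t)"
  by (auto simp: conn_defs)

lemma evn_upd [simp]: "x \<notin> fvNn t \<Longrightarrow> evn I (na(x:=n)) sa t = evn I na sa t"
  "X \<notin> fvSn t \<Longrightarrow> evn I na (sa(X:=A)) t = evn I na sa t"
  by (rule ev_coinc; auto)+

lemma evf_upd: "x \<notin> fvN \<phi> \<Longrightarrow> evf I (na(x:=n)) sa \<phi> = evf I na sa \<phi>"
  "X \<notin> fvS \<phi> \<Longrightarrow> evf I na (sa(X:=A)) \<phi> = evf I na sa \<phi>"
  by (rule evf_coinc; auto)+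

lemma evf_bounded [simp]:
  assumes "x \<notin> fvNn t"
  shows "evf I na sa (AllLe x t a) = (\<forall>n \<le> evn I na sa t. evf I (na(x:=n)) sa a)"
    "evf I na sa (ExLe x t a) = (\<exists>n \<le> evn I na sa t. evf I (na(x:=n)) sa a)"
    "evf I na sa (AllLt x t a) = (\<forall>n < evn I na sa t. evf I (na(x:=n)) sa a)"
    "evf I na sa (ExLt x t a) = (\<exists>n < evn I na sa t. evf I (na(x:=n)) sa a)"
  using assms by (simp_all add: AllLe_def ExLe_def AllLt_def ExLt_def Not_def nat_less_le imp_conjL)

section \<open>Simultaneous substitution of number terms\<close>

primrec subn :: "(nat \<Rightarrow> nterm) \<Rightarrow> nterm \<Rightarrow> nterm" and subs :: "(nat \<Rightarrow> nterm) \<Rightarrow> sterm \<Rightarrow> sterm" where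
  "subn \<sigma> (NVar x) = \<sigma> x"
| "subn \<sigma> Zero = Zero"
| "subn \<sigma> One = One"
| "subn \<sigma> (Plus s t) = Plus (subn \<sigma> s) (subn \<sigma> t)"
| "subn \<sigma> (Times s t) = Times (subn \<sigma> s) (subn \<sigma> t)"
| "subn \<sigma> (Len T) = Len (subs \<sigma> T)"
| "subn \<sigma> (NFun f ts Ss) = NFun f (map (subn \<sigma>) ts) (map (subs \<sigma>) Ss)"
| "subs \<sigma> (SVar X) = SVar X"
| "subs \<sigma> (SFun f ts Ss) = SFun f (map (subn \<sigma>) ts) (map (subs \<sigma>) Ss)"

lemma ev_sub [simp]:
  "evn I na sa (subn \<sigma> t) = evn I (\<lambda>i. evn I na sa (\<sigma> i)) sa t"
  "evs I na sa (subs \<sigma> T) = evs I (\<lambda>i. evn I na sa (\<sigma> i)) sa T"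
proof (induction t and T rule: nterm.induct sterm.induct)
  case (NFun f ts Ss)
  then have "map (evn I na sa) (map (subn \<sigma>) ts) = map (evn I (\<lambda>i. evn I na sa (\<sigma> i)) sa) ts"
    "map (evs I na sa) (map (subs \<sigma>) Ss) = map (evs I (\<lambda>i. evn I na sa (\<sigma> i)) sa) Ss" by auto
  then show ?case by (simp del: map_map)
next
  case (SFun f ts Ss)
  then have "map (evn I na sa) (map (subn \<sigma>) ts) = map (evn I (\<lambda>i. evn I na sa (\<sigma> i)) sa) ts"
    "map (evs I na sa) (map (subs \<sigma>) Ss) = map (evs I (\<lambda>i. evn I na sa (\<sigma> i)) sa) Ss" by auto
  then show ?case by (simp del: map_map)
qed auto

lemma fvN_sub:
  "fvNn (subn \<sigma> t) = (\<Union>i\<in>fvNn t. fvNn (\<sigma> i))" "fvNs (subs \<sigma> T) = (\<Union>i\<in>fvNs T. fvNn (\<sigma> i))"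
  by (induction t and T rule: nterm.induct sterm.induct) auto

lemma fvS_sub:
  "fvSn (subn \<sigma> t) = fvSn t \<union> (\<Union>i\<in>fvNn t. fvSn (\<sigma> i))" "fvSs (subs \<sigma> T) = fvSs T \<union> (\<Union>i\<in>fvNs T. fvSn (\<sigma> i))"
  by (induction t and T rule: nterm.induct sterm.induct) auto

lemma pure_sub:
  "pureN t \<Longrightarrow> \<forall>i. pureN (\<sigma> i) \<Longrightarrow> pureN (subn \<sigma> t)" "pureS T \<Longrightarrow> pureS (subs \<sigma> T)"
  by (induction t and T rule: nterm.induct sterm.induct) auto

lemma wf_sub:
  "wfn ar t \<Longrightarrow> \<forall>i. wfn ar (\<sigma> i) \<Longrightarrow> wfn ar (subn \<sigma> t)" "wfs ar T \<Longrightarrow> \<forall>i. wfn ar (\<sigma> i) \<Longrightarrow> wfs ar (subs \<sigma> T)"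
  by (induction t and T rule: nterm.induct sterm.induct) (auto simp: list_all_iff)

lemma fresh_nat: "finite A \<Longrightarrow> \<exists>x::nat. x \<notin> A \<and> k \<le> x"
  by (meson finite_nat_set_iff_bounded_le le_cases not_less_eq_eq le_Suc_eq)

text \<open>Substitution below a bounded quantifier has to rename the bound variable, so the result
  is described by its meaning and its free variables instead of being computed. The later passages
  between named variables, de Bruijn indices and program variables in Sigma^B_0 formulas are
  instances.\<close>

definition is_subst where
  "is_subst \<phi> \<sigma> \<phi>' \<longleftrightarrow> sigB0 \<phi>' \<and>
   (\<forall>I na sa. evf I na sa \<phi>' = evf I (\<lambda>i. evn I na sa (\<sigma> i)) sa \<phi>) \<and>
   (pureF \<phi> \<longrightarrow> (\<forall>i. pureN (\<sigma> i)) \<longrightarrow> pureF \<phi>') \<and>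
   (\<forall>ar. wff ar \<phi> \<longrightarrow> (\<forall>i. wfn ar (\<sigma> i)) \<longrightarrow> wff ar \<phi>') \<and>
   fvN \<phi>' \<subseteq> (\<Union>i\<in>fvN \<phi>. fvNn (\<sigma> i)) \<and> fvS \<phi>' \<subseteq> fvS \<phi> \<union> (\<Union>i\<in>fvN \<phi>. fvSn (\<sigma> i))"

lemma subst_ex: "sigB0 \<phi> \<Longrightarrow> \<exists>\<phi>'. is_subst \<phi> \<sigma> \<phi>'"
proof (induction \<phi> arbitrary: \<sigma> rule: sigB0.induct)
  case 1 then show ?case by (intro exI[of _ Bot]) (simp add: is_subst_def)
next
  case (2 s t) then show ?case
    by (intro exI[of _ "Eq1 (subn \<sigma> s) (subn \<sigma> t)"]) (auto simp: is_subst_def fvN_sub fvS_sub pure_sub wf_sub)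
next
  case (3 s t) then show ?case
    by (intro exI[of _ "Le (subn \<sigma> s) (subn \<sigma> t)"]) (auto simp: is_subst_def fvN_sub fvS_sub pure_sub wf_sub)
next
  case (4 s t) then show ?case
    by (intro exI[of _ "Mem (subn \<sigma> s) (subs \<sigma> t)"]) (auto simp: is_subst_def fvN_sub fvS_sub pure_sub wf_sub)
next
  case (5 s t) then show ?case
    by (intro exI[of _ "Eq2 (subs \<sigma> s) (subs \<sigma> t)"]) (auto simp: is_subst_def fvN_sub fvS_sub pure_sub wf_sub)
next
  case (6 a b)
  then obtain a' b' where "is_subst a \<sigma> a'" "is_subst b \<sigma> b'" by meson
  then show ?case by (intro exI[of _ "Imp a' b'"]) (auto simp: is_subst_def)
next
  case (7 a x t)
  let ?F = "fvNn (subn \<sigma> t) \<union> (\<Union>i\<in>fvN a. fvNn (\<sigma> i))"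
  have "finite ?F" by simp
  \<comment> \<open>The new bound variable avoids the substituted bound, as a bounded quantifier
    requires, and every term that may be put into the body, so that nothing is captured.\<close>
  then obtain x' where x': "x' \<notin> ?F" using fresh_nat by blast
  let ?\<sigma> = "\<sigma>(x:=NVar x')"
  obtain a' where a': "is_subst a ?\<sigma> a'" using 7 by meson
  have e: "evf I (na(x':=n)) sa a' = evf I ((\<lambda>i. evn I na sa (\<sigma> i))(x:=n)) sa a" for I na sa n
  proof -
    have "evf I (na(x':=n)) sa a' = evf I (\<lambda>i. evn I (na(x':=n)) sa (?\<sigma> i)) sa a"
      using a' unfolding is_subst_def by blast
    also have "\<dots> = evf I ((\<lambda>i. evn I na sa (\<sigma> i))(x:=n)) sa a"
      by (rule evf_coinc) (use x' in auto)
    finally show ?thesis .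
  qed
  show ?case unfolding is_subst_def
  proof (intro exI[of _ "AllLe x' (subn \<sigma> t) a'"] conjI allI impI)
    show "sigB0 (AllLe x' (subn \<sigma> t) a')" using x' a' by (auto simp: is_subst_def)
    fix I na sa
    show "evf I na sa (AllLe x' (subn \<sigma> t) a') = evf I (\<lambda>i. evn I na sa (\<sigma> i)) sa (AllLe x t a)"
      using x' 7 by (simp add: e)
  next
    show "fvN (AllLe x' (subn \<sigma> t) a') \<subseteq> (\<Union>i\<in>fvN (AllLe x t a). fvNn (\<sigma> i))"
      using a' 7 by (auto simp: is_subst_def fvN_sub split: if_splits)
    show "fvS (AllLe x' (subn \<sigma> t) a') \<subseteq> fvS (AllLe x t a) \<union> (\<Union>i\<in>fvN (AllLe x t a). fvSn (\<sigma> i))"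
      using a' 7 by (auto simp: is_subst_def fvS_sub split: if_splits)
  qed (use a' in \<open>auto simp: is_subst_def pure_sub wf_sub\<close>)
qed

section \<open>Two-sorted structures\<close>

text \<open>Equality is interpreted by relations \<open>meq1\<close>, \<open>meq2\<close>, so that a restricted ultrapower is
a structure without passing to classes.\<close>

record ('a, 's) mdl =
  mN :: "'a set"
  mS :: "'s set"
  mz :: 'a
  mo :: 'a
  ma :: "'a \<Rightarrow> 'a \<Rightarrow> 'a"
  mm :: "'a \<Rightarrow> 'a \<Rightarrow> 'a"
  mlen :: "'s \<Rightarrow> 'a"
  mle :: "'a \<Rightarrow> 'a \<Rightarrow> bool"
  mmem :: "'a \<Rightarrow> 's \<Rightarrow> bool"
  meq1 :: "'a \<Rightarrow> 'a \<Rightarrow> bool"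
  meq2 :: "'s \<Rightarrow> 's \<Rightarrow> bool"

text \<open>The structures interpret the pure language. Function symbols get arbitrary values, which
  pure formulas never see.\<close>

primrec mev :: "('a, 's) mdl \<Rightarrow> (nat \<Rightarrow> 'a) \<Rightarrow> (nat \<Rightarrow> 's) \<Rightarrow> nterm \<Rightarrow> 'a"
  and mevs :: "('a, 's) mdl \<Rightarrow> (nat \<Rightarrow> 'a) \<Rightarrow> (nat \<Rightarrow> 's) \<Rightarrow> sterm \<Rightarrow> 's" where
  "mev M na sa (NVar x) = na x"
| "mev M na sa Zero = mz M"
| "mev M na sa One = mo M"
| "mev M na sa (Plus s t) = ma M (mev M na sa s) (mev M na sa t)"
| "mev M na sa (Times s t) = mm M (mev M na sa s) (mev M na sa t)"
| "mev M na sa (Len T) = mlen M (mevs M na sa T)"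
| "mev M na sa (NFun f ts Ss) = mz M"
| "mevs M na sa (SVar X) = sa X"
| "mevs M na sa (SFun f ts Ss) = sa 0"

primrec msat :: "('a, 's) mdl \<Rightarrow> (nat \<Rightarrow> 'a) \<Rightarrow> (nat \<Rightarrow> 's) \<Rightarrow> form \<Rightarrow> bool" where
  "msat M na sa Bot = False"
| "msat M na sa (Eq1 s t) = meq1 M (mev M na sa s) (mev M na sa t)"
| "msat M na sa (Le s t) = mle M (mev M na sa s) (mev M na sa t)"
| "msat M na sa (Mem t T) = mmem M (mev M na sa t) (mevs M na sa T)"
| "msat M na sa (Eq2 S T) = meq2 M (mevs M na sa S) (mevs M na sa T)"
| "msat M na sa (Imp \<phi> \<psi>) = (msat M na sa \<phi> \<longrightarrow> msat M na sa \<psi>)"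
| "msat M na sa (AllN x \<phi>) = (\<forall>n\<in>mN M. msat M (na(x := n)) sa \<phi>)"
| "msat M na sa (AllS X \<phi>) = (\<forall>A\<in>mS M. msat M na (sa(X := A)) \<phi>)"

lemma msat_conn [simp]:
  "msat M na sa (Not a) = (\<not> msat M na sa a)" "msat M na sa (Or a b) = (msat M na sa a \<or> msat M na sa b)"
  "msat M na sa (And a b) = (msat M na sa a \<and> msat M na sa b)" "msat M na sa (Iff a b) = (msat M na sa a \<longleftrightarrow> msat M na sa b)"
  "msat M na sa (ExN x a) = (\<exists>n\<in>mN M. msat M (na(x:=n)) sa a)" "msat M na sa (ExS X a) = (\<exists>A\<in>mS M. msat M na (sa(X:=A)) a)"
  "msat M na sa (Lt s t) = (mle M (mev M na sa s) (mev M na sa t) \<and> \<not> meq1 M (mev M na sa s) (mev M na sa t))"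
  "msat M na sa (ExSb X t a) = (\<exists>A\<in>mS M. msat M na (sa(X:=A)) (Le (Len (SVar X)) t) \<and> msat M na (sa(X:=A)) a)"
  by (auto simp: conn_defs)

lemma mev_coinc: "pureN t \<Longrightarrow> \<forall>x\<in>fvNn t. na x = na' x \<Longrightarrow> \<forall>X\<in>fvSn t. sa X = sa' X \<Longrightarrow> mev M na sa t = mev M na' sa' t"
  "pureS T \<Longrightarrow> \<forall>X\<in>fvSs T. sa X = sa' X \<Longrightarrow> mevs M na sa T = mevs M na' sa' T"
  by (induction t and T rule: nterm.induct sterm.induct) auto

lemma mev_upd [simp]: "pureN t \<Longrightarrow> x \<notin> fvNn t \<Longrightarrow> mev M (na(x:=n)) sa t = mev M na sa t"
  "pureN t \<Longrightarrow> X \<notin> fvSn t \<Longrightarrow> mev M na (sa(X:=A)) t = mev M na sa t"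
  by (rule mev_coinc; auto)+

lemma msat_bounded [simp]:
  assumes "x \<notin> fvNn t" "pureN t"
  shows "msat M na sa (AllLe x t a) = (\<forall>n\<in>mN M. mle M n (mev M na sa t) \<longrightarrow> msat M (na(x:=n)) sa a)"
    "msat M na sa (ExLe x t a) = (\<exists>n\<in>mN M. mle M n (mev M na sa t) \<and> msat M (na(x:=n)) sa a)"
    "msat M na sa (AllLt x t a) = (\<forall>n\<in>mN M. mle M n (mev M na sa t) \<and> \<not> meq1 M n (mev M na sa t) \<longrightarrow> msat M (na(x:=n)) sa a)"
    "msat M na sa (ExLt x t a) = (\<exists>n\<in>mN M. mle M n (mev M na sa t) \<and> \<not> meq1 M n (mev M na sa t) \<and> msat M (na(x:=n)) sa a)"
  using assms by (auto simp: AllLe_def ExLe_def AllLt_def ExLt_def Not_def)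

lemma msat_coinc:
  "pureF \<phi> \<Longrightarrow> \<forall>x\<in>fvN \<phi>. na x = na' x \<Longrightarrow> \<forall>X\<in>fvS \<phi>. sa X = sa' X \<Longrightarrow> msat M na sa \<phi> = msat M na' sa' \<phi>"
proof (induction \<phi> arbitrary: na na' sa sa')
  case (Eq1 s t) then show ?case using mev_coinc(1)[of s na na' sa sa' M] mev_coinc(1)[of t na na' sa sa' M] by auto
next
  case (Le s t) then show ?case using mev_coinc(1)[of s na na' sa sa' M] mev_coinc(1)[of t na na' sa sa' M] by auto
next
  case (Mem s t) then show ?case using mev_coinc(1)[of s na na' sa sa' M] mev_coinc(2)[of t sa sa' M na na'] by auto
next
  case (Eq2 s t) then show ?case using mev_coinc(2)[of s sa sa' M na na'] mev_coinc(2)[of t sa sa' M na na'] by auto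
next
  case (Imp a b)
  have "msat M na sa a = msat M na' sa' a" "msat M na sa b = msat M na' sa' b"
    by (rule Imp.IH; use Imp.prems in auto)+
  then show ?case by simp
next
  case (AllN x a)
  have "msat M (na(x:=n)) sa a = msat M (na'(x:=n)) sa' a" for n
    by (rule AllN.IH) (use AllN.prems in auto)
  then show ?case by simp
next
  case (AllS x a)
  have "msat M na (sa(x:=n)) a = msat M na' (sa'(x:=n)) a" for n
    by (rule AllS.IH) (use AllS.prems in auto)
  then show ?case by simp
qed simp

lemma msat_upd: "pureF \<phi> \<Longrightarrow> x \<notin> fvN \<phi> \<Longrightarrow> msat M (na(x:=n)) sa \<phi> = msat M na sa \<phi>"
  "pureF \<phi> \<Longrightarrow> X \<notin> fvS \<phi> \<Longrightarrow> msat M na (sa(X:=A)) \<phi> = msat M na sa \<phi>"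
  by (rule msat_coinc; auto)+

section \<open>The substitutions of the calculus and their meaning\<close>

lemma sb_pure [simp]: "pureS S \<Longrightarrow> sbNs x u S = S" "pureS S \<Longrightarrow> fvNs S = {}"
  "pureS S \<Longrightarrow> pureS (sbSs X Y S)"
  by (cases S; simp)+

lemma mev_sb: "pureN t \<Longrightarrow> pureN u \<Longrightarrow> mev M na sa (sbNn x u t) = mev M (na(x:=mev M na sa u)) sa t"
  "pureN t \<Longrightarrow> mev M na sa (sbSn X Y t) = mev M na (sa(X:=sa Y)) t"
  "pureS S \<Longrightarrow> mevs M na sa (sbSs X Y S) = mevs M na (sa(X:=sa Y)) S"
  "pureS S \<Longrightarrow> mevs M na sa S = mevs M na' sa S"
proof -
  show a: "pureS S \<Longrightarrow> mevs M na sa (sbSs X Y S) = mevs M na (sa(X:=sa Y)) S" 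
    "pureS S \<Longrightarrow> mevs M na sa S = mevs M na' sa S" for S na'
    by (cases S; simp)+
  show "pureN t \<Longrightarrow> pureN u \<Longrightarrow> mev M na sa (sbNn x u t) = mev M (na(x:=mev M na sa u)) sa t"
    by (induction t rule: nterm.induct[where ?P2.0="\<lambda>_. True"]) (auto intro!: arg_cong[of _ _ "mlen M"] a(2))
  show "pureN t \<Longrightarrow> mev M na sa (sbSn X Y t) = mev M na (sa(X:=sa Y)) t"
    by (induction t rule: nterm.induct[where ?P2.0="\<lambda>_. True"]) (auto simp: a)
qed

lemma sbNn_id [simp]: "pureN t \<Longrightarrow> x \<notin> fvNn t \<Longrightarrow> sbNn x u t = t" "pureN t \<Longrightarrow> sbNn x (NVar x) t = t"
  "pureN t \<Longrightarrow> X \<notin> fvSn t \<Longrightarrow> sbSn X Y t = t" "pureS T \<Longrightarrow> X \<notin> fvSs T \<Longrightarrow> sbSs X Y T = T"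
  "pureN t \<Longrightarrow> sbSn X X t = t" "pureS T \<Longrightarrow> sbSs X X T = T"
proof -
  show *: "pureS T \<Longrightarrow> X \<notin> fvSs T \<Longrightarrow> sbSs X Y T = T" "pureS T \<Longrightarrow> sbSs X X T = T" for T by (cases T; simp)+
  show "pureN t \<Longrightarrow> x \<notin> fvNn t \<Longrightarrow> sbNn x u t = t" 
    by (induction t rule: nterm.induct[where ?P2.0="\<lambda>_. True"]) auto
  show "pureN t \<Longrightarrow> sbNn x (NVar x) t = t"
    by (induction t rule: nterm.induct[where ?P2.0="\<lambda>_. True"]) auto
  show "pureN t \<Longrightarrow> X \<notin> fvSn t \<Longrightarrow> sbSn X Y t = t" 
    by (induction t rule: nterm.induct[where ?P2.0="\<lambda>_. True"]) (auto simp: *)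
  show "pureN t \<Longrightarrow> sbSn X X t = t" 
    by (induction t rule: nterm.induct[where ?P2.0="\<lambda>_. True"]) (auto simp: *)
qed

lemma sb_id [simp]: "pureF \<phi> \<Longrightarrow> x \<notin> fvN \<phi> \<Longrightarrow> sbN x u \<phi> = \<phi>" "pureF \<phi> \<Longrightarrow> sbN x (NVar x) \<phi> = \<phi>"
  "pureF \<phi> \<Longrightarrow> X \<notin> fvS \<phi> \<Longrightarrow> sbS X Y \<phi> = \<phi>" "pureF \<phi> \<Longrightarrow> sbS X X \<phi> = \<phi>"
  by (induction \<phi>) auto

lemma pure_sbn [simp]: "pureN t \<Longrightarrow> pureN u \<Longrightarrow> pureN (sbNn x u t)" "pureN t \<Longrightarrow> pureN (sbSn X Y t)"
  by (induction t rule: nterm.induct[where ?P2.0="\<lambda>_. True"]; simp)+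

lemma pure_sb [simp]: "pureF \<phi> \<Longrightarrow> pureN u \<Longrightarrow> pureF (sbN x u \<phi>)" "pureF \<phi> \<Longrightarrow> pureF (sbS X Y \<phi>)"
  by (induction \<phi>) auto

lemma msat_sbN: "pureF \<phi> \<Longrightarrow> pureN u \<Longrightarrow> freeN u x \<phi> \<Longrightarrow> msat M na sa (sbN x u \<phi>) = msat M (na(x:=mev M na sa u)) sa \<phi>"
proof (induction \<phi> arbitrary: na sa)
  case (AllN y a)
  show ?case
  proof (cases "x \<notin> fvN (AllN y a)")
    case True
    have "msat M na sa (sbN x u (AllN y a)) = msat M na sa (AllN y a)" using True AllN.prems by (subst sb_id) auto
    also have "\<dots> = msat M (na(x:=mev M na sa u)) sa (AllN y a)"
      by (rule msat_upd[symmetric]) (use True AllN.prems in auto)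
    finally show ?thesis .
  next
    case False
    then have "y \<noteq> x" "y \<notin> fvNn u" "freeN u x a" using AllN.prems by auto
    then show ?thesis using AllN by (simp add: fun_upd_twist[of y x] del: fun_upd_apply)
  qed
next
  case (AllS y a)
  show ?case
  proof (cases "x \<notin> fvN (AllS y a)")
    case True
    have "msat M na sa (sbN x u (AllS y a)) = msat M na sa (AllS y a)" using True AllS.prems by (subst sb_id) auto
    also have "\<dots> = msat M (na(x:=mev M na sa u)) sa (AllS y a)"
      by (rule msat_upd[symmetric]) (use True AllS.prems in auto)
    finally show ?thesis .
  next
    case False
    then have "y \<notin> fvSn u" "freeN u x a" using AllS.prems by auto
    then show ?thesis using AllS by (simp del: fun_upd_apply)
  qed
next
  case (Mem t T) then show ?case using mev_sb(4)[of T M na sa "na(x:=mev M na sa u)"] by (simp add: mev_sb(1) del: fun_upd_apply)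
next
  case (Eq2 S T) then show ?case using mev_sb(4)[of S M na sa "na(x:=mev M na sa u)"] mev_sb(4)[of T M na sa "na(x:=mev M na sa u)"]
    by (simp del: fun_upd_apply)
qed (auto simp: mev_sb)

lemma msat_sbS: "pureF \<phi> \<Longrightarrow> freeS Y X \<phi> \<Longrightarrow> msat M na sa (sbS X Y \<phi>) = msat M na (sa(X:=sa Y)) \<phi>"
proof (induction \<phi> arbitrary: na sa)
  case (AllS y a)
  show ?case
  proof (cases "X \<notin> fvS (AllS y a)")
    case True
    have "msat M na sa (sbS X Y (AllS y a)) = msat M na sa (AllS y a)" using True AllS.prems by (subst sb_id) auto
    also have "\<dots> = msat M na (sa(X:=sa Y)) (AllS y a)"
      by (rule msat_upd[symmetric]) (use True AllS.prems in auto)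
    finally show ?thesis .
  next
    case False
    then have "y \<noteq> X" "y \<noteq> Y" "freeS Y X a" using AllS.prems by auto
    then show ?thesis using AllS by (simp add: fun_upd_twist[of y X] fun_upd_other del: fun_upd_apply)
  qed
qed (auto simp: mev_sb)

lemma freeN_fresh: "x \<notin> allN \<phi> \<Longrightarrow> freeN (NVar x) y \<phi>"
  by (induction \<phi>) auto

lemma freeS_fresh: "Y \<notin> allS \<phi> \<Longrightarrow> freeS Y X \<phi>"
  by (induction \<phi>) auto

lemma freeN_self: "freeN (NVar x) x \<phi>"
  by (induction \<phi>) auto

lemma freeS_self: "freeS X X \<phi>"
  by (induction \<phi>) auto

section \<open>The standard structure\<close>

definition Std :: "(nat, nat set) mdl" where
  "Std = \<lparr>mN = UNIV, mS = {A. finite A}, mz = 0, mo = 1, ma = (+), mm = (*), mlen = slen, mle = (\<le>),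
    mmem = (\<in>), meq1 = (=), meq2 = (=)\<rparr>"

lemma mev_Std [simp]: "pureN t \<Longrightarrow> mev Std na sa t = evn I0 na sa t" "pureS T \<Longrightarrow> mevs Std na sa T = evs I0 na sa T"
  by (induction t and T rule: nterm.induct sterm.induct) (auto simp: Std_def)

lemma msat_Std: "pureF \<phi> \<Longrightarrow> msat Std na sa \<phi> = evf I0 na sa \<phi>"
proof (induction \<phi> arbitrary: na sa)
qed (auto, auto simp: Std_def)

section \<open>Completeness of the calculus\<close>

text \<open>Derivability from assumptions whose free variables are held fixed: modus ponens is the
  only rule, generalization is confined to theorems. Hence the deduction theorem holds without a
  condition on variables, and generalization comes back as \<open>D_genN\<close> and
  \<open>D_genS\<close> for variables that are not free in the assumptions.\<close>

inductive D :: "form set \<Rightarrow> form set \<Rightarrow> form \<Rightarrow> bool" for T \<Gamma> where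
  Dthm: "prv T \<phi> \<Longrightarrow> D T \<Gamma> \<phi>"
| Dasm: "\<phi> \<in> \<Gamma> \<Longrightarrow> D T \<Gamma> \<phi>"
| Dmp: "D T \<Gamma> (Imp \<phi> \<psi>) \<Longrightarrow> D T \<Gamma> \<phi> \<Longrightarrow> D T \<Gamma> \<psi>"

abbreviation pureT :: "form set \<Rightarrow> bool" where "pureT \<Gamma> \<equiv> \<forall>\<phi>\<in>\<Gamma>. pureF \<phi>"

lemma prv_pure: "prv T \<phi> \<Longrightarrow> pureT T \<Longrightarrow> pureF \<phi>"
  by (induction rule: prv.induct) auto

lemma prv_mono: "prv T \<phi> \<Longrightarrow> T \<subseteq> T' \<Longrightarrow> prv T' \<phi>"
  by (induction rule: prv.induct) (auto intro: prv.intros)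

lemma D_pure: "D T \<Gamma> \<phi> \<Longrightarrow> pureT T \<Longrightarrow> pureT \<Gamma> \<Longrightarrow> pureF \<phi>"
  by (induction rule: D.induct) (auto dest: prv_pure)

lemma D_mono: "D T \<Gamma> \<phi> \<Longrightarrow> \<Gamma> \<subseteq> \<Delta> \<Longrightarrow> D T \<Delta> \<phi>"
  by (induction rule: D.induct) (auto intro: D.intros)

lemma D_empty: "D T {} \<phi> \<Longrightarrow> prv T \<phi>"
  by (induction rule: D.induct) (auto intro: prv.MP)

lemma D_finite: "D T \<Gamma> \<phi> \<Longrightarrow> \<exists>\<Delta>\<subseteq>\<Gamma>. finite \<Delta> \<and> D T \<Delta> \<phi>"
proof (induction rule: D.induct)
  case (Dthm \<phi>) then show ?case by (intro exI[of _ "{}"]) (auto intro: D.Dthm)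
next
  case (Dasm \<phi>) then show ?case by (intro exI[of _ "{\<phi>}"]) (auto intro: D.Dasm)
next
  case (Dmp \<phi> \<psi>)
  then obtain A B where "A \<subseteq> \<Gamma>" "finite A" "D T A (Imp \<phi> \<psi>)" "B \<subseteq> \<Gamma>" "finite B" "D T B \<phi>" by blast
  then show ?case by (intro exI[of _ "A \<union> B"]) (auto intro: D.Dmp D_mono)
qed

lemma prv_finite: "prv T \<phi> \<Longrightarrow> \<exists>T'\<subseteq>T. finite T' \<and> prv T' \<phi>"
proof (induction rule: prv.induct)
  case (Ax \<phi>) then show ?case by (intro exI[of _ "{\<phi>}"]) (auto intro: prv.Ax)
next
  case (MP \<phi> \<psi>)
  then obtain A B where "A \<subseteq> T" "finite A" "prv A (Imp \<phi> \<psi>)" "B \<subseteq> T" "finite B" "prv B \<phi>" by blast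
  then show ?case by (intro exI[of _ "A \<union> B"]) (auto intro: prv.MP prv_mono)
next
  case (GenN \<phi> x) then show ?case by (auto intro: prv.GenN)
next
  case (GenS \<phi> x) then show ?case by (auto intro: prv.GenS)
qed (rule exI[of _ "{}"], simp, (rule prv.intros; assumption)+)+

lemma prv_refl: "pureF \<phi> \<Longrightarrow> prv T (Imp \<phi> \<phi>)"
  using A1[of \<phi> \<phi> T] A1[of \<phi> "Imp \<phi> \<phi>" T] A2[of \<phi> "Imp \<phi> \<phi>" \<phi> T] by (auto intro: prv.MP)

lemma D_ded:
  assumes "D T (insert \<phi> \<Gamma>) \<psi>" "pureT T" "pureT \<Gamma>" "pureF \<phi>"
  shows "D T \<Gamma> (Imp \<phi> \<psi>)"
  using assms(1)
proof (induction rule: D.induct)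
  case (Dthm \<psi>)
  then show ?case using A1[of \<psi> \<phi> T] prv_pure assms by (meson D.Dthm prv.MP)
next
  case (Dasm \<psi>)
  then show ?case using A1[of \<psi> \<phi> T] prv_refl[of \<phi> T] assms by (metis D.Dasm D.Dthm D.Dmp insertE)
next
  case (Dmp a b)
  then have "pureF a" "pureF b" using D_pure[of T "insert \<phi> \<Gamma>" "Imp a b"] assms by auto
  then show ?case using A2[of \<phi> a b T] Dmp assms by (meson D.Dthm D.Dmp)
qed

lemma D_Not: "D T (insert \<phi> \<Gamma>) Bot \<Longrightarrow> pureT T \<Longrightarrow> pureT \<Gamma> \<Longrightarrow> pureF \<phi> \<Longrightarrow> D T \<Gamma> (Not \<phi>)"
  unfolding Not_def by (rule D_ded)

lemma D_ccontr: "D T (insert (Not \<phi>) \<Gamma>) Bot \<Longrightarrow> pureT T \<Longrightarrow> pureT \<Gamma> \<Longrightarrow> pureF \<phi> \<Longrightarrow> D T \<Gamma> \<phi>"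
  using D_Not[of T "Not \<phi>" \<Gamma>] A3[of \<phi> T] unfolding Not_def by (auto intro: D.Dmp D.Dthm)

text \<open>Distribution of a universal quantifier over an implication is not an axiom of the
  calculus; it is what lets \<open>D_genN\<close> pass through modus ponens.\<close>

lemma prv_distN:
  assumes "pureT T" "pureF \<phi>" "pureF \<psi>"
  shows "prv T (Imp (AllN x (Imp \<phi> \<psi>)) (Imp (AllN x \<phi>) (AllN x \<psi>)))"
proof -
  let ?A = "AllN x (Imp \<phi> \<psi>)" and ?B = "AllN x \<phi>"
  have q: "prv T (Imp ?A (Imp \<phi> \<psi>))" "prv T (Imp ?B \<phi>)"
    using Q1N[of "Imp \<phi> \<psi>" "NVar x" x T] Q1N[of \<phi> "NVar x" x T] assms freeN_self by auto
  have "D T {?B, ?A} \<psi>" using q by (meson D.intros insertCI)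
  then have "prv T (Imp ?A (Imp ?B \<psi>))" using D_ded[of T ?B "{?A}" \<psi>] D_ded[of T ?A "{}"] assms D_empty by simp
  then have "prv T (Imp ?A (AllN x (Imp ?B \<psi>)))"
    using GenN[of T _ x] Q2N[of ?A "Imp ?B \<psi>" x T] assms by (auto intro: prv.MP)
  moreover have "prv T (Imp (AllN x (Imp ?B \<psi>)) (Imp ?B (AllN x \<psi>)))"
    by (rule Q2N) (use assms in auto)
  ultimately have "D T {?A} (Imp ?B (AllN x \<psi>))" by (meson D.intros insertCI)
  then show ?thesis using D_ded[of T ?A "{}"] assms D_empty by simp
qed

lemma prv_distS:
  assumes "pureT T" "pureF \<phi>" "pureF \<psi>"
  shows "prv T (Imp (AllS x (Imp \<phi> \<psi>)) (Imp (AllS x \<phi>) (AllS x \<psi>)))"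
proof -
  let ?A = "AllS x (Imp \<phi> \<psi>)" and ?B = "AllS x \<phi>"
  have q: "prv T (Imp ?A (Imp \<phi> \<psi>))" "prv T (Imp ?B \<phi>)"
    using Q1S[of "Imp \<phi> \<psi>" x x T] Q1S[of \<phi> x x T] assms freeS_self by auto
  have "D T {?B, ?A} \<psi>" using q by (meson D.intros insertCI)
  then have "prv T (Imp ?A (Imp ?B \<psi>))" using D_ded[of T ?B "{?A}" \<psi>] D_ded[of T ?A "{}"] assms D_empty by simp
  then have "prv T (Imp ?A (AllS x (Imp ?B \<psi>)))"
    using GenS[of T _ x] Q2S[of ?A "Imp ?B \<psi>" x T] assms by (auto intro: prv.MP)
  moreover have "prv T (Imp (AllS x (Imp ?B \<psi>)) (Imp ?B (AllS x \<psi>)))"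
    by (rule Q2S) (use assms in auto)
  ultimately have "D T {?A} (Imp ?B (AllS x \<psi>))" by (meson D.intros insertCI)
  then show ?thesis using D_ded[of T ?A "{}"] assms D_empty by simp
qed

lemma D_genN:
  assumes "D T \<Gamma> \<phi>" "pureT T" "pureT \<Gamma>" "\<forall>\<gamma>\<in>\<Gamma>. x \<notin> fvN \<gamma>"
  shows "D T \<Gamma> (AllN x \<phi>)"
  using assms(1)
proof (induction rule: D.induct)
  case (Dthm \<phi>) then show ?case by (auto intro: D.Dthm prv.GenN)
next
  case (Dasm \<phi>)
  have "prv T (AllN x (Imp \<phi> \<phi>))" using Dasm assms by (intro prv.GenN prv_refl) auto
  then have "prv T (Imp \<phi> (AllN x \<phi>))" using Q2N[of \<phi> \<phi> x T] Dasm assms by (auto intro: prv.MP)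
  then show ?case using Dasm by (meson D.intros)
next
  case (Dmp a b)
  then have "pureF a" "pureF b" using D_pure[of T \<Gamma> "Imp a b"] assms by auto
  then show ?case using prv_distN[of T a b x] Dmp assms by (meson D.Dthm D.Dmp)
qed

lemma D_genS:
  assumes "D T \<Gamma> \<phi>" "pureT T" "pureT \<Gamma>" "\<forall>\<gamma>\<in>\<Gamma>. x \<notin> fvS \<gamma>"
  shows "D T \<Gamma> (AllS x \<phi>)"
  using assms(1)
proof (induction rule: D.induct)
  case (Dthm \<phi>) then show ?case by (auto intro: D.Dthm prv.GenS)
next
  case (Dasm \<phi>)
  have "prv T (AllS x (Imp \<phi> \<phi>))" using Dasm assms by (intro prv.GenS prv_refl) auto
  then have "prv T (Imp \<phi> (AllS x \<phi>))" using Q2S[of \<phi> \<phi> x T] Dasm assms by (auto intro: prv.MP)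
  then show ?case using Dasm by (meson D.intros)
next
  case (Dmp a b)
  then have "pureF a" "pureF b" using D_pure[of T \<Gamma> "Imp a b"] assms by auto
  then show ?case using prv_distS[of T a b x] Dmp assms by (meson D.Dthm D.Dmp)
qed

section \<open>Renaming to a fresh variable and back\<close>

lemma sbn_back:
  "pureN t \<Longrightarrow> c \<notin> fvNn t \<Longrightarrow> sbNn c (NVar x) (sbNn x (NVar c) t) = t"
  "pureN t \<Longrightarrow> fvNn (sbNn x u t) \<subseteq> fvNn u \<union> (fvNn t - {x})"
  "pureN t \<Longrightarrow> X \<notin> fvSn t \<Longrightarrow> sbSn X Y (sbSn Y X t) = t"
  "pureS S \<Longrightarrow> X \<notin> fvSs S \<Longrightarrow> sbSs X Y (sbSs Y X S) = S"
  "pureN t \<Longrightarrow> fvSn (sbSn X Y t) \<subseteq> insert Y (fvSn t - {X})"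
  "pureS S \<Longrightarrow> fvSs (sbSs X Y S) \<subseteq> insert Y (fvSs S - {X})"
proof -
  show *: "pureS S \<Longrightarrow> X \<notin> fvSs S \<Longrightarrow> sbSs X Y (sbSs Y X S) = S"
    "pureS S \<Longrightarrow> fvSs (sbSs X Y S) \<subseteq> insert Y (fvSs S - {X})" for S by (cases S; simp)+
  show "pureN t \<Longrightarrow> c \<notin> fvNn t \<Longrightarrow> sbNn c (NVar x) (sbNn x (NVar c) t) = t"
    by (induction t rule: nterm.induct[where ?P2.0="\<lambda>_. True"]) auto
  show "pureN t \<Longrightarrow> fvNn (sbNn x u t) \<subseteq> fvNn u \<union> (fvNn t - {x})"
    by (induction t rule: nterm.induct[where ?P2.0="\<lambda>_. True"]) auto
  show "pureN t \<Longrightarrow> X \<notin> fvSn t \<Longrightarrow> sbSn X Y (sbSn Y X t) = t"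
    by (induction t rule: nterm.induct[where ?P2.0="\<lambda>_. True"]) (auto simp: *)
  show "pureN t \<Longrightarrow> fvSn (sbSn X Y t) \<subseteq> insert Y (fvSn t - {X})"
    by (induction t rule: nterm.induct[where ?P2.0="\<lambda>_. True"]) (use * in auto)
qed

lemma fvN_sbN: "pureF \<chi> \<Longrightarrow> fvN (sbN x (NVar c) \<chi>) \<subseteq> insert c (fvN \<chi> - {x})"
proof (induction \<chi>)
  case (Eq1 s t) then show ?case using sbn_back(2)[of s x "NVar c"] sbn_back(2)[of t x "NVar c"] by auto
next
  case (Le s t) then show ?case using sbn_back(2)[of s x "NVar c"] sbn_back(2)[of t x "NVar c"] by auto
next
  case (Mem s t) then show ?case using sbn_back(2)[of s x "NVar c"] by auto
qed auto

lemma fvS_sbS: "pureF \<chi> \<Longrightarrow> fvS (sbS x c \<chi>) \<subseteq> insert c (fvS \<chi> - {x})"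
proof (induction \<chi>)
  case (Eq1 s t) then show ?case using sbn_back(5)[of s x c] sbn_back(5)[of t x c] by auto
next
  case (Le s t) then show ?case using sbn_back(5)[of s x c] sbn_back(5)[of t x c] by auto
next
  case (Mem s t) then show ?case using sbn_back(5)[of s x c] sbn_back(6)[of t x c] by auto
next
  case (Eq2 s t) then show ?case using sbn_back(6)[of s x c] sbn_back(6)[of t x c] by auto
qed auto

lemma not_fv: "x \<notin> allN \<phi> \<Longrightarrow> x \<notin> fvN \<phi>" "X \<notin> allS \<phi> \<Longrightarrow> X \<notin> fvS \<phi>"
  using fv_subset_all by blast+

lemma sb_back:
  "pureF \<chi> \<Longrightarrow> c \<notin> allN \<chi> \<Longrightarrow> sbN c (NVar x) (sbN x (NVar c) \<chi>) = \<chi>"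
  "pureF \<chi> \<Longrightarrow> C \<notin> allS \<chi> \<Longrightarrow> sbS C X (sbS X C \<chi>) = \<chi>"
proof -
  show "pureF \<chi> \<Longrightarrow> c \<notin> allN \<chi> \<Longrightarrow> sbN c (NVar x) (sbN x (NVar c) \<chi>) = \<chi>"
    by (induction \<chi>) (auto simp: sbn_back not_fv)
  show "pureF \<chi> \<Longrightarrow> C \<notin> allS \<chi> \<Longrightarrow> sbS C X (sbS X C \<chi>) = \<chi>"
    by (induction \<chi>) (auto simp: sbn_back not_fv)
qed

lemma free_back:
  "pureF \<chi> \<Longrightarrow> c \<notin> allN \<chi> \<Longrightarrow> freeN (NVar x) c (sbN x (NVar c) \<chi>)"
  "pureF \<chi> \<Longrightarrow> C \<notin> allS \<chi> \<Longrightarrow> freeS X C (sbS X C \<chi>)"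
proof -
  show "pureF \<chi> \<Longrightarrow> c \<notin> allN \<chi> \<Longrightarrow> freeN (NVar x) c (sbN x (NVar c) \<chi>)"
    by (induction \<chi>) (auto simp: not_fv)
  show "pureF \<chi> \<Longrightarrow> C \<notin> allS \<chi> \<Longrightarrow> freeS X C (sbS X C \<chi>)"
    by (induction \<chi>) (auto simp: not_fv)
qed

section \<open>Consistent sets and their Henkin extensions\<close>

abbreviation Con :: "form set \<Rightarrow> form set \<Rightarrow> bool" where "Con T \<Gamma> \<equiv> \<not> D T \<Gamma> Bot"

text \<open>If adding the negated instance were inconsistent, \<Gamma> would prove \<chi> at
  \<open>c\<close>. As \<open>c\<close> is not free in \<Gamma>, it can be generalized and renamed
  back to \<open>x\<close>, contradicting the negated universal formula in \<Gamma>. Fresh variables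
  thus play the part of Henkin constants.\<close>

lemma Con_witN:
  assumes "Con T \<Gamma>" "Not (AllN x \<chi>) \<in> \<Gamma>" "pureT T" "pureT \<Gamma>" "\<forall>\<gamma>\<in>\<Gamma>. c \<notin> fvN \<gamma>" "c \<notin> allN \<chi>" "c \<noteq> x"
  shows "Con T (insert (Not (sbN x (NVar c) \<chi>)) \<Gamma>)"
proof
  let ?\<chi> = "sbN x (NVar c) \<chi>"
  have p: "pureF \<chi>" using assms(2,4) by auto
  assume "D T (insert (Not ?\<chi>) \<Gamma>) Bot"
  then have "D T \<Gamma> ?\<chi>" using D_ccontr assms p by simp
  then have 1: "D T \<Gamma> (AllN c ?\<chi>)" using D_genN assms by simp
  have "prv T (Imp (AllN c ?\<chi>) (sbN c (NVar x) ?\<chi>))"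
    by (rule Q1N) (use p assms free_back in auto)
  then have "D T {AllN c ?\<chi>} \<chi>" using sb_back(1)[OF p] assms by (metis D.intros insertCI)
  then have "D T {AllN c ?\<chi>} (AllN x \<chi>)"
    by (rule D_genN) (use assms p fvN_sbN[OF p, of x c] in auto)
  then have "D T {} (Imp (AllN c ?\<chi>) (AllN x \<chi>))" using D_ded assms p by simp
  then have "D T \<Gamma> (AllN x \<chi>)" using 1 by (meson D.Dmp D_mono empty_subsetI)
  then have "D T \<Gamma> Bot" using assms(2) unfolding Not_def by (meson D.intros)
  then show False using assms by simp
qed

lemma Con_witS:
  assumes "Con T \<Gamma>" "Not (AllS x \<chi>) \<in> \<Gamma>" "pureT T" "pureT \<Gamma>" "\<forall>\<gamma>\<in>\<Gamma>. c \<notin> fvS \<gamma>" "c \<notin> allS \<chi>" "c \<noteq> x"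
  shows "Con T (insert (Not (sbS x c \<chi>)) \<Gamma>)"
proof
  let ?\<chi> = "sbS x c \<chi>"
  have p: "pureF \<chi>" using assms(2,4) by auto
  assume "D T (insert (Not ?\<chi>) \<Gamma>) Bot"
  then have "D T \<Gamma> ?\<chi>" using D_ccontr assms p by simp
  then have 1: "D T \<Gamma> (AllS c ?\<chi>)" using D_genS assms by simp
  have "prv T (Imp (AllS c ?\<chi>) (sbS c x ?\<chi>))"
    by (rule Q1S) (use p assms free_back in auto)
  then have "D T {AllS c ?\<chi>} \<chi>" using sb_back(2)[OF p] assms by (metis D.intros insertCI)
  then have "D T {AllS c ?\<chi>} (AllS x \<chi>)"
    by (rule D_genS) (use assms p fvS_sbS[OF p, of x c] in auto)
  then have "D T {} (Imp (AllS c ?\<chi>) (AllS x \<chi>))" using D_ded assms p by simp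
  then have "D T \<Gamma> (AllS x \<chi>)" using 1 by (meson D.Dmp D_mono empty_subsetI)
  then have "D T \<Gamma> Bot" using assms(2) unfolding Not_def by (meson D.intros)
  then show False using assms by simp
qed

text \<open>A witness is demanded beyond every bound \<open>k\<close>. This makes each element of
  the later term model the value of variables with arbitrarily large index, in particular of one
  that does not occur in a given formula.\<close>

definition hwit :: "nat \<Rightarrow> form \<Rightarrow> form set \<Rightarrow> bool" where
  "hwit k \<phi> \<Gamma> \<longleftrightarrow> 
    (\<forall>x \<chi>. \<phi> = Not (AllN x \<chi>) \<longrightarrow> (\<exists>c\<ge>k. c \<notin> allN \<chi> \<and> c \<noteq> x \<and> Not (sbN x (NVar c) \<chi>) \<in> \<Gamma>)) \<and>
    (\<forall>x \<chi>. \<phi> = Not (AllS x \<chi>) \<longrightarrow> (\<exists>c\<ge>k. c \<notin> allS \<chi> \<and> c \<noteq> x \<and> Not (sbS x c \<chi>) \<in> \<Gamma>))"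

definition hstep :: "form set \<Rightarrow> form \<times> nat \<Rightarrow> form set \<Rightarrow> form set \<Rightarrow> bool" where
  "hstep T p \<Gamma> \<Gamma>' \<longleftrightarrow> \<Gamma> \<subseteq> \<Gamma>' \<and>
    (pureF (fst p) \<longrightarrow> Con T (insert (fst p) \<Gamma>) \<longrightarrow> fst p \<in> \<Gamma>' \<and> hwit (snd p) (fst p) \<Gamma>')"

lemma hwit_mono:
  assumes "hwit k \<phi> A" "A \<subseteq> B"
  shows "hwit k \<phi> B"
  unfolding hwit_def
proof (intro conjI allI impI)
  fix x \<chi> assume "\<phi> = Not (AllN x \<chi>)"
  from assms(1)[unfolded hwit_def, THEN conjunct1, rule_format, OF this] assms(2)
  show "\<exists>c\<ge>k. c \<notin> allN \<chi> \<and> c \<noteq> x \<and> Not (sbN x (NVar c) \<chi>) \<in> B" by auto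
next
  fix x \<chi> assume "\<phi> = Not (AllS x \<chi>)"
  from assms(1)[unfolded hwit_def, THEN conjunct2, rule_format, OF this] assms(2)
  show "\<exists>c\<ge>k. c \<notin> allS \<chi> \<and> c \<noteq> x \<and> Not (sbS x c \<chi>) \<in> B" by auto
qed

lemma hstep_ex:
  assumes "pureT T" "finite \<Gamma>" "pureT \<Gamma>" "Con T \<Gamma>"
  shows "\<exists>\<Gamma>'. (finite \<Gamma>' \<and> pureT \<Gamma>' \<and> Con T \<Gamma>') \<and> hstep T (\<phi>,k) \<Gamma> \<Gamma>'"
proof (cases "pureF \<phi> \<and> Con T (insert \<phi> \<Gamma>)")
  case False then show ?thesis using assms by (auto simp: hstep_def)
next
  case True
  let ?G = "insert \<phi> \<Gamma>"
  consider x \<chi> where "\<phi> = Not (AllN x \<chi>)" | x \<chi> where "\<phi> = Not (AllS x \<chi>)" 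
    | "\<forall>x \<chi>. \<phi> \<noteq> Not (AllN x \<chi>) \<and> \<phi> \<noteq> Not (AllS x \<chi>)" by blast
  then show ?thesis
  proof cases
    case 1
    have "finite (insert x (allN \<chi> \<union> (\<Union>\<gamma>\<in>?G. fvN \<gamma>)))" using assms by simp
    then obtain c where c: "c \<notin> insert x (allN \<chi> \<union> (\<Union>\<gamma>\<in>?G. fvN \<gamma>))" "k \<le> c" using fresh_nat by meson
    have "Con T (insert (Not (sbN x (NVar c) \<chi>)) ?G)"
      by (rule Con_witN) (use True 1 assms c in auto)
    moreover have "hwit k \<phi> (insert (Not (sbN x (NVar c) \<chi>)) ?G)"
      using 1 c by (auto simp: hwit_def Not_def)
    ultimately show ?thesis using True 1 assms
      by (intro exI[of _ "insert (Not (sbN x (NVar c) \<chi>)) ?G"]) (auto simp: hstep_def)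
  next
    case 2
    have "finite (insert x (allS \<chi> \<union> (\<Union>\<gamma>\<in>?G. fvS \<gamma>)))" using assms by simp
    then obtain c where c: "c \<notin> insert x (allS \<chi> \<union> (\<Union>\<gamma>\<in>?G. fvS \<gamma>))" "k \<le> c" using fresh_nat by meson
    have "Con T (insert (Not (sbS x c \<chi>)) ?G)"
      by (rule Con_witS) (use True 2 assms c in auto)
    moreover have "hwit k \<phi> (insert (Not (sbS x c \<chi>)) ?G)"
      using 2 c by (auto simp: hwit_def Not_def)
    ultimately show ?thesis using True 2 assms
      by (intro exI[of _ "insert (Not (sbS x c \<chi>)) ?G"]) (auto simp: hstep_def)
  next
    case 3
    then show ?thesis using True assms by (intro exI[of _ ?G]) (auto simp: hstep_def hwit_def)
  qed
qed

text \<open>Stages stay finite, so fresh variables never run out. The enumeration runs over pairs of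
  a formula and a bound: each formula is considered once for every \<open>k\<close>, and one pass
  yields both maximality and unboundedly large witnesses.\<close>

lemma henkin_extension:
  assumes "pureT T" "finite \<Gamma>" "pureT \<Gamma>" "Con T \<Gamma>"
  shows "\<exists>H. \<Gamma> \<subseteq> H \<and> pureT H \<and> Con T H \<and> (\<forall>\<phi>. pureF \<phi> \<longrightarrow> Con T (insert \<phi> H) \<longrightarrow> \<phi> \<in> H) \<and>
    (\<forall>\<phi>\<in>H. \<forall>k. hwit k \<phi> H)"
proof -
  let ?Q = "\<lambda>(n::nat) \<Gamma>. finite \<Gamma> \<and> pureT \<Gamma> \<and> Con T \<Gamma>"
  have "\<exists>f. \<forall>n. ?Q n (f n) \<and> (n = 0 \<longrightarrow> f n = \<Gamma>) \<and> hstep T (from_nat n) (f n) (f (Suc n))"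
  proof -
    have "\<exists>f. \<forall>n. (?Q n (f n) \<and> (n = 0 \<longrightarrow> f n = \<Gamma>)) \<and> hstep T (from_nat n) (f n) (f (Suc n))"
    proof (rule dependent_nat_choice)
      show "\<exists>x. ?Q 0 x \<and> (0 = (0::nat) \<longrightarrow> x = \<Gamma>)" using assms by auto
      fix x n assume "?Q n x \<and> ((n::nat) = 0 \<longrightarrow> x = \<Gamma>)"
      then have "finite x" "pureT x" "Con T x" by blast+
      moreover obtain \<phi> k where "from_nat n = (\<phi> :: form, k :: nat)" by fastforce
      ultimately show "\<exists>y. (?Q (Suc n) y \<and> (Suc n = 0 \<longrightarrow> y = \<Gamma>)) \<and> hstep T (from_nat n) x y"
        using hstep_ex[OF assms(1), of x \<phi> k] by simp
    qed
    then show ?thesis by blast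
  qed
  then obtain f where f: "\<And>n. ?Q n (f n)" "f 0 = \<Gamma>" "\<And>n. hstep T (from_nat n) (f n) (f (Suc n))" by blast
  have mono: "n \<le> m \<Longrightarrow> f n \<subseteq> f m" for n m
    by (rule lift_Suc_mono_le[of f]) (use f(3) in \<open>auto simp: hstep_def\<close>)
  define H where "H = (\<Union>n. f n)"
  have sub: "\<exists>n. \<Delta> \<subseteq> f n" if "finite \<Delta>" "\<Delta> \<subseteq> H" for \<Delta>
    using that
  proof (induction \<Delta>)
    case (insert a A)
    then obtain n m where "A \<subseteq> f n" "a \<in> f m" unfolding H_def by auto
    then have "insert a A \<subseteq> f (max n m)" using mono[of n "max n m"] mono[of m "max n m"] by auto
    then show ?case by blast
  qed auto
  have con: "Con T H"
  proof
    assume a: "D T H Bot"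
    obtain \<Delta> where d: "\<Delta> \<subseteq> H" "finite \<Delta>" "D T \<Delta> Bot" using D_finite[OF a] by (elim exE conjE)
    obtain n where n: "\<Delta> \<subseteq> f n" using sub[OF d(2,1)] by (elim exE)
    have "Con T (f n)" using f(1)[of n] by (elim conjE)
    then show False using D_mono[OF d(3) n] by (rule notE)
  qed
  \<comment> \<open>A formula consistent with the union is consistent with the stage at which its
    pair comes up, so it was accepted there together with a witness.\<close>
  have stage: "\<phi> \<in> H \<and> hwit k \<phi> H" if p: "pureF \<phi>" and c: "Con T (insert \<phi> H)" for \<phi> k
  proof -
    let ?n = "to_nat (\<phi>, k)"
    have "insert \<phi> (f ?n) \<subseteq> insert \<phi> H" unfolding H_def by auto
    then have c': "Con T (insert \<phi> (f ?n))" using c D_mono by metis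
    have "hstep T (\<phi>, k) (f ?n) (f (Suc ?n))" using f(3)[of ?n] by simp
    then have *: "\<phi> \<in> f (Suc ?n)" "hwit k \<phi> (f (Suc ?n))" using p c' by (simp_all add: hstep_def)
    have "f (Suc ?n) \<subseteq> H" by (auto simp: H_def)
    then show ?thesis using *(1) hwit_mono[OF *(2)] by blast
  qed
  have "\<Gamma> \<subseteq> H" using f(2) unfolding H_def by blast
  moreover have pH: "pureT H" using f(1) unfolding H_def by blast
  moreover have "\<forall>\<phi>. pureF \<phi> \<longrightarrow> Con T (insert \<phi> H) \<longrightarrow> \<phi> \<in> H" using stage by simp
  moreover have "hwit k \<phi> H" if "\<phi> \<in> H" for \<phi> k
  proof -
    have "insert \<phi> H = H" using that by blast
    then show ?thesis using stage[of \<phi> k] that con pH by simp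
  qed
  ultimately show ?thesis using con by (intro exI[of _ H]) simp
qed

text \<open>The two successor axioms make the numerals pairwise distinct. The number sort of the
  term model is then countably infinite and can be identified with the natural numbers.\<close>

locale henkin =
  fixes T H :: "form set"
  assumes Tp: "pureT T" and Hp: "pureT H" and con: "Con T H"
    and max: "pureF \<phi> \<Longrightarrow> Con T (insert \<phi> H) \<Longrightarrow> \<phi> \<in> H"
    and wit: "\<phi> \<in> H \<Longrightarrow> hwit k \<phi> H"
    and B1: "Not (Eq1 (Plus vx One) Zero) \<in> T"
    and B2: "Imp (Eq1 (Plus vx One) (Plus vy One)) (Eq1 vx vy) \<in> T"
begin

lemma inH: assumes "D T H \<phi>" shows "\<phi> \<in> H"
proof (rule max)
  show p: "pureF \<phi>" using D_pure[OF assms Tp Hp] .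
  show "Con T (insert \<phi> H)"
  proof
    assume "D T (insert \<phi> H) Bot"
    then have "D T H (Not \<phi>)" using D_Not Tp Hp p by blast
    then show False using assms con unfolding Not_def by (meson D.Dmp)
  qed
qed

lemma thmH: "prv T \<phi> \<Longrightarrow> \<phi> \<in> H"
  by (intro inH D.Dthm)

lemma mpH: "Imp a b \<in> H \<Longrightarrow> a \<in> H \<Longrightarrow> b \<in> H"
  by (rule inH, rule D.Dmp; rule D.Dasm)

lemma BotH: "Bot \<notin> H"
proof
  assume "Bot \<in> H"
  then have "D T H Bot" by (rule D.Dasm)
  then show False using con by (rule notE[rotated])
qed

lemma NotH: assumes p: "pureF a" shows "Not a \<in> H \<longleftrightarrow> a \<notin> H"
proof
  show "Not a \<in> H \<Longrightarrow> a \<notin> H" using mpH[of a Bot] BotH by (auto simp: Not_def)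
  assume "a \<notin> H"
  then have "D T (insert a H) Bot" using max[OF p] by (rule contrapos_np)
  then show "Not a \<in> H" by (rule inH[OF D_Not[OF _ Tp Hp p]])
qed

lemma ImpH: assumes p: "pureF a" "pureF b" shows "Imp a b \<in> H \<longleftrightarrow> (a \<in> H \<longrightarrow> b \<in> H)"
proof
  show "Imp a b \<in> H \<Longrightarrow> a \<in> H \<longrightarrow> b \<in> H" using mpH by simp
  assume h: "a \<in> H \<longrightarrow> b \<in> H"
  show "Imp a b \<in> H"
  proof (cases "a \<in> H")
    case True
    then have "D T (insert a H) b" using h by (intro D.Dasm) simp
    then show ?thesis by (rule inH[OF D_ded[OF _ Tp Hp p(1)]])
  next
    case False
    let ?G = "insert (Not b) (insert a H)"
    have "D T ?G (Imp a Bot)" using False NotH[OF p(1)] by (intro D.Dasm) (simp add: Not_def)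
    moreover have "D T ?G a" by (rule D.Dasm) simp
    ultimately have "D T ?G Bot" by (rule D.Dmp)
    then have "D T (insert a H) b" by (rule D_ccontr) (use Tp Hp p in auto)
    then show ?thesis by (rule inH[OF D_ded[OF _ Tp Hp p(1)]])
  qed
qed

lemma allH: assumes "AllN x \<chi> \<in> H" "pureN u" "freeN u x \<chi>" shows "sbN x u \<chi> \<in> H"
proof -
  have "pureF \<chi>" using Hp assms(1) by auto
  from mpH[OF thmH[OF Q1N[OF this assms(2,3)]] assms(1)] show ?thesis .
qed

lemma allHS: assumes "AllS x \<chi> \<in> H" "freeS u x \<chi>" shows "sbS x u \<chi> \<in> H"
proof -
  have "pureF \<chi>" using Hp assms(1) by auto
  from mpH[OF thmH[OF Q1S[OF this assms(2)]] assms(1)] show ?thesis .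
qed

lemma nallH:
  assumes "pureF \<chi>" "AllN x \<chi> \<notin> H"
  obtains c where "c \<ge> k" "c \<notin> allN \<chi>" "c \<noteq> x" "sbN x (NVar c) \<chi> \<notin> H"
proof -
  have "Not (AllN x \<chi>) \<in> H" using NotH[of "AllN x \<chi>"] assms by simp
  from wit[OF this, of k, unfolded hwit_def, THEN conjunct1, rule_format, OF refl]
  obtain c where c: "c \<ge> k" "c \<notin> allN \<chi>" "c \<noteq> x" "Not (sbN x (NVar c) \<chi>) \<in> H" by (elim exE conjE)
  have "sbN x (NVar c) \<chi> \<notin> H" using c(4) NotH[of "sbN x (NVar c) \<chi>"] assms(1) by simp
  then show thesis using that c by simp
qed

lemma nallHS:
  assumes "pureF \<chi>" "AllS x \<chi> \<notin> H"
  obtains c where "c \<ge> k" "c \<notin> allS \<chi>" "c \<noteq> x" "sbS x c \<chi> \<notin> H"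
proof -
  have "Not (AllS x \<chi>) \<in> H" using NotH[of "AllS x \<chi>"] assms by simp
  from wit[OF this, of k, unfolded hwit_def, THEN conjunct2, rule_format, OF refl]
  obtain c where c: "c \<ge> k" "c \<notin> allS \<chi>" "c \<noteq> x" "Not (sbS x c \<chi>) \<in> H" by (elim exE conjE)
  have "sbS x c \<chi> \<notin> H" using c(4) NotH[of "sbS x c \<chi>"] assms(1) by simp
  then show thesis using that c by simp
qed

text \<open>The equality axiom \<open>E2N\<close> exchanges variables only. Replacement of a term
  \<open>u\<close> by \<open>v\<close> is obtained by generalizing the axiom over both variables and
  instantiating them; with \<alpha> an atom these substitutions capture nothing.\<close>

lemma repl:
  assumes "\<alpha> = Eq1 s t \<or> \<alpha> = Le s t \<or> \<alpha> = Mem s (SVar X) \<and> t = Zero" "pureN s" "pureN t" "pureN u" "pureN v"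
    and e: "Eq1 u v \<in> H" and a: "sbN w u \<alpha> \<in> H"
    and w: "w \<notin> fvNn u" "w \<notin> fvNn v"
  shows "sbN w v \<alpha> \<in> H"
proof -
  obtain y where "y \<notin> insert w (fvNn s \<union> fvNn t \<union> fvNn u \<union> fvNn v)"
    using fresh_nat[of "insert w (fvNn s \<union> fvNn t \<union> fvNn u \<union> fvNn v)" 0] by auto
  then have y: "y \<noteq> w" "y \<notin> fvNn s" "y \<notin> fvNn t" "y \<notin> fvNn u" "y \<notin> fvNn v" by auto
  have wt: "w \<notin> fvNn (sbNn w (NVar y) r)" if "pureN r" for r
    using sbn_back(2)[OF that, of w "NVar y"] y by auto
  have t1: "sbNn w u (sbNn w (NVar y) r) = sbNn w (NVar y) r" if "pureN r" for r
    by (rule sbNn_id(1)) (use wt that in auto)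
  have t2: "sbNn y v (sbNn w u r) = sbNn w u r" if "pureN r" "y \<notin> fvNn r" for r
    by (rule sbNn_id(1)) (use sbn_back(2)[OF that(1), of w u] that assms y in auto)
  have t3: "sbNn y v (sbNn w (NVar y) r) = sbNn w v r" if "pureN r" "y \<notin> fvNn r" for r
    using that by (induction r rule: nterm.induct[where ?P2.0="\<lambda>_. True"]) auto
  let ?\<theta> = "Imp (Eq1 (NVar w) (NVar y)) (Imp \<alpha> (sbN w (NVar y) \<alpha>))"
  have "prv T ?\<theta>" by (rule E2N) (use assms in auto)
  then have "AllN w (AllN y ?\<theta>) \<in> H" by (intro thmH GenN)
  from allH[OF this, of u] have "AllN y (sbN w u ?\<theta>) \<in> H" using assms y by auto
  from allH[OF this, of v] have "sbN y v (sbN w u ?\<theta>) \<in> H" using assms y by auto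
  moreover have "sbN y v (sbN w u ?\<theta>) = Imp (Eq1 u v) (Imp (sbN w u \<alpha>) (sbN w v \<alpha>))"
    using assms y by (auto simp: t1 t2 t3)
  ultimately show ?thesis using mpH e a by metis
qed

lemma reflH: "pureN u \<Longrightarrow> Eq1 u u \<in> H"
  using allH[of 0 "Eq1 (NVar 0) (NVar 0)" u] thmH[OF GenN[OF E1N]] by simp

lemma fresh_obtain: obtains w where "w \<notin> fvNn (u::nterm)" "w \<notin> fvNn (v::nterm)" "w \<notin> fvNn (t::nterm)"
  using fresh_nat[of "fvNn u \<union> fvNn v \<union> fvNn t" 0] by auto

lemma symH: assumes "Eq1 u v \<in> H" shows "Eq1 v u \<in> H"
proof -
  have p: "pureN u" "pureN v" using Hp assms by auto
  obtain w where w: "w \<notin> fvNn u" "w \<notin> fvNn v" by (rule fresh_obtain)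
  show ?thesis using repl[of "Eq1 (NVar w) u" "NVar w" u _ u v w] p w assms reflH by simp
qed

lemma transH: assumes "Eq1 u v \<in> H" "Eq1 v t \<in> H" shows "Eq1 u t \<in> H"
proof -
  have p: "pureN u" "pureN v" "pureN t" using Hp assms by auto
  obtain w where w: "w \<notin> fvNn u" "w \<notin> fvNn v" "w \<notin> fvNn t" by (rule fresh_obtain)
  show ?thesis using repl[of "Eq1 u (NVar w)" u "NVar w" _ v t w] p w assms by simp
qed

lemma congH:
  assumes "Eq1 u v \<in> H" "pureN t"
  shows "Eq1 (Plus t u) (Plus t v) \<in> H" "Eq1 (Times t u) (Times t v) \<in> H"
    "Eq1 (Plus u t) (Plus v t) \<in> H" "Eq1 (Times u t) (Times v t) \<in> H"
    "Le t u \<in> H \<Longrightarrow> Le t v \<in> H" "Le u t \<in> H \<Longrightarrow> Le v t \<in> H" "Mem u (SVar X) \<in> H \<Longrightarrow> Mem v (SVar X) \<in> H"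
proof -
  have p: "pureN u" "pureN v" using Hp assms by auto
  obtain w where w: "w \<notin> fvNn u" "w \<notin> fvNn v" "w \<notin> fvNn t" by (rule fresh_obtain)
  show "Eq1 (Plus t u) (Plus t v) \<in> H" 
    using repl[of "Eq1 (Plus t u) (Plus t (NVar w))" "Plus t u" "Plus t (NVar w)" _ u v w] p w assms reflH by simp
  show "Eq1 (Times t u) (Times t v) \<in> H" 
    using repl[of "Eq1 (Times t u) (Times t (NVar w))" "Times t u" "Times t (NVar w)" _ u v w] p w assms reflH by simp
  show "Eq1 (Plus u t) (Plus v t) \<in> H" 
    using repl[of "Eq1 (Plus u t) (Plus (NVar w) t)" "Plus u t" "Plus (NVar w) t" _ u v w] p w assms reflH by simp
  show "Eq1 (Times u t) (Times v t) \<in> H" 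
    using repl[of "Eq1 (Times u t) (Times (NVar w) t)" "Times u t" "Times (NVar w) t" _ u v w] p w assms reflH by simp
  show "Le t u \<in> H \<Longrightarrow> Le t v \<in> H"
    using repl[of "Le t (NVar w)" t "NVar w" _ u v w] p w assms by simp
  show "Le u t \<in> H \<Longrightarrow> Le v t \<in> H"
    using repl[of "Le (NVar w) t" "NVar w" t _ u v w] p w assms by simp
  show "Mem u (SVar X) \<in> H \<Longrightarrow> Mem v (SVar X) \<in> H"
    using repl[of "Mem (NVar w) (SVar X)" "NVar w" Zero X u v w] p w assms by simp
qed

text \<open>The formula saying that every \<open>x\<close> differs from \<open>u\<close> is refuted
  by \<open>u\<close> itself, and its negation has witnesses beyond every bound.\<close>

lemma ex_var: assumes "pureN u" obtains c where "c \<ge> k" "Eq1 u (NVar c) \<in> H"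
proof -
  obtain x where x: "x \<notin> fvNn u" by (rule fresh_obtain)
  let ?\<chi> = "Not (Eq1 u (NVar x))"
  have "AllN x ?\<chi> \<notin> H"
  proof
    assume "AllN x ?\<chi> \<in> H"
    from allH[OF this assms] have "Not (Eq1 u u) \<in> H" using x assms by (simp add: Not_def)
    then show False using NotH reflH assms by simp
  qed
  then obtain c where "c \<ge> k" "sbN x (NVar c) ?\<chi> \<notin> H" by (rule nallH[rotated]) (use assms in auto)
  then have "c \<ge> k" "Eq1 u (NVar c) \<in> H" using x assms NotH[of "Eq1 u (NVar c)"] by (auto simp: Not_def)
  then show thesis by (rule that)
qed

lemma reflHS: "Eq2 (SVar X) (SVar X) \<in> H"
  using thmH[OF E1S] .

lemma symHS: assumes "Eq2 (SVar X) (SVar Y) \<in> H" shows "Eq2 (SVar Y) (SVar X) \<in> H"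
proof -
  obtain W where W: "W \<noteq> X" "W \<noteq> Y" using fresh_nat[of "{X,Y}" 0] by auto
  have "prv T (Imp (Eq2 (SVar W) (SVar Y)) (Imp (Eq2 (SVar W) (SVar X)) (sbS W Y (Eq2 (SVar W) (SVar X)))))"
    by (rule E2S) auto
  from allHS[OF thmH[OF GenS[OF this, of W]], of X] show ?thesis using W assms reflHS by (auto intro: mpH)
qed

lemma congHS:
  assumes "Eq2 (SVar X) (SVar Y) \<in> H" 
  shows "Eq2 (SVar X) (SVar Z) \<in> H \<Longrightarrow> Eq2 (SVar Y) (SVar Z) \<in> H"
    "Mem (NVar a) (SVar X) \<in> H \<Longrightarrow> Mem (NVar a) (SVar Y) \<in> H"
    "Eq1 (Len (SVar X)) (NVar a) \<in> H \<Longrightarrow> Eq1 (Len (SVar Y)) (NVar a) \<in> H"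
proof -
  have *: "\<phi> \<in> H \<Longrightarrow> sbS X Y \<phi> \<in> H" if "freeS Y X \<phi>" for \<phi>
    using thmH[OF E2S[OF _ that]] assms mpH Hp by metis
  show "Mem (NVar a) (SVar X) \<in> H \<Longrightarrow> Mem (NVar a) (SVar Y) \<in> H" using *[of "Mem (NVar a) (SVar X)"] by simp
  show "Eq1 (Len (SVar X)) (NVar a) \<in> H \<Longrightarrow> Eq1 (Len (SVar Y)) (NVar a) \<in> H"
    using *[of "Eq1 (Len (SVar X)) (NVar a)"] by simp
  show "Eq2 (SVar X) (SVar Z) \<in> H \<Longrightarrow> Eq2 (SVar Y) (SVar Z) \<in> H"
    using *[of "Eq2 (SVar X) (SVar Z)"] symHS[OF assms] by (cases "Z = X") auto
qed

lemma ex_varS: obtains C where "C \<ge> k" "Eq2 (SVar X) (SVar C) \<in> H"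
proof -
  obtain Z where Z: "Z \<noteq> X" using fresh_nat[of "{X}" 0] by auto
  let ?\<chi> = "Not (Eq2 (SVar X) (SVar Z))"
  have "AllS Z ?\<chi> \<notin> H"
  proof
    assume "AllS Z ?\<chi> \<in> H"
    from allHS[OF this, of X] have "Not (Eq2 (SVar X) (SVar X)) \<in> H" using Z by (simp add: Not_def)
    then show False using NotH reflHS by simp
  qed
  then obtain c where "c \<ge> k" "sbS Z c ?\<chi> \<notin> H" by (rule nallHS[rotated]) auto
  then have "c \<ge> k" "Eq2 (SVar X) (SVar c) \<in> H" using Z NotH[of "Eq2 (SVar X) (SVar c)"] by (auto simp: Not_def)
  then show thesis by (rule that)
qed

lemma fv_num [simp]: "fvNn (numeral_t i) = {}" "fvSn (numeral_t i) = {}" "pureN (numeral_t i)"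
  by (induction i) auto

lemma num_neq: "i < j \<Longrightarrow> Eq1 (numeral_t i) (numeral_t j) \<notin> H"
proof (induction i arbitrary: j)
  case 0
  then obtain j' where j: "j = Suc j'" by (cases j) auto
  have "AllN 0 (Not (Eq1 (Plus vx One) Zero)) \<in> H" by (intro thmH GenN prv.Ax B1)
  from allH[OF this, of "numeral_t j'"] have "Not (Eq1 (numeral_t j) Zero) \<in> H" using j by (simp add: Not_def)
  then show ?case using NotH[of "Eq1 (numeral_t j) Zero"] symH by (auto simp: j)
next
  case (Suc i)
  then obtain j' where j: "j = Suc j'" by (cases j) auto
  have "AllN 0 (AllN 1 (Imp (Eq1 (Plus vx One) (Plus vy One)) (Eq1 vx vy))) \<in> H" by (intro thmH GenN prv.Ax B2)
  from allH[OF this, of "numeral_t i"] have "AllN 1 (Imp (Eq1 (numeral_t (Suc i)) (Plus vy One)) (Eq1 (numeral_t i) vy)) \<in> H" by simp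
  from allH[OF this, of "numeral_t j'"] have "Imp (Eq1 (numeral_t (Suc i)) (numeral_t j)) (Eq1 (numeral_t i) (numeral_t j')) \<in> H"
    by (simp add: j)
  then show ?case using Suc mpH by (auto simp: j simp del: numeral_t.simps)
qed

section \<open>The term model\<close>

definition "R = {(a, b). Eq1 (NVar a) (NVar b) \<in> H}"

lemma equivR: "equiv UNIV R"
  by (rule equivI) (auto simp: R_def refl_on_def sym_def trans_def reflH intro: symH transH)

definition cl :: "nat \<Rightarrow> nat set" where "cl a = R `` {a}"

lemma cl_eq: "cl a = cl b \<longleftrightarrow> Eq1 (NVar a) (NVar b) \<in> H"
  using eq_equiv_class_iff[OF equivR, of a b] by (simp add: cl_def R_def)

text \<open>The numerals name pairwise different classes, by \<open>num_neq\<close>.\<close>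

lemma infinite_cl: "infinite (range cl)"
proof -
  have "\<exists>c. Eq1 (numeral_t i) (NVar c) \<in> H" for i by (rule ex_var[of "numeral_t i" 0]) auto
  then obtain g where g: "\<And>i. Eq1 (numeral_t i) (NVar (g i)) \<in> H" by metis
  have "inj (\<lambda>i. cl (g i))"
  proof (rule linorder_injI)
    fix i j :: nat assume "i < j"
    show "cl (g i) \<noteq> cl (g j)"
    proof
      assume "cl (g i) = cl (g j)"
      then have "Eq1 (NVar (g i)) (NVar (g j)) \<in> H" by (simp add: cl_eq)
      then have "Eq1 (numeral_t i) (numeral_t j) \<in> H" using transH[OF transH[OF g] symH[OF g]] by blast
      then show False using num_neq \<open>i < j\<close> by blast
    qed
  qed
  then have "infinite (range (\<lambda>i. cl (g i)))" using finite_imageD infinite_UNIV_nat by blast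
  then show ?thesis by (rule infinite_super[rotated]) auto
qed

text \<open>The classes are numbered bijectively by all natural numbers, so that number equality in
  the model is identity and the number domain is the whole type, as \<open>normal\<close>
  demands.\<close>

definition idx :: "nat \<Rightarrow> nat" where "idx a = to_nat_on (range cl) (cl a)"

lemma idx_eq: "idx a = idx b \<longleftrightarrow> Eq1 (NVar a) (NVar b) \<in> H"
  unfolding idx_def cl_eq[symmetric] by (subst inj_on_eq_iff[OF inj_on_to_nat_on]) auto

lemma idx_surj: "surj idx"
  using bij_betw_imp_surj_on[OF to_nat_on_infinite[OF _ infinite_cl]] by (auto simp: idx_def image_image[symmetric] surj_def)

definition rp :: "nat \<Rightarrow> nat" where "rp = inv idx"

lemma idx_rp [simp]: "idx (rp e) = e"
  unfolding rp_def using idx_surj by (rule surj_f_inv_f)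

definition tv :: "nterm \<Rightarrow> nat" where "tv u = idx (SOME c. Eq1 u (NVar c) \<in> H)"

lemma tv_some: "pureN u \<Longrightarrow> Eq1 u (NVar (SOME c. Eq1 u (NVar c) \<in> H)) \<in> H"
  by (rule someI_ex) (rule ex_var[of u 0], auto)

lemma tv_eq: assumes "pureN u" "pureN v" shows "tv u = tv v \<longleftrightarrow> Eq1 u v \<in> H"
  unfolding tv_def idx_eq using tv_some[OF assms(1)] tv_some[OF assms(2)] symH transH by blast

lemma tv_var [simp]: "tv (NVar a) = idx a"
  using tv_some[of "NVar a"] symH by (auto simp: tv_def idx_eq)

lemma tv_rp: "pureN u \<Longrightarrow> Eq1 (NVar (rp (tv u))) u \<in> H"
  using tv_eq[of "NVar (rp (tv u))" u] by simp

text \<open>String classes are not renumbered: the class itself is the element, and the string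
  domain of the model is the range of \<open>sx\<close>.\<close>

definition sx :: "nat \<Rightarrow> nat set" where "sx X = {Y. Eq2 (SVar X) (SVar Y) \<in> H}"

lemma sx_eq: "sx X = sx Y \<longleftrightarrow> Eq2 (SVar X) (SVar Y) \<in> H"
  unfolding sx_def using reflHS symHS congHS(1) by blast

definition rpS :: "nat set \<Rightarrow> nat" where "rpS = inv sx"

lemma sx_rpS: "Eq2 (SVar X) (SVar (rpS (sx X))) \<in> H" "Eq2 (SVar (rpS (sx X))) (SVar X) \<in> H"
  using f_inv_into_f[of "sx X" sx UNIV] by (auto simp: rpS_def sx_eq[symmetric])

definition HM :: "(nat, nat set) mdl" where
  "HM = \<lparr>mN = UNIV, mS = range sx, mz = tv Zero, mo = tv One,
    ma = (\<lambda>a b. tv (Plus (NVar (rp a)) (NVar (rp b)))), mm = (\<lambda>a b. tv (Times (NVar (rp a)) (NVar (rp b)))),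
    mlen = (\<lambda>A. tv (Len (SVar (rpS A)))), mle = (\<lambda>a b. Le (NVar (rp a)) (NVar (rp b)) \<in> H),
    mmem = (\<lambda>a A. Mem (NVar (rp a)) (SVar (rpS A)) \<in> H), meq1 = (=), meq2 = (=)\<rparr>"

lemma HM_mev: "pureN u \<Longrightarrow> mev HM idx sx u = tv u"
proof (induction u rule: nterm.induct[where ?P2.0="\<lambda>_. True"])
  case (Plus s t)
  then have "Eq1 (Plus (NVar (rp (tv s))) (NVar (rp (tv t)))) (Plus s t) \<in> H"
    using transH[OF congH(3)[OF tv_rp[of s]] congH(1)[OF tv_rp[of t]]] by simp
  then show ?case using Plus by (simp add: HM_def tv_eq)
next
  case (Times s t)
  then have "Eq1 (Times (NVar (rp (tv s))) (NVar (rp (tv t)))) (Times s t) \<in> H"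
    using transH[OF congH(4)[OF tv_rp[of s]] congH(2)[OF tv_rp[of t]]] by simp
  then show ?case using Times by (simp add: HM_def tv_eq)
next
  case (Len S)
  then obtain X where X: "S = SVar X" by (cases S) auto
  obtain c where c: "Eq1 (Len (SVar X)) (NVar c) \<in> H" by (rule ex_var[of _ 0]) auto
  have "Eq1 (Len (SVar (rpS (sx X)))) (NVar c) \<in> H" by (rule congHS(3)[OF sx_rpS(1) c])
  then have "Eq1 (Len (SVar (rpS (sx X)))) (Len (SVar X)) \<in> H" using transH symH c by blast
  then show ?case using Len X by (simp add: HM_def tv_eq)
qed (auto simp: HM_def)

primrec fsz :: "form \<Rightarrow> nat" where
  "fsz Bot = 0" | "fsz (Eq1 s t) = 0" | "fsz (Le s t) = 0" | "fsz (Mem s t) = 0" | "fsz (Eq2 s t) = 0"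
| "fsz (Imp a b) = Suc (fsz a + fsz b)" | "fsz (AllN x a) = Suc (fsz a)" | "fsz (AllS x a) = Suc (fsz a)"

lemma fsz_sb [simp]: "fsz (sbN x u \<phi>) = fsz \<phi>" "fsz (sbS x y \<phi>) = fsz \<phi>"
  by (induction \<phi>) auto

text \<open>The induction is on the number of connectives and quantifiers, since the quantifier
  cases pass to substitution instances. An element of the model is first named by a variable that
  does not occur in \<chi>, for which substitution captures nothing.\<close>

lemma truth: "pureF \<phi> \<Longrightarrow> msat HM idx sx \<phi> \<longleftrightarrow> \<phi> \<in> H"
proof (induction "fsz \<phi>" arbitrary: \<phi> rule: less_induct)
  case less
  show ?case
  proof (cases \<phi>)
    case Bot then show ?thesis using BotH by simp
  next
    case (Eq1 s t) then show ?thesis using less.prems by (simp add: HM_mev tv_eq) (simp add: HM_def tv_eq)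
  next
    case (Le s t)
    then have p: "pureN s" "pureN t" using less.prems by auto
    have "Le (NVar (rp (tv s))) (NVar (rp (tv t))) \<in> H \<longleftrightarrow> Le s t \<in> H"
      using congH(5)[OF tv_rp[OF p(2)]] congH(6)[OF tv_rp[OF p(1)]] 
        congH(5)[OF symH[OF tv_rp[OF p(2)]]] congH(6)[OF symH[OF tv_rp[OF p(1)]]] p pureN.simps(1) by blast
    then show ?thesis using Le p by (simp add: HM_mev) (simp add: HM_def)
  next
    case (Mem s S)
    then obtain X where X: "S = SVar X" using less.prems by (cases S) auto
    have p: "pureN s" using Mem less.prems by auto
    have "Mem (NVar (rp (tv s))) (SVar (rpS (sx X))) \<in> H \<longleftrightarrow> Mem s (SVar X) \<in> H"
      using congH(7)[OF tv_rp[OF p]] congH(7)[OF symH[OF tv_rp[OF p]]] congHS(2)[OF sx_rpS(1)[of X]] congHS(2)[OF sx_rpS(2)[of X]] 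
        p by blast
    then show ?thesis using Mem X p by (simp add: HM_mev) (simp add: HM_def)
  next
    case (Eq2 S S')
    then obtain X X' where "S = SVar X" "S' = SVar X'" using less.prems by (cases S; cases S') auto
    then show ?thesis using Eq2 by (simp add: HM_def sx_eq)
  next
    case (Imp a b) then show ?thesis using less ImpH by simp
  next
    case (AllN x \<chi>)
    then have p: "pureF \<chi>" using less.prems by simp
    have IH: "msat HM (idx(x := idx c)) sx \<chi> \<longleftrightarrow> sbN x (NVar c) \<chi> \<in> H" if "c \<notin> allN \<chi>" for c
    proof -
      have "freeN (NVar c) x \<chi>" using that freeN_fresh by blast
      from msat_sbN[OF p _ this, of HM idx sx] have "msat HM idx sx (sbN x (NVar c) \<chi>) = msat HM (idx(x := idx c)) sx \<chi>" by simp
      then show ?thesis using less.hyps[of "sbN x (NVar c) \<chi>"] p AllN by simp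
    qed
    show ?thesis
    proof
      assume a: "\<phi> \<in> H"
      have "msat HM (idx(x := e)) sx \<chi>" for e
      proof -
        obtain c where c: "c \<ge> Suc (Max (insert 0 (allN \<chi>)))" "Eq1 (NVar (rp e)) (NVar c) \<in> H" 
          by (rule ex_var[of "NVar (rp e)"]) auto
        then have "idx c = e" using idx_eq[of "rp e" c] by simp
        have n: "c \<notin> allN \<chi>"
        proof
          assume "c \<in> allN \<chi>"
          then have "c \<le> Max (insert 0 (allN \<chi>))" by simp
          then show False using c by simp
        qed
        have "sbN x (NVar c) \<chi> \<in> H" using allH[of x \<chi> "NVar c"] a AllN freeN_fresh[OF n] by simp
        then show ?thesis using IH[OF n] \<open>idx c = e\<close> by simp
      qed
      then show "msat HM idx sx \<phi>" using AllN by simp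
    next
      assume m: "msat HM idx sx \<phi>"
      show "\<phi> \<in> H"
      proof (rule ccontr)
        assume "\<phi> \<notin> H"
        then obtain c where "c \<notin> allN \<chi>" "sbN x (NVar c) \<chi> \<notin> H" using AllN by (metis nallH p)
        then have "\<not> msat HM (idx(x := idx c)) sx \<chi>" using IH by simp
        then show False using m AllN by (simp add: HM_def)
      qed
    qed
  next
    case (AllS x \<chi>)
    then have p: "pureF \<chi>" using less.prems by simp
    have IH: "msat HM idx (sx(x := sx c)) \<chi> \<longleftrightarrow> sbS x c \<chi> \<in> H" if "c \<notin> allS \<chi>" for c
    proof -
      have "freeS c x \<chi>" using that freeS_fresh by blast
      from msat_sbS[OF p this, of HM idx sx] have "msat HM idx sx (sbS x c \<chi>) = msat HM idx (sx(x := sx c)) \<chi>" by simp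
      then show ?thesis using less.hyps[of "sbS x c \<chi>"] p AllS by simp
    qed
    show ?thesis
    proof
      assume a: "\<phi> \<in> H"
      have "msat HM idx (sx(x := sx X)) \<chi>" for X
      proof -
        obtain c where c: "c \<ge> Suc (Max (insert 0 (allS \<chi>)))" "Eq2 (SVar X) (SVar c) \<in> H" 
          by (rule ex_varS)
        then have "sx c = sx X" using sx_eq[of X c] by simp
        have n: "c \<notin> allS \<chi>"
        proof
          assume "c \<in> allS \<chi>"
          then have "c \<le> Max (insert 0 (allS \<chi>))" by simp
          then show False using c by simp
        qed
        have "sbS x c \<chi> \<in> H" using allHS[of x \<chi> c] a AllS freeS_fresh[OF n] by simp
        then show ?thesis using IH[OF n] \<open>sx c = sx X\<close> by simp
      qed
      then show "msat HM idx sx \<phi>" using AllS by (auto simp: HM_def)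
    next
      assume m: "msat HM idx sx \<phi>"
      show "\<phi> \<in> H"
      proof (rule ccontr)
        assume "\<phi> \<notin> H"
        then obtain c where "c \<notin> allS \<chi>" "sbS x c \<chi> \<notin> H" using AllS by (metis nallHS p)
        then have "\<not> msat HM idx (sx(x := sx c)) \<chi>" using IH by simp
        then show False using m AllS by (simp add: HM_def)
      qed
    qed
  qed
qed

end

section \<open>Completeness with respect to normal models\<close>

definition valid_env :: "('a, 's) mdl \<Rightarrow> (nat \<Rightarrow> 'a) \<Rightarrow> (nat \<Rightarrow> 's) \<Rightarrow> bool" where
  "valid_env M na sa \<longleftrightarrow> (\<forall>i. na i \<in> mN M) \<and> (\<forall>i. sa i \<in> mS M)"

definition normal :: "('a, 's) mdl \<Rightarrow> bool" where
  "normal M \<longleftrightarrow> mN M = UNIV \<and> meq1 M = (=) \<and> meq2 M = (=)"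

definition models :: "('a, 's) mdl \<Rightarrow> form set \<Rightarrow> bool" where
  "models M T \<longleftrightarrow> (\<forall>\<phi>\<in>T. \<forall>na sa. valid_env M na sa \<longrightarrow> msat M na sa \<phi>)"

lemma msat_foldrN: "msat M na sa (foldr AllN xs \<phi>) \<Longrightarrow> \<forall>i. na' i \<in> mN M \<Longrightarrow> \<forall>i. i \<notin> set xs \<longrightarrow> na' i = na i \<Longrightarrow> msat M na' sa \<phi>"
proof (induction xs arbitrary: na)
  case Nil then have "na' = na" by auto then show ?case using Nil by simp
next
  case (Cons x xs)
  have "msat M (na(x := na' x)) sa (foldr AllN xs \<phi>)" using Cons.prems(1,2) by (simp del: fun_upd_apply)
  then show ?case by (rule Cons.IH) (use Cons.prems in auto)
qed

lemma msat_foldrS: "msat M na sa (foldr AllS xs \<phi>) \<Longrightarrow> \<forall>i. sa' i \<in> mS M \<Longrightarrow> \<forall>i. i \<notin> set xs \<longrightarrow> sa' i = sa i \<Longrightarrow> msat M na sa' \<phi>"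
proof (induction xs arbitrary: sa)
  case Nil then have "sa' = sa" by auto then show ?case using Nil by simp
next
  case (Cons x xs)
  have "msat M na (sa(x := sa' x)) (foldr AllS xs \<phi>)" using Cons.prems(1,2) by (simp del: fun_upd_apply)
  then show ?case by (rule Cons.IH) (use Cons.prems in auto)
qed

lemma prv_foldr: "prv T \<phi> \<Longrightarrow> prv T (foldr AllN xs \<phi>)" "prv T \<phi> \<Longrightarrow> prv T (foldr AllS xs \<phi>)"
  by (induction xs) (auto intro: prv.GenN prv.GenS)

text \<open>Axioms have to hold under all assignments, in accordance with unrestricted
  generalization. Validity is tested only in structures with number elements in \<open>nat\<close>
  and strings in \<open>nat set\<close>, the types of the term model, which keeps the statement
  within fixed types.\<close>

theorem completeness:
  assumes "pureT T" "V0 \<subseteq> T" "pureF \<psi>"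
    and "\<And>M :: (nat, nat set) mdl. normal M \<Longrightarrow> models M T \<Longrightarrow> (\<And>na sa. valid_env M na sa \<Longrightarrow> msat M na sa \<psi>)"
  shows "prv T \<psi>"
proof (rule ccontr)
  assume n: "\<not> prv T \<psi>"
  have "Con T {Not \<psi>}"
    using D_ccontr[of T \<psi> "{}"] assms(1,3) n D_empty by auto
  from henkin_extension[OF assms(1) _ _ this] assms(3) obtain H where H: "{Not \<psi>} \<subseteq> H" "pureT H" "Con T H"
    "\<forall>\<phi>. pureF \<phi> \<longrightarrow> Con T (insert \<phi> H) \<longrightarrow> \<phi> \<in> H" "\<forall>\<phi>\<in>H. \<forall>k. hwit k \<phi> H" by auto
  interpret henkin T H
  proof
    show "Not (Eq1 (Plus vx One) Zero) \<in> T" "Imp (Eq1 (Plus vx One) (Plus vy One)) (Eq1 vx vy) \<in> T"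
      using assms(2) by (auto simp: V0_def basic_axioms_def)
  qed (use H assms in \<open>simp_all\<close>)
  have nm: "normal HM" by (simp add: normal_def HM_def)
  have "models HM T" unfolding models_def
  proof (intro ballI allI impI)
    fix \<phi> na sa assume ph: "\<phi> \<in> T" and v: "valid_env HM na sa"
    let ?xs = "sorted_list_of_set (fvN \<phi>)" and ?Xs = "sorted_list_of_set (fvS \<phi>)"
    let ?na = "\<lambda>i. if i \<in> fvN \<phi> then na i else idx i" and ?sa = "\<lambda>i. if i \<in> fvS \<phi> then sa i else sx i"
    have p: "pureF \<phi>" using ph assms by auto
    \<comment> \<open>The universal closure of an axiom is provable, hence true at the canonical
      assignment, and this gives the axiom under every assignment.\<close>
    have "prv T (foldr AllN ?xs (foldr AllS ?Xs \<phi>))" by (intro prv_foldr prv.Ax ph)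
    then have "msat HM idx sx (foldr AllN ?xs (foldr AllS ?Xs \<phi>))" using truth thmH prv_pure assms(1) by blast
    then have "msat HM ?na sx (foldr AllS ?Xs \<phi>)" by (rule msat_foldrN) (auto simp: HM_def)
    then have "msat HM ?na ?sa \<phi>" by (rule msat_foldrS) (use v in \<open>auto simp: HM_def valid_env_def\<close>)
    then show "msat HM na sa \<phi>" using msat_coinc[OF p, of na ?na sa ?sa HM] by simp
  qed
  then have "msat HM idx sx \<psi>"
    by (intro assms(4)[OF nm]) (auto simp: valid_env_def HM_def)
  then show False using truth[OF assms(3)] NotH[OF assms(3)] H(1) by simp
qed

section \<open>Counting programs in models of the theory\<close>

text \<open>\<open>phiMOD\<close> with arbitrary string variables for the set and its table, so that
  one formula can speak about many tables.\<close>

definition pm :: "nat \<Rightarrow> nat \<Rightarrow> nat \<Rightarrow> form" where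
  "pm m X Y = (let z = NVar 0; y = NVar 1; y' = NVar 2; r = NVar 3; q = NVar 4; mm = numeral_t m;
     Ym = (\<lambda>s t. Mem (pairt s t) (SVar Y));
     exu = And (ExLt 1 mm (Ym z y))
               (AllLt 1 mm (AllLt 2 mm (Imp (And (Ym z y) (Ym z y')) (Eq1 y y'))));
     succmod = ExLt 3 mm (ExLe 4 (Plus y One)
                 (And (Eq1 (Plus y One) (Plus (Times q mm) r)) (Ym (Plus z One) r)))
   in And (AllLe 0 (Len (SVar X)) exu)
       (And (Ym Zero Zero)
         (AllLt 0 (Len (SVar X)) (AllLt 1 mm
            (Imp (Ym z y)
               (And (Imp (Mem z (SVar X)) succmod)
                    (Imp (Not (Mem z (SVar X))) (Ym (Plus z One) y))))))))"

lemma phiMOD_pm: "phiMOD m = pm m 0 1"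
  by (simp add: phiMOD_def pm_def Ymem_def)

lemma pairt_simps [simp]: "fvNn (pairt s t) = fvNn s \<union> fvNn t" "fvSn (pairt s t) = fvSn s \<union> fvSn t"
  "pureN (pairt s t) = (pureN s \<and> pureN t)"
  by (auto simp: pairt_def)

lemma fv_num [simp]: "fvNn (numeral_t i) = {}" "fvSn (numeral_t i) = {}" "pureN (numeral_t i)"
  by (induction i) auto

lemma pm_simps [simp]: "fvN (pm m X Y) = {}" "fvS (pm m X Y) = {X, Y}" "pureF (pm m X Y)" "sigB0 (pm m X Y)"
  by (auto simp: pm_def Let_def)

primrec mnum :: "('a, 's) mdl \<Rightarrow> nat \<Rightarrow> 'a" where
  "mnum M 0 = mz M" | "mnum M (Suc n) = ma M (mnum M n) (mo M)"

definition mpair :: "('a, 's) mdl \<Rightarrow> 'a \<Rightarrow> 'a \<Rightarrow> 'a" where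
  "mpair M s t = ma M (mm M (ma M s t) (ma M (ma M s t) (mo M))) (ma M t t)"

lemma mev_num [simp]: "mev M na sa (numeral_t i) = mnum M i" "mev M na sa (pairt s t) = mpair M (mev M na sa s) (mev M na sa t)"
  by (induction i) (auto simp: pairt_def mpair_def)

abbreviation msuc :: "('a, 's) mdl \<Rightarrow> 'a \<Rightarrow> 'a" where "msuc M x \<equiv> ma M x (mo M)"
abbreviation mlt :: "('a, 's) mdl \<Rightarrow> 'a \<Rightarrow> 'a \<Rightarrow> bool" where "mlt M x y \<equiv> mle M x y \<and> x \<noteq> y"

text \<open>The table enters only through the relation "y is an entry of row z", so strings with the
  same relevant entries can be exchanged.\<close>

definition modP :: "('a, 's) mdl \<Rightarrow> nat \<Rightarrow> 's \<Rightarrow> ('a \<Rightarrow> 'a \<Rightarrow> bool) \<Rightarrow> bool" where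
  "modP M m X P \<longleftrightarrow>
    (\<forall>z. mle M z (mlen M X) \<longrightarrow> (\<exists>y. mlt M y (mnum M m) \<and> P z y) \<and>
       (\<forall>y. mlt M y (mnum M m) \<longrightarrow> (\<forall>y'. mlt M y' (mnum M m) \<longrightarrow> P z y \<and> P z y' \<longrightarrow> y = y'))) \<and>
    P (mz M) (mz M) \<and>
    (\<forall>z. mlt M z (mlen M X) \<longrightarrow> (\<forall>y. mlt M y (mnum M m) \<longrightarrow> P z y \<longrightarrow>
       (mmem M z X \<longrightarrow> (\<exists>r. mlt M r (mnum M m) \<and> (\<exists>q. mle M q (msuc M y) \<and>
            msuc M y = ma M (mm M q (mnum M m)) r \<and> P (msuc M z) r))) \<and>
       (\<not> mmem M z X \<longrightarrow> P (msuc M z) y)))"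

lemma msat_pm: "normal M \<Longrightarrow> msat M na sa (pm m X Y) \<longleftrightarrow> modP M m (sa X) (\<lambda>z y. mmem M (mpair M z y) (sa Y))"
  by (simp add: pm_def Let_def modP_def normal_def conj_assoc)

text \<open>For a set of length at most \<open>B\<close> the entries are codes of pairs (z, y) with
  z at most \<open>B\<close> and y below \<open>m\<close>. In the standard structure these lie below
  the given bound because pairing is monotone.\<close>

definition tb :: "nat \<Rightarrow> nterm \<Rightarrow> nterm" where "tb m B = Plus (pairt B (numeral_t m)) One"

lemma tb_simps [simp]: "fvNn (tb m B) = fvNn B" "fvSn (tb m B) = fvSn B" "pureN (tb m B) = pureN B"
  by (auto simp: tb_def)

text \<open>The facts about pairing and division by \<open>m\<close> needed for tables below \<open>B\<close> are not derived in the
theory: they hold in the intended model and are \<open>\<Sigma>\<^sup>B\<^sub>0\<close>, so the defining formula tests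
them and describes the empty table when they fail.\<close>

definition guard :: "nat \<Rightarrow> nat \<Rightarrow> nterm \<Rightarrow> form" where
  "guard m k B = And
     (AllLe k B (AllLt (k+1) (numeral_t m) (Lt (pairt (NVar k) (NVar (k+1))) (tb m B))))
     (AllLt k (numeral_t m) (AllLt (k+1) (numeral_t m) (AllLt (k+2) (numeral_t m)
       (AllLe (k+3) (Plus (NVar k) One) (AllLe (k+4) (Plus (NVar k) One)
         (Imp (And (Eq1 (Plus (NVar k) One) (Plus (Times (NVar (k+3)) (numeral_t m)) (NVar (k+1))))
                   (Eq1 (Plus (NVar k) One) (Plus (Times (NVar (k+4)) (numeral_t m)) (NVar (k+2)))))
              (Eq1 (NVar (k+1)) (NVar (k+2)))))))))"

text \<open>Bounds may depend on the arguments but not on strings computed by a program. They keep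
  their value throughout a run and can bound the string quantifiers over it.\<close>

definition inT :: "nat \<Rightarrow> nat \<Rightarrow> nterm \<Rightarrow> bool" where
  "inT k l B \<longleftrightarrow> pureN B \<and> fvNn B \<subseteq> {..<k} \<and> fvSn B \<subseteq> {..<l}"

lemma guard_simps:
  assumes "inT k l B"
  shows "fvN (guard m k B) \<subseteq> {..<k}" "fvS (guard m k B) \<subseteq> {..<l}" "pureF (guard m k B)" "sigB0 (guard m k B)"
proof -
  have [simp]: "k \<notin> fvNn B" "Suc k \<notin> fvNn B" "pureN B" using assms by (auto simp: inT_def)
  show "sigB0 (guard m k B)" by (simp add: guard_def)
qed (use assms in \<open>auto simp: inT_def guard_def\<close>)

definition compf :: "nat \<Rightarrow> nat \<Rightarrow> nterm \<Rightarrow> form \<Rightarrow> form" where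
  "compf k X B \<theta> = And (Le (Len (SVar X)) B) (AllLt k B (Iff (Mem (NVar k) (SVar X)) \<theta>))"

text \<open>\<open>phiMOD\<close> leaves open which other numbers belong to the table. Requiring
  every element to be the code of an entry makes the table unique as a string.\<close>

definition normf :: "nat \<Rightarrow> nat \<Rightarrow> nat \<Rightarrow> form" where
  "normf m k X = ExLe (k+1) (Len (SVar X)) (ExLt (k+2) (numeral_t m) (Eq1 (NVar k) (pairt (NVar (k+1)) (NVar (k+2)))))"

definition tabf :: "nat \<Rightarrow> nat \<Rightarrow> nat \<Rightarrow> nat \<Rightarrow> nterm \<Rightarrow> form" where
  "tabf m k X Y B = And (Le (Len (SVar Y)) (tb m B))
     (And (Imp (guard m k B) (And (pm m X Y) (AllLt k (Len (SVar Y)) (Imp (Mem (NVar k) (SVar Y)) (normf m k X)))))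
          (Imp (Not (guard m k B)) (Eq1 (Len (SVar Y)) Zero)))"

lemma compf_simps:
  assumes "inT k l B" "sigB0 \<theta>" "pureF \<theta>" "fvN \<theta> \<subseteq> {..k}"
  shows "fvN (compf k X B \<theta>) \<subseteq> {..<k}" "fvS (compf k X B \<theta>) \<subseteq> {..<l} \<union> fvS \<theta> \<union> {X}" 
    "pureF (compf k X B \<theta>)" "sigB0 (compf k X B \<theta>)"
proof -
  have [simp]: "k \<notin> fvNn B" "pureN B" using assms by (auto simp: inT_def)
  show "sigB0 (compf k X B \<theta>)" using assms by (simp add: compf_def)
qed (use assms in \<open>auto simp: inT_def compf_def nat_less_le\<close>)

lemma tabf_simps:
  assumes "inT k l B"
  shows "fvN (tabf m k X Y B) \<subseteq> {..<k}" "fvS (tabf m k X Y B) \<subseteq> {..<l} \<union> {X,Y}" 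
    "pureF (tabf m k X Y B)" "sigB0 (tabf m k X Y B)"
  using assms guard_simps[OF assms, of m] by (auto simp: inT_def tabf_def normf_def nat_less_le)

section \<open>Programs and their formulas\<close>

type_synonym prog = "(nterm \<times> form) list"

text \<open>A step at position \<open>j\<close> writes the comprehended set to string variable
  \<open>j\<close> and its counting table to \<open>Suc j\<close>; later steps may read
  both.\<close>

primrec gam :: "nat \<Rightarrow> nat \<Rightarrow> nat \<Rightarrow> prog \<Rightarrow> form" where
  "gam m k j [] = Not Bot"
| "gam m k j (s # pr) = And (compf k j (fst s) (snd s)) (And (tabf m k j (Suc j) (fst s)) (gam m k (j + 2) pr))"

text \<open>Variable layout: numbers below \<open>k\<close> and strings below \<open>l\<close> are
  the arguments, number \<open>k\<close> is the comprehension variable, and string \<open>l\<close>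
  is kept free for the output. Programs start at \<open>Suc l\<close>.\<close>

primrec okp :: "nat \<Rightarrow> nat \<Rightarrow> nat \<Rightarrow> prog \<Rightarrow> bool" where
  "okp k l j [] = True"
| "okp k l j (s # pr) = (inT k l (fst s) \<and> sigB0 (snd s) \<and> pureF (snd s) \<and> fvN (snd s) \<subseteq> {..k} \<and>
     fvS (snd s) \<subseteq> {..<j} - {l} \<and> okp k l (j + 2) pr)"

primrec pre :: "nat \<Rightarrow> nat \<Rightarrow> prog \<Rightarrow> form \<Rightarrow> form" where
  "pre m j [] \<phi> = \<phi>"
| "pre m j (s # pr) \<phi> = ExSb j (fst s) (ExSb (Suc j) (tb m (fst s)) (pre m (j + 2) pr \<phi>))"

text \<open>A second prefix is needed because \<open>sig11\<close> admits unbounded string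
  quantifiers only: a bounded one puts a conjunction between itself and the string quantifiers that
  follow, which is not of that shape.\<close>

primrec preU :: "nat \<Rightarrow> nat \<Rightarrow> prog \<Rightarrow> form \<Rightarrow> form" where
  "preU m j [] \<phi> = \<phi>"
| "preU m j (s # pr) \<phi> = ExS j (ExS (Suc j) (preU m (j + 2) pr \<phi>))"

abbreviation "blk j pr \<equiv> {j..<j + 2 * length pr}"

lemma gam_simps:
  "okp k l j pr \<Longrightarrow> l < j \<Longrightarrow> fvN (gam m k j pr) \<subseteq> {..<k} \<and> fvS (gam m k j pr) \<subseteq> {..<j + 2 * length pr} - {l} \<and>
    pureF (gam m k j pr) \<and> sigB0 (gam m k j pr)"
proof (induction pr arbitrary: j)
  case (Cons s pr)
  have o: "inT k l (fst s)" "sigB0 (snd s)" "pureF (snd s)" "fvN (snd s) \<subseteq> {..k}" "fvS (snd s) \<subseteq> {..<j} - {l}"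
    "okp k l (j+2) pr" using Cons.prems by auto
  note c = compf_simps[OF o(1-4), of j] and t = tabf_simps[OF o(1), of m j "Suc j"] and i = Cons.IH[OF o(6)]
  have "{..<l} \<union> fvS (snd s) \<union> {j} \<subseteq> {..<j + 2 * length (s # pr)} - {l}" using o Cons.prems by auto
  moreover have "{..<l} \<union> {j, Suc j} \<subseteq> {..<j + 2 * length (s # pr)} - {l}" using Cons.prems by auto
  ultimately show ?case using c t i Cons.prems by auto
qed auto

lemma pre_simps:
  "okp k l j pr \<Longrightarrow> l < j \<Longrightarrow> fvN (pre m j pr \<phi>) \<subseteq> fvN \<phi> \<union> {..<k} \<and> fvS (pre m j pr \<phi>) \<subseteq> {..<l} \<union> (fvS \<phi> - blk j pr) \<and>
    (pureF \<phi> \<longrightarrow> pureF (pre m j pr \<phi>)) \<and> (sigB0 \<phi> \<longrightarrow> sigB1 (pre m j pr \<phi>))"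
proof (induction pr arbitrary: j)
  case (Cons s pr)
  have "sigB1 (pre m (j + 2) pr \<phi>) \<Longrightarrow> sigB1 (pre m j (s # pr) \<phi>)"
    unfolding pre.simps by (intro sigB1.intros(2)) (use Cons.prems in \<open>auto simp: inT_def\<close>)
  then show ?case using Cons.prems Cons.IH[of "j+2"] by (auto simp: inT_def)
qed (auto intro: sigB1.intros)

lemma preU_simps:
  "okp k l j pr \<Longrightarrow> l < j \<Longrightarrow> fvN (preU m j pr \<phi>) \<subseteq> fvN \<phi> \<and> fvS (preU m j pr \<phi>) \<subseteq> (fvS \<phi> - blk j pr) \<and>
    (pureF \<phi> \<longrightarrow> pureF (preU m j pr \<phi>)) \<and> (sigB0 \<phi> \<longrightarrow> sig11 (preU m j pr \<phi>))"
proof (induction pr arbitrary: j)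
  case (Cons s pr)
  have "sig11 (preU m (j + 2) pr \<phi>) \<Longrightarrow> sig11 (preU m j (s # pr) \<phi>)"
    unfolding preU.simps by (intro sig11.intros(2))
  then show ?case using Cons.prems Cons.IH[of "j+2"] by (auto simp: inT_def)
qed (auto intro: sig11.intros)

section \<open>Arithmetic, counting tables and runs in models of V^0(m)\<close>

locale v0 =
  fixes M :: "('a, 's) mdl" and m :: nat
  assumes nm: "normal M" and mdls: "models M (V0m m)" and m2: "m \<ge> 2" and ne: "mS M \<noteq> {}"
begin

abbreviation "Z \<equiv> mz M"
abbreviation "su \<equiv> msuc M"
abbreviation "le \<equiv> mle M"
abbreviation "lt \<equiv> mlt M"
abbreviation "len \<equiv> mlen M"
abbreviation "mem \<equiv> mmem M"
abbreviation "vS sa \<equiv> \<forall>i. sa i \<in> mS M"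

lemma nms [simp]: "mN M = UNIV" "meq1 M = (=)" "meq2 M = (=)"
  using nm by (auto simp: normal_def)

lemma ax: "\<phi> \<in> V0m m \<Longrightarrow> vS sa \<Longrightarrow> msat M na sa \<phi>"
  using mdls by (auto simp: models_def valid_env_def)

lemma axB: "\<phi> \<in> basic_axioms \<Longrightarrow> vS sa \<Longrightarrow> msat M na sa \<phi>"
  by (rule ax) (auto simp: V0m_def V0_def)

lemma axN: assumes "\<phi> \<in> basic_axioms" shows "\<exists>sa. msat M na sa \<phi>"
proof -
  obtain A where "A \<in> mS M" using ne by blast
  then show ?thesis using axB[OF assms, of "\<lambda>_. A" na] by blast
qed

lemma B1: "su x \<noteq> Z"
  using axN[of "Not (Eq1 (Plus vx One) Zero)" "\<lambda>_. x"] by (simp add: basic_axioms_def)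
lemma B7: "le x y \<Longrightarrow> le y x \<Longrightarrow> x = y"
  using axN[of "Imp (And (Le vx vy) (Le vy vx)) (Eq1 vx vy)" "(\<lambda>_. x)(1:=y)"] by (simp add: basic_axioms_def)
lemma B9: "le Z x"
  using axN[of "Le Zero vx" "\<lambda>_. x"] by (simp add: basic_axioms_def)
lemma B10: "le x y \<or> le y x"
  using axN[of "Or (Le vx vy) (Le vy vx)" "(\<lambda>_. x)(1:=y)"] by (simp add: basic_axioms_def)
lemma B11: "le x y \<longleftrightarrow> lt x (su y)"
  using axN[of "Iff (Le vx vy) (Lt vx (Plus vy One))" "(\<lambda>_. x)(1:=y)"] by (simp add: basic_axioms_def)
lemma B12: "x \<noteq> Z \<Longrightarrow> \<exists>y. lt y x \<and> su y = x"
  using axN[of "Imp (Not (Eq1 vx Zero)) (ExLt 1 vx (Eq1 (Plus vy One) vx))" "\<lambda>_. x"] by (auto simp: basic_axioms_def)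
lemma L1: "X \<in> mS M \<Longrightarrow> mem y X \<Longrightarrow> lt y (len X)"
  using axB[of "Imp (Mem vy vX) (Lt vy (Len vX))" "\<lambda>_. X" "\<lambda>_. y"] by (simp add: basic_axioms_def)
lemma L2: "X \<in> mS M \<Longrightarrow> su y = len X \<Longrightarrow> mem y X"
  using axB[of "Imp (Eq1 (Plus vy One) (Len vX)) (Mem vy vX)" "\<lambda>_. X" "\<lambda>_. y"] by (simp add: basic_axioms_def)
lemma Ext: "X \<in> mS M \<Longrightarrow> Y \<in> mS M \<Longrightarrow> len X = len Y \<Longrightarrow> \<forall>z. lt z (len X) \<longrightarrow> mem z X = mem z Y \<Longrightarrow> X = Y"
  using axB[of "Iff (Eq2 vX vY) (And (Eq1 (Len vX) (Len vY)) (AllLt 2 (Len vX) (Iff (Mem vz vX) (Mem vz vY))))"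
      "(\<lambda>_. X)(1:=Y)"] by (simp add: basic_axioms_def)

lemma refl [simp]: "le x x" using B10 by blast

text \<open>The axiom has a variable as its bound; assigning \<open>e\<close> to a fresh variable
  gives comprehension below any element, with arbitrary parameters.\<close>

lemma comp:
  assumes "sigB0 \<phi>" "pureF \<phi>" "vS sa"
  shows "\<exists>A\<in>mS M. le (len A) e \<and> (\<forall>x. lt x e \<longrightarrow> (mem x A \<longleftrightarrow> msat M (na(p:=x)) sa \<phi>))"
proof -
  obtain X where X: "X \<notin> fvS \<phi>" using fresh_nat[of "fvS \<phi>" 0] by auto
  obtain a where a: "a \<notin> fvN \<phi>" "a \<noteq> p" using fresh_nat[of "insert p (fvN \<phi>)" 0] by auto
  let ?c = "ExSb X (NVar a) (AllLt p (NVar a) (Iff (Mem (NVar p) (SVar X)) \<phi>))"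
  have "?c \<in> comp_axioms" unfolding comp_axioms_def mem_Collect_eq
    by (intro exI[of _ X] exI[of _ a] exI[of _ p] exI[of _ \<phi>]) (use assms X a in auto)
  then have "?c \<in> V0m m" by (simp add: V0m_def V0_def)
  then have "msat M (na(a:=e)) sa ?c" using ax assms by blast
  then obtain A where A: "A \<in> mS M" "le (len A) e" "\<forall>x. lt x e \<longrightarrow> (mem x A \<longleftrightarrow> msat M (na(a:=e,p:=x)) (sa(X:=A)) \<phi>)"
    using a by auto
  have "msat M (na(a:=e,p:=x)) (sa(X:=A)) \<phi> = msat M (na(p:=x)) sa \<phi>" for x
    by (rule msat_coinc) (use a X assms in auto)
  then show ?thesis using A by auto
qed

text \<open>Comprehension yields induction through the length function. Collect in \<open>A\<close>
  the elements below a counterexample \<open>x\<close> that satisfy \<phi>. The last element of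
  \<open>A\<close>, one below \<open>len A\<close>, passes \<phi> on to \<open>len A\<close> itself,
  which is at most \<open>x\<close>: it is either \<open>x\<close>, contradicting the choice, or a
  member of \<open>A\<close>, contradicting L1.\<close>

lemma ind:
  assumes "sigB0 \<phi>" "pureF \<phi>" "vS sa" and b: "msat M (na(p:=Z)) sa \<phi>"
    and s: "\<And>x. msat M (na(p:=x)) sa \<phi> \<Longrightarrow> msat M (na(p:=su x)) sa \<phi>"
  shows "msat M (na(p:=x)) sa \<phi>"
proof (rule ccontr)
  assume n: "\<not> msat M (na(p:=x)) sa \<phi>"
  obtain A where A: "A \<in> mS M" "le (len A) x" "\<And>y. lt y x \<Longrightarrow> (mem y A \<longleftrightarrow> msat M (na(p:=y)) sa \<phi>)"
    using comp[OF assms(1-3)] by blast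
  have "x \<noteq> Z" using b n by auto
  then have "mem Z A" using A(3)[of Z] B9 b by simp
  then have "lt Z (len A)" using L1 A by blast
  then obtain y where y: "lt y (len A)" "su y = len A" using B12 by metis
  then have my: "mem y A" using L2 A by blast
  have "lt y x"
  proof -
    have "\<not> le x y" using B11[of x y] y A(2) B7 by metis
    then show ?thesis using B10[of x y] by auto
  qed
  then have "msat M (na(p:=su y)) sa \<phi>" using A(3) my s by blast
  moreover have "le (su y) x" "su y = x \<or> lt (su y) x" using y A(2) by auto
  ultimately have "mem (su y) A" using A(3) n by auto
  then show False using L1[OF A(1)] y by auto
qed

text \<open>Transitivity is not among the basic axioms. It is proved by induction on
  \<open>z\<close>, with B11 in the successor step.\<close>

lemma trans: "le x y \<Longrightarrow> le y z \<Longrightarrow> le x z"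
proof -
  obtain A where A: "A \<in> mS M" using ne by blast
  let ?\<phi> = "Imp (And (Le vx vy) (Le vy (NVar 2))) (Le vx (NVar 2))"
  have "msat M (((\<lambda>_. x)(1:=y))(2:=z)) (\<lambda>_. A) ?\<phi>"
  proof (rule ind)
    show "msat M (((\<lambda>_. x)(1:=y))(2:=Z)) (\<lambda>_. A) ?\<phi>" using B7 B9 by auto
    fix w assume "msat M (((\<lambda>_. x)(1:=y))(2:=w)) (\<lambda>_. A) ?\<phi>"
    then have "le x y \<and> le y w \<longrightarrow> le x w" by simp
    then have "le x y \<and> le y (su w) \<longrightarrow> le x (su w)" using B11 by metis
    then show "msat M (((\<lambda>_. x)(1:=y))(2:=su w)) (\<lambda>_. A) ?\<phi>" by simp
  qed (use A in auto)
  then show "le x y \<Longrightarrow> le y z \<Longrightarrow> le x z" by simp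
qed

lemma suc_le: "le (su y) b \<longleftrightarrow> lt y b"
  using B11[of y y] B11[of b y] B10[of "su y" b] B7 trans refl by metis

lemma lt_le_trans: "lt x y \<Longrightarrow> le y z \<Longrightarrow> lt x z"
  using trans B7 by metis

lemma not_lt_Z: "\<not> lt x Z" using B7 B9 by metis

lemma len_le: "A \<in> mS M \<Longrightarrow> (\<And>x. mem x A \<Longrightarrow> lt x b) \<Longrightarrow> le (len A) b"
  using B12[of "len A"] L2[of A] suc_le B9 by metis

text \<open>By L1, L2 and B12 the length is the least strict upper bound of the elements, so equal
  elements force equal lengths and extensionality applies.\<close>

lemma str_eqI:
  assumes A: "A \<in> mS M" and B: "B \<in> mS M" and e: "\<And>x. mem x A \<longleftrightarrow> mem x B"
  shows "A = B"
proof (rule Ext[OF A B])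
  show "len A = len B"
    by (rule B7; rule len_le) (use A B e L1 in auto)
qed (use e in simp)

lemma msat_guard:
  assumes "inT k l B"
  shows "msat M na sa (guard m k B) \<longleftrightarrow>
   (\<forall>z. le z (mev M na sa B) \<longrightarrow> (\<forall>y. lt y (mnum M m) \<longrightarrow> lt (mpair M z y) (mev M na sa (tb m B)))) \<and>
   (\<forall>y. lt y (mnum M m) \<longrightarrow> (\<forall>r. lt r (mnum M m) \<longrightarrow> (\<forall>r'. lt r' (mnum M m) \<longrightarrow> (\<forall>q. le q (su y) \<longrightarrow> (\<forall>q'. le q' (su y) \<longrightarrow>
     su y = ma M (mm M q (mnum M m)) r \<and> su y = ma M (mm M q' (mnum M m)) r' \<longrightarrow> r = r')))))"
proof -
  have [simp]: "k \<notin> fvNn B" "Suc k \<notin> fvNn B" "pureN B" using assms by (auto simp: inT_def)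
  show ?thesis by (simp add: guard_def)
qed

lemma msat_compf:
  assumes "inT k l B"
  shows "msat M na sa (compf k X B \<theta>) \<longleftrightarrow> le (len (sa X)) (mev M na sa B) \<and>
    (\<forall>x. lt x (mev M na sa B) \<longrightarrow> (mem x (sa X) \<longleftrightarrow> msat M (na(k:=x)) sa \<theta>))"
proof -
  have [simp]: "k \<notin> fvNn B" "pureN B" using assms by (auto simp: inT_def)
  show ?thesis by (simp add: compf_def)
qed

lemma msat_tabf:
  assumes "inT k l B"
  shows "msat M na sa (tabf m k X Y B) \<longleftrightarrow> le (len (sa Y)) (mev M na sa (tb m B)) \<and>
    (msat M na sa (guard m k B) \<longrightarrow> modP M m (sa X) (\<lambda>z y. mem (mpair M z y) (sa Y)) \<and>
      (\<forall>w. lt w (len (sa Y)) \<longrightarrow> mem w (sa Y) \<longrightarrow> (\<exists>z. le z (len (sa X)) \<and> (\<exists>y. lt y (mnum M m) \<and> w = mpair M z y)))) \<and>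
    (\<not> msat M na sa (guard m k B) \<longrightarrow> len (sa Y) = Z)"
  by (simp add: tabf_def normf_def msat_pm[OF nm])

lemma mnum_pos: "lt Z (mnum M m)"
  using m2 B9 B1 by (cases m) (auto dest: sym)

text \<open>\<open>modP\<close> reads rows up to the length and entries below \<open>m\<close> only.
  A successor row is read from a row strictly below the length, so it is still in range.\<close>

lemma modP_cong:
  assumes "\<And>z y. le z (len X) \<Longrightarrow> lt y (mnum M m) \<Longrightarrow> P z y = P' z y"
  shows "modP M m X P \<longleftrightarrow> modP M m X P'"
proof -
  have *: "modP M m X P'" if "modP M m X P" and c: "\<And>z y. le z (len X) \<Longrightarrow> lt y (mnum M m) \<Longrightarrow> P z y = P' z y" for P P'
  proof -
    have 1: "P' Z Z" using that(1) c[of Z Z] B9 mnum_pos by (simp add: modP_def)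
    have 2: "(\<exists>y. lt y (mnum M m) \<and> P' z y) \<and> (\<forall>y. lt y (mnum M m) \<longrightarrow> (\<forall>y'. lt y' (mnum M m) \<longrightarrow> P' z y \<and> P' z y' \<longrightarrow> y = y'))"
      if z: "le z (len X)" for z
    proof -
      have e: "\<exists>y. lt y (mnum M m) \<and> P z y" using that(1) \<open>modP M m X P\<close> unfolding modP_def by blast
      have u: "y = y'" if "lt y (mnum M m)" "lt y' (mnum M m)" "P z y" "P z y'" for y y'
        using that z \<open>modP M m X P\<close> unfolding modP_def by blast
      show ?thesis using e u c[OF z] by blast
    qed
    have 3: "(mem z X \<longrightarrow> (\<exists>r. lt r (mnum M m) \<and> (\<exists>q. le q (su y) \<and> su y = ma M (mm M q (mnum M m)) r \<and> P' (su z) r))) \<and>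
       (\<not> mem z X \<longrightarrow> P' (su z) y)" if z: "lt z (len X)" and y: "lt y (mnum M m)" and p: "P' z y" for z y
    proof -
      have "le z (len X)" "le (su z) (len X)" using z suc_le by auto
      then have e: "\<And>y. lt y (mnum M m) \<Longrightarrow> P z y = P' z y" "\<And>y. lt y (mnum M m) \<Longrightarrow> P (su z) y = P' (su z) y"
        using c by blast+
      have "P z y" using e y p by blast
      then have "(mem z X \<longrightarrow> (\<exists>r. lt r (mnum M m) \<and> (\<exists>q. le q (su y) \<and> su y = ma M (mm M q (mnum M m)) r \<and> P (su z) r))) \<and>
       (\<not> mem z X \<longrightarrow> P (su z) y)" using \<open>modP M m X P\<close> z y unfolding modP_def by blast
      then show ?thesis using e y by blast
    qed
    show ?thesis unfolding modP_def using 1 2 3 by blast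
  qed
  show ?thesis using *[of P P'] *[of P' P] assms by blast
qed

text \<open>The table supplied by \<open>MODax\<close> is cut down by comprehension to the codes of
  entries below \<open>tb m B\<close>. The first half of the guard says that no relevant entry is
  lost; where the guard fails, the empty string is the answer.\<close>

lemma tab_ex:
  assumes B: "inT k l B" and v: "vS sa" and b: "le (len (sa X)) (mev M na sa B)" and XY: "X \<noteq> Y" "l \<le> X" "l \<le> Y"
  shows "\<exists>A\<in>mS M. msat M na (sa(Y:=A)) (tabf m k X Y B)"
proof -
  have [simp]: "mev M na (sa(Y:=A)) B = mev M na sa B" "mev M na (sa(Y:=A)) (tb m B) = mev M na sa (tb m B)" for A
    using B XY by (auto simp: inT_def intro!: mev_upd)
  have [simp]: "msat M na (sa(Y:=A)) (guard m k B) = msat M na sa (guard m k B)" for A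
    using guard_simps[OF B, of m] XY by (intro msat_upd) auto
  show ?thesis
  proof (cases "msat M na sa (guard m k B)")
    case False
    obtain A where "A \<in> mS M" "le (len A) Z" using comp[of Bot sa Z] v by auto
    moreover have "len A = Z" using calculation B9 B7 by blast
    ultimately show ?thesis using False B9 XY by (intro bexI[of _ A]) (auto simp: msat_tabf[OF B])
  next
    case True
    have g: "lt (mpair M z y) (mev M na sa (tb m B))" if "le z (mev M na sa B)" "lt y (mnum M m)" for z y
      using True that unfolding msat_guard[OF B] by blast
    have "msat M na sa (MODax m)" by (rule ax) (use v in \<open>auto simp: V0m_def\<close>)
    then obtain Y0 where Y0: "Y0 \<in> mS M" "modP M m (sa X) (\<lambda>z y. mem (mpair M z y) Y0)"
      using v by (auto simp: MODax_def phiMOD_pm msat_pm[OF nm])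
    let ?\<phi> = "And (Mem (NVar 0) (SVar 1)) (normf m 0 0)"
    let ?s = "(\<lambda>_. sa X)(1:=Y0)"
    have ph: "msat M ((\<lambda>_. Z)(0:=w)) ?s ?\<phi> \<longleftrightarrow> mem w Y0 \<and> (\<exists>z. le z (len (sa X)) \<and> (\<exists>y. lt y (mnum M m) \<and> w = mpair M z y))" for w
      by (simp add: normf_def conj_assoc)
    have "\<exists>A\<in>mS M. le (len A) (mev M na sa (tb m B)) \<and> (\<forall>w. lt w (mev M na sa (tb m B)) \<longrightarrow>
      (mem w A \<longleftrightarrow> msat M ((\<lambda>_. Z)(0:=w)) ?s ?\<phi>))"
      by (rule comp) (use v Y0 in \<open>auto simp: normf_def\<close>)
    then obtain A where A: "A \<in> mS M" "le (len A) (mev M na sa (tb m B))"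
      "\<And>w. lt w (mev M na sa (tb m B)) \<Longrightarrow> mem w A \<longleftrightarrow> mem w Y0 \<and> (\<exists>z. le z (len (sa X)) \<and> (\<exists>y. lt y (mnum M m) \<and> w = mpair M z y))"
      unfolding ph by blast
    have "mem (mpair M z y) Y0 = mem (mpair M z y) A" if "le z (len (sa X))" "lt y (mnum M m)" for z y
      using A(3)[OF g[OF trans[OF that(1) b] that(2)]] that by blast
    then have "modP M m (sa X) (\<lambda>z y. mem (mpair M z y) A)" using Y0(2) modP_cong[of "sa X" "\<lambda>z y. mem (mpair M z y) Y0" "\<lambda>z y. mem (mpair M z y) A"] by blast
    moreover have "\<exists>z. le z (len (sa X)) \<and> (\<exists>y. lt y (mnum M m) \<and> w = mpair M z y)" if "mem w A" for w
      using A(3)[OF lt_le_trans[OF L1[OF A(1) that] A(2)]] that by blast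
    ultimately show ?thesis using True A XY by (intro bexI[of _ A]) (auto simp: msat_tabf[OF B])
  qed
qed

text \<open>Induction on the row. A row has exactly one entry, so one common entry makes two rows
  equal. In the successor step it comes from division with remainder, whose uniqueness is assumption
  \<open>d\<close>; the guard provides it in its second half.\<close>

lemma modP_uniq:
  assumes "X \<in> mS M" "Y \<in> mS M" "Y' \<in> mS M"
    and P: "modP M m X (\<lambda>z y. mem (mpair M z y) Y)" and P': "modP M m X (\<lambda>z y. mem (mpair M z y) Y')"
    and d: "\<And>y r r' q q'. lt y (mnum M m) \<Longrightarrow> lt r (mnum M m) \<Longrightarrow> lt r' (mnum M m) \<Longrightarrow> le q (su y) \<Longrightarrow> le q' (su y) \<Longrightarrow>
       su y = ma M (mm M q (mnum M m)) r \<Longrightarrow> su y = ma M (mm M q' (mnum M m)) r' \<Longrightarrow> r = r'"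
    and z: "le z (len X)" and y: "lt y (mnum M m)"
  shows "mem (mpair M z y) Y \<longleftrightarrow> mem (mpair M z y) Y'"
proof -
  let ?P = "\<lambda>z y. mem (mpair M z y) Y" and ?P' = "\<lambda>z y. mem (mpair M z y) Y'"
  let ?\<phi> = "Imp (Le (NVar 0) (Len (SVar 0))) (AllLt 1 (numeral_t m) (Iff (Mem (pairt (NVar 0) (NVar 1)) (SVar 1)) (Mem (pairt (NVar 0) (NVar 1)) (SVar 2))))"
  let ?s = "(\<lambda>_. X)(1:=Y,2:=Y')"
  have ph: "msat M ((\<lambda>_. Z)(0:=w)) ?s ?\<phi> \<longleftrightarrow> (le w (len X) \<longrightarrow> (\<forall>y. lt y (mnum M m) \<longrightarrow> ?P w y = ?P' w y))" for w
    by (simp add: conj_assoc)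
  have eu: "\<exists>y. lt y (mnum M m) \<and> Q z y" "\<And>y y'. lt y (mnum M m) \<Longrightarrow> lt y' (mnum M m) \<Longrightarrow> Q z y \<Longrightarrow> Q z y' \<Longrightarrow> y = y'"
    if "modP M m X Q" "le z (len X)" for Q z using that unfolding modP_def by blast+
  have agree: "\<forall>y. lt y (mnum M m) \<longrightarrow> ?P w y = ?P' w y" if "le w (len X)" "lt r (mnum M m)" "?P w r" "?P' w r" for w r
    using eu(2)[OF P that(1)] eu(2)[OF P' that(1)] that by blast
  have "msat M ((\<lambda>_. Z)(0:=z)) ?s ?\<phi>"
  proof (rule ind)
    have "?P Z Z" "?P' Z Z" using P P' unfolding modP_def by blast+
    then have "\<forall>y. lt y (mnum M m) \<longrightarrow> ?P Z y = ?P' Z y" by (rule agree[OF B9 mnum_pos])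
    then show "msat M ((\<lambda>_. Z)(0:=Z)) ?s ?\<phi>" unfolding ph by (rule impI)
    fix w assume "msat M ((\<lambda>_. Z)(0:=w)) ?s ?\<phi>"
    then have IH: "le w (len X) \<Longrightarrow> \<forall>y. lt y (mnum M m) \<longrightarrow> ?P w y = ?P' w y" unfolding ph by (rule mp)
    show "msat M ((\<lambda>_. Z)(0:=su w)) ?s ?\<phi>" unfolding ph
    proof
      assume s: "le (su w) (len X)"
      then have w: "lt w (len X)" by (simp add: suc_le)
      then have w': "le w (len X)" by (rule conjunct1)
      obtain y0 where y0: "lt y0 (mnum M m)" "?P w y0" using eu(1)[OF P w'] by blast
      then have y0': "?P' w y0" using IH[OF w', rule_format, OF y0(1)] by simp
      have step: "(mem w X \<longrightarrow> (\<exists>r. lt r (mnum M m) \<and> (\<exists>q. le q (su y0) \<and> su y0 = ma M (mm M q (mnum M m)) r \<and> Q (su w) r))) \<and>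
       (\<not> mem w X \<longrightarrow> Q (su w) y0)" if "modP M m X Q" "Q w y0" for Q
        using that w y0(1) unfolding modP_def by blast
      show "\<forall>y. lt y (mnum M m) \<longrightarrow> ?P (su w) y = ?P' (su w) y"
      proof (cases "mem w X")
        case True
        obtain r q where r: "lt r (mnum M m)" "le q (su y0)" "su y0 = ma M (mm M q (mnum M m)) r" "?P (su w) r"
          using step[OF P y0(2)] True by blast
        obtain r' q' where r': "lt r' (mnum M m)" "le q' (su y0)" "su y0 = ma M (mm M q' (mnum M m)) r'" "?P' (su w) r'"
          using step[OF P' y0'] True by blast
        have "r = r'" by (rule d[OF y0(1) r(1) r'(1) r(2) r'(2) r(3) r'(3)])
        then show ?thesis using agree[OF s r(1) r(4)] r'(4) by simp
      next
        case False
        then have "?P (su w) y0" "?P' (su w) y0" using step[OF P y0(2)] step[OF P' y0'] by simp_all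
        then show ?thesis by (rule agree[OF s y0(1)])
      qed
    qed
  qed (use assms in auto)
  then show ?thesis unfolding ph using z y by simp
qed

text \<open>Where the guard fails, both strings have length 0. Otherwise both contain only codes of
  entries, and on these they agree by \<open>modP_uniq\<close>.\<close>

lemma tab_uniq:
  assumes B: "inT k l B" and v: "vS sa" "vS sa'" and t: "msat M na sa (tabf m k X Y B)" "msat M na sa' (tabf m k X Y B)"
    and e: "\<forall>i<l. sa' i = sa i" "sa' X = sa X" and b: "le (len (sa X)) (mev M na sa B)"
  shows "sa Y = sa' Y"
proof -
  have g: "msat M na sa (guard m k B) = msat M na sa' (guard m k B)"
    by (rule msat_coinc) (use guard_simps[OF B, of m] e in auto)
  show ?thesis
  proof (cases "msat M na sa (guard m k B)")
    case False
    then have "len (sa Y) = Z" "len (sa' Y) = Z" using t g unfolding msat_tabf[OF B] by blast+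
    then show ?thesis by (intro str_eqI) (use v L1 not_lt_Z in metis)+
  next
    case True
    then have m: "modP M m (sa X) (\<lambda>z y. mem (mpair M z y) (sa Y))" "modP M m (sa X) (\<lambda>z y. mem (mpair M z y) (sa' Y))"
      using t g e unfolding msat_tabf[OF B] by auto
    have n: "\<exists>z. le z (len (sa X)) \<and> (\<exists>y. lt y (mnum M m) \<and> w = mpair M z y)" if "mem w (sa Y) \<or> mem w (sa' Y)" for w
      using that t g e True L1[of "sa Y" w] L1[of "sa' Y" w] v unfolding msat_tabf[OF B] by auto
    have "mem (mpair M z y) (sa Y) \<longleftrightarrow> mem (mpair M z y) (sa' Y)" if "le z (len (sa X))" "lt y (mnum M m)" for z y
      by (rule modP_uniq[OF _ _ _ m]) (use v that True[unfolded msat_guard[OF B]] in blast)+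
    then show ?thesis by (intro str_eqI) (use v n in blast)+
  qed
qed

lemma compf_ex:
  assumes B: "inT k l B" and "sigB0 \<theta>" "pureF \<theta>" and v: "vS sa" and X: "X \<notin> fvS \<theta>" "l \<le> X"
  shows "\<exists>A\<in>mS M. msat M na (sa(X:=A)) (compf k X B \<theta>)"
proof -
  obtain A where A: "A\<in>mS M" "le (len A) (mev M na sa B)"
     "\<And>x. lt x (mev M na sa B) \<Longrightarrow> (mem x A \<longleftrightarrow> msat M (na(k:=x)) sa \<theta>)"
    using comp[OF assms(2,3) v] by blast
  have "mev M na (sa(X:=A)) B = mev M na sa B" using B X by (intro mev_upd) (auto simp: inT_def)
  moreover have "msat M (na(k:=x)) (sa(X:=A)) \<theta> = msat M (na(k:=x)) sa \<theta>" for x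
    by (rule msat_upd) (use assms in auto)
  ultimately show ?thesis using A by (intro bexI[of _ A]) (auto simp: msat_compf[OF B])
qed

lemma compf_uniq:
  assumes B: "inT k l B" and "pureF \<theta>" and v: "vS sa" "vS sa'" and t: "msat M na sa (compf k X B \<theta>)" "msat M na sa' (compf k X B \<theta>)"
    and e: "\<forall>i<l. sa' i = sa i" "\<forall>i\<in>fvS \<theta>. sa' i = sa i"
  shows "sa X = sa' X"
proof (rule str_eqI)
  have e1: "mev M na sa B = mev M na sa' B" using B e by (intro mev_coinc) (auto simp: inT_def)
  have e2: "msat M (na(k:=x)) sa \<theta> = msat M (na(k:=x)) sa' \<theta>" for x by (rule msat_coinc) (use assms in auto)
  note c = t[unfolded msat_compf[OF B]]
  fix x
  show "mem x (sa X) \<longleftrightarrow> mem x (sa' X)"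
  proof (cases "lt x (mev M na sa B)")
    case True then show ?thesis using c e1 e2 by auto
  next
    case False
    then have "\<not> mem x (sa X)" "\<not> mem x (sa' X)" using c e1 L1 lt_le_trans v by metis+
    then show ?thesis by simp
  qed
qed (use v in auto)

lemma gam_ex:
  "okp k l j pr \<Longrightarrow> l < j \<Longrightarrow> vS sa \<Longrightarrow> \<exists>sa'. (\<forall>i. i \<notin> blk j pr \<longrightarrow> sa' i = sa i) \<and> vS sa' \<and> msat M na sa' (gam m k j pr)"
proof (induction pr arbitrary: j sa)
  case (Cons s pr)
  obtain B \<theta> where s: "s = (B, \<theta>)" by fastforce
  have o: "inT k l B" "sigB0 \<theta>" "pureF \<theta>" "fvN \<theta> \<subseteq> {..k}" "fvS \<theta> \<subseteq> {..<j} - {l}" "okp k l (j+2) pr" using Cons.prems s by auto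
  obtain A where A: "A \<in> mS M" "msat M na (sa(j:=A)) (compf k j B \<theta>)"
    using compf_ex[OF o(1-3) Cons.prems(3), of j na] o Cons.prems by auto
  have "le (len A) (mev M na (sa(j:=A)) B)" using A(2) by (simp add: msat_compf[OF o(1)])
  moreover have "vS (sa(j:=A))" using A Cons.prems(3) by simp
  ultimately obtain Y where Y: "Y \<in> mS M" "msat M na (sa(j:=A,Suc j:=Y)) (tabf m k j (Suc j) B)"
    using tab_ex[OF o(1), of "sa(j:=A)" j na "Suc j"] A Cons.prems by auto
  let ?s = "sa(j:=A,Suc j:=Y)"
  have "vS ?s" using A Y Cons.prems by simp
  then obtain sa' where sa': "\<forall>i. i \<notin> blk (j+2) pr \<longrightarrow> sa' i = ?s i" "vS sa'" "msat M na sa' (gam m k (j+2) pr)"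
    using Cons.IH[OF o(6), of ?s] Cons.prems by auto
  have "msat M na sa' (compf k j B \<theta>) = msat M na (sa(j:=A)) (compf k j B \<theta>)"
  proof (rule msat_coinc)
    have "\<forall>X\<in>fvS (compf k j B \<theta>). X \<le> j" using compf_simps(2)[OF o(1-4), of j] o(5) Cons.prems(2) by fastforce
    then show "\<forall>X\<in>fvS (compf k j B \<theta>). sa' X = (sa(j:=A)) X" using sa'(1) by fastforce
  qed (use compf_simps[OF o(1-4), of j] in auto)
  moreover have "msat M na sa' (tabf m k j (Suc j) B) = msat M na ?s (tabf m k j (Suc j) B)"
  proof (rule msat_coinc)
    have "\<forall>X\<in>fvS (tabf m k j (Suc j) B). X \<le> Suc j" using tabf_simps(2)[OF o(1), of m j "Suc j"] Cons.prems(2) by fastforce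
    then show "\<forall>X\<in>fvS (tabf m k j (Suc j) B). sa' X = ?s X" using sa'(1) by fastforce
  qed (use tabf_simps[OF o(1), of m j "Suc j"] in auto)
  ultimately show ?case using A Y sa' s by (intro exI[of _ sa']) auto
qed auto

text \<open>The two assignments agree outside the block. Going through the steps, first the set and
  then its table are forced, which leaves the same claim for a shorter program.\<close>

lemma gam_uniq:
  "okp k l j pr \<Longrightarrow> l < j \<Longrightarrow> vS sa' \<Longrightarrow> vS sa'' \<Longrightarrow> \<forall>i. i \<notin> blk j pr \<longrightarrow> sa' i = sa'' i \<Longrightarrow>
    msat M na sa' (gam m k j pr) \<Longrightarrow> msat M na sa'' (gam m k j pr) \<Longrightarrow> sa' = sa''"
proof (induction pr arbitrary: j)
  case (Cons s pr)
  obtain B \<theta> where s: "s = (B, \<theta>)" by fastforce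
  have o: "inT k l B" "sigB0 \<theta>" "pureF \<theta>" "fvN \<theta> \<subseteq> {..k}" "fvS \<theta> \<subseteq> {..<j} - {l}" "okp k l (j+2) pr" using Cons.prems s by auto
  have lo: "\<forall>i<j. sa' i = sa'' i" using Cons.prems by auto
  have c: "msat M na sa' (compf k j B \<theta>)" "msat M na sa'' (compf k j B \<theta>)" using Cons.prems s by auto
  have j: "sa' j = sa'' j" by (rule compf_uniq[OF o(1,3) _ _ c]) (use Cons.prems lo o in auto)
  have t: "msat M na sa' (tabf m k j (Suc j) B)" "msat M na sa'' (tabf m k j (Suc j) B)" using Cons.prems s by auto
  have sj: "sa' (Suc j) = sa'' (Suc j)"
    by (rule tab_uniq[OF o(1) _ _ t]) (use Cons.prems lo o j c in \<open>auto simp: msat_compf[OF o(1)]\<close>)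
  have "\<forall>i. i \<notin> blk (j+2) pr \<longrightarrow> sa' i = sa'' i"
  proof (intro allI impI)
    fix i assume "i \<notin> blk (j+2) pr"
    then have "i = j \<or> i = Suc j \<or> i \<notin> blk j (s # pr)" by auto
    then show "sa' i = sa'' i" using j sj Cons.prems(5) by blast
  qed
  then show ?case using Cons.IH[OF o(6)] Cons.prems by auto
qed auto

primrec bnd :: "(nat \<Rightarrow> 'a) \<Rightarrow> (nat \<Rightarrow> 's) \<Rightarrow> nat \<Rightarrow> prog \<Rightarrow> bool" where
  "bnd na sa j [] = True"
| "bnd na sa j (s # pr) = (le (len (sa j)) (mev M na sa (fst s)) \<and> le (len (sa (Suc j))) (mev M na sa (tb m (fst s))) \<and> bnd na sa (j + 2) pr)"

text \<open>Every solution obeys the bounds by itself, so in front of \<open>gam\<close> the bounded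
  prefix \<open>pre\<close> and the unbounded prefix \<open>preU\<close> have the same
  meaning.\<close>

lemma gam_bnd: "okp k l j pr \<Longrightarrow> msat M na sa (gam m k j pr) \<Longrightarrow> bnd na sa j pr"
  by (induction pr arbitrary: j) (auto simp: msat_compf msat_tabf)

text \<open>The whole prefix is one choice of strings for the block. The bounds read arguments only,
  so it does not matter at which stage of the choice they are evaluated.\<close>

lemma pre_iff:
  "okp k l j pr \<Longrightarrow> l < j \<Longrightarrow> vS sa \<Longrightarrow>
   msat M na sa (pre m j pr \<phi>) \<longleftrightarrow> (\<exists>sa'. (\<forall>i. i \<notin> blk j pr \<longrightarrow> sa' i = sa i) \<and> vS sa' \<and> bnd na sa' j pr \<and> msat M na sa' \<phi>)"
proof (induction pr arbitrary: j sa)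
  case Nil
  have "(\<forall>i. sa' i = sa i) \<longleftrightarrow> sa' = sa" for sa' by auto
  then show ?case using Nil by auto
next
  case (Cons s pr)
  obtain B \<theta> where s: "s = (B, \<theta>)" by fastforce
  have o: "inT k l B" "okp k l (j+2) pr" using Cons.prems s by auto
  have lt: "\<forall>X\<in>fvSn B. X < j" using o(1) Cons.prems(2) by (auto simp: inT_def)
  have pB: "pureN B" using o(1) by (simp add: inT_def)
  have ev: "mev M na sa' B = mev M na sa B" "mev M na sa' (tb m B) = mev M na sa (tb m B)" if "\<forall>i<j. sa' i = sa i" for sa'
    by (rule mev_coinc; use lt pB that in simp)+
  have fr: "j \<notin> fvSn B" "Suc j \<notin> fvSn B" using lt by auto
  have "msat M na sa (pre m j (s # pr) \<phi>) \<longleftrightarrow> (\<exists>A\<in>mS M. le (len A) (mev M na sa B) \<and> (\<exists>Y\<in>mS M. le (len Y) (mev M na sa (tb m B)) \<and>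
    msat M na (sa(j:=A,Suc j:=Y)) (pre m (j+2) pr \<phi>)))"
    using fr pB by (simp add: s)
  also have "\<dots> \<longleftrightarrow> (\<exists>A\<in>mS M. le (len A) (mev M na sa B) \<and> (\<exists>Y\<in>mS M. le (len Y) (mev M na sa (tb m B)) \<and>
     (\<exists>sa'. (\<forall>i. i \<notin> blk (j+2) pr \<longrightarrow> sa' i = (sa(j:=A,Suc j:=Y)) i) \<and> vS sa' \<and> bnd na sa' (j+2) pr \<and> msat M na sa' \<phi>)))"
    using Cons.IH[OF o(2)] Cons.prems by simp
  also have "\<dots> \<longleftrightarrow> (\<exists>sa'. (\<forall>i. i \<notin> blk j (s # pr) \<longrightarrow> sa' i = sa i) \<and> vS sa' \<and> bnd na sa' j (s # pr) \<and> msat M na sa' \<phi>)"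
    (is "?L \<longleftrightarrow> ?R")
  proof
    assume ?L
    then obtain A Y sa' where h: "A \<in> mS M" "le (len A) (mev M na sa B)" "Y \<in> mS M" "le (len Y) (mev M na sa (tb m B))"
      "\<forall>i. i \<notin> blk (j+2) pr \<longrightarrow> sa' i = (sa(j:=A,Suc j:=Y)) i" "vS sa'" "bnd na sa' (j+2) pr" "msat M na sa' \<phi>" by blast
    have e: "sa' j = A" "sa' (Suc j) = Y" "\<forall>i<j. sa' i = sa i" "\<forall>i. i \<notin> blk j (s # pr) \<longrightarrow> sa' i = sa i"
      using h(5) by simp_all
    have "bnd na sa' j (s # pr)" using h(2,4,7) e(1,2) ev[OF e(3)] s by simp
    then show ?R using h(6,8) e(4) by blast
  next
    assume ?R
    then obtain sa' where h: "\<forall>i. i \<notin> blk j (s # pr) \<longrightarrow> sa' i = sa i" "vS sa'" "bnd na sa' j (s # pr)" "msat M na sa' \<phi>" by blast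
    have e: "\<forall>i<j. sa' i = sa i" using h by auto
    have "\<forall>i. i \<notin> blk (j+2) pr \<longrightarrow> sa' i = (sa(j:=sa' j,Suc j:=sa' (Suc j))) i"
    proof (intro allI impI)
      fix i assume "i \<notin> blk (j+2) pr"
      then have "i = j \<or> i = Suc j \<or> i \<notin> blk j (s # pr)" by auto
      then show "sa' i = (sa(j:=sa' j,Suc j:=sa' (Suc j))) i" using h(1) by auto
    qed
    moreover have "le (len (sa' j)) (mev M na sa B)" "le (len (sa' (Suc j))) (mev M na sa (tb m B))" "bnd na sa' (j+2) pr"
      using h(3) s ev[OF e] by simp_all
    ultimately show ?L using h(2,4) by blast
  qed
  finally show ?case .
qed

lemma preU_iff:
  "vS sa \<Longrightarrow> msat M na sa (preU m j pr \<phi>) \<longleftrightarrow> (\<exists>sa'. (\<forall>i. i \<notin> blk j pr \<longrightarrow> sa' i = sa i) \<and> vS sa' \<and> msat M na sa' \<phi>)"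
proof (induction pr arbitrary: j sa)
  case Nil
  have "(\<forall>i. sa' i = sa i) \<longleftrightarrow> sa' = sa" for sa' by auto
  then show ?case using Nil by auto
next
  case (Cons s pr)
  have "msat M na sa (preU m j (s # pr) \<phi>) \<longleftrightarrow> (\<exists>A\<in>mS M. \<exists>Y\<in>mS M.
    msat M na (sa(j:=A,Suc j:=Y)) (preU m (j+2) pr \<phi>))"
    by simp
  also have "\<dots> \<longleftrightarrow> (\<exists>A\<in>mS M. \<exists>Y\<in>mS M. 
     (\<exists>sa'. (\<forall>i. i \<notin> blk (j+2) pr \<longrightarrow> sa' i = (sa(j:=A,Suc j:=Y)) i) \<and> vS sa' \<and> msat M na sa' \<phi>))"
    using Cons by simp
  also have "\<dots> \<longleftrightarrow> (\<exists>sa'. (\<forall>i. i \<notin> blk j (s # pr) \<longrightarrow> sa' i = sa i) \<and> vS sa' \<and> msat M na sa' \<phi>)"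
    (is "?L \<longleftrightarrow> ?R")
  proof
    assume ?L
    then obtain A Y sa' where h: "\<forall>i. i \<notin> blk (j+2) pr \<longrightarrow> sa' i = (sa(j:=A,Suc j:=Y)) i" "vS sa'" "msat M na sa' \<phi>" by blast
    then have "\<forall>i. i \<notin> blk j (s # pr) \<longrightarrow> sa' i = sa i" by simp
    then show ?R using h(2,3) by blast
  next
    assume ?R
    then obtain sa' where h: "\<forall>i. i \<notin> blk j (s # pr) \<longrightarrow> sa' i = sa i" "vS sa'" "msat M na sa' \<phi>" by blast
    have "\<forall>i. i \<notin> blk (j+2) pr \<longrightarrow> sa' i = (sa(j:=sa' j,Suc j:=sa' (Suc j))) i"
    proof (intro allI impI)
      fix i assume "i \<notin> blk (j+2) pr"
      then have "i = j \<or> i = Suc j \<or> i \<notin> blk j (s # pr)" by auto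
      then show "sa' i = (sa(j:=sa' j,Suc j:=sa' (Suc j))) i" using h(1) by auto
    qed
    then show ?L using h(2,3) by blast
  qed
  finally show ?case .
qed

text \<open>As \<open>s\<close> is the only solution of \<open>gam\<close>, quantifying
  existentially over solutions amounts to evaluating at \<open>s\<close>.\<close>

lemma pre_sol:
  assumes o: "okp k l j pr" "l < j" and sa: "vS sa"
    and s: "\<forall>i. i \<notin> blk j pr \<longrightarrow> s i = sa i" "vS s" "msat M na s (gam m k j pr)"
  shows "msat M na sa (pre m j pr (And (gam m k j pr) \<phi>)) \<longleftrightarrow> msat M na s \<phi>"
    "msat M na sa (preU m j pr (And (gam m k j pr) \<phi>)) \<longleftrightarrow> msat M na s \<phi>"
proof -
  have u: "sa' = s" if "\<forall>i. i \<notin> blk j pr \<longrightarrow> sa' i = sa i" "vS sa'" "msat M na sa' (gam m k j pr)" for sa'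
  proof (rule gam_uniq[OF o that(2) s(2) _ that(3) s(3)])
    show "\<forall>i. i \<notin> blk j pr \<longrightarrow> sa' i = s i" using s(1) that(1) by metis
  qed
  show "msat M na sa (pre m j pr (And (gam m k j pr) \<phi>)) \<longleftrightarrow> msat M na s \<phi>"
  proof
    assume "msat M na sa (pre m j pr (And (gam m k j pr) \<phi>))"
    then obtain sa' where h: "\<forall>i. i \<notin> blk j pr \<longrightarrow> sa' i = sa i" "vS sa'" "msat M na sa' (gam m k j pr)" "msat M na sa' \<phi>"
      unfolding pre_iff[OF o sa] msat_conn by (elim exE conjE)
    show "msat M na s \<phi>" using u[OF h(1-3)] h(4) by simp
  next
    assume "msat M na s \<phi>"
    then show "msat M na sa (pre m j pr (And (gam m k j pr) \<phi>))"
      unfolding pre_iff[OF o sa] msat_conn by (intro exI[of _ s] conjI s gam_bnd[OF o(1) s(3)])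
  qed
  show "msat M na sa (preU m j pr (And (gam m k j pr) \<phi>)) \<longleftrightarrow> msat M na s \<phi>"
  proof
    assume "msat M na sa (preU m j pr (And (gam m k j pr) \<phi>))"
    then obtain sa' where h: "\<forall>i. i \<notin> blk j pr \<longrightarrow> sa' i = sa i" "vS sa'" "msat M na sa' (gam m k j pr)" "msat M na sa' \<phi>"
      unfolding preU_iff[OF sa] msat_conn by (elim exE conjE)
    show "msat M na s \<phi>" using u[OF h(1-3)] h(4) by simp
  next
    assume "msat M na s \<phi>"
    then show "msat M na sa (preU m j pr (And (gam m k j pr) \<phi>))"
      unfolding preU_iff[OF sa] msat_conn by (intro exI[of _ s] conjI s)
  qed
qed

end

section \<open>Defining formulas for the outputs of programs\<close>

definition okF :: "nat \<Rightarrow> nat \<Rightarrow> nterm \<Rightarrow> form \<Rightarrow> prog \<Rightarrow> bool" where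
  "okF k l t \<theta> pr \<longleftrightarrow> okp k l (Suc l) pr \<and> inT k l t \<and> sigB0 \<theta> \<and> pureF \<theta> \<and> fvN \<theta> \<subseteq> {..k} \<and>
     fvS \<theta> \<subseteq> {..<Suc l + 2 * length pr} - {l}"

definition bodyF where "bodyF m k l t \<theta> pr = And (gam m k (Suc l) pr) (compf k l t \<theta>)"
text \<open>A number is output as the length of the string at \<open>l\<close>, which is then
  quantified as well. The output variable is number \<open>k\<close>; its use as comprehension
  variable inside the steps is bound and does not interfere.\<close>

definition bodyN where "bodyN m k l t \<theta> pr = And (gam m k (Suc l) pr) (And (compf k l t \<theta>) (Eq1 (NVar k) (Len (SVar l))))"
definition defS where "defS m k l t \<theta> pr = pre m (Suc l) pr (bodyF m k l t \<theta> pr)"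
definition defSU where "defSU m k l t \<theta> pr = preU m (Suc l) pr (bodyF m k l t \<theta> pr)"
definition defN where "defN m k l t \<theta> pr = ExSb l t (pre m (Suc l) pr (bodyN m k l t \<theta> pr))"
definition defNU where "defNU m k l t \<theta> pr = ExS l (preU m (Suc l) pr (bodyN m k l t \<theta> pr))"

lemma def_simps:
  assumes "okF k l t \<theta> pr"
  shows "pureF (defS m k l t \<theta> pr)" "fvN (defS m k l t \<theta> pr) \<subseteq> {..<k}" "fvS (defS m k l t \<theta> pr) \<subseteq> {..<Suc l}" "sigB1 (defS m k l t \<theta> pr)"
    "pureF (defSU m k l t \<theta> pr)" "fvN (defSU m k l t \<theta> pr) \<subseteq> {..<k}" "fvS (defSU m k l t \<theta> pr) \<subseteq> {..<Suc l}" "sig11 (defSU m k l t \<theta> pr)"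
    "pureF (defN m k l t \<theta> pr)" "fvN (defN m k l t \<theta> pr) \<subseteq> {..<Suc k}" "fvS (defN m k l t \<theta> pr) \<subseteq> {..<l}" "sigB1 (defN m k l t \<theta> pr)"
    "pureF (defNU m k l t \<theta> pr)" "fvN (defNU m k l t \<theta> pr) \<subseteq> {..<Suc k}" "fvS (defNU m k l t \<theta> pr) \<subseteq> {..<l}" "sig11 (defNU m k l t \<theta> pr)"
proof -
  have o: "okp k l (Suc l) pr" "inT k l t" "sigB0 \<theta>" "pureF \<theta>" "fvN \<theta> \<subseteq> {..k}" "fvS \<theta> \<subseteq> {..<Suc l + 2 * length pr} - {l}"
    using assms by (auto simp: okF_def)
  have g: "fvN (gam m k (Suc l) pr) \<subseteq> {..<k}" "fvS (gam m k (Suc l) pr) \<subseteq> {..<Suc l + 2 * length pr} - {l}"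
    "pureF (gam m k (Suc l) pr)" "sigB0 (gam m k (Suc l) pr)"
    using gam_simps[OF o(1) lessI, of m] by simp_all
  note c = compf_simps[OF o(2-5), of l]
  have "{..<l} \<union> fvS \<theta> \<union> {l} \<subseteq> {..<Suc l + 2 * length pr}" using o(6) by auto
  then have c2: "fvS (compf k l t \<theta>) \<subseteq> {..<Suc l + 2 * length pr}" by (rule order_trans[OF c(2)])
  have F: "pureF (bodyF m k l t \<theta> pr)" "sigB0 (bodyF m k l t \<theta> pr)" "fvN (bodyF m k l t \<theta> pr) \<subseteq> {..<k}"
     "fvS (bodyF m k l t \<theta> pr) \<subseteq> {..<Suc l + 2 * length pr}"
    unfolding bodyF_def fvN_conn fvS_conn
    by (simp_all only: pureF_conn g c sigB0_conn simp_thms) (intro Un_least g c c2 order_trans[OF g(2) Diff_subset])+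
  have N: "pureF (bodyN m k l t \<theta> pr)" "sigB0 (bodyN m k l t \<theta> pr)" "fvN (bodyN m k l t \<theta> pr) \<subseteq> {..<Suc k}"
     "fvS (bodyN m k l t \<theta> pr) \<subseteq> {..<Suc l + 2 * length pr}"
  proof -
    show "pureF (bodyN m k l t \<theta> pr)" "sigB0 (bodyN m k l t \<theta> pr)"
      by (simp_all add: bodyN_def g c)
    have "{..<k} \<subseteq> {..<Suc k}" by auto
    then have "fvN (gam m k (Suc l) pr) \<subseteq> {..<Suc k}" "fvN (compf k l t \<theta>) \<subseteq> {..<Suc k}"
      by (rule order_trans[OF g(1)], rule order_trans[OF c(1)])
    then show "fvN (bodyN m k l t \<theta> pr) \<subseteq> {..<Suc k}" by (simp add: bodyN_def)
    have "fvS (gam m k (Suc l) pr) \<subseteq> {..<Suc l + 2 * length pr}" by (rule order_trans[OF g(2) Diff_subset])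
    then show "fvS (bodyN m k l t \<theta> pr) \<subseteq> {..<Suc l + 2 * length pr}" using c2 by (simp add: bodyN_def)
  qed
  note p1 = pre_simps[OF o(1) lessI, of m "bodyF m k l t \<theta> pr"] preU_simps[OF o(1) lessI, of m "bodyF m k l t \<theta> pr"]
  note p2 = pre_simps[OF o(1) lessI, of m "bodyN m k l t \<theta> pr"] preU_simps[OF o(1) lessI, of m "bodyN m k l t \<theta> pr"]
  have s: "{..<Suc l + 2 * length pr} - blk (Suc l) pr \<subseteq> {..<Suc l}" by auto
  show "pureF (defS m k l t \<theta> pr)" "sigB1 (defS m k l t \<theta> pr)" "pureF (defSU m k l t \<theta> pr)" "sig11 (defSU m k l t \<theta> pr)"
    using p1 F by (simp_all add: defS_def defSU_def)
  have F1: "fvN (defS m k l t \<theta> pr) \<subseteq> fvN (bodyF m k l t \<theta> pr) \<union> {..<k}" "fvN (defSU m k l t \<theta> pr) \<subseteq> fvN (bodyF m k l t \<theta> pr)"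
    "fvS (defS m k l t \<theta> pr) \<subseteq> {..<l} \<union> (fvS (bodyF m k l t \<theta> pr) - blk (Suc l) pr)" "fvS (defSU m k l t \<theta> pr) \<subseteq> fvS (bodyF m k l t \<theta> pr) - blk (Suc l) pr"
    using p1 by (simp_all add: defS_def defSU_def)
  show "fvN (defS m k l t \<theta> pr) \<subseteq> {..<k}" by (rule order_trans[OF F1(1) Un_least[OF F(3) order_refl]])
  show "fvN (defSU m k l t \<theta> pr) \<subseteq> {..<k}" by (rule order_trans[OF F1(2) F(3)])
  have s1: "fvS (bodyF m k l t \<theta> pr) - blk (Suc l) pr \<subseteq> {..<Suc l}" by (rule order_trans[OF Diff_mono[OF F(4) order_refl] s])
  have s2: "fvS (bodyN m k l t \<theta> pr) - blk (Suc l) pr \<subseteq> {..<Suc l}" by (rule order_trans[OF Diff_mono[OF N(4) order_refl] s])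
  have ll: "{..<l} \<subseteq> {..<Suc l}" by auto
  show "fvS (defS m k l t \<theta> pr) \<subseteq> {..<Suc l}" by (rule order_trans[OF F1(3) Un_least[OF ll s1]])
  show "fvS (defSU m k l t \<theta> pr) \<subseteq> {..<Suc l}" by (rule order_trans[OF F1(4) s1])
  show "pureF (defN m k l t \<theta> pr)" "pureF (defNU m k l t \<theta> pr)"
    using p2 N o by (simp_all add: defN_def defNU_def inT_def)
  show "sig11 (defNU m k l t \<theta> pr)" using p2 N by (simp add: defNU_def sig11.intros)
  show "sigB1 (defN m k l t \<theta> pr)" unfolding defN_def
    by (rule sigB1.intros(2)) (use p2 N o in \<open>auto simp: inT_def\<close>)
  have N1: "fvN (defN m k l t \<theta> pr) \<subseteq> fvN (bodyN m k l t \<theta> pr) \<union> {..<k}" "fvN (defNU m k l t \<theta> pr) \<subseteq> fvN (bodyN m k l t \<theta> pr)"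
    "fvS (defN m k l t \<theta> pr) \<subseteq> {..<l} \<union> (fvS (bodyN m k l t \<theta> pr) - blk (Suc l) pr - {l})" "fvS (defNU m k l t \<theta> pr) \<subseteq> fvS (bodyN m k l t \<theta> pr) - blk (Suc l) pr - {l}"
    using p2 o(2) by (auto simp: defN_def defNU_def inT_def)
  have kk: "{..<k} \<subseteq> {..<Suc k}" by auto
  show "fvN (defN m k l t \<theta> pr) \<subseteq> {..<Suc k}" by (rule order_trans[OF N1(1) Un_least[OF N(3) kk]])
  show "fvN (defNU m k l t \<theta> pr) \<subseteq> {..<Suc k}" by (rule order_trans[OF N1(2) N(3)])
  have "{..<Suc l} - {l} \<subseteq> {..<l}" by auto
  then have s3: "fvS (bodyN m k l t \<theta> pr) - blk (Suc l) pr - {l} \<subseteq> {..<l}" by (rule order_trans[OF Diff_mono[OF s2 order_refl]])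
  show "fvS (defN m k l t \<theta> pr) \<subseteq> {..<l}" by (rule order_trans[OF N1(3) Un_least[OF order_refl s3]])
  show "fvS (defNU m k l t \<theta> pr) \<subseteq> {..<l}" by (rule order_trans[OF N1(4) s3])
qed

context v0
begin

lemma def_sol:
  assumes ok: "okF k l t \<theta> pr" and sa: "vS sa" and s: "\<forall>i. i \<notin> blk (Suc l) pr \<longrightarrow> s i = sa i" "vS s" "msat M na s (gam m k (Suc l) pr)"
    and Y: "Y \<in> mS M"
  shows "msat M na (sa(l:=Y)) (defS m k l t \<theta> pr) \<longleftrightarrow> msat M na (s(l:=Y)) (compf k l t \<theta>)"
    "msat M na (sa(l:=Y)) (defSU m k l t \<theta> pr) \<longleftrightarrow> msat M na (s(l:=Y)) (compf k l t \<theta>)"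
    "msat M (na(k:=y)) (sa(l:=Y)) (pre m (Suc l) pr (bodyN m k l t \<theta> pr)) \<longleftrightarrow> msat M na (s(l:=Y)) (compf k l t \<theta>) \<and> y = len Y"
    "msat M (na(k:=y)) (sa(l:=Y)) (preU m (Suc l) pr (bodyN m k l t \<theta> pr)) \<longleftrightarrow> msat M na (s(l:=Y)) (compf k l t \<theta>) \<and> y = len Y"
proof -
  have o: "okp k l (Suc l) pr" "inT k l t" "sigB0 \<theta>" "pureF \<theta>" "fvN \<theta> \<subseteq> {..k}" "l < Suc l"
    using ok by (auto simp: okF_def)
  note g = gam_simps[OF o(1,6), of m]
  have v: "vS (sa(l:=Y))" "vS (s(l:=Y))" using sa s Y by auto
  have e: "\<forall>i. i \<notin> blk (Suc l) pr \<longrightarrow> (s(l:=Y)) i = (sa(l:=Y)) i" using s by auto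
  have gl: "msat M na (s(l:=Y)) (gam m k (Suc l) pr)" using g s by (subst msat_upd) auto
  have gk: "msat M (na(k:=y)) (s(l:=Y)) (gam m k (Suc l) pr)" using g gl by (subst msat_upd) auto
  have ck: "msat M (na(k:=y)) (s(l:=Y)) (compf k l t \<theta>) = msat M na (s(l:=Y)) (compf k l t \<theta>)"
    using compf_simps[OF o(2-5), of l] by (intro msat_upd) auto
  show "msat M na (sa(l:=Y)) (defS m k l t \<theta> pr) \<longleftrightarrow> msat M na (s(l:=Y)) (compf k l t \<theta>)"
    "msat M na (sa(l:=Y)) (defSU m k l t \<theta> pr) \<longleftrightarrow> msat M na (s(l:=Y)) (compf k l t \<theta>)"
    unfolding defS_def defSU_def bodyF_def using pre_sol[OF o(1,6) v(1) e v(2) gl] by blast+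
  show "msat M (na(k:=y)) (sa(l:=Y)) (pre m (Suc l) pr (bodyN m k l t \<theta> pr)) \<longleftrightarrow> msat M na (s(l:=Y)) (compf k l t \<theta>) \<and> y = len Y"
    "msat M (na(k:=y)) (sa(l:=Y)) (preU m (Suc l) pr (bodyN m k l t \<theta> pr)) \<longleftrightarrow> msat M na (s(l:=Y)) (compf k l t \<theta>) \<and> y = len Y"
    unfolding bodyN_def pre_sol[OF o(1,6) v(1) e v(2) gk] by (simp_all add: ck del: fun_upd_apply) simp_all
qed

lemma def_iff:
  assumes ok: "okF k l t \<theta> pr" and sa: "vS sa" and s: "\<forall>i. i \<notin> blk (Suc l) pr \<longrightarrow> s i = sa i" "vS s" "msat M na s (gam m k (Suc l) pr)"
  shows "msat M (na(k:=y)) sa (defN m k l t \<theta> pr) \<longleftrightarrow> (\<exists>Y\<in>mS M. msat M na (s(l:=Y)) (compf k l t \<theta>) \<and> y = len Y)"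
    "msat M (na(k:=y)) sa (defNU m k l t \<theta> pr) \<longleftrightarrow> (\<exists>Y\<in>mS M. msat M na (s(l:=Y)) (compf k l t \<theta>) \<and> y = len Y)"
proof -
  have o: "inT k l t" using ok by (simp add: okF_def)
  have t: "mev M (na(k:=y)) (sa(l:=Y)) t = mev M na (s(l:=Y)) t" for Y
    using o s by (intro mev_coinc) (auto simp: inT_def)
  show "msat M (na(k:=y)) sa (defN m k l t \<theta> pr) \<longleftrightarrow> (\<exists>Y\<in>mS M. msat M na (s(l:=Y)) (compf k l t \<theta>) \<and> y = len Y)"
    "msat M (na(k:=y)) sa (defNU m k l t \<theta> pr) \<longleftrightarrow> (\<exists>Y\<in>mS M. msat M na (s(l:=Y)) (compf k l t \<theta>) \<and> y = len Y)"
    unfolding defN_def defNU_def msat_conn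
  proof -
    have 1: "msat M (na(k:=y)) (sa(l:=Y)) (Le (Len (SVar l)) t)" if "msat M na (s(l:=Y)) (compf k l t \<theta>)" for Y
      using that t[of Y] by (simp add: msat_compf[OF o])
    show "(\<exists>A\<in>mS M. msat M (na(k:=y)) (sa(l:=A)) (Le (Len (SVar l)) t) \<and> msat M (na(k:=y)) (sa(l:=A)) (pre m (Suc l) pr (bodyN m k l t \<theta> pr)))
      \<longleftrightarrow> (\<exists>Y\<in>mS M. msat M na (s(l:=Y)) (compf k l t \<theta>) \<and> y = len Y)"
      by (rule bex_cong[OF HOL.refl]) (use 1 def_sol(3)[OF ok sa s] in blast)
    show "(\<exists>A\<in>mS M. msat M (na(k:=y)) (sa(l:=A)) (preU m (Suc l) pr (bodyN m k l t \<theta> pr)))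
      \<longleftrightarrow> (\<exists>Y\<in>mS M. msat M na (s(l:=Y)) (compf k l t \<theta>) \<and> y = len Y)"
      by (rule bex_cong[OF HOL.refl]) (use def_sol(4)[OF ok sa s] in blast)
  qed
qed

lemma def_unique:
  assumes ok: "okF k l t \<theta> pr" and sa: "vS sa"
  shows "\<exists>!Y. Y \<in> mS M \<and> msat M na (sa(l:=Y)) (defS m k l t \<theta> pr)"
    "\<exists>!Y. Y \<in> mS M \<and> msat M na (sa(l:=Y)) (defSU m k l t \<theta> pr)"
    "\<exists>!y. msat M (na(k:=y)) sa (defN m k l t \<theta> pr)"
    "\<exists>!y. msat M (na(k:=y)) sa (defNU m k l t \<theta> pr)"
proof -
  have o: "okp k l (Suc l) pr" "inT k l t" "sigB0 \<theta>" "pureF \<theta>" "fvN \<theta> \<subseteq> {..k}" "l \<notin> fvS \<theta>" "l < Suc l"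
    using ok by (auto simp: okF_def)
  obtain s where s: "\<forall>i. i \<notin> blk (Suc l) pr \<longrightarrow> s i = sa i" "vS s" "msat M na s (gam m k (Suc l) pr)"
    using gam_ex[OF o(1,7) sa, of na] by blast
  obtain Y where Y: "Y \<in> mS M" "msat M na (s(l:=Y)) (compf k l t \<theta>)"
    using compf_ex[OF o(2-4) s(2) o(6), of na] by blast
  have u: "Y' = Y" if "Y' \<in> mS M" "msat M na (s(l:=Y')) (compf k l t \<theta>)" for Y'
  proof -
    have "(s(l:=Y')) l = (s(l:=Y)) l"
    proof (rule compf_uniq[OF o(2,4) _ _ that(2) Y(2)])
      show "vS (s(l:=Y'))" "vS (s(l:=Y))" using that(1) Y(1) s(2) by auto
    qed (use o(6) in auto)
    then show ?thesis by simp
  qed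
  show "\<exists>!Y. Y \<in> mS M \<and> msat M na (sa(l:=Y)) (defS m k l t \<theta> pr)"
    by (rule ex1I[of _ Y]) (use def_sol(1)[OF ok sa s] Y u in blast)+
  show "\<exists>!Y. Y \<in> mS M \<and> msat M na (sa(l:=Y)) (defSU m k l t \<theta> pr)"
    by (rule ex1I[of _ Y]) (use def_sol(2)[OF ok sa s] Y u in blast)+
  show "\<exists>!y. msat M (na(k:=y)) sa (defN m k l t \<theta> pr)"
    by (rule ex1I[of _ "len Y"]) (use def_iff(1)[OF ok sa s] Y u in blast)+
  show "\<exists>!y. msat M (na(k:=y)) sa (defNU m k l t \<theta> pr)"
    by (rule ex1I[of _ "len Y"]) (use def_iff(2)[OF ok sa s] Y u in blast)+
qed

end

section \<open>Provable unique existence\<close>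

lemma msat_ExUS:
  assumes "normal M" "pureF \<phi>" "\<exists>!Y. Y \<in> mS M \<and> msat M na (sa(l:=Y)) \<phi>"
  shows "msat M na sa (ExUS l \<phi>)"
proof -
  define Z where "Z = Suc (Max (insert l (allS \<phi>)))"
  have Zb: "x < Z" if "x \<in> insert l (allS \<phi>)" for x
    unfolding Z_def using that by (intro le_imp_less_Suc Max_ge) auto
  then have Z: "Z \<noteq> l" "Z \<notin> allS \<phi>" by blast+
  have p: "msat M na (sa(l:=A,Z:=B)) \<phi> = msat M na (sa(l:=A)) \<phi>" for A B
    by (rule msat_upd) (use assms Z fv_subset_all in auto)
  have "msat M na (sa(l:=A,Z:=B)) (sbS l Z \<phi>) = msat M na (sa(l:=B)) \<phi>" for A B
  proof -
    have "msat M na (sa(l:=A,Z:=B)) (sbS l Z \<phi>) = msat M na ((sa(l:=A,Z:=B))(l:=B)) \<phi>"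
      using msat_sbS[OF assms(2) freeS_fresh[OF Z(2)], where M=M and na=na and sa="sa(l:=A,Z:=B)" and X=l] by simp
    also have "\<dots> = msat M na (sa(l:=B,Z:=B)) \<phi>" using Z by (simp add: fun_upd_twist)
    finally show ?thesis using p by simp
  qed
  then show ?thesis using assms Z unfolding ExUS_def Let_def Z_def[symmetric] normal_def by (auto simp: p)
qed

lemma msat_ExUN:
  assumes "normal M" "pureF \<phi>" "\<exists>!y. msat M (na(l:=y)) sa \<phi>"
  shows "msat M na sa (ExUN l \<phi>)"
proof -
  define Z where "Z = Suc (Max (insert l (allN \<phi>)))"
  have Zb: "x < Z" if "x \<in> insert l (allN \<phi>)" for x
    unfolding Z_def using that by (intro le_imp_less_Suc Max_ge) auto
  then have Z: "Z \<noteq> l" "Z \<notin> allN \<phi>" by blast+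
  have p: "msat M (na(l:=A,Z:=B)) sa \<phi> = msat M (na(l:=A)) sa \<phi>" for A B
    by (rule msat_upd) (use assms Z fv_subset_all in auto)
  have "msat M (na(l:=A,Z:=B)) sa (sbN l (NVar Z) \<phi>) = msat M (na(l:=B)) sa \<phi>" for A B
  proof -
    have "msat M (na(l:=A,Z:=B)) sa (sbN l (NVar Z) \<phi>) = msat M ((na(l:=A,Z:=B))(l:=B)) sa \<phi>"
      using msat_sbN[OF assms(2) _ freeN_fresh[OF Z(2)], where M=M and na="na(l:=A,Z:=B)" and sa=sa and x=l] by simp
    also have "\<dots> = msat M (na(l:=B,Z:=B)) sa \<phi>" using Z by (simp add: fun_upd_twist)
    finally show ?thesis using p by simp
  qed
  then show ?thesis using assms Z unfolding ExUN_def Let_def Z_def[symmetric] normal_def by (auto simp: p)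
qed

lemma pureT_V0m: "pureT V0" "pureF (MODax m)" "pureT (V0m m)" "V0 \<subseteq> V0m m"
proof -
  show a: "pureT V0" by (auto simp: V0_def basic_axioms_def comp_axioms_def)
  show b: "pureF (MODax m)" by (simp add: MODax_def phiMOD_pm)
  show "pureT (V0m m)" "V0 \<subseteq> V0m m" using a b by (auto simp: V0m_def)
qed

lemma pureF_ExU: "pureF \<phi> \<Longrightarrow> pureF (ExUS l \<phi>)" "pureF \<phi> \<Longrightarrow> pureF (ExUN l \<phi>)"
  by (simp_all add: ExUS_def ExUN_def Let_def)

lemma def_prv:
  assumes ok: "okF k l t \<theta> pr" and m: "m \<ge> 2"
  shows "prv (V0m m) (closeN k (closeS l (ExUS l (defS m k l t \<theta> pr))))"
    "prv (V0m m) (closeN k (closeS l (ExUS l (defSU m k l t \<theta> pr))))"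
    "prv (V0m m) (closeN k (closeS l (ExUN k (defN m k l t \<theta> pr))))"
    "prv (V0m m) (closeN k (closeS l (ExUN k (defNU m k l t \<theta> pr))))"
proof -
  note p = def_simps[OF ok, of m]
  \<comment> \<open>A valid assignment is the source of the nonempty string domain.\<close>
  have *: "v0 M m" if "normal M" "models M (V0m m)" "valid_env M na sa" for M :: "(nat, nat set) mdl" and na sa
    using that m by unfold_locales (auto simp: valid_env_def)
  have c: "prv (V0m m) \<phi>" if "pureF \<phi>" "\<And>(M :: (nat, nat set) mdl) na sa. v0 M m \<Longrightarrow> \<forall>i. sa i \<in> mS M \<Longrightarrow> msat M na sa \<phi>" for \<phi>
    by (rule completeness) (use pureT_V0m that * in \<open>auto simp: valid_env_def\<close>)
  have "prv (V0m m) (ExUS l (defS m k l t \<theta> pr))"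
    by (rule c[OF pureF_ExU(1)[OF p(1)]], rule msat_ExUS[OF _ p(1) v0.def_unique(1)[OF _ ok]]) (auto dest: v0.nm)
  then show "prv (V0m m) (closeN k (closeS l (ExUS l (defS m k l t \<theta> pr))))"
    unfolding closeN_def closeS_def by (intro prv_foldr)
  have "prv (V0m m) (ExUS l (defSU m k l t \<theta> pr))"
    by (rule c[OF pureF_ExU(1)[OF p(5)]], rule msat_ExUS[OF _ p(5) v0.def_unique(2)[OF _ ok]]) (auto dest: v0.nm)
  then show "prv (V0m m) (closeN k (closeS l (ExUS l (defSU m k l t \<theta> pr))))"
    unfolding closeN_def closeS_def by (intro prv_foldr)
  have "prv (V0m m) (ExUN k (defN m k l t \<theta> pr))"
    by (rule c[OF pureF_ExU(2)[OF p(9)]], rule msat_ExUN[OF _ p(9) v0.def_unique(3)[OF _ ok]]) (auto dest: v0.nm)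
  then show "prv (V0m m) (closeN k (closeS l (ExUN k (defN m k l t \<theta> pr))))"
    unfolding closeN_def closeS_def by (intro prv_foldr)
  have "prv (V0m m) (ExUN k (defNU m k l t \<theta> pr))"
    by (rule c[OF pureF_ExU(2)[OF p(13)]], rule msat_ExUN[OF _ p(13) v0.def_unique(4)[OF _ ok]]) (auto dest: v0.nm)
  then show "prv (V0m m) (closeN k (closeS l (ExUN k (defNU m k l t \<theta> pr))))"
    unfolding closeN_def closeS_def by (intro prv_foldr)
qed

section \<open>Bounded formulas with modular counting quantifiers\<close>

abbreviation "fin sa \<equiv> \<forall>i. finite (sa i)"

definition ncons :: "nat \<Rightarrow> (nat \<Rightarrow> nat) \<Rightarrow> nat \<Rightarrow> nat" (infixr "##" 65) where
  "n ## na = (\<lambda>i. case i of 0 \<Rightarrow> n | Suc j \<Rightarrow> na j)"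

definition ntl :: "(nat \<Rightarrow> nat) \<Rightarrow> nat \<Rightarrow> nat" where "ntl na i = na (Suc i)"

lemma ncons_simps [simp]: "(n ## na) 0 = n" "(n ## na) (Suc i) = na i" "ntl (n ## na) = na" "na 0 ## ntl na = na"
  by (auto simp: ncons_def ntl_def fun_eq_iff split: nat.splits)

text \<open>Number variables are de Bruijn indices here; the values of a class member matter only on finite strings.\<close>

inductive MR :: "nat \<Rightarrow> ((nat \<Rightarrow> nat) \<Rightarrow> (nat \<Rightarrow> nat set) \<Rightarrow> bool) \<Rightarrow> bool" for m where
  MR_eq: "pureN s \<Longrightarrow> pureN t \<Longrightarrow> MR m (\<lambda>na sa. evn I0 na sa s = evn I0 na sa t)"
| MR_le: "pureN s \<Longrightarrow> pureN t \<Longrightarrow> MR m (\<lambda>na sa. evn I0 na sa s \<le> evn I0 na sa t)"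
| MR_mem: "pureN s \<Longrightarrow> MR m (\<lambda>na sa. evn I0 na sa s \<in> sa X)"
| MR_imp: "MR m P \<Longrightarrow> MR m Q \<Longrightarrow> MR m (\<lambda>na sa. P na sa \<longrightarrow> Q na sa)"
| MR_all: "pureN t \<Longrightarrow> MR m P \<Longrightarrow> MR m (\<lambda>na sa. \<forall>n \<le> evn I0 na sa t. P (n ## na) sa)"
| MR_mod: "pureN t \<Longrightarrow> pureN u \<Longrightarrow> MR m P \<Longrightarrow>
    MR m (\<lambda>na sa. card {n. n < evn I0 na sa t \<and> P (n ## na) sa} mod m = evn I0 na sa u)"
| MR_cong: "MR m P \<Longrightarrow> (\<And>na sa. fin sa \<Longrightarrow> Q na sa = P na sa) \<Longrightarrow> MR m Q"

definition shf :: "nterm \<Rightarrow> nterm" where "shf = subn (\<lambda>i. NVar (Suc i))"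

lemma shf_simps [simp]: "evn I na sa (shf t) = evn I (ntl na) sa t" "pureN t \<Longrightarrow> pureN (shf t)"
proof -
  have "(\<lambda>i. na (Suc i)) = ntl na" by (auto simp: ntl_def)
  then show "evn I na sa (shf t) = evn I (ntl na) sa t" by (simp add: shf_def)
qed (auto simp: shf_def intro: pure_sub)

lemma evn_mono:
  assumes "\<forall>i. na i \<le> na' i" shows "pureN t \<Longrightarrow> evn I0 na sa t \<le> evn I0 na' sa t"
proof (induction t rule: nterm.induct[where ?P2.0="\<lambda>_. True"])
  case (Len T) then show ?case by (cases T) auto
qed (use assms in \<open>auto intro: add_mono mult_mono\<close>)

text \<open>Besides substitution of terms this provides the weakenings and exchanges of number
  variables used below.\<close>

lemma MR_subt:
  "MR m P \<Longrightarrow> \<forall>i. pureN (\<sigma> i) \<Longrightarrow> MR m (\<lambda>na sa. P (\<lambda>i. evn I0 na sa (\<sigma> i)) sa)"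
proof (induction arbitrary: \<sigma> rule: MR.induct)
  case (MR_eq s t)
  show ?case using MR.MR_eq[of "subn \<sigma> s" "subn \<sigma> t" m] MR_eq by (simp add: pure_sub)
next
  case (MR_le s t)
  show ?case using MR.MR_le[of "subn \<sigma> s" "subn \<sigma> t" m] MR_le by (simp add: pure_sub)
next
  case (MR_mem s X)
  show ?case using MR.MR_mem[of "subn \<sigma> s" m X] MR_mem by (simp add: pure_sub)
next
  case (MR_imp P Q)
  then show ?case by (intro MR.MR_imp) auto
next
  case (MR_all t P)
  let ?s = "\<lambda>i. case i of 0 \<Rightarrow> NVar 0 | Suc j \<Rightarrow> shf (\<sigma> j)"
  have "(\<lambda>i. evn I0 (n ## na) sa (?s i)) = n ## (\<lambda>i. evn I0 na sa (\<sigma> i))" for n na sa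
    by (auto simp: fun_eq_iff split: nat.splits)
  then show ?case using MR.MR_all[OF pure_sub(1)[OF MR_all(1,4)] MR_all(3)[of ?s]] MR_all(4)
    by (simp split: nat.splits)
next
  case (MR_mod t u P)
  let ?s = "\<lambda>i. case i of 0 \<Rightarrow> NVar 0 | Suc j \<Rightarrow> shf (\<sigma> j)"
  have "(\<lambda>i. evn I0 (n ## na) sa (?s i)) = n ## (\<lambda>i. evn I0 na sa (\<sigma> i))" for n na sa
    by (auto simp: fun_eq_iff split: nat.splits)
  then show ?case using MR.MR_mod[OF pure_sub(1)[OF MR_mod(1,5)] pure_sub(1)[OF MR_mod(2,5)] MR_mod(4)[of ?s]] MR_mod(5)
    by (simp split: nat.splits)
next
  case (MR_cong P Q)
  then show ?case by (intro MR.MR_cong[OF MR_cong.IH]) auto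
qed

section \<open>Closure properties of the class and its functions\<close>

lemma MR_not: "MR m P \<Longrightarrow> MR m (\<lambda>na sa. \<not> P na sa)"
  using MR_imp[OF _ MR_eq[of Zero One m], of P] by simp

lemma MR_or: assumes "MR m P" "MR m Q" shows "MR m (\<lambda>na sa. P na sa \<or> Q na sa)"
  by (rule MR_cong[OF MR_imp[OF MR_not[OF assms(1)] assms(2)]]) auto

lemma MR_and: assumes "MR m P" "MR m Q" shows "MR m (\<lambda>na sa. P na sa \<and> Q na sa)"
  by (rule MR_cong[OF MR_not[OF MR_imp[OF assms(1) MR_not[OF assms(2)]]]]) auto

lemma MR_iff: assumes "MR m P" "MR m Q" shows "MR m (\<lambda>na sa. P na sa = Q na sa)"
  by (rule MR_cong[OF MR_and[OF MR_imp[OF assms] MR_imp[OF assms(2,1)]]]) auto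

lemma MR_const: "MR m (\<lambda>na sa. c)"
  using MR_eq[of Zero Zero m] MR_eq[of Zero One m] by (cases c) simp_all

lemma MR_ex: assumes "pureN t" "MR m P" shows "MR m (\<lambda>na sa. \<exists>n \<le> evn I0 na sa t. P (n ## na) sa)"
  by (rule MR_cong[OF MR_not[OF MR_all[OF assms(1) MR_not[OF assms(2)]]]]) auto

text \<open>\<open>GN\<close> and \<open>GS\<close> are FAC^0(m) in semantic form, with whole
  assignments instead of argument lists; the identification is made in \<open>FAC0N_GN\<close> and
  \<open>FAC0S_GS\<close>. Index 0 is the slot for the value, or for the tested element of a
  string.\<close>

definition GN :: "nat \<Rightarrow> ((nat \<Rightarrow> nat) \<Rightarrow> (nat \<Rightarrow> nat set) \<Rightarrow> nat) \<Rightarrow> bool" where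
  "GN m f \<longleftrightarrow> (\<exists>t. pureN t \<and> (\<forall>na sa. fin sa \<longrightarrow> f na sa \<le> evn I0 na sa t)) \<and> MR m (\<lambda>na sa. na 0 = f (ntl na) sa)"

definition GS :: "nat \<Rightarrow> ((nat \<Rightarrow> nat) \<Rightarrow> (nat \<Rightarrow> nat set) \<Rightarrow> nat set) \<Rightarrow> bool" where
  "GS m F \<longleftrightarrow> (\<exists>t. pureN t \<and> (\<forall>na sa. fin sa \<longrightarrow> finite (F na sa) \<and> slen (F na sa) \<le> evn I0 na sa t)) \<and>
     MR m (\<lambda>na sa. na 0 \<in> F (ntl na) sa)"

text \<open>A value is plugged into a relation by guessing it below its bound and checking the
  graph.\<close>

lemma GN_rel:
  assumes "GN m f" "MR m R" shows "MR m (\<lambda>na sa. R (f na sa ## na) sa)"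
proof -
  obtain t where t: "pureN t" "\<forall>na sa. fin sa \<longrightarrow> f na sa \<le> evn I0 na sa t" and g: "MR m (\<lambda>na sa. na 0 = f (ntl na) sa)"
    using assms(1) unfolding GN_def by blast
  show ?thesis by (rule MR_cong[OF MR_ex[OF t(1) MR_and[OF g assms(2)]]]) (use t(2) in auto)
qed

lemma GN_term: "pureN t \<Longrightarrow> GN m (\<lambda>na sa. evn I0 na sa t)"
  unfolding GN_def using MR_eq[of "NVar 0" "shf t" m] by auto

lemma GN_var: "GN m (\<lambda>na sa. na i)"
  using GN_term[of "NVar i"] by simp

lemma evn_num [simp]: "evn I na sa (numeral_t n) = n" "pureN (numeral_t n)" "fvNn (numeral_t n) = {}" "fvSn (numeral_t n) = {}"
  by (induction n) auto

lemma GN_const: "GN m (\<lambda>na sa. c)"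
  using GN_term[of "numeral_t c"] by simp

text \<open>Weakening for graphs: an unread variable is inserted just after the value slot.\<close>

lemma MR_skip: "MR m (\<lambda>na sa. P (na 0) (ntl na) sa) \<Longrightarrow> MR m (\<lambda>na sa. P (na 0) (ntl (ntl na)) sa)"
proof -
  let ?\<sigma> = "\<lambda>i. if i = 0 then NVar 0 else NVar (Suc i)"
  assume "MR m (\<lambda>na sa. P (na 0) (ntl na) sa)"
  from MR_subt[OF this, of ?\<sigma>] have "MR m (\<lambda>na sa. P (na 0) (ntl (\<lambda>i. evn I0 na sa (?\<sigma> i))) sa)" by simp
  moreover have "ntl (\<lambda>i. evn I0 na sa (?\<sigma> i)) = ntl (ntl na)" for na sa by (auto simp: ntl_def fun_eq_iff)
  ultimately show ?thesis by simp
qed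

lemma MR_tl: "MR m P \<Longrightarrow> MR m (\<lambda>na sa. P (ntl na) sa)"
proof -
  assume "MR m P"
  from MR_subt[OF this, of "\<lambda>i. NVar (Suc i)"] have "MR m (\<lambda>na sa. P (\<lambda>i. na (Suc i)) sa)" by simp
  moreover have "(\<lambda>i. na (Suc i)) = ntl na" for na by (auto simp: ntl_def)
  ultimately show ?thesis by simp
qed

lemma GN_tl: "GN m f \<Longrightarrow> GN m (\<lambda>na sa. f (ntl na) sa)"
  unfolding GN_def using MR_skip[of m "\<lambda>n na sa. n = f na sa"] by (metis shf_simps)

lemma GS_tl: "GS m f \<Longrightarrow> GS m (\<lambda>na sa. f (ntl na) sa)"
  unfolding GS_def using MR_skip[of m "\<lambda>n na sa. n \<in> f na sa"] by (metis shf_simps)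

lemma GN_rel2: "GN m f \<Longrightarrow> GN m g \<Longrightarrow> MR m R \<Longrightarrow> MR m (\<lambda>na sa. R (g na sa ## f na sa ## na) sa)"
  using GN_rel[of m f "\<lambda>na sa. R (g (ntl na) sa ## na) sa"] GN_rel[OF GN_tl[of m g], of R] by simp

lemma MR_eqI: "GN m f \<Longrightarrow> GN m g \<Longrightarrow> MR m (\<lambda>na sa. f na sa = g na sa)"
  using GN_rel2[of m f g, OF _ _ MR_eq[of "NVar (Suc 0)" "NVar 0"]] by simp

lemma MR_leI: "GN m f \<Longrightarrow> GN m g \<Longrightarrow> MR m (\<lambda>na sa. f na sa \<le> g na sa)"
  using GN_rel2[of m f g, OF _ _ MR_le[of "NVar (Suc 0)" "NVar 0"]] by simp

lemma MR_lessI: "GN m f \<Longrightarrow> GN m g \<Longrightarrow> MR m (\<lambda>na sa. f na sa < g na sa)"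
  using MR_not[OF MR_leI[of m g f]] by (simp add: not_le)

lemma MR_memI: "GN m f \<Longrightarrow> GS m F \<Longrightarrow> MR m (\<lambda>na sa. f na sa \<in> F na sa)"
  using GN_rel[of m f "\<lambda>na sa. na 0 \<in> F (ntl na) sa"] by (simp add: GS_def)

lemma GN_op:
  assumes "GN m f" "GN m g" "op = (+) \<or> op = (*)"
  shows "GN m (\<lambda>na sa. op (f na sa) (g na sa))"
proof -
  obtain t u where t: "pureN t" "\<forall>na sa. fin sa \<longrightarrow> f na sa \<le> evn I0 na sa t" "pureN u" "\<forall>na sa. fin sa \<longrightarrow> g na sa \<le> evn I0 na sa u"
    using assms(1,2) unfolding GN_def by blast
  have "\<exists>v. pureN v \<and> (\<forall>na sa. fin sa \<longrightarrow> op (f na sa) (g na sa) \<le> evn I0 na sa v)"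
    using assms(3)
  proof
    assume "op = (+)"
    then show ?thesis using t by (intro exI[of _ "Plus t u"]) (simp add: add_mono)
  next
    assume "op = (*)"
    then show ?thesis using t by (intro exI[of _ "Times t u"]) (simp add: mult_mono)
  qed
  moreover
  have "MR m (\<lambda>na sa. na (Suc (Suc 0)) = op (na (Suc 0)) (na 0))"
    using assms(3) MR_eq[of "NVar (Suc (Suc 0))" "Plus (NVar (Suc 0)) (NVar 0)" m]
       MR_eq[of "NVar (Suc (Suc 0))" "Times (NVar (Suc 0)) (NVar 0)" m] by auto
  from GN_rel2[OF GN_tl[OF assms(1)] GN_tl[OF assms(2)] this]
  have "MR m (\<lambda>na sa. na 0 = op (f (ntl na) sa) (g (ntl na) sa))" by simp
  ultimately show ?thesis unfolding GN_def by blast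
qed

lemma GN_add: "GN m f \<Longrightarrow> GN m g \<Longrightarrow> GN m (\<lambda>na sa. f na sa + g na sa)"
  using GN_op[of m f g "(+)"] by simp

lemma GN_mult: "GN m f \<Longrightarrow> GN m g \<Longrightarrow> GN m (\<lambda>na sa. f na sa * g na sa)"
  using GN_op[of m f g "(*)"] by simp

text \<open>The rule \<open>MR_all\<close> takes terms as bounds. A class function used as bound is
  majorized by its bounding term, and the range is cut down inside the scope.\<close>

lemma MR_allI:
  assumes "GN m f" "MR m (\<lambda>na sa. Q (na 0) (ntl na) sa)" shows "MR m (\<lambda>na sa. \<forall>n \<le> f na sa. Q n na sa)"
proof -
  obtain t where t: "pureN t" "\<forall>na sa. fin sa \<longrightarrow> f na sa \<le> evn I0 na sa t"
    using assms(1) unfolding GN_def by blast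
  have "MR m (\<lambda>na sa. na 0 \<le> f (ntl na) sa \<longrightarrow> Q (na 0) (ntl na) sa)"
    by (intro MR_imp MR_leI GN_var GN_tl assms)
  from MR_all[OF t(1) this] show ?thesis
  proof (rule MR_cong)
    fix na :: "nat \<Rightarrow> nat" and sa :: "nat \<Rightarrow> nat set" assume "fin sa"
    then have "f na sa \<le> evn I0 na sa t" using t(2) by blast
    then show "(\<forall>n\<le>f na sa. Q n na sa) = (\<forall>n\<le>evn I0 na sa t. (n ## na) 0 \<le> f (ntl (n ## na)) sa \<longrightarrow> Q ((n ## na) 0) (ntl (n ## na)) sa)"
      by auto
  qed
qed

lemma MR_exI:
  assumes "GN m f" "MR m (\<lambda>na sa. Q (na 0) (ntl na) sa)" shows "MR m (\<lambda>na sa. \<exists>n \<le> f na sa. Q n na sa)"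
  using MR_not[OF MR_allI[OF assms(1) MR_not[OF assms(2)]]] by simp

lemma MR_exlI:
  assumes "GN m f" "MR m (\<lambda>na sa. Q (na 0) (ntl na) sa)" shows "MR m (\<lambda>na sa. \<exists>n < f na sa. Q n na sa)"
proof -
  have "MR m (\<lambda>na sa. \<exists>n \<le> f na sa. n < f na sa \<and> Q n na sa)"
    by (intro MR_exI MR_and MR_lessI GN_var GN_tl assms)
  then show ?thesis by (rule MR_cong) (auto intro: less_imp_le)
qed

lemma MR_alllI:
  assumes "GN m f" "MR m (\<lambda>na sa. Q (na 0) (ntl na) sa)" shows "MR m (\<lambda>na sa. \<forall>n < f na sa. Q n na sa)"
  using MR_not[OF MR_exlI[OF assms(1) MR_not[OF assms(2)]]] by simp

text \<open>Counting runs up to a majorizing term, with the true bound made part of the counted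
  condition.\<close>

lemma MR_modI:
  assumes f: "GN m f" and g: "GN m g" and Q: "MR m (\<lambda>na sa. Q (na 0) (ntl na) sa)"
  shows "MR m (\<lambda>na sa. card {n. n < f na sa \<and> Q n na sa} mod m = g na sa)"
proof -
  obtain t where t: "pureN t" "\<forall>na sa. fin sa \<longrightarrow> f na sa \<le> evn I0 na sa t"
    using f unfolding GN_def by blast
  let ?Q = "\<lambda>n na sa. n < f na sa \<and> Q n na sa"
  have "MR m (\<lambda>na sa. ?Q (na 0) (ntl na) sa)"
    by (intro MR_and MR_lessI GN_var GN_tl f Q)
  from MR_mod[OF shf_simps(2)[OF t(1)] _ MR_skip[of m ?Q, OF this], of "NVar 0"]
  have "MR m (\<lambda>na sa. card {n. n < evn I0 (ntl na) sa t \<and> ?Q n (ntl na) sa} mod m = na 0)" by simp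
  from GN_rel[OF g this] show ?thesis
  proof (rule MR_cong)
    fix na :: "nat \<Rightarrow> nat" and sa :: "nat \<Rightarrow> nat set" assume "fin sa"
    then have "f na sa \<le> evn I0 na sa t" using t(2) by blast
    then have "{n. n < f na sa \<and> Q n na sa} = {n. n < evn I0 na sa t \<and> n < f na sa \<and> Q n na sa}" by auto
    then show "(card {n. n < f na sa \<and> Q n na sa} mod m = g na sa) =
      (card {n. n < evn I0 (ntl (g na sa ## na)) sa t \<and> n < f (ntl (g na sa ## na)) sa \<and> Q n (ntl (g na sa ## na)) sa} mod m = (g na sa ## na) 0)"
      by simp
  qed
qed

lemma slen_props:
  assumes "finite A"
  shows "z \<in> A \<Longrightarrow> z < slen A" "slen A = Suc z \<Longrightarrow> z \<in> A"
    "(\<And>z. z \<in> A \<Longrightarrow> z < y) \<Longrightarrow> slen A \<le> y"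
proof -
  have n: "A \<noteq> {} \<Longrightarrow> slen A = Suc (Max A)" by (simp add: slen_def)
  show "z < slen A" if "z \<in> A"
  proof -
    have "A \<noteq> {}" using that by blast
    then show ?thesis using n Max_ge[OF assms that] by simp
  qed
  show "z \<in> A" if "slen A = Suc z"
  proof -
    have "A \<noteq> {}" using that by (auto simp: slen_def)
    then show ?thesis using n that Max_in[OF assms] by simp
  qed
  show "slen A \<le> y" if "\<And>z. z \<in> A \<Longrightarrow> z < y"
  proof (cases "A = {}")
    case False
    then show ?thesis using n that[OF Max_in[OF assms]] by simp
  qed (simp add: slen_def)
qed

lemma slen_iff:
  assumes "finite A" shows "y = slen A \<longleftrightarrow> (\<forall>n\<in>A. n < y) \<and> (y = 0 \<or> (\<exists>z\<le>y. y = z + 1 \<and> z \<in> A))"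
proof
  assume y: "y = slen A"
  have "y = 0 \<or> (\<exists>z\<le>y. y = z + 1 \<and> z \<in> A)"
  proof (cases y)
    case (Suc z)
    then have "z \<in> A" using slen_props(2)[OF assms] y by simp
    then show ?thesis using Suc by auto
  qed simp
  then show "(\<forall>n\<in>A. n < y) \<and> (y = 0 \<or> (\<exists>z\<le>y. y = z + 1 \<and> z \<in> A))" using slen_props(1)[OF assms] y by simp
next
  assume h: "(\<forall>n\<in>A. n < y) \<and> (y = 0 \<or> (\<exists>z\<le>y. y = z + 1 \<and> z \<in> A))"
  then have 1: "slen A \<le> y" using slen_props(3)[OF assms] by simp
  have "y \<le> slen A"
  proof (cases "y = 0")
    case False
    then obtain z where "y = z + 1" "z \<in> A" using h by auto
    then show ?thesis using slen_props(1)[OF assms] by (simp add: Suc_le_eq)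
  qed simp
  then show "y = slen A" using 1 by simp
qed

lemma slen_empty [simp]: "slen {} = 0" by (simp add: slen_def)

lemma GN_slen:
  assumes "GS m F" shows "GN m (\<lambda>na sa. slen (F na sa))"
proof -
  obtain t where t: "pureN t" "\<forall>na sa. fin sa \<longrightarrow> finite (F na sa) \<and> slen (F na sa) \<le> evn I0 na sa t"
    using assms unfolding GS_def by blast
  have "MR m (\<lambda>na sa. (\<forall>n \<le> evn I0 na sa (shf t). n \<in> F (ntl na) sa \<longrightarrow> n < na 0) \<and> (na 0 = 0 \<or> (\<exists>z\<le>na 0. na 0 = z + 1 \<and> z \<in> F (ntl na) sa)))"
  proof (intro MR_and MR_allI MR_or MR_exI MR_imp MR_eqI GN_term shf_simps t)
    show "MR m (\<lambda>na sa. na 0 \<in> F (ntl (ntl na)) sa)"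
      by (rule MR_memI[OF GN_var GS_tl[OF GS_tl[OF assms]]])
    then show "MR m (\<lambda>na sa. na 0 \<in> F (ntl (ntl na)) sa)" .
    show "MR m (\<lambda>na sa. na 0 < ntl na 0)" unfolding ntl_def by (intro MR_lessI GN_var)
    show "GN m (\<lambda>na sa. na 0)" "GN m (\<lambda>na sa. 0)" "GN m (\<lambda>na sa. ntl na 0)" "GN m (\<lambda>na sa. na 0 + 1)" "GN m (\<lambda>na sa. na 0)"
      unfolding ntl_def by (intro GN_var GN_const GN_add)+
  qed
  moreover have "(na 0 = slen (F (ntl na) sa)) \<longleftrightarrow> (\<forall>n \<le> evn I0 na sa (shf t). n \<in> F (ntl na) sa \<longrightarrow> n < na 0) \<and> (na 0 = 0 \<or> (\<exists>z\<le>na 0. na 0 = z + 1 \<and> z \<in> F (ntl na) sa))"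
    if "fin sa" for na sa
  proof -
    have f: "finite (F (ntl na) sa)" "slen (F (ntl na) sa) \<le> evn I0 na sa (shf t)" using t that by auto
    then have "(\<forall>n\<in>F (ntl na) sa. n < na 0) \<longleftrightarrow> (\<forall>n \<le> evn I0 na sa (shf t). n \<in> F (ntl na) sa \<longrightarrow> n < na 0)"
    proof -
      have "n \<le> evn I0 na sa (shf t)" if "n \<in> F (ntl na) sa" for n using slen_props(1)[OF f(1) that] f(2) by simp
      then show ?thesis by blast
    qed
    then show ?thesis using slen_iff[OF f(1)] by simp
  qed
  ultimately have "MR m (\<lambda>na sa. na 0 = slen (F (ntl na) sa))" by (rule MR_cong)
  then show ?thesis unfolding GN_def using t by blast
qed

lemma GS_var: "GS m (\<lambda>na sa. sa X)"
  unfolding GS_def using MR_mem[of "NVar 0" m X] by (auto intro!: exI[of _ "Len (SVar X)"])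

lemma GS_empty: "GS m (\<lambda>na sa. {})"
  unfolding GS_def using MR_const[of m False] by (auto intro!: exI[of _ "Zero"])

lemma GS_compr:
  assumes "GN m f" "MR m (\<lambda>na sa. Q (na 0) (ntl na) sa)" shows "GS m (\<lambda>na sa. {n. n < f na sa \<and> Q n na sa})"
proof -
  obtain t where t: "pureN t" "\<forall>na sa. fin sa \<longrightarrow> f na sa \<le> evn I0 na sa t"
    using assms(1) unfolding GN_def by blast
  have "slen {n. n < f na sa \<and> Q n na sa} \<le> f na sa" for na sa
    by (rule slen_props(3)) auto
  then have "\<forall>na sa. fin sa \<longrightarrow> finite {n. n < f na sa \<and> Q n na sa} \<and> slen {n. n < f na sa \<and> Q n na sa} \<le> evn I0 na sa t"
    using order_trans[OF _ t(2)[rule_format]] by simp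
  moreover have "MR m (\<lambda>na sa. na 0 \<in> {n. n < f (ntl na) sa \<and> Q n (ntl na) sa})"
    unfolding mem_Collect_eq by (intro MR_and MR_lessI GN_var GN_tl assms)
  ultimately show ?thesis unfolding GS_def using t(1) by blast
qed

lemma GS_fin: "GS m F \<Longrightarrow> fin sa \<Longrightarrow> finite (F na sa)"
  unfolding GS_def by blast

lemma GN_evn:
  assumes "\<forall>i. GN m (\<sigma> i)" "\<forall>i. GS m (\<Sigma> i)"
  shows "pureN t \<Longrightarrow> GN m (\<lambda>na sa. evn I0 (\<lambda>i. \<sigma> i na sa) (\<lambda>i. \<Sigma> i na sa) t)"
proof (induction t rule: nterm.induct[where ?P2.0="\<lambda>_. True"])
  case (Len T) then show ?case using assms GN_slen by (cases T) auto
qed (use assms in \<open>auto intro: GN_add GN_mult GN_const\<close>)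

lemma GN_ncons: "\<forall>i. GN m (\<sigma> i) \<Longrightarrow> GN m (\<lambda>na sa. (na 0 ## (\<lambda>j. \<sigma> j (ntl na) sa)) i)"
  by (cases i) (simp_all add: GN_var GN_tl)

text \<open>Closure under composition, for both sorts at once. In the congruence case the
  substituted strings are finite on finite assignments, so an equivalence assumed only for finite
  strings still applies.\<close>

theorem MR_subst:
  "MR m P \<Longrightarrow> \<forall>i. GN m (\<sigma> i) \<Longrightarrow> \<forall>i. GS m (\<Sigma> i) \<Longrightarrow> MR m (\<lambda>na sa. P (\<lambda>i. \<sigma> i na sa) (\<lambda>i. \<Sigma> i na sa))"
proof (induction arbitrary: \<sigma> \<Sigma> rule: MR.induct)
  case (MR_eq s t) then show ?case by (intro MR_eqI GN_evn)
next
  case (MR_le s t) then show ?case by (intro MR_leI GN_evn)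
next
  case (MR_mem s X) then show ?case using MR_memI[OF GN_evn[OF MR_mem(2,3,1)], of "\<Sigma> X"] by simp
next
  case (MR_imp P Q)
  then show ?case by (intro MR.MR_imp) auto
next
  case (MR_all t P)
  let ?s = "\<lambda>i na sa. (na 0 ## (\<lambda>j. \<sigma> j (ntl na) sa)) i"
  have "\<forall>i. GN m (?s i)" using GN_ncons[OF MR_all(4)] by blast
  moreover have "\<forall>i. GS m (\<lambda>na sa. \<Sigma> i (ntl na) sa)" using MR_all(5) GS_tl by blast
  ultimately have "MR m (\<lambda>na sa. P (\<lambda>i. ?s i na sa) (\<lambda>i. \<Sigma> i (ntl na) sa))" by (rule MR_all.IH)
  then show ?case by (rule MR_allI[OF GN_evn[OF MR_all(4,5,1)]])
next
  case (MR_mod t u P)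
  let ?s = "\<lambda>i na sa. (na 0 ## (\<lambda>j. \<sigma> j (ntl na) sa)) i"
  have "\<forall>i. GN m (?s i)" using GN_ncons[OF MR_mod(5)] by blast
  moreover have "\<forall>i. GS m (\<lambda>na sa. \<Sigma> i (ntl na) sa)" using MR_mod(6) GS_tl by blast
  ultimately have "MR m (\<lambda>na sa. P (\<lambda>i. ?s i na sa) (\<lambda>i. \<Sigma> i (ntl na) sa))" by (rule MR_mod.IH)
  then show ?case by (rule MR_modI[OF GN_evn[OF MR_mod(5,6,1)] GN_evn[OF MR_mod(5,6,2)]])
next
  case (MR_cong P Q)
  have "fin (\<lambda>i. \<Sigma> i na sa)" if "fin sa" for na sa using GS_fin MR_cong.prems(2) that by blast
  then show ?case using MR_cong.hyps(2) by (intro MR.MR_cong[OF MR_cong.IH[OF MR_cong.prems]]) simp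
qed

subsection \<open>Eliminating the function symbols of a reduction\<close>

definition lenv :: "nat \<Rightarrow> (nat \<Rightarrow> 'a) \<Rightarrow> 'a list" where "lenv k na = map na [0..<k]"

lemma lenv_simps [simp]: "length (lenv k na) = k" "i < k \<Longrightarrow> lenv k na ! i = na i" "lenv 0 na = []"
  "lenv (Suc k) na = lenv k na @ [na k]" "set (lenv k sa) = sa ` {..<k}" 
  by (auto simp: lenv_def atLeast0LessThan)

lemma nenv_lenv: "i < k \<Longrightarrow> nenv (lenv k na) i = na i" "i < k \<Longrightarrow> senv (lenv k sa) i = sa i"
  by (auto simp: nenv_def senv_def)

lemma lenv_nenv: "length xs = k \<Longrightarrow> lenv k (nenv xs) = xs" "length Xs = l \<Longrightarrow> lenv l (senv Xs) = Xs"
  by (auto intro!: nth_equalityI simp: nenv_def senv_def)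

lemma fin_senv: "\<forall>X\<in>set Xs. finite X \<Longrightarrow> fin (senv Xs)"
  by (auto simp: senv_def)

definition goodF :: "nat \<Rightarrow> sfun \<Rightarrow> bool" where
  "goodF m f \<longleftrightarrow> (case f of (k, l, F) \<Rightarrow> pbS k l F \<and> MR m (\<lambda>na sa. na 0 \<in> F (lenv k (ntl na)) (lenv l sa)))"

lemma poly_pure: "polyterm t \<Longrightarrow> pureN t \<and> fvSn t = {}"
  by (induction t rule: nterm.induct[where ?P2.0="\<lambda>_. True"]) auto

lemma poly_sa: "polyterm t \<Longrightarrow> evn I0 na sa t = evn I0 na sa' t"
  using poly_pure[of t] by (intro ev_coinc) auto

lemma GN_bound: "GN m f \<Longrightarrow> \<exists>b. pureN b \<and> (\<forall>na sa. fin sa \<longrightarrow> f na sa \<le> evn I0 na sa b)"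
  unfolding GN_def by (rule conjunct1)

lemma GS_bound:
  assumes "GS m F" shows "\<exists>b. pureN b \<and> (\<forall>na sa. fin sa \<longrightarrow> slen (F na sa) \<le> evn I0 na sa b)"
proof -
  obtain t where "pureN t" "\<forall>na sa. fin sa \<longrightarrow> finite (F na sa) \<and> slen (F na sa) \<le> evn I0 na sa t"
    using assms unfolding GS_def by (elim conjE exE)
  then show ?thesis by (intro exI[of _ t]) simp
qed

lemma GS_app:
  assumes F: "goodF m (k, l, F)" and \<sigma>: "\<forall>i. GN m (\<sigma> i)" and \<Sigma>: "\<forall>i. GS m (\<Sigma> i)"
  shows "GS m (\<lambda>na sa. F (lenv k (\<lambda>i. \<sigma> i na sa)) (lenv l (\<lambda>i. \<Sigma> i na sa)))"
proof -
  obtain t where t: "polyterm t" "\<And>xs Xs. length xs = k \<Longrightarrow> length Xs = l \<Longrightarrow> \<forall>X\<in>set Xs. finite X \<Longrightarrow>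
        finite (F xs Xs) \<and> slen (F xs Xs) \<le> evn I0 (nenv (xs @ map slen Xs)) (senv []) t"
    using F unfolding goodF_def pbS_def prod.case by blast
  have "\<forall>i. \<exists>b. pureN b \<and> (\<forall>na sa. fin sa \<longrightarrow> \<sigma> i na sa \<le> evn I0 na sa b)" by (rule allI, rule GN_bound, rule \<sigma>[rule_format])
  from choice[OF this] obtain b where "\<forall>i. pureN (b i) \<and> (\<forall>na sa. fin sa \<longrightarrow> \<sigma> i na sa \<le> evn I0 na sa (b i))" by (rule exE)
  then have b: "\<And>i. pureN (b i)" "\<And>i na sa. fin sa \<Longrightarrow> \<sigma> i na sa \<le> evn I0 na sa (b i)" by simp_all
  have "\<forall>i. \<exists>b. pureN b \<and> (\<forall>na sa. fin sa \<longrightarrow> slen (\<Sigma> i na sa) \<le> evn I0 na sa b)" by (rule allI, rule GS_bound, rule \<Sigma>[rule_format])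
  from choice[OF this] obtain c where "\<forall>i. pureN (c i) \<and> (\<forall>na sa. fin sa \<longrightarrow> slen (\<Sigma> i na sa) \<le> evn I0 na sa (c i))" by (rule exE)
  then have c: "\<And>i. pureN (c i)" "\<And>i na sa. fin sa \<Longrightarrow> slen (\<Sigma> i na sa) \<le> evn I0 na sa (c i)" by simp_all
  \<comment> \<open>In a polynomial bound the variables from \<open>k\<close> on stand for the
    lengths of the string arguments. By monotonicity, number arguments and lengths may be replaced
    by their own bounding terms.\<close>
  let ?\<sigma> = "\<lambda>i. if i < k then b i else c (i - k)"
  have "finite (F (lenv k (\<lambda>i. \<sigma> i na sa)) (lenv l (\<lambda>i. \<Sigma> i na sa))) \<and>
     slen (F (lenv k (\<lambda>i. \<sigma> i na sa)) (lenv l (\<lambda>i. \<Sigma> i na sa))) \<le> evn I0 na sa (subn ?\<sigma> t)" if "fin sa" for na sa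
  proof -
    let ?xs = "lenv k (\<lambda>i. \<sigma> i na sa)" and ?Xs = "lenv l (\<lambda>i. \<Sigma> i na sa)"
    have "finite (\<Sigma> i na sa)" for i using GS_fin \<Sigma> that by blast
    then have f: "\<forall>X\<in>set ?Xs. finite X" by simp
    have "evn I0 (nenv (?xs @ map slen ?Xs)) (senv []) t \<le> evn I0 (\<lambda>i. evn I0 na sa (?\<sigma> i)) (senv []) t"
    proof (rule evn_mono)
      show "\<forall>i. nenv (?xs @ map slen ?Xs) i \<le> evn I0 na sa (?\<sigma> i)"
      proof
        fix i show "nenv (?xs @ map slen ?Xs) i \<le> evn I0 na sa (?\<sigma> i)"
          using b(2)[OF that, of i na] c(2)[OF that, of "i - k" na] by (simp add: nenv_def nth_append)
      qed
    qed (use poly_pure t(1) in blast)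
    also have "\<dots> = evn I0 na sa (subn ?\<sigma> t)" using poly_sa[OF t(1)] by simp
    finally show ?thesis using t(2)[OF lenv_simps(1) lenv_simps(1) f] order_trans by blast
  qed
  moreover have "pureN (subn ?\<sigma> t)" by (rule pure_sub(1)) (use poly_pure[OF t(1)] b(1) c(1) in simp_all)
  moreover have "MR m (\<lambda>na sa. na 0 \<in> F (lenv k (\<lambda>i. \<sigma> i (ntl na) sa)) (lenv l (\<lambda>i. \<Sigma> i (ntl na) sa)))"
  proof -
    let ?s = "\<lambda>i na sa. (na 0 ## (\<lambda>j. \<sigma> j (ntl na) sa)) i"
    have "\<forall>i. GN m (?s i)" using GN_ncons[OF \<sigma>] by blast
    moreover have "\<forall>i. GS m (\<lambda>na sa. \<Sigma> i (ntl na) sa)" using \<Sigma> GS_tl by blast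
    moreover have "MR m (\<lambda>na sa. na 0 \<in> F (lenv k (ntl na)) (lenv l sa))" using F by (simp add: goodF_def)
    ultimately have "MR m (\<lambda>na sa. ?s 0 na sa \<in> F (lenv k (ntl (\<lambda>i. ?s i na sa))) (lenv l (\<lambda>i. \<Sigma> i (ntl na) sa)))"
      using MR_subst[of m "\<lambda>na sa. na 0 \<in> F (lenv k (ntl na)) (lenv l sa)" ?s "\<lambda>i na sa. \<Sigma> i (ntl na) sa"] by blast
    then show ?thesis by simp
  qed
  ultimately show ?thesis unfolding GS_def by blast
qed

lemma lenv_cong: "(\<And>i. i < k \<Longrightarrow> f i = g i) \<Longrightarrow> lenv k f = lenv k g"
  by (auto simp: lenv_def)

text \<open>A term denotes a composition of class functions: \<open>mod_fn\<close> enters through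
  the counting quantifier, a function of the chain through \<open>GS_app\<close>.\<close>

lemma GN_GS_terms:
  assumes "\<forall>f\<in>set Fs. goodF m f"
  shows "wfn (sym_arities Fs) t \<Longrightarrow> GN m (\<lambda>na sa. evn (Imod m Fs) na sa t)"
    "wfs (sym_arities Fs) T \<Longrightarrow> GS m (\<lambda>na sa. evs (Imod m Fs) na sa T)"
proof (induction t and T rule: nterm.induct sterm.induct)
  case (NFun f ts Ss)
  then obtain t S where ts: "ts = [t]" "Ss = [S]" "f = 0" by (auto simp: length_Suc_conv)
  have t: "GN m (\<lambda>na sa. evn (Imod m Fs) na sa t)" and S: "GS m (\<lambda>na sa. evs (Imod m Fs) na sa S)"
    using NFun ts by auto
  let ?c = "\<lambda>na sa. card {n. n < evn (Imod m Fs) na sa t \<and> n \<in> evs (Imod m Fs) na sa S}"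
  have e: "evn (Imod m Fs) na sa (NFun f ts Ss) = ?c na sa mod m" for na sa
    by (simp add: ts Imod_def mod_fn_def conj_commute)
  obtain b where b: "pureN b" "\<And>na sa. fin sa \<Longrightarrow> evn (Imod m Fs) na sa t \<le> evn I0 na sa b"
    using GN_bound[OF t] by blast
  \<comment> \<open>Bounding by the number of candidates, instead of bounding the remainder by
    \<open>m\<close>, also covers \<open>m\<close> = 0.\<close>
  have "?c na sa mod m \<le> evn (Imod m Fs) na sa t" for na sa
  proof -
    have "?c na sa \<le> card {..<evn (Imod m Fs) na sa t}" by (rule card_mono) auto
    then have "?c na sa \<le> evn (Imod m Fs) na sa t" by simp
    then show ?thesis by (rule order_trans[OF mod_less_eq_dividend])
  qed
  then have bd: "\<forall>na sa. fin sa \<longrightarrow> ?c na sa mod m \<le> evn I0 na sa b" using order_trans[OF _ b(2)] by simp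
  have "MR m (\<lambda>na sa. card {n. n < evn (Imod m Fs) (ntl na) sa t \<and> n \<in> evs (Imod m Fs) (ntl na) sa S} mod m = na 0)"
    by (rule MR_modI[OF GN_tl[OF t] GN_var MR_memI[OF GN_var GS_tl[OF GS_tl[OF S]]]])
  then have "MR m (\<lambda>na sa. na 0 = ?c (ntl na) sa mod m)" by (rule MR_cong) (rule eq_commute)
  then show ?case unfolding GN_def e using b(1) bd by blast
next
  case (SFun i ts Ss)
  obtain k l F where F: "Fs ! i = (k, l, F)" using prod_cases3 by blast
  have i: "i < length Fs" "length ts = k" "length Ss = l" using SFun.prems F by (auto simp: sym_arities_def)
  have g: "goodF m (k, l, F)" using assms nth_mem[OF i(1)] F by simp
  let ?s = "\<lambda>j. if j < k then (\<lambda>na sa. evn (Imod m Fs) na sa (ts ! j)) else (\<lambda>na sa. 0)"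
  let ?S = "\<lambda>j. if j < l then (\<lambda>na sa. evs (Imod m Fs) na sa (Ss ! j)) else (\<lambda>na sa. {})"
  have w: "\<forall>t\<in>set ts. wfn (sym_arities Fs) t" "\<forall>T\<in>set Ss. wfs (sym_arities Fs) T"
    using SFun.prems by (simp_all add: list_all_iff)
  have "GN m (?s j)" for j
  proof (cases "j < k")
    case True
    then have "ts ! j \<in> set ts" using i by simp
    then show ?thesis using SFun.IH(1) w(1) True by simp
  qed (simp add: GN_const)
  then have "\<forall>j. GN m (?s j)" by blast
  moreover have "GS m (?S j)" for j
  proof (cases "j < l")
    case True
    then have "Ss ! j \<in> set Ss" using i by simp
    then show ?thesis using SFun.IH(2) w(2) True by simp
  qed (simp add: GS_empty)
  then have "\<forall>j. GS m (?S j)" by blast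
  ultimately have "GS m (\<lambda>na sa. F (lenv k (\<lambda>j. ?s j na sa)) (lenv l (\<lambda>j. ?S j na sa)))" by (rule GS_app[OF g])
  moreover have "lenv k (\<lambda>j. ?s j na sa) = map (evn (Imod m Fs) na sa) ts" "lenv l (\<lambda>j. ?S j na sa) = map (evs (Imod m Fs) na sa) Ss" for na sa
    using i by (auto intro!: nth_equalityI)
  ultimately show ?case using F by (simp add: Imod_def)
next
  case (Plus s t) then show ?case by (simp add: GN_add)
next
  case (Times s t) then show ?case by (simp add: GN_mult)
next
  case (Len T) then show ?case by (simp add: GN_slen)
qed (simp_all add: GN_var GN_const GS_var)

lemma MR_evf:
  assumes "\<forall>f\<in>set Fs. goodF m f"
  shows "sigB0 \<phi> \<Longrightarrow> wff (sym_arities Fs) \<phi> \<Longrightarrow> MR m (\<lambda>na sa. evf (Imod m Fs) na sa \<phi>)"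
proof (induction rule: sigB0.induct)
  case 1 then show ?case by (simp add: MR_const)
next
  case (2 s t) then show ?case by (auto intro!: MR_eqI GN_GS_terms assms)
next
  case (3 s t) then show ?case by (auto intro!: MR_leI GN_GS_terms assms)
next
  case (4 s t) then show ?case by (auto intro!: MR_memI GN_GS_terms assms)
next
  case (5 S T)
  let ?S = "\<lambda>na sa. evs (Imod m Fs) na sa S" and ?T = "\<lambda>na sa. evs (Imod m Fs) na sa T"
  have g: "GS m ?S" "GS m ?T" using 5 GN_GS_terms(2)[OF assms] by auto
  \<comment> \<open>Equality of strings is tested extensionally up to the sum of the lengths, beyond
    which neither string has elements.\<close>
  have "MR m (\<lambda>na sa. \<forall>n \<le> slen (?S na sa) + slen (?T na sa). (n \<in> ?S na sa) = (n \<in> ?T na sa))"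
    by (intro MR_allI GN_add GN_slen g MR_iff MR_memI[OF GN_var GS_tl] g)
  then show ?case
  proof (rule MR_cong)
    fix na :: "nat \<Rightarrow> nat" and sa :: "nat \<Rightarrow> nat set" assume "fin sa"
    then have f: "finite (?S na sa)" "finite (?T na sa)" using GS_fin[OF g(1)] GS_fin[OF g(2)] by simp_all
    have "n \<le> slen (?S na sa) + slen (?T na sa)" if "n \<in> ?S na sa \<or> n \<in> ?T na sa" for n
      using that slen_props(1)[OF f(1), of n] slen_props(1)[OF f(2), of n] by linarith
    then show "evf (Imod m Fs) na sa (Eq2 S T) = (\<forall>n \<le> slen (?S na sa) + slen (?T na sa). (n \<in> ?S na sa) = (n \<in> ?T na sa))"
      unfolding evf.simps set_eq_iff by blast
  qed
next
  case (6 a b) then show ?case by (auto intro: MR_imp)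
next
  case (7 \<phi> x t)
  \<comment> \<open>The bound variable, named \<open>x\<close> in the formula, becomes index 0, and
    the other variables move up by one.\<close>
  let ?\<sigma> = "\<lambda>i. if i = x then NVar 0 else NVar (Suc i)"
  have "MR m (\<lambda>na sa. evf (Imod m Fs) (\<lambda>i. evn I0 na sa (?\<sigma> i)) sa \<phi>)"
    by (rule MR_subt) (use 7 in auto)
  moreover have "(\<lambda>i. evn I0 na sa (?\<sigma> i)) = (ntl na)(x := na 0)" for na sa by (auto simp: ntl_def)
  ultimately have "MR m (\<lambda>na sa. evf (Imod m Fs) ((ntl na)(x := na 0)) sa \<phi>)" by simp
  then have "MR m (\<lambda>na sa. \<forall>n \<le> evn (Imod m Fs) na sa t. evf (Imod m Fs) (na(x := n)) sa \<phi>)"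
    by (intro MR_allI GN_GS_terms assms) (use 7 in auto)
  then show ?case using 7(2) by simp
qed

lemma ev_I: "pureN t \<Longrightarrow> evn I na sa t = evn I' na sa t" "pureS T \<Longrightarrow> evs I na sa T = evs I' na sa T"
  by (induction t and T rule: nterm.induct sterm.induct) auto

lemma wf_pure: "pureN t \<Longrightarrow> wfn ar t" "pureS T \<Longrightarrow> wfs ar T"
  by (induction t and T rule: nterm.induct sterm.induct) auto

lemma evf_I: "pureF \<phi> \<Longrightarrow> evf I na sa \<phi> = evf I' na sa \<phi>"
  by (induction \<phi> arbitrary: na sa) (auto simp: ev_I[of _ I _ _ I'])

lemma wff_pure: "pureF \<phi> \<Longrightarrow> wff ar \<phi>"
  by (induction \<phi>) (auto simp: wf_pure)

lemma MR_form: "sigB0 \<phi> \<Longrightarrow> pureF \<phi> \<Longrightarrow> MR m (\<lambda>na sa. evf I0 na sa \<phi>)"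
  using MR_evf[of "[]" m \<phi>] by (simp add: wff_pure evf_I[of \<phi> I0 _ _ "Imod m []"])

lemma represents_MR:
  assumes "\<forall>f\<in>set Fs. goodF m f" "represents m Fs k l R"
  shows "MR m (\<lambda>na sa. R (lenv k na) (lenv l sa))"
proof -
  obtain \<phi> where ph: "sigB0 \<phi>" "wff (sym_arities Fs) \<phi>" "fvN \<phi> \<subseteq> {..<k}" "fvS \<phi> \<subseteq> {..<l}"
    "\<And>xs Xs. length xs = k \<Longrightarrow> length Xs = l \<Longrightarrow> \<forall>X\<in>set Xs. finite X \<Longrightarrow>
        R xs Xs \<longleftrightarrow> evf (Imod m Fs) (nenv xs) (senv Xs) \<phi>" using assms(2) unfolding represents_def by (elim exE conjE) simp
  show ?thesis
  proof (rule MR_cong[OF MR_evf[OF assms(1) ph(1,2)]])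
    fix na :: "nat \<Rightarrow> nat" and sa :: "nat \<Rightarrow> nat set" assume "fin sa"
    then have "R (lenv k na) (lenv l sa) = evf (Imod m Fs) (nenv (lenv k na)) (senv (lenv l sa)) \<phi>"
      by (intro ph(5)) auto
    also have "\<dots> = evf (Imod m Fs) na sa \<phi>"
    proof (rule evf_coinc)
      show "\<forall>x\<in>fvN \<phi>. nenv (lenv k na) x = na x"
        by (intro ballI nenv_lenv(1) lessThan_iff[THEN iffD1] subsetD[OF ph(3)])
      show "\<forall>x\<in>fvS \<phi>. senv (lenv l sa) x = sa x"
        by (intro ballI nenv_lenv(2) lessThan_iff[THEN iffD1] subsetD[OF ph(4)])
    qed
    finally show "R (lenv k na) (lenv l sa) = evf (Imod m Fs) na sa \<phi>" .
  qed
qed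

text \<open>An entry of a chain is represented over earlier entries only, which allows strong
  induction on its position.\<close>

lemma chain_good: "chain_ok m Fs \<Longrightarrow> f \<in> set Fs \<Longrightarrow> goodF m f"
proof -
  assume c: "chain_ok m Fs"
  have "i < length Fs \<Longrightarrow> goodF m (Fs ! i)" for i
  proof (induction i rule: less_induct)
    case (less i)
    obtain k l F where F: "Fs ! i = (k, l, F)" using prod_cases3 by blast
    have r: "pbS k l F" "represents m (take i Fs) (Suc k) l (\<lambda>ys Xs. last ys \<in> F (butlast ys) Xs)"
      using c[unfolded chain_ok_def, rule_format, OF less.prems] F by simp_all
    have "\<forall>f\<in>set (take i Fs). goodF m f"
    proof
      fix f assume "f \<in> set (take i Fs)"
      then obtain j where "j < i" "j < length Fs" "f = Fs ! j" by (auto simp: in_set_conv_nth)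
      then show "goodF m f" using less.IH by simp
    qed
    from represents_MR[OF this r(2)] have "MR m (\<lambda>na sa. na k \<in> F (lenv k na) (lenv l sa))" by simp
    \<comment> \<open>In a representing formula the tested element is the last argument, number
      \<open>k\<close>; in the class it has index 0.\<close>
    from MR_subt[OF this, of "\<lambda>i. if i = k then NVar 0 else NVar (Suc i)"]
    have "MR m (\<lambda>na sa. na 0 \<in> F (lenv k (\<lambda>i. evn I0 na sa (if i = k then NVar 0 else NVar (Suc i)))) (lenv l sa))" by simp
    moreover have "lenv k (\<lambda>i. evn I0 na sa (if i = k then NVar 0 else NVar (Suc i))) = lenv k (ntl na)" for na sa
      by (rule lenv_cong) (auto simp: ntl_def)
    ultimately show ?case using r(1) F by (simp add: goodF_def)
  qed
  then show "f \<in> set Fs \<Longrightarrow> goodF m f" by (auto simp: in_set_conv_nth)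
qed

lemma AC0m_MR: "AC0m m k l R \<Longrightarrow> MR m (\<lambda>na sa. R (lenv k na) (lenv l sa))"
  unfolding AC0m_def by (elim exE conjE, rule represents_MR) (simp_all add: chain_good)

subsection \<open>Introducing function symbols for the counted sets\<close>

text \<open>Representing formulas may mention strings below \<open>l\<close> only. Lengths of the
  others are replaced by 0, which amounts to reading these strings as empty, as \<open>scut\<close>
  does.\<close>

primrec trl :: "nat \<Rightarrow> nterm \<Rightarrow> nterm" where
  "trl l (NVar x) = NVar x"
| "trl l Zero = Zero"
| "trl l One = One"
| "trl l (Plus s t) = Plus (trl l s) (trl l t)"
| "trl l (Times s t) = Times (trl l s) (trl l t)"
| "trl l (Len T) = (case T of SVar X \<Rightarrow> if X < l then Len (SVar X) else Zero | _ \<Rightarrow> Zero)"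
| "trl l (NFun f ts Ss) = Zero"

definition scut :: "nat \<Rightarrow> (nat \<Rightarrow> nat set) \<Rightarrow> nat \<Rightarrow> nat set" where "scut l sa i = (if i < l then sa i else {})"

lemma trl_simps: "pureN t \<Longrightarrow> evn I na sa (trl l t) = evn I na (scut l sa) t" "pureN (trl l t)" "fvSn (trl l t) \<subseteq> {..<l}"
  "fvNn (trl l t) \<subseteq> fvNn t" "wfn ar (trl l t)"
proof -
  show "pureN t \<Longrightarrow> evn I na sa (trl l t) = evn I na (scut l sa) t"
    by (induction t rule: nterm.induct[where ?P2.0="\<lambda>_. True"]) (auto simp: scut_def split: sterm.splits)
  show "pureN (trl l t)"
    by (induction t rule: nterm.induct[where ?P2.0="\<lambda>_. True"]) (auto split: sterm.splits)
  then show "wfn ar (trl l t)" by (rule wf_pure)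
  show "fvSn (trl l t) \<subseteq> {..<l}"
    by (induction t rule: nterm.induct[where ?P2.0="\<lambda>_. True"]) (auto split: sterm.splits)
  show "fvNn (trl l t) \<subseteq> fvNn t"
    by (induction t rule: nterm.induct[where ?P2.0="\<lambda>_. True"]) (auto split: sterm.splits)
qed

text \<open>Turns a bound in lengths of strings into a polynomial: the length of string
  \<open>X\<close> becomes the number variable \<open>k + X\<close>, its place in the list of number
  arguments followed by lengths.\<close>

primrec ptm :: "nat \<Rightarrow> nterm \<Rightarrow> nterm" where
  "ptm k (NVar x) = NVar x"
| "ptm k Zero = Zero"
| "ptm k One = One"
| "ptm k (Plus s t) = Plus (ptm k s) (ptm k t)"
| "ptm k (Times s t) = Times (ptm k s) (ptm k t)"
| "ptm k (Len T) = (case T of SVar X \<Rightarrow> NVar (k + X) | _ \<Rightarrow> Zero)"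
| "ptm k (NFun f ts Ss) = Zero"

lemma ptm_simps:
  "polyterm (ptm k t)" "pureN t \<Longrightarrow> fvNn t \<subseteq> {..<k} \<Longrightarrow> fvSn t \<subseteq> {..<l} \<Longrightarrow> length xs = k \<Longrightarrow> length Xs = l \<Longrightarrow>
    evn I0 (nenv (xs @ map slen Xs)) sa (ptm k t) = evn I0 (nenv xs) (senv Xs) t"
proof -
  show "polyterm (ptm k t)"
    by (induction t rule: nterm.induct[where ?P2.0="\<lambda>_. True"]) (auto split: sterm.splits)
  show "pureN t \<Longrightarrow> fvNn t \<subseteq> {..<k} \<Longrightarrow> fvSn t \<subseteq> {..<l} \<Longrightarrow> length xs = k \<Longrightarrow> length Xs = l \<Longrightarrow>
    evn I0 (nenv (xs @ map slen Xs)) sa (ptm k t) = evn I0 (nenv xs) (senv Xs) t"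
    by (induction t rule: nterm.induct[where ?P2.0="\<lambda>_. True"]) (auto simp: nenv_def senv_def nth_append split: sterm.splits)
qed

lemma sym_arities_append: "sym_arities (As @ Bs) = sym_arities As @ sym_arities Bs" "length (sym_arities As) = length As"
  by (auto simp: sym_arities_def)

lemma wf_append:
  "wfn as t \<Longrightarrow> wfn (as @ bs) t" "wfs as T \<Longrightarrow> wfs (as @ bs) T"
  by (induction t and T rule: nterm.induct sterm.induct) (auto simp: nth_append list_all_iff)

lemma wff_append: "wff as \<phi> \<Longrightarrow> wff (as @ bs) \<phi>"
  by (induction \<phi>) (auto simp: wf_append)

lemma ev_append:
  "wfn (sym_arities As) t \<Longrightarrow> evn (Imod m (As @ Bs)) na sa t = evn (Imod m As) na sa t"
  "wfs (sym_arities As) T \<Longrightarrow> evs (Imod m (As @ Bs)) na sa T = evs (Imod m As) na sa T"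
proof (induction t and T rule: nterm.induct sterm.induct)
  case (NFun f ts Ss)
  have "map (evn (Imod m (As @ Bs)) na sa) ts = map (evn (Imod m As) na sa) ts" "map (evs (Imod m (As @ Bs)) na sa) Ss = map (evs (Imod m As) na sa) Ss"
    using NFun by (auto simp: list_all_iff)
  then show ?case by (simp only: evn.simps) (simp add: Imod_def)
next
  case (SFun f ts Ss)
  have "map (evn (Imod m (As @ Bs)) na sa) ts = map (evn (Imod m As) na sa) ts" "map (evs (Imod m (As @ Bs)) na sa) Ss = map (evs (Imod m As) na sa) Ss"
    using SFun by (auto simp: list_all_iff)
  then show ?case using SFun.prems by (simp only: evs.simps) (simp add: Imod_def nth_append sym_arities_append)
qed auto

lemma evf_append: "wff (sym_arities As) \<phi> \<Longrightarrow> evf (Imod m (As @ Bs)) na sa \<phi> = evf (Imod m As) na sa \<phi>"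
  by (induction \<phi> arbitrary: na sa) (auto simp: ev_append)

lemma chain_snoc:
  assumes "chain_ok m Fs" "pbS k l F" "represents m Fs (Suc k) l (\<lambda>ys Xs. last ys \<in> F (butlast ys) Xs)"
  shows "chain_ok m (Fs @ [(k, l, F)])"
  using assms unfolding chain_ok_def by (auto simp: nth_append less_Suc_eq)

text \<open>Each counting quantifier contributes one new string function, whose value is the set to
  be counted, and becomes \<open>mod_fn\<close> applied to it. The chain is an input to be extended,
  so that the formulas of two subformulas can live over one common chain; a formula keeps its
  meaning when the chain grows.\<close>

theorem MR_chain:
  "MR m P \<Longrightarrow> chain_ok m Fs \<Longrightarrow> \<exists>Gs \<phi>. chain_ok m (Fs @ Gs) \<and> sigB0 \<phi> \<and> wff (sym_arities (Fs @ Gs)) \<phi> \<and> fvS \<phi> \<subseteq> {..<l} \<and>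
     (\<forall>na sa. fin sa \<longrightarrow> evf (Imod m (Fs @ Gs)) na sa \<phi> = P na (scut l sa))"
proof (induction arbitrary: Fs rule: MR.induct)
  case (MR_eq s t)
  then show ?case
    by (intro exI[of _ "[]"] exI[of _ "Eq1 (trl l s) (trl l t)"]) (auto simp: trl_simps ev_I[of _ "Imod m Fs" _ _ I0] dest: subsetD[OF trl_simps(3)])
next
  case (MR_le s t)
  then show ?case
    by (intro exI[of _ "[]"] exI[of _ "Le (trl l s) (trl l t)"]) (auto simp: trl_simps ev_I[of _ "Imod m Fs" _ _ I0] dest: subsetD[OF trl_simps(3)])
next
  case (MR_mem s X)
  then show ?case
    by (intro exI[of _ "[]"] exI[of _ "if X < l then Mem (trl l s) (SVar X) else Bot"])
      (auto simp: trl_simps ev_I[of _ "Imod m Fs" _ _ I0] scut_def[of l _ X] dest: subsetD[OF trl_simps(3)])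
next
  case (MR_imp P Q)
  obtain Gs \<phi> where 1: "chain_ok m (Fs @ Gs)" "sigB0 \<phi>" "wff (sym_arities (Fs @ Gs)) \<phi>" "fvS \<phi> \<subseteq> {..<l}"
     "\<forall>na sa. fin sa \<longrightarrow> evf (Imod m (Fs @ Gs)) na sa \<phi> = P na (scut l sa)" using MR_imp.IH(1)[OF MR_imp.prems] by blast
  obtain Hs \<psi> where 2: "chain_ok m ((Fs @ Gs) @ Hs)" "sigB0 \<psi>" "wff (sym_arities ((Fs @ Gs) @ Hs)) \<psi>" "fvS \<psi> \<subseteq> {..<l}"
     "\<forall>na sa. fin sa \<longrightarrow> evf (Imod m ((Fs @ Gs) @ Hs)) na sa \<psi> = Q na (scut l sa)" using MR_imp.IH(2)[OF 1(1)] by blast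
  have "wff (sym_arities ((Fs @ Gs) @ Hs)) \<phi>" using 1(3) wff_append by (metis sym_arities_append(1))
  then show ?case using 1 2 evf_append[OF 1(3), of m Hs]
    by (intro exI[of _ "Gs @ Hs"] exI[of _ "Imp \<phi> \<psi>"]) auto
next
  case (MR_all t P)
  obtain Gs \<phi> where 1: "chain_ok m (Fs @ Gs)" "sigB0 \<phi>" "wff (sym_arities (Fs @ Gs)) \<phi>" "fvS \<phi> \<subseteq> {..<l}"
     "\<forall>na sa. fin sa \<longrightarrow> evf (Imod m (Fs @ Gs)) na sa \<phi> = P na (scut l sa)" using MR_all.IH[OF MR_all.prems] by blast
  obtain x where xb: "\<forall>i\<in>fvNn t \<union> fvN \<phi>. i < x"
    using finite_nat_set_iff_bounded[of "fvNn t \<union> fvN \<phi>"] by auto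
  then have x: "x \<notin> fvNn t" by auto
  have xs: "j \<noteq> x" if "Suc j \<in> fvN \<phi>" for j
  proof -
    have "Suc j < x" using xb that by simp
    then show ?thesis by simp
  qed
  \<comment> \<open>Lying above all indices in use, \<open>x\<close> can name the quantified index 0
    while the other indices move down to their outer values.\<close>
  let ?\<sigma> = "\<lambda>i. case i of 0 \<Rightarrow> NVar x | Suc j \<Rightarrow> NVar j"
  obtain \<phi>' where s: "is_subst \<phi> ?\<sigma> \<phi>'" using subst_ex[OF 1(2)] by blast
  let ?\<psi> = "AllLe x (trl l t) \<phi>'"
  have xt: "x \<notin> fvNn (trl l t)" using x trl_simps(4) by blast
  have "evf (Imod m (Fs @ Gs)) (na(x:=n)) sa \<phi>' = P (n ## na) (scut l sa)" if f: "fin sa" for n na sa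
  proof -
    have "evf (Imod m (Fs @ Gs)) (na(x:=n)) sa \<phi>' = evf (Imod m (Fs @ Gs)) (\<lambda>i. evn (Imod m (Fs @ Gs)) (na(x:=n)) sa (?\<sigma> i)) sa \<phi>"
      using s unfolding is_subst_def by blast
    also have "\<dots> = evf (Imod m (Fs @ Gs)) (n ## na) sa \<phi>"
    proof (rule evf_coinc)
      show "\<forall>i\<in>fvN \<phi>. evn (Imod m (Fs @ Gs)) (na(x:=n)) sa (?\<sigma> i) = (n ## na) i"
      proof
        fix i assume "i \<in> fvN \<phi>"
        then show "evn (Imod m (Fs @ Gs)) (na(x:=n)) sa (?\<sigma> i) = (n ## na) i" using xs by (cases i) auto
      qed
    qed simp
    finally show ?thesis using 1(5) f by simp
  qed
  then have "\<forall>na sa. fin sa \<longrightarrow> evf (Imod m (Fs @ Gs)) na sa ?\<psi> = (\<forall>n\<le>evn I0 na (scut l sa) t. P (n ## na) (scut l sa))"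
    using xt MR_all by (simp add: trl_simps ev_I[of _ "Imod m (Fs @ Gs)" _ _ I0])
  moreover have "sigB0 ?\<psi>" "wff (sym_arities (Fs @ Gs)) ?\<psi>" using s xt 1 trl_simps unfolding is_subst_def by (auto split: nat.splits)
  moreover have "fvS \<phi>' \<subseteq> fvS \<phi> \<union> (\<Union>i\<in>fvN \<phi>. fvSn (?\<sigma> i))" using s unfolding is_subst_def by blast
  then have "fvS \<phi>' \<subseteq> {..<l}" by (rule order_trans) (intro Un_least UN_least 1(4), simp split: nat.split)
  then have "fvS ?\<psi> \<subseteq> {..<l}" using trl_simps(3)[of l t] by simp
  ultimately show ?case using 1(1) by (intro exI[of _ Gs] exI[of _ ?\<psi>]) auto
next
  case (MR_mod t u P)
  obtain Gs \<phi> where 1: "chain_ok m (Fs @ Gs)" "sigB0 \<phi>" "wff (sym_arities (Fs @ Gs)) \<phi>" "fvS \<phi> \<subseteq> {..<l}"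
     "\<forall>na sa. fin sa \<longrightarrow> evf (Imod m (Fs @ Gs)) na sa \<phi> = P na (scut l sa)" using MR_mod.IH[OF MR_mod.prems] by blast
  let ?I = "Imod m (Fs @ Gs)"
  obtain k where k: "\<forall>i\<in>fvNn t \<union> fvN \<phi>. i < k"
    using finite_nat_set_iff_bounded[of "fvNn t \<union> fvN \<phi>"] by auto
  let ?t = "trl l t"
  \<comment> \<open>All free number variables, found below \<open>k\<close>, and the first
    \<open>l\<close> strings become arguments of the new function, so that it can be applied inside
    the scope of outer quantifiers.\<close>
  define F where "F = (\<lambda>xs Xs. {n. n < evn I0 (nenv xs) (senv Xs) ?t \<and> evf ?I (n ## nenv xs) (senv Xs) \<phi>})"
  have tk: "fvNn ?t \<subseteq> {..<k}" "fvSn ?t \<subseteq> {..<l}" "pureN ?t" using k trl_simps(2-4)[where l=l and t=t] by auto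
  have pb: "pbS k l F" unfolding pbS_def
  proof (intro exI[of _ "ptm k ?t"] conjI allI impI)
    fix xs :: "nat list" and Xs :: "nat set list" assume l: "length xs = k" "length Xs = l"
    show "finite (F xs Xs)" unfolding F_def by auto
    then show "slen (F xs Xs) \<le> evn I0 (nenv (xs @ map slen Xs)) (senv []) (ptm k ?t)"
      unfolding ptm_simps(2)[OF tk(3,1,2) l] by (rule slen_props(3)) (auto simp: F_def)
  qed (rule ptm_simps)
  let ?\<sigma> = "\<lambda>i. case i of 0 \<Rightarrow> NVar k | Suc j \<Rightarrow> NVar j"
  obtain \<phi>' where s: "is_subst \<phi> ?\<sigma> \<phi>'" using subst_ex[OF 1(2)] by blast
  have rep: "represents m (Fs @ Gs) (Suc k) l (\<lambda>ys Xs. last ys \<in> F (butlast ys) Xs)" unfolding represents_def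
  proof (intro exI[of _ "And (Lt (NVar k) ?t) \<phi>'"] conjI allI impI)
    show "sigB0 (And (Lt (NVar k) ?t) \<phi>')" "wff (sym_arities (Fs @ Gs)) (And (Lt (NVar k) ?t) \<phi>')"
      using s 1 trl_simps unfolding is_subst_def by (auto split: nat.splits)
    have "fvS \<phi>' \<subseteq> fvS \<phi> \<union> (\<Union>i\<in>fvN \<phi>. fvSn (?\<sigma> i))" using s unfolding is_subst_def by blast
    also have "\<dots> \<subseteq> {..<l}" by (intro Un_least UN_least 1(4)) (simp split: nat.split)
    finally show "fvS (And (Lt (NVar k) ?t) \<phi>') \<subseteq> {..<l}" using tk(2) by simp
    have "fvN \<phi>' \<subseteq> (\<Union>i\<in>fvN \<phi>. fvNn (?\<sigma> i))" using s unfolding is_subst_def by blast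
    also have "\<dots> \<subseteq> {..<Suc k}"
    proof (rule UN_least)
      fix i assume "i \<in> fvN \<phi>"
      then have "i < k" using k by simp
      then show "fvNn (?\<sigma> i) \<subseteq> {..<Suc k}" by (cases i) auto
    qed
    finally have "fvN \<phi>' \<subseteq> {..<Suc k}" .
    moreover have "{..<k} \<subseteq> {..<Suc k}" by auto
    ultimately show "fvN (And (Lt (NVar k) ?t) \<phi>') \<subseteq> {..<Suc k}" using order_trans[OF tk(1)] by simp
    fix ys :: "nat list" and Xs :: "nat set list" assume l: "length ys = Suc k" "length Xs = l"
    then obtain xs n where ys: "ys = xs @ [n]" "length xs = k" by (cases ys rule: rev_cases) auto
    have yk: "nenv ys k = n" "\<And>i. i < k \<Longrightarrow> nenv ys i = nenv xs i" using ys by (auto simp: nenv_def nth_append)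
    have "evf ?I (nenv ys) (senv Xs) \<phi>' = evf ?I (\<lambda>i. evn ?I (nenv ys) (senv Xs) (?\<sigma> i)) (senv Xs) \<phi>"
      using s unfolding is_subst_def by blast
    also have "\<dots> = evf ?I (n ## nenv xs) (senv Xs) \<phi>"
    proof (rule evf_coinc)
      show "\<forall>i\<in>fvN \<phi>. evn ?I (nenv ys) (senv Xs) (?\<sigma> i) = (n ## nenv xs) i"
      proof
        fix i assume "i \<in> fvN \<phi>"
        then have "i < k" using k by simp
        then show "evn ?I (nenv ys) (senv Xs) (?\<sigma> i) = (n ## nenv xs) i" using yk by (cases i) auto
      qed
    qed simp
    finally have e1: "evf ?I (nenv ys) (senv Xs) \<phi>' = evf ?I (n ## nenv xs) (senv Xs) \<phi>" .
    have e2: "evn ?I (nenv ys) (senv Xs) ?t = evn I0 (nenv xs) (senv Xs) ?t"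
      unfolding ev_I(1)[OF tk(3), of ?I _ _ I0]
      by (rule ev_coinc; intro ballI) (use tk(1) yk(2) in auto)
    show "(last ys \<in> F (butlast ys) Xs) = evf ?I (nenv ys) (senv Xs) (And (Lt (NVar k) ?t) \<phi>')"
      using e1 e2 yk by (simp add: ys F_def)
  qed
  let ?Hs = "Fs @ Gs @ [(k, l, F)]" and ?i = "length (Fs @ Gs)"
  have ch: "chain_ok m ?Hs" using chain_snoc[OF 1(1) pb rep] by simp
  let ?T = "SFun ?i (map NVar [0..<k]) (map SVar [0..<l])"
  let ?\<psi> = "Eq1 (NFun 0 [?t] [?T]) (trl l u)"
  have hi: "?Hs ! ?i = (k, l, F)" by (simp add: nth_append)
  have wf: "wff (sym_arities ?Hs) ?\<psi>"
    by (auto simp: trl_simps sym_arities_append list_all_iff) (auto simp: sym_arities_def nth_append)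
  have sem: "evf (Imod m ?Hs) na sa ?\<psi> = (card {n. n < evn I0 na (scut l sa) t \<and> P (n ## na) (scut l sa)} mod m = evn I0 na (scut l sa) u)"
    if f: "fin sa" for na sa
  proof -
    have m: "map (evn (Imod m ?Hs) na sa) (map NVar [0..<k]) = lenv k na" "map (evs (Imod m ?Hs) na sa) (map SVar [0..<l]) = lenv l sa"
      by (auto simp: lenv_def)
    have T: "evs (Imod m ?Hs) na sa ?T = F (lenv k na) (lenv l sa)"
      unfolding evs.simps m using hi by (simp add: Imod_def)
    have c1: "evn I0 (nenv (lenv k na)) (senv (lenv l sa)) ?t = evn I0 na (scut l sa) t"
      unfolding trl_simps(1)[OF MR_mod(1), symmetric]
      by (rule ev_coinc; intro ballI nenv_lenv lessThan_iff[THEN iffD1]; rule subsetD, rule tk, assumption)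
    have c2: "evf ?I (n ## nenv (lenv k na)) (senv (lenv l sa)) \<phi> = P (n ## na) (scut l sa)" for n
    proof -
      have "evf ?I (n ## nenv (lenv k na)) (senv (lenv l sa)) \<phi> = evf ?I (n ## na) sa \<phi>"
      proof (rule evf_coinc)
        show "\<forall>i\<in>fvN \<phi>. (n ## nenv (lenv k na)) i = (n ## na) i"
        proof
          fix i assume "i \<in> fvN \<phi>"
          then have "i < k" using k by simp
          then show "(n ## nenv (lenv k na)) i = (n ## na) i" by (cases i) (simp_all add: nenv_lenv)
        qed
        show "\<forall>x\<in>fvS \<phi>. senv (lenv l sa) x = sa x"
          by (intro ballI nenv_lenv(2) lessThan_iff[THEN iffD1] subsetD[OF 1(4)])
      qed
      then show ?thesis using 1(5) f by simp
    qed
    have "F (lenv k na) (lenv l sa) = {n. n < evn I0 na (scut l sa) t \<and> P (n ## na) (scut l sa)}"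
      unfolding F_def c1 c2 ..
    then have "{x \<in> F (lenv k na) (lenv l sa). x < evn I0 na (scut l sa) t} = {n. n < evn I0 na (scut l sa) t \<and> P (n ## na) (scut l sa)}" by auto
    moreover have "evn (Imod m ?Hs) na sa ?t = evn I0 na (scut l sa) t" "evn (Imod m ?Hs) na sa (trl l u) = evn I0 na (scut l sa) u"
      unfolding trl_simps(1)[OF MR_mod(1)] trl_simps(1)[OF MR_mod(2)] by (rule ev_I, rule MR_mod)+
    moreover have "evn (Imod m ?Hs) na sa (NFun 0 [?t] [?T]) = mod_fn m (evn (Imod m ?Hs) na sa ?t) (evs (Imod m ?Hs) na sa ?T)"
      by (simp only: evn.simps list.map) (simp add: Imod_def)
    ultimately show ?thesis unfolding evf.simps T mod_fn_def by simp
  qed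
  show ?case using ch wf sem trl_simps(3)[of l t] trl_simps(3)[of l u]
    by (intro exI[of _ "Gs @ [(k, l, F)]"] exI[of _ ?\<psi>]) auto
next
  case (MR_cong P Q)
  have "fin (scut l sa)" if "fin sa" for sa using that by (auto simp: scut_def)
  then have "fin sa \<Longrightarrow> Q na (scut l sa) = P na (scut l sa)" for na sa using MR_cong.hyps(2) by simp
  then show ?case using MR_cong.IH[OF MR_cong.prems] by simp
qed

theorem MR_AC0m:
  assumes "MR m (\<lambda>na sa. R (lenv k na) (lenv l sa))"
  shows "AC0m m k l R"
proof -
  obtain Gs \<phi> where 1: "chain_ok m Gs" "sigB0 \<phi>" "wff (sym_arities Gs) \<phi>" "fvS \<phi> \<subseteq> {..<l}"
     "\<forall>na sa. fin sa \<longrightarrow> evf (Imod m Gs) na sa \<phi> = R (lenv k na) (lenv l (scut l sa))"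
    using MR_chain[OF assms, of "[]" l] by (auto simp: chain_ok_def)
  \<comment> \<open>The relation depends on the first \<open>k\<close> numbers only, so other free
    variables of the formula may be set to 0.\<close>
  let ?\<sigma> = "\<lambda>i. if i < k then NVar i else Zero"
  obtain \<phi>' where s: "is_subst \<phi> ?\<sigma> \<phi>'" using subst_ex[OF 1(2)] by blast
  have "represents m Gs k l R" unfolding represents_def
  proof (intro exI[of _ \<phi>'] conjI allI impI)
    show "sigB0 \<phi>'" "wff (sym_arities Gs) \<phi>'" using s 1 unfolding is_subst_def by auto
    have "fvN \<phi>' \<subseteq> (\<Union>i\<in>fvN \<phi>. fvNn (?\<sigma> i))" using s unfolding is_subst_def by blast
    also have "\<dots> \<subseteq> {..<k}" by (auto split: if_splits)
    finally show "fvN \<phi>' \<subseteq> {..<k}" .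
    have "fvS \<phi>' \<subseteq> fvS \<phi> \<union> (\<Union>i\<in>fvN \<phi>. fvSn (?\<sigma> i))" using s unfolding is_subst_def by blast
    also have "\<dots> \<subseteq> {..<l}" using 1(4) by (auto split: if_splits)
    finally show "fvS \<phi>' \<subseteq> {..<l}" .
    fix xs :: "nat list" and Xs :: "nat set list" assume l: "length xs = k" "length Xs = l" "\<forall>X\<in>set Xs. finite X"
    have "evf (Imod m Gs) (nenv xs) (senv Xs) \<phi>' = evf (Imod m Gs) (\<lambda>i. evn (Imod m Gs) (nenv xs) (senv Xs) (?\<sigma> i)) (senv Xs) \<phi>"
      using s unfolding is_subst_def by blast
    also have "\<dots> = R (lenv k (\<lambda>i. evn (Imod m Gs) (nenv xs) (senv Xs) (?\<sigma> i))) (lenv l (scut l (senv Xs)))"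
      using 1(5) fin_senv[OF l(3)] by blast
    also have "lenv k (\<lambda>i. evn (Imod m Gs) (nenv xs) (senv Xs) (?\<sigma> i)) = lenv k (nenv xs)" by (rule lenv_cong) simp
    also have "lenv l (scut l (senv Xs)) = lenv l (senv Xs)" by (rule lenv_cong) (simp add: scut_def)
    finally show "R xs Xs = evf (Imod m Gs) (nenv xs) (senv Xs) \<phi>'" using lenv_nenv l by simp
  qed
  then show ?thesis using 1(1) unfolding AC0m_def by blast
qed

section \<open>Running counting programs in the intended model\<close>

lemma Std_simps [simp]:
  "mN Std = UNIV" "mS Std = {A. finite A}" "mz Std = 0" "mo Std = 1" "ma Std = (+)" "mm Std = (*)" "mlen Std = slen"
  "mle Std = (\<le>)" "mmem Std = (\<in>)" "meq1 Std = (=)" "meq2 Std = (=)" "mnum Std i = i"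
proof -
  show "mnum Std i = i" by (induction i) (auto simp: Std_def)
qed (auto simp: Std_def)

abbreviation "npair \<equiv> mpair Std"

text \<open>With s = a + b the code is s(s+1) + 2b, and 2b is at most 2s, so the codes with sum s
  end before (s+1)(s+2), the first code with sum s + 1. Equal codes thus have equal sums, and then
  equal second components.\<close>

lemma npair_inj: assumes "npair a b = npair c d" shows "a = c \<and> b = d"
proof -
  have *: False if h: "npair a b = npair c d" and lt: "a + b < c + d" for a b c d
  proof -
    define s where "s = a + b"
    have "(s + 1) * (s + 2) \<le> (c + d) * (c + d + 1)" using lt s_def by (intro mult_le_mono) auto
    moreover have "npair a b \<le> s * (s + 1) + 2 * s" by (simp add: mpair_def s_def)
    moreover have "(s + 1) * (s + 2) = s * (s + 1) + 2 * s + 2" by (simp add: algebra_simps)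
    moreover have "(c + d) * (c + d + 1) \<le> npair c d" by (simp add: mpair_def)
    ultimately show False using h by linarith
  qed
  have "a + b = c + d" using *[OF assms] *[OF assms[symmetric]] linorder_neqE_nat by blast
  moreover from this have "b + b = d + d" using assms by (simp add: mpair_def)
  ultimately show ?thesis by simp
qed

text \<open>The normalized counting table in the sense of \<open>tabf\<close>; the row for z equal
  to the length, holding the total count, is included.\<close>

definition ctab :: "nat \<Rightarrow> nat set \<Rightarrow> nat set" where
  "ctab m X = (\<lambda>z. npair z (mod_fn m z X)) ` {..slen X}"

lemma ctab_mem: "npair z y \<in> ctab m X \<longleftrightarrow> z \<le> slen X \<and> y = mod_fn m z X"
proof
  assume "npair z y \<in> ctab m X"
  then obtain z' where "z' \<le> slen X" "npair z y = npair z' (mod_fn m z' X)" by (auto simp: ctab_def)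
  then show "z \<le> slen X \<and> y = mod_fn m z X" using npair_inj[of z y z' "mod_fn m z' X"] by simp
qed (simp add: ctab_def)

lemma finite_ctab: "finite (ctab m X)" by (simp add: ctab_def)

lemma mod_fn_Suc:
  "mod_fn m 0 X = 0" "mod_fn m (Suc z) X = (if z \<in> X then (mod_fn m z X + 1) mod m else mod_fn m z X)"
proof -
  show "mod_fn m 0 X = 0" by (simp add: mod_fn_def)
  have "{x \<in> X. x < Suc z} = (if z \<in> X then insert z {x \<in> X. x < z} else {x \<in> X. x < z})" by (auto simp: less_Suc_eq)
  moreover have "finite {x \<in> X. x < z}" by simp
  ultimately show "mod_fn m (Suc z) X = (if z \<in> X then (mod_fn m z X + 1) mod m else mod_fn m z X)"
    by (simp add: mod_fn_def mod_Suc_eq)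
qed

lemma ctab_modP: assumes "m \<ge> 2" shows "modP Std m X (\<lambda>z y. npair z y \<in> ctab m X)"
proof -
  have l: "mod_fn m z X < m" for z using assms by (simp add: mod_fn_def)
  have s: "\<exists>r. (r \<le> m \<and> r \<noteq> m) \<and> (\<exists>q\<le>mod_fn m z X + 1. mod_fn m z X + 1 = q * m + r \<and> z + 1 \<le> slen X \<and> r = mod_fn m (z + 1) X)"
    if "z \<in> X" "z \<le> slen X \<and> z \<noteq> slen X" for z
  proof (rule exI[of _ "(mod_fn m z X + 1) mod m"], intro conjI)
    have "(mod_fn m z X + 1) mod m < m" using assms by simp
    then show "(mod_fn m z X + 1) mod m \<le> m" "(mod_fn m z X + 1) mod m \<noteq> m" by simp_all
    have "(mod_fn m z X + 1) mod m = mod_fn m (z + 1) X" using that by (simp add: mod_fn_Suc)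
    then show "\<exists>q\<le>mod_fn m z X + 1. mod_fn m z X + 1 = q * m + (mod_fn m z X + 1) mod m \<and> z + 1 \<le> slen X \<and>
       (mod_fn m z X + 1) mod m = mod_fn m (z + 1) X"
      using that by (intro exI[of _ "(mod_fn m z X + 1) div m"] conjI div_mult_mod_eq[symmetric]) simp_all
  qed
  show ?thesis unfolding modP_def Std_simps ctab_mem
  proof (intro conjI allI impI)
    fix z assume "z \<le> slen X"
    then show "\<exists>y. (y \<le> m \<and> y \<noteq> m) \<and> z \<le> slen X \<and> y = mod_fn m z X"
      using l[of z] by (intro exI[of _ "mod_fn m z X"]) simp
  next
    fix z y assume "z \<le> slen X \<and> z \<noteq> slen X" and y: "z \<le> slen X \<and> y = mod_fn m z X" and "z \<in> X"
    then show "\<exists>r. (r \<le> m \<and> r \<noteq> m) \<and> (\<exists>q\<le>y + 1. y + 1 = q * m + r \<and> z + 1 \<le> slen X \<and> r = mod_fn m (z + 1) X)"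
      using s[of z] by blast
  next
    fix z y assume "z \<le> slen X \<and> z \<noteq> slen X"
    then show "z + 1 \<le> slen X" by simp
  next
    fix z y assume "z \<le> slen X \<and> y = mod_fn m z X" "z \<notin> X"
    then show "y = mod_fn m (z + 1) X" by (simp add: mod_fn_Suc)
  next
    fix z y y' assume "(z \<le> slen X \<and> y = mod_fn m z X) \<and> z \<le> slen X \<and> y' = mod_fn m z X"
    then show "y = y'" by simp
  qed (simp_all add: mod_fn_Suc)
qed

lemma msat_Std_basic: "\<phi> \<in> basic_axioms \<Longrightarrow> fin sa \<Longrightarrow> msat Std na sa \<phi>"
proof -
  assume f: "fin sa" and b: "\<phi> \<in> basic_axioms"
  have e: "(sa 0 = sa (Suc 0)) \<longleftrightarrow> slen (sa 0) = slen (sa (Suc 0)) \<and> (\<forall>n. n \<le> slen (sa 0) \<and> n \<noteq> slen (sa 0) \<longrightarrow> (n \<in> sa 0) = (n \<in> sa (Suc 0)))"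
    (is "?L \<longleftrightarrow> ?R")
  proof
    assume R: ?R
    show ?L
    proof (rule set_eqI)
      fix x show "x \<in> sa 0 \<longleftrightarrow> x \<in> sa (Suc 0)"
      proof (cases "x < slen (sa 0)")
        case True then show ?thesis using R by simp
      next
        case False then show ?thesis using R slen_props(1)[OF f[rule_format], of x 0] slen_props(1)[OF f[rule_format], of x "Suc 0"] by auto
      qed
    qed
  qed simp
  have l: "x \<le> slen (sa 0)" "x \<noteq> slen (sa 0)" if "x \<in> sa 0" for x using slen_props(1)[OF f[rule_format] that] by simp_all
  have l2: "x \<in> sa 0" if "Suc x = slen (sa 0)" for x using slen_props(2)[OF f[rule_format] that[symmetric]] .
  have p: "\<exists>n\<le>x. n \<noteq> x \<and> Suc n = x" if "0 < x" for x :: nat using that by (cases x) auto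
  have o: "x \<le> y \<longleftrightarrow> x \<le> Suc y \<and> x \<noteq> Suc y" for x y :: nat by auto
  show ?thesis using b unfolding basic_axioms_def
    by (elim insertE emptyE) (simp_all add: e p l l2 o[symmetric] nat_le_linear)
qed

lemma msat_Std_comp: "\<phi> \<in> comp_axioms \<Longrightarrow> fin sa \<Longrightarrow> msat Std na sa \<phi>"
proof -
  assume "\<phi> \<in> comp_axioms" and f: "fin sa"
  then obtain X a z \<psi> where h: "\<phi> = ExSb X (NVar a) (AllLt z (NVar a) (Iff (Mem (NVar z) (SVar X)) \<psi>))"
    "sigB0 \<psi>" "pureF \<psi>" "X \<notin> fvS \<psi>" "z \<noteq> a" unfolding comp_axioms_def by blast
  let ?A = "{n. n < na a \<and> msat Std (na(z:=n)) sa \<psi>}"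
  have "slen ?A \<le> na a" by (rule slen_props(3)) auto
  moreover have "msat Std (na(z:=n)) (sa(X:=?A)) \<psi> = msat Std (na(z:=n)) sa \<psi>" for n
    by (rule msat_upd(2)) (use h in auto)
  ultimately show ?thesis unfolding h(1) msat_conn using h(5)
    by (intro bexI[of _ ?A]) auto
qed

text \<open>Makes the results on uniqueness of runs available in the standard structure.\<close>

lemma v0_Std: assumes "m \<ge> 2" shows "v0 Std m"
proof
  show "normal Std" by (simp add: normal_def)
  show "models Std (V0m m)" unfolding models_def
  proof (intro ballI allI impI)
    fix \<phi> na sa assume "\<phi> \<in> V0m m" and v: "valid_env Std na sa"
    then have f: "fin sa" by (simp add: valid_env_def)
    consider "\<phi> \<in> basic_axioms" | "\<phi> \<in> comp_axioms" | "\<phi> = MODax m" using \<open>\<phi> \<in> V0m m\<close> by (auto simp: V0m_def V0_def)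
    then show "msat Std na sa \<phi>"
    proof cases
      case 3
      have "modP Std m X (\<lambda>z y. npair z y \<in> ctab m X)" for X by (rule ctab_modP[OF assms])
      then show ?thesis unfolding 3 MODax_def phiMOD_pm using finite_ctab
        by (auto simp: msat_pm[OF \<open>normal Std\<close>])
    qed (use f msat_Std_basic msat_Std_comp in blast)+
  qed
qed (use assms in auto)

section \<open>Execution of programs\<close>

primrec run :: "nat \<Rightarrow> nat \<Rightarrow> (nat \<Rightarrow> nat) \<Rightarrow> (nat \<Rightarrow> nat set) \<Rightarrow> nat \<Rightarrow> prog \<Rightarrow> (nat \<Rightarrow> nat set)" where
  "run m k na sa j [] = sa"
| "run m k na sa j (s # pr) =
    (let A = {p. p < evn I0 na sa (fst s) \<and> evf I0 (na(k := p)) sa (snd s)} in run m k na (sa(j := A, Suc j := ctab m A)) (j + 2) pr)"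

lemma run_append: "run m k na sa j (p @ q) = run m k na (run m k na sa j p) (j + 2 * length p) q"
  by (induction p arbitrary: sa j) (auto simp: Let_def)

lemma run_out: "i \<notin> blk j pr \<Longrightarrow> run m k na sa j pr i = sa i"
proof (induction pr arbitrary: sa j)
  case (Cons s pr)
  have "i \<notin> blk (j + 2) pr" "i \<noteq> j" "i \<noteq> Suc j" using Cons.prems by auto
  then show ?case using Cons.IH by (simp add: Let_def)
qed simp

lemma run_fin: "fin sa \<Longrightarrow> fin (run m k na sa j pr)"
proof (induction pr arbitrary: sa j)
  case (Cons s pr)
  show ?case unfolding run.simps Let_def by (rule Cons.IH) (use Cons.prems finite_ctab in simp)
qed simp

text \<open>In the standard structure the guard holds, since pairing is monotone and remainders are
  unique. The table clause therefore asks for a genuine counting table, and \<open>ctab\<close> is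
  one.\<close>

lemma run_gam:
  assumes m: "m \<ge> 2"
  shows "okp k l j pr \<Longrightarrow> l < j \<Longrightarrow> fin sa \<Longrightarrow> msat Std na (run m k na sa j pr) (gam m k j pr)"
proof (induction pr arbitrary: sa j)
  case (Cons s pr)
  interpret v0 Std m by (rule v0_Std[OF m])
  obtain B \<theta> where s: "s = (B, \<theta>)" by fastforce
  have o: "inT k l B" "sigB0 \<theta>" "pureF \<theta>" "fvN \<theta> \<subseteq> {..k}" "fvS \<theta> \<subseteq> {..<j} - {l}" "okp k l (j+2) pr" using Cons.prems s by auto
  define A where "A = {p. p < evn I0 na sa B \<and> evf I0 (na(k := p)) sa \<theta>}"
  let ?s = "sa(j := A, Suc j := ctab m A)" and ?r = "run m k na sa j (s # pr)"
  have r: "?r = run m k na ?s (j + 2) pr" by (simp add: s A_def Let_def)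
  have f: "fin ?s" using Cons.prems finite_ctab by (simp add: A_def)
  have rj: "?r j = A" "?r (Suc j) = ctab m A" unfolding r by (subst run_out; simp)+
  have rl: "?r i = sa i" if "i < j" for i using run_out[of i j "s # pr"] that by simp
  have pB: "pureN B" "\<forall>X\<in>fvSn B. X < j" using o(1) Cons.prems(2) by (auto simp: inT_def)
  have eB: "mev Std na ?r B = evn I0 na sa B"
    unfolding mev_Std(1)[OF pB(1)] by (rule ev_coinc) (use pB rl in auto)
  have e\<theta>: "msat Std (na(k:=x)) ?r \<theta> = evf I0 (na(k:=x)) sa \<theta>" for x
    unfolding msat_Std[OF o(3)] by (rule evf_coinc) (use o(5) rl in auto)
  have sl: "slen A \<le> evn I0 na sa B" by (rule slen_props(3)) (auto simp: A_def)
  have c: "msat Std na ?r (compf k j B \<theta>)"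
    unfolding msat_compf[OF o(1)] eB rj e\<theta> using sl by (auto simp: A_def)
  have tB: "mev Std na ?r (tb m B) = npair (evn I0 na sa B) m + 1"
    unfolding tb_def mev.simps mev_num eB by simp
  have pl: "npair z y < npair (evn I0 na sa B) m + 1" if "z \<le> evn I0 na sa B" "y < m" for z y
    using that by (auto simp: mpair_def less_Suc_eq_le intro!: add_mono mult_le_mono)
  have g: "msat Std na ?r (guard m k B)" unfolding msat_guard[OF o(1)] eB tB Std_simps
  proof (intro conjI allI impI)
    fix z y assume "z \<le> evn I0 na sa B" "y \<le> m \<and> y \<noteq> m"
    then show "npair z y \<le> npair (evn I0 na sa B) m + 1" "npair z y \<noteq> npair (evn I0 na sa B) m + 1" using pl[of z y] by simp_all
  next
    fix y r r' q q' assume "y \<le> m \<and> y \<noteq> m" "r \<le> m \<and> r \<noteq> m" "r' \<le> m \<and> r' \<noteq> m" and e: "y + 1 = q * m + r \<and> y + 1 = q' * m + r'"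
    then have "r < m" "r' < m" "q * m + r = q' * m + r'" by auto
    then have "(r + q * m) mod m = (r' + q' * m) mod m" by (simp add: add.commute)
    then show "r = r'" using \<open>r < m\<close> \<open>r' < m\<close> by simp
  qed
  have t: "msat Std na ?r (tabf m k j (Suc j) B)" unfolding msat_tabf[OF o(1)] rj tB Std_simps
  proof (intro conjI impI allI)
    show "slen (ctab m A) \<le> npair (evn I0 na sa B) m + 1"
    proof (rule slen_props(3)[OF finite_ctab])
      fix w assume "w \<in> ctab m A"
      then obtain z where z: "z \<le> slen A" "w = npair z (mod_fn m z A)" by (auto simp: ctab_def)
      have "mod_fn m z A < m" using m by (simp add: mod_fn_def)
      then show "w < npair (evn I0 na sa B) m + 1" using pl z sl by (simp del: One_nat_def)
    qed
    show "modP Std m A (\<lambda>z y. npair z y \<in> ctab m A)" by (rule ctab_modP[OF m])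
    fix w assume "w \<in> ctab m A"
    then obtain z where z: "z \<le> slen A" "w = npair z (mod_fn m z A)" by (auto simp: ctab_def)
    have "mod_fn m z A < m" using m by (simp add: mod_fn_def)
    then show "\<exists>z\<le>slen A. \<exists>y. (y \<le> m \<and> y \<noteq> m) \<and> w = npair z y" using z by (intro exI[of _ z] conjI exI[of _ "mod_fn m z A"]) auto
  next
    assume "\<not> msat Std na ?r (guard m k B)" then show "slen (ctab m A) = 0" using g by blast
  qed
  have "msat Std na ?r (gam m k (j + 2) pr)" unfolding r by (rule Cons.IH[OF o(6) _ f]) (use Cons.prems in simp)
  then show ?case using c t by (simp add: s)
qed simp

definition henv :: "nat \<Rightarrow> nat \<Rightarrow> nat list \<Rightarrow> nat set list \<Rightarrow> nat \<Rightarrow> prog \<Rightarrow> nat \<Rightarrow> nat set" where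
  "henv m k xs Xs l pr = run m k (nenv xs) (senv Xs) (Suc l) pr"

text \<open>Arguments keep their names below \<open>k\<close>; the de Bruijn variable
  \<open>i\<close> of a class relation is placed at \<open>k + i\<close>.\<close>

definition mixe :: "nat \<Rightarrow> nat list \<Rightarrow> (nat \<Rightarrow> nat) \<Rightarrow> nat \<Rightarrow> nat" where
  "mixe k xs na i = (if i < k then xs ! i else na (i - k))"

lemma mixe_simps [simp]: "mixe k xs na (k + i) = na i" "mixe k xs na (Suc (k + i)) = na (Suc i)" "mixe k xs na k = na 0" "i < k \<Longrightarrow> mixe k xs na i = xs ! i"
  by (auto simp: mixe_def)

lemma henv_lower: "length Xs = l \<Longrightarrow> i < l \<Longrightarrow> henv m k xs Xs l pr i = Xs ! i"
  "length Xs = l \<Longrightarrow> scut l (henv m k xs Xs l pr) = senv Xs"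
proof -
  have a: "henv m k xs Xs l pr i = Xs ! i" if "length Xs = l" "i < l" for i
    unfolding henv_def using that by (subst run_out) (auto simp: senv_def)
  then show "length Xs = l \<Longrightarrow> i < l \<Longrightarrow> henv m k xs Xs l pr i = Xs ! i" .
  show "length Xs = l \<Longrightarrow> scut l (henv m k xs Xs l pr) = senv Xs"
    using a by (auto simp: scut_def senv_def fun_eq_iff)
qed

lemma okp_append: "okp k l j (p @ q) \<longleftrightarrow> okp k l j p \<and> okp k l (j + 2 * length p) q"
  by (induction p arbitrary: j) auto

lemma henv_append:
  "i < Suc l + 2 * length p \<Longrightarrow> henv m k xs Xs l (p @ q) i = henv m k xs Xs l p i"
  unfolding henv_def run_append by (rule run_out) simp

definition inenv where "inenv k l xs Xs \<longleftrightarrow> length xs = k \<and> length Xs = l \<and> (\<forall>X\<in>set Xs. finite X)"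

lemma inT_eval:
  assumes "inT k l T" "length xs = k" "length Xs = l"
  shows "evn I0 (mixe k xs na) (henv m k xs Xs l pr) T = evn I0 (nenv xs) (senv Xs) T"
    "\<forall>i<k. na' i = xs ! i \<Longrightarrow> evn I0 na' (henv m k xs Xs l pr) T = evn I0 (nenv xs) (senv Xs) T"
proof -
  show *: "evn I0 na' (henv m k xs Xs l pr) T = evn I0 (nenv xs) (senv Xs) T" if n: "\<forall>i<k. na' i = xs ! i" for na'
  proof (rule ev_coinc)
    show "\<forall>x\<in>fvNn T. na' x = nenv xs x" using assms n by (auto simp: inT_def nenv_def)
    show "\<forall>X\<in>fvSn T. henv m k xs Xs l pr X = senv Xs X"
      using assms by (auto simp: inT_def senv_def henv_lower)
  qed
  show "evn I0 (mixe k xs na) (henv m k xs Xs l pr) T = evn I0 (nenv xs) (senv Xs) T"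
    by (rule *) simp
qed

text \<open>Moves the de Bruijn variables of a term to their places from \<open>k + d\<close> on and
  reads strings from \<open>l\<close> on as empty. The offset \<open>d\<close> is 1 where the
  counted variable has been pushed and the term belongs outside its scope.\<close>

definition shn :: "nat \<Rightarrow> nat \<Rightarrow> nat \<Rightarrow> nterm \<Rightarrow> nterm" where
  "shn k l d t = subn (\<lambda>i. NVar (k + d + i)) (trl l t)"

lemma shn_simps:
  "pureN (shn k l d t)" "fvSn (shn k l d t) \<subseteq> {..<l}"
  "x \<in> fvNn (shn k l d t) \<Longrightarrow> \<exists>i\<in>fvNn t. x = k + d + i"
proof -
  show "pureN (shn k l d t)" unfolding shn_def by (rule pure_sub(1)) (simp_all add: trl_simps)
  show "fvSn (shn k l d t) \<subseteq> {..<l}" unfolding shn_def fvS_sub using trl_simps(3)[of l t] by auto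
  show "x \<in> fvNn (shn k l d t) \<Longrightarrow> \<exists>i\<in>fvNn t. x = k + d + i"
    unfolding shn_def fvN_sub using trl_simps(4)[of l t] by auto
qed

lemma shn_eval: "pureN t \<Longrightarrow> length Xs = l \<Longrightarrow> evn I0 na (henv m k xs Xs l pr) (shn k l d t) = evn I0 (\<lambda>i. na (k + d + i)) (senv Xs) t"
  unfolding shn_def ev_sub using trl_simps(1)[of t I0 _ "henv m k xs Xs l pr" l] henv_lower(2) by simp

text \<open>If all variables are at most \<open>T\<close>, then by monotonicity a value bounded by
  \<open>t\<close> is at most \<open>t\<close> with \<open>T\<close> in every place. Adding
  \<open>T\<close> gives a common bound for the old variables and the quantified one, again a term
  in the arguments.\<close>

definition tops :: "nat \<Rightarrow> nterm \<Rightarrow> nterm \<Rightarrow> nterm" where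
  "tops l T t = Plus T (subn (\<lambda>_. T) (trl l t))"

lemma tops_inT: "inT k l T \<Longrightarrow> inT k l (tops l T t)"
  unfolding inT_def tops_def using trl_simps(2-4)[where t=t and l=l]
  by (auto simp: fvN_sub fvS_sub intro!: pure_sub)

lemma tops_le:
  assumes "pureN t" "length Xs = l"
  shows "evn I0 (nenv xs) (senv Xs) T \<le> evn I0 (nenv xs) (senv Xs) (tops l T t)"
    "\<forall>i. na i \<le> evn I0 (nenv xs) (senv Xs) T \<Longrightarrow> evn I0 na (senv Xs) t \<le> evn I0 (nenv xs) (senv Xs) (tops l T t)"
proof -
  have sc: "scut l (senv Xs) = senv Xs" using assms(2) by (auto simp: scut_def senv_def fun_eq_iff)
  show "evn I0 (nenv xs) (senv Xs) T \<le> evn I0 (nenv xs) (senv Xs) (tops l T t)" by (simp add: tops_def)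
  assume "\<forall>i. na i \<le> evn I0 (nenv xs) (senv Xs) T"
  then have "evn I0 na (senv Xs) t \<le> evn I0 (\<lambda>_. evn I0 (nenv xs) (senv Xs) T) (senv Xs) t"
    using assms(1) by (intro evn_mono) simp_all
  then show "evn I0 na (senv Xs) t \<le> evn I0 (nenv xs) (senv Xs) (tops l T t)"
    by (simp add: tops_def trl_simps(1)[OF assms(1)] sc)
qed

lemma is_substD: "is_subst \<phi> \<sigma> \<phi>' \<Longrightarrow> evf I na sa \<phi>' = evf I (\<lambda>i. evn I na sa (\<sigma> i)) sa \<phi>"
  "is_subst \<phi> \<sigma> \<phi>' \<Longrightarrow> sigB0 \<phi>'" "is_subst \<phi> \<sigma> \<phi>' \<Longrightarrow> pureF \<phi> \<Longrightarrow> \<forall>i. pureN (\<sigma> i) \<Longrightarrow> pureF \<phi>'"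
  "is_subst \<phi> \<sigma> \<phi>' \<Longrightarrow> fvN \<phi>' \<subseteq> (\<Union>i\<in>fvN \<phi>. fvNn (\<sigma> i))"
  "is_subst \<phi> \<sigma> \<phi>' \<Longrightarrow> \<forall>i. fvSn (\<sigma> i) = {} \<Longrightarrow> fvS \<phi>' \<subseteq> fvS \<phi>"
  unfolding is_subst_def by (blast, simp_all)

text \<open>\<open>hval c\<close> is the value of a digit list in base \<open>c\<close>, least significant digit first.\<close>

primrec hval :: "nat \<Rightarrow> nat list \<Rightarrow> nat" where
  "hval c [] = 0" | "hval c (d # ds) = d + c * hval c ds"

lemma hval_inj: "length ds = length es \<Longrightarrow> \<forall>d\<in>set ds. d < c \<Longrightarrow> \<forall>d\<in>set es. d < c \<Longrightarrow> hval c ds = hval c es \<Longrightarrow> ds = es"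
proof (induction ds arbitrary: es)
  case (Cons d ds)
  then obtain e es' where es: "es = e # es'" by (cases es) auto
  have "(d + c * hval c ds) mod c = (e + c * hval c es') mod c" using Cons.prems(4) es by simp
  then have de: "d = e" using Cons.prems es by simp
  then have "c * hval c ds = c * hval c es'" using Cons.prems(4) es by simp
  moreover have "c > 0" using Cons.prems(2) by (cases c) auto
  ultimately have "hval c ds = hval c es'" by simp
  then show ?case using Cons.IH[of es'] Cons.prems es de by simp
qed simp

lemma hval_mono: "length ds = length es \<Longrightarrow> \<forall>i<length ds. ds ! i \<le> es ! i \<Longrightarrow> hval c ds \<le> hval c es"
proof (induction ds arbitrary: es)
  case (Cons d ds)
  then obtain e es' where es: "es = e # es'" by (cases es) auto
  have "d \<le> e" using Cons.prems(2)[rule_format, of 0] es by simp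
  moreover have "hval c ds \<le> hval c es'"
  proof (rule Cons.IH)
    show "\<forall>i<length ds. ds ! i \<le> es' ! i" using Cons.prems(2) es by (metis Suc_less_eq length_Cons nth_Cons_Suc)
  qed (use Cons.prems es in simp)
  ultimately show ?case by (simp add: es add_mono)
qed simp

primrec hterm :: "nterm \<Rightarrow> nterm list \<Rightarrow> nterm" where
  "hterm c [] = Zero" | "hterm c (d # ds) = Plus d (Times c (hterm c ds))"

lemma hterm_simps: "evn I na sa (hterm c ds) = hval (evn I na sa c) (map (evn I na sa) ds)"
  "pureN c \<Longrightarrow> \<forall>d\<in>set ds. pureN d \<Longrightarrow> pureN (hterm c ds)"
  "fvNn (hterm c ds) \<subseteq> fvNn c \<union> (\<Union>d\<in>set ds. fvNn d)" "fvSn (hterm c ds) \<subseteq> fvSn c \<union> (\<Union>d\<in>set ds. fvSn d)"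
  by (induction ds) auto

definition exb :: "nterm \<Rightarrow> nat list \<Rightarrow> form \<Rightarrow> form" where
  "exb T vs \<phi> = foldr (\<lambda>v. ExLe v T) vs \<phi>"

lemma exb_iff:
  "distinct vs \<Longrightarrow> set vs \<inter> fvNn T = {} \<Longrightarrow>
   evf I na sa (exb T vs \<phi>) \<longleftrightarrow> (\<exists>f. (\<forall>v\<in>set vs. f v \<le> evn I na sa T) \<and> evf I (\<lambda>i. if i \<in> set vs then f i else na i) sa \<phi>)"
proof (induction vs arbitrary: na)
  case (Cons v vs)
  have v: "v \<notin> fvNn T" "v \<notin> set vs" using Cons.prems by auto
  have IH: "evf I (na(v := n)) sa (exb T vs \<phi>) \<longleftrightarrow>
     (\<exists>f. (\<forall>v\<in>set vs. f v \<le> evn I na sa T) \<and> evf I (\<lambda>i. if i \<in> set vs then f i else (na(v := n)) i) sa \<phi>)" for n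
    using Cons.IH[of "na(v := n)"] Cons.prems v by (simp del: fun_upd_apply)
  have "evf I na sa (exb T (v # vs) \<phi>) \<longleftrightarrow> (\<exists>n\<le>evn I na sa T. evf I (na(v := n)) sa (exb T vs \<phi>))"
    using v by (simp add: exb_def)
  also have "\<dots> \<longleftrightarrow> (\<exists>f. (\<forall>v\<in>set (v # vs). f v \<le> evn I na sa T) \<and> evf I (\<lambda>i. if i \<in> set (v # vs) then f i else na i) sa \<phi>)"
  proof
    assume "\<exists>n\<le>evn I na sa T. evf I (na(v := n)) sa (exb T vs \<phi>)"
    then obtain n f where h: "n \<le> evn I na sa T" "\<forall>v\<in>set vs. f v \<le> evn I na sa T"
      "evf I (\<lambda>i. if i \<in> set vs then f i else (na(v := n)) i) sa \<phi>" unfolding IH by (elim exE conjE)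
    have "(\<lambda>i. if i \<in> set vs then f i else (na(v := n)) i) = (\<lambda>i. if i \<in> set (v # vs) then (f(v := n)) i else na i)"
      using v by (auto simp: fun_eq_iff)
    then have "evf I (\<lambda>i. if i \<in> set (v # vs) then (f(v := n)) i else na i) sa \<phi>" using h(3) by (simp only:)
    moreover have "\<forall>u\<in>set (v # vs). (f(v := n)) u \<le> evn I na sa T" using h(1,2) by simp
    ultimately show "\<exists>f. (\<forall>v\<in>set (v # vs). f v \<le> evn I na sa T) \<and> evf I (\<lambda>i. if i \<in> set (v # vs) then f i else na i) sa \<phi>" by blast
  next
    assume "\<exists>f. (\<forall>v\<in>set (v # vs). f v \<le> evn I na sa T) \<and> evf I (\<lambda>i. if i \<in> set (v # vs) then f i else na i) sa \<phi>"
    then obtain f where h: "\<forall>v\<in>set (v # vs). f v \<le> evn I na sa T" "evf I (\<lambda>i. if i \<in> set (v # vs) then f i else na i) sa \<phi>"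
      by (elim exE conjE)
    have "(\<lambda>i. if i \<in> set (v # vs) then f i else na i) = (\<lambda>i. if i \<in> set vs then f i else (na(v := f v)) i)"
      by (auto simp: fun_eq_iff)
    then have "evf I (\<lambda>i. if i \<in> set vs then f i else (na(v := f v)) i) sa \<phi>" using h(2) by (simp only:)
    moreover have "\<forall>u\<in>set vs. f u \<le> evn I na sa T" "f v \<le> evn I na sa T" using h(1) by simp_all
    ultimately show "\<exists>n\<le>evn I na sa T. evf I (na(v := n)) sa (exb T vs \<phi>)" unfolding IH by blast
  qed
  finally show ?case .
qed (simp add: exb_def)

lemma exb_simps:
  "sigB0 \<phi> \<Longrightarrow> set vs \<inter> fvNn T = {} \<Longrightarrow> sigB0 (exb T vs \<phi>)" "pureF \<phi> \<Longrightarrow> pureN T \<Longrightarrow> pureF (exb T vs \<phi>)"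
  "fvN (exb T vs \<phi>) \<subseteq> fvNn T \<union> (fvN \<phi> - set vs)" "fvS (exb T vs \<phi>) \<subseteq> fvSn T \<union> fvS \<phi>"
  unfolding exb_def by (induction vs) auto

text \<open>With \<open>c\<close> elements in front of a row and \<open>N\<close> in it, the table
  only gives the remainders of \<open>c\<close> and \<open>c + N\<close>. The remainder of
  \<open>N\<close> is their difference modulo \<open>m\<close>, expressed by additions; as both
  remainders are below \<open>m\<close>, there is at most one wrap-around.\<close>

lemma mod_count:
  fixes c N m u :: nat assumes "0 < m"
  shows "N mod m = u \<longleftrightarrow> u < m \<and> (c mod m + u = (c + N) mod m \<or> c mod m + u = (c + N) mod m + m)"
proof -
  have e: "(c + N) mod m = (c mod m + N mod m) mod m" by (simp add: mod_add_eq)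
  have l: "c mod m < m" "N mod m < m" using assms by simp_all
  have *: "(a + b) mod m = (if a + b < m then a + b else a + b - m)" if "a < m" "b < m" for a b :: nat
    using that by (simp add: mod_if)
  have "b = u \<longleftrightarrow> u < m \<and> (a + u = (if a + b < m then a + b else a + b - m) \<or> a + u = (if a + b < m then a + b else a + b - m) + m)"
    if "a < m" "b < m" for a b :: nat
    using that by (cases "a + b < m") (simp_all, presburger+)
  then show ?thesis unfolding e *[OF l] using l by blast
qed

section \<open>From relations of the class to programs\<close>

definition okt :: "nat \<Rightarrow> prog \<Rightarrow> form \<Rightarrow> bool" where
  "okt l pr \<theta> \<longleftrightarrow> sigB0 \<theta> \<and> pureF \<theta> \<and> fvS \<theta> \<subseteq> {..<Suc l + 2 * length pr} - {l}"

text \<open>The formula has to be right only for variables up to \<open>T\<close>: the counting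
  tables in a program are finite strings, so they serve a range of parameters fixed by the
  arguments.\<close>

definition repr :: "nat \<Rightarrow> nat \<Rightarrow> nat \<Rightarrow> nterm \<Rightarrow> prog \<Rightarrow> form \<Rightarrow> ((nat \<Rightarrow> nat) \<Rightarrow> (nat \<Rightarrow> nat set) \<Rightarrow> bool) \<Rightarrow> bool" where
  "repr m k l T pr \<theta> P \<longleftrightarrow> (\<forall>xs Xs na. inenv k l xs Xs \<longrightarrow> (\<forall>i. na i \<le> evn I0 (nenv xs) (senv Xs) T) \<longrightarrow>
     evf I0 (mixe k xs na) (henv m k xs Xs l pr) \<theta> = P na (senv Xs))"

lemma repr_append:
  assumes "repr m k l T p \<theta> P" "okt l p \<theta>" shows "repr m k l T (p @ q) \<theta> P" "okt l (p @ q) \<theta>"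
proof -
  have "evf I0 na (henv m k xs Xs l (p @ q)) \<theta> = evf I0 na (henv m k xs Xs l p) \<theta>" for na xs Xs
    by (rule evf_coinc) (use assms(2) henv_append in \<open>auto simp: okt_def\<close>)
  then show "repr m k l T (p @ q) \<theta> P" using assms(1) by (simp add: repr_def)
  show "okt l (p @ q) \<theta>" using assms(2) by (auto simp: okt_def)
qed

lemma repr_all:
  assumes P: "repr m k l (tops l T t) pr \<theta> P" "okt l pr \<theta>" and t: "pureN t"
  shows "\<exists>\<psi>. okt l pr \<psi> \<and> repr m k l T pr \<psi> (\<lambda>na sa. \<forall>n \<le> evn I0 na sa t. P (n ## na) sa)"
proof -
  have p: "sigB0 \<theta>" "pureF \<theta>" "fvS \<theta> \<subseteq> {..<Suc l + 2 * length pr} - {l}" using P(2) by (auto simp: okt_def)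
  obtain x where x: "\<forall>i\<in>fvNn (shn k l 0 t) \<union> fvN \<theta> \<union> {k}. i < x"
    using finite_nat_set_iff_bounded[of "fvNn (shn k l 0 t) \<union> fvN \<theta> \<union> {k}"] by auto
  \<comment> \<open>The variable pushed by the quantifier sits at \<open>k\<close>. It becomes the
    quantified \<open>x\<close>, and the outer variables return to their places one below.\<close>
  let ?\<sigma> = "\<lambda>i. if i < k then NVar i else if i = k then NVar x else NVar (i - 1)"
  obtain \<theta>' where s: "is_subst \<theta> ?\<sigma> \<theta>'" using subst_ex[OF p(1)] by blast
  let ?\<psi> = "AllLe x (shn k l 0 t) \<theta>'"
  have xf: "x \<notin> fvNn (shn k l 0 t)" using x by auto
  have "okt l pr ?\<psi>" unfolding okt_def
  proof (intro conjI)
    show "sigB0 ?\<psi>" using is_substD(2)[OF s] xf by simp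
    show "pureF ?\<psi>" using is_substD(3)[OF s p(2)] shn_simps(1) by simp
    have "fvS \<theta>' \<subseteq> fvS \<theta>" using is_substD(5)[OF s] by simp
    moreover have "{..<l} \<subseteq> {..<Suc l + 2 * length pr} - {l}" by auto
    ultimately show "fvS ?\<psi> \<subseteq> {..<Suc l + 2 * length pr} - {l}" using p(3) shn_simps(2)[of k l 0 t] by auto
  qed
  moreover have "repr m k l T pr ?\<psi> (\<lambda>na sa. \<forall>n \<le> evn I0 na sa t. P (n ## na) sa)" unfolding repr_def
  proof (intro allI impI)
    fix xs Xs and na :: "nat \<Rightarrow> nat" assume i: "inenv k l xs Xs" and b: "\<forall>i. na i \<le> evn I0 (nenv xs) (senv Xs) T"
    then have l: "length xs = k" "length Xs = l" by (auto simp: inenv_def)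
    let ?h = "henv m k xs Xs l pr"
    have te: "evn I0 (mixe k xs na) ?h (shn k l 0 t) = evn I0 na (senv Xs) t"
      using shn_eval[OF t l(2)] by simp
    have "evf I0 ((mixe k xs na)(x := n)) ?h \<theta>' = P (n ## na) (senv Xs)" if n: "n \<le> evn I0 na (senv Xs) t" for n
    proof -
      have "evf I0 ((mixe k xs na)(x := n)) ?h \<theta>' = evf I0 (mixe k xs (n ## na)) ?h \<theta>"
        unfolding is_substD(1)[OF s]
      proof (rule evf_coinc)
        show "\<forall>i\<in>fvN \<theta>. evn I0 ((mixe k xs na)(x := n)) ?h (?\<sigma> i) = mixe k xs (n ## na) i"
        proof
          fix i assume "i \<in> fvN \<theta>"
          then have ix: "i < x" "k < x" using x by auto
          consider "i < k" | "i = k" | j where "i = k + Suc j" using less_imp_Suc_add by (metis linorder_neqE_nat add_Suc_right)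
          then show "evn I0 ((mixe k xs na)(x := n)) ?h (?\<sigma> i) = mixe k xs (n ## na) i"
            by cases (use ix in auto)
        qed
      qed simp
      also have "\<dots> = P (n ## na) (senv Xs)"
      proof -
        have "\<forall>i. (n ## na) i \<le> evn I0 (nenv xs) (senv Xs) (tops l T t)"
        proof
          fix i show "(n ## na) i \<le> evn I0 (nenv xs) (senv Xs) (tops l T t)"
            using order_trans[OF n tops_le(2)[OF t l(2) b]] order_trans[OF b[rule_format] tops_le(1)[OF t l(2)]] by (cases i) simp_all
        qed
        then show ?thesis using P(1) i unfolding repr_def by blast
      qed
      finally show ?thesis .
    qed
    then show "evf I0 (mixe k xs na) ?h ?\<psi> = (\<forall>n\<le>evn I0 na (senv Xs) t. P (n ## na) (senv Xs))"
      using xf te by simp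
  qed
  ultimately show ?thesis by blast
qed

text \<open>The counts of all rows \<open>n \<mapsto> P (n ## na)\<close> are read off a single counting table: the rows are laid out
one after the other in base \<open>C\<close>, so the count of a row is the difference of two entries. The additional
element at the top makes the table long enough.\<close>

lemma repr_mod:
  assumes P: "repr m k l (tops l T t) pr \<theta> P" "okt l pr \<theta>" and t: "pureN t" and u: "pureN u" and m: "m \<ge> 2"
    and ok: "okp k l (Suc l) pr" and T: "inT k l T"
  shows "\<exists>s \<psi>. okp k l (Suc l) (pr @ [s]) \<and> okt l (pr @ [s]) \<psi> \<and>
    repr m k l T (pr @ [s]) \<psi> (\<lambda>na sa. card {n. n < evn I0 na sa t \<and> P (n ## na) sa} mod m = evn I0 na sa u)"
proof -
  have p: "sigB0 \<theta>" "pureF \<theta>" "fvS \<theta> \<subseteq> {..<Suc l + 2 * length pr} - {l}" using P(2) by (auto simp: okt_def)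
  obtain K where K: "\<forall>i\<in>fvNn t \<union> fvNn u \<union> fvN \<theta>. i < K"
    using finite_nat_set_iff_bounded[of "fvNn t \<union> fvNn u \<union> fvN \<theta>"] by auto
  \<comment> \<open>A bound for the counted variable as well as for the parameters, so that one base
    suits all digits.\<close>
  define T' where "T' = tops l T t"
  have T': "inT k l T'" unfolding T'_def by (rule tops_inT[OF T])
  then have T'p: "pureN T'" "fvNn T' \<subseteq> {..<k}" "fvSn T' \<subseteq> {..<l}" by (auto simp: inT_def)
  \<comment> \<open>A position in a row is coded by \<open>Suc K\<close> digits: the counted value
    and the first \<open>K\<close> parameters, which include all that occur. The digits occupy the
    variables from \<open>k\<close> on, so the code itself is temporarily called
    \<open>q\<close>.\<close>
  define q where "q = k + Suc K"
  define vs where "vs = [k..<q]"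
  have vs: "distinct vs" "set vs \<inter> fvNn T' = {}" "set vs = {k..<q}" "length vs = Suc K"
    using T'p(2) by (auto simp: vs_def q_def)
  \<comment> \<open>Digits are at most \<open>T'\<close>, so base \<open>T'\<close> + 1 makes the
    coding injective.\<close>
  define C where "C = Plus T' One"
  \<comment> \<open>All digits maximal, hence the largest code. The comprehension bound of the new
    step is one more, so that \<open>top\<close> itself can be a member.\<close>
  define top where "top = hterm C (replicate (Suc K) T')"
  define \<phi>1 where "\<phi>1 = And (Eq1 (NVar q) (hterm C (map NVar vs))) (And (Lt (NVar k) (shn k l 1 t)) \<theta>)"
  define \<psi>0 where "\<psi>0 = Or (Eq1 (NVar q) top) (exb T' vs \<phi>1)"
  have topi: "inT k l (Plus top One)"
  proof -
    have "pureN top" unfolding top_def by (rule hterm_simps(2)) (use T'p in \<open>auto simp: C_def\<close>)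
    moreover have "fvNn top \<subseteq> {..<k}" unfolding top_def
      by (rule order_trans[OF hterm_simps(3)]) (use T'p(2) in \<open>auto simp: C_def split: if_splits\<close>)
    moreover have "fvSn top \<subseteq> {..<l}" unfolding top_def
      by (rule order_trans[OF hterm_simps(4)]) (use T'p(3) in \<open>auto simp: C_def split: if_splits\<close>)
    ultimately show ?thesis by (simp add: inT_def)
  qed
  have hv: "pureN (hterm C (map NVar vs))" "fvSn (hterm C (map NVar vs)) \<subseteq> {..<l}"
  proof -
    show "pureN (hterm C (map NVar vs))" by (rule hterm_simps(2)) (use T'p in \<open>auto simp: C_def\<close>)
    show "fvSn (hterm C (map NVar vs)) \<subseteq> {..<l}"
      by (rule order_trans[OF hterm_simps(4)]) (use T'p(3) in \<open>auto simp: C_def\<close>)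
  qed
  have ll: "{..<l} \<subseteq> {..<Suc l + 2 * length pr} - {l}" by auto
  have s0: "sigB0 \<psi>0" unfolding \<psi>0_def \<phi>1_def using exb_simps(1)[OF _ vs(2)] p(1) by simp
  have p0: "pureF \<psi>0" unfolding \<psi>0_def \<phi>1_def using p(2) topi hv(1) shn_simps(1) T'p(1) by (simp add: exb_simps inT_def)
  have S0: "fvS \<psi>0 \<subseteq> {..<Suc l + 2 * length pr} - {l}"
  proof -
    have "fvS \<phi>1 \<subseteq> {..<Suc l + 2 * length pr} - {l}"
      unfolding \<phi>1_def using order_trans[OF hv(2) ll] order_trans[OF shn_simps(2) ll] p(3) by simp
    then have "fvS (exb T' vs \<phi>1) \<subseteq> {..<Suc l + 2 * length pr} - {l}"
      by (intro order_trans[OF exb_simps(4)] Un_least order_trans[OF T'p(3) ll])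
    moreover have "fvSn top \<subseteq> {..<l}" using topi by (simp add: inT_def)
    ultimately show ?thesis unfolding \<psi>0_def using order_trans[OF _ ll] by simp
  qed
  \<comment> \<open>With the digits quantified away, the comprehension variable \<open>k\<close>
    takes the place of \<open>q\<close>; \<open>Zero\<close> is a default for indices that do not
    occur.\<close>
  let ?\<sigma> = "\<lambda>i. if i = q then NVar k else if i < k then NVar i else Zero"
  obtain \<Theta> where \<Theta>: "is_subst \<psi>0 ?\<sigma> \<Theta>" using subst_ex[OF s0] by blast
  let ?s = "(Plus top One, \<Theta>)" and ?pr = "pr @ [(Plus top One, \<Theta>)]"
  have okp': "okp k l (Suc l) ?pr"
  proof -
    have "fvN \<Theta> \<subseteq> (\<Union>i\<in>fvN \<psi>0. fvNn (?\<sigma> i))" by (rule is_substD(4)[OF \<Theta>])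
    also have "\<dots> \<subseteq> {..k}" by (rule UN_least) (auto split: if_splits)
    finally have "fvN \<Theta> \<subseteq> {..k}" .
    moreover have "fvS \<Theta> \<subseteq> fvS \<psi>0" by (rule is_substD(5)[OF \<Theta>]) simp
    moreover have "pureF \<Theta>" by (rule is_substD(3)[OF \<Theta> p0]) simp
    ultimately show ?thesis using ok topi is_substD(2)[OF \<Theta>] S0 by (simp add: okp_append)
  qed
  obtain x where x: "\<forall>i\<in>fvNn (shn k l 0 t) \<union> fvNn (shn k l 0 u) \<union> {k + K}. i < x"
    using finite_nat_set_iff_bounded[of "fvNn (shn k l 0 t) \<union> fvNn (shn k l 0 u) \<union> {k + K}"] by auto
  \<comment> \<open>The code of the first position of a row. The counted value is the least
    significant digit, so the row belonging to given parameters is an interval of codes starting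
    here.\<close>
  define S where "S = hterm C (Zero # map (\<lambda>i. NVar (k + i)) [0..<K])"
  define TV where "TV = shn k l 0 t"
  define U where "U = shn k l 0 u"
  have Sp: "pureN S" unfolding S_def by (rule hterm_simps(2)) (use T'p in \<open>auto simp: C_def\<close>)
  have Sx: "fvNn S \<subseteq> {..<k+K}" unfolding S_def
    by (rule order_trans[OF hterm_simps(3)]) (use T'p(2) in \<open>auto simp: C_def\<close>)
  have SS: "fvSn S \<subseteq> {..<l}" unfolding S_def
    by (rule order_trans[OF hterm_simps(4)]) (use T'p(3) in \<open>auto simp: C_def\<close>)
  have fresh: "y \<notin> fvNn S \<and> y \<notin> fvNn TV \<and> y \<notin> fvNn U" if "x \<le> y" for y
  proof -
    have "i < x" if "i \<in> fvNn S \<or> i \<in> fvNn TV \<or> i \<in> fvNn U" for i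
    proof -
      have "i \<in> fvNn S \<Longrightarrow> i < k + K" using Sx by auto
      moreover have "k + K < x" using x by simp
      ultimately show ?thesis using x that unfolding TV_def U_def by auto
    qed
    then show ?thesis using that not_le by blast
  qed
  have fr: "x \<notin> fvNn S" "Suc x \<notin> fvNn S" "x \<notin> fvNn TV" "Suc x \<notin> fvNn TV" "x \<notin> fvNn U" "Suc x \<notin> fvNn U"
    using fresh[of x] fresh[of "Suc x"] by simp_all
  let ?Y = "SVar (Suc (Suc l + 2 * length pr))"
  \<comment> \<open>The table entries at both ends of the row, compared in the way of
    \<open>mod_count\<close>.\<close>
  define \<chi> where "\<chi> = And (Mem (pairt S (NVar x)) ?Y) (And (Mem (pairt (Plus S TV) (NVar (Suc x))) ?Y)
       (Or (Eq1 (Plus (NVar x) U) (NVar (Suc x))) (Eq1 (Plus (NVar x) U) (Plus (NVar (Suc x)) (numeral_t m)))))"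
  define \<psi> where "\<psi> = And (Lt U (numeral_t m)) (ExLt x (numeral_t m) (ExLt (Suc x) (numeral_t m) \<chi>))"
  have okt': "okt l ?pr \<psi>" unfolding okt_def
  proof (intro conjI)
    show "sigB0 \<psi>" unfolding \<psi>_def \<chi>_def by simp
    show "pureF \<psi>" unfolding \<psi>_def \<chi>_def using Sp shn_simps(1) by (simp add: TV_def U_def)
    have LL: "{..<l} \<subseteq> {..<Suc l + 2 * length ?pr} - {l}" by auto
    have "fvSn S \<subseteq> {..<Suc l + 2 * length ?pr} - {l}" by (rule order_trans[OF SS LL])
    moreover have "fvSn TV \<subseteq> {..<Suc l + 2 * length ?pr} - {l}" unfolding TV_def by (rule order_trans[OF shn_simps(2) LL])
    moreover have "fvSn U \<subseteq> {..<Suc l + 2 * length ?pr} - {l}" unfolding U_def by (rule order_trans[OF shn_simps(2) LL])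
    moreover have "Suc (Suc l + 2 * length pr) \<in> {..<Suc l + 2 * length ?pr} - {l}" by simp
    ultimately show "fvS \<psi> \<subseteq> {..<Suc l + 2 * length ?pr} - {l}" unfolding \<psi>_def \<chi>_def
      by (simp only: fvS_conn fvS.simps pairt_simps fvSn.simps fvSs.simps evn_num Un_subset_iff empty_subsetI insert_subset simp_thms)
  qed
  have "repr m k l T ?pr \<psi> (\<lambda>na sa. card {n. n < evn I0 na sa t \<and> P (n ## na) sa} mod m = evn I0 na sa u)" unfolding repr_def
  proof (intro allI impI)
    fix xs Xs and na :: "nat \<Rightarrow> nat" assume i: "inenv k l xs Xs" and b: "\<forall>i. na i \<le> evn I0 (nenv xs) (senv Xs) T"
    then have l: "length xs = k" "length Xs = l" by (auto simp: inenv_def)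
    let ?h = "henv m k xs Xs l pr" and ?h' = "henv m k xs Xs l ?pr"
    define \<tau> where "\<tau> = evn I0 (nenv xs) (senv Xs) T'"
    define c where "c = \<tau> + 1"
    define b0 where "b0 = hval c (replicate (Suc K) \<tau>)"
    define tv where "tv = evn I0 na (senv Xs) t"
    have T\<tau>: "evn I0 na' (henv m k xs Xs l pr') T' = \<tau>" if "\<forall>i<k. na' i = xs ! i" for na' pr'
      unfolding \<tau>_def by (rule inT_eval(2)[OF T' l that])
    have C\<tau>: "evn I0 na' (henv m k xs Xs l pr') C = c" if "\<forall>i<k. na' i = xs ! i" for na' pr'
      using T\<tau>[OF that] by (simp add: C_def c_def)
    have top\<tau>: "evn I0 na' (henv m k xs Xs l pr') top = b0" if "\<forall>i<k. na' i = xs ! i" for na' pr'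
      unfolding top_def hterm_simps(1) C\<tau>[OF that] map_replicate T\<tau>[OF that] b0_def ..
    have na\<tau>: "na i \<le> \<tau>" for i
      unfolding \<tau>_def T'_def using b tops_le(1)[OF t l(2)] order_trans by blast
    have tv\<tau>: "tv \<le> \<tau>" unfolding tv_def \<tau>_def T'_def by (rule tops_le(2)[OF t l(2) b])
    have Prep: "evf I0 (mixe k xs na') ?h \<theta> = P na' (senv Xs)" if "\<forall>i. na' i \<le> \<tau>" for na'
      using P(1) i that unfolding repr_def \<tau>_def T'_def by blast
    define A where "A = {p. p < b0 + 1 \<and> evf I0 ((nenv xs)(k := p)) ?h \<Theta>}"
    have kn: "\<forall>i<k. nenv xs i = xs ! i" using l by (simp add: nenv_def)
    have h': "?h' = ?h(Suc l + 2 * length pr := A, Suc (Suc l + 2 * length pr) := ctab m A)"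
      unfolding henv_def run_append run.simps Let_def A_def
      using top\<tau>[OF kn, of pr] by (simp add: henv_def)
    define Q where "Q = (\<lambda>p. \<exists>ds. length ds = Suc K \<and> (\<forall>d\<in>set ds. d \<le> \<tau>) \<and> p = hval c ds \<and>
       ds ! 0 < evn I0 (ntl (nenv ds)) (senv Xs) t \<and> P (nenv ds) (senv Xs))"
    have \<Theta>p: "evf I0 ((nenv xs)(k := p)) ?h \<Theta> \<longleftrightarrow> p = b0 \<or> Q p" for p
    proof -
      define \<nu> where "\<nu> = (\<lambda>i. evn I0 ((nenv xs)(k := p)) ?h (?\<sigma> i))"
      have \<nu>: "\<nu> q = p" "\<forall>i<k. \<nu> i = xs ! i" using l by (auto simp: \<nu>_def nenv_def q_def)
      define g where "g = (\<lambda>f i. if i \<in> set vs then f i else \<nu> i)"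
      have g: "g f q = p" "\<forall>i<k. g f i = xs ! i" "i < Suc K \<Longrightarrow> g f (k + i) = f (k + i)" for f i
        using \<nu> by (auto simp: g_def vs(3) q_def)
      have d: "map (g f) vs = map f vs" for f by (simp add: g_def)
      have dn: "nenv (map f vs) i = f (k + i)" if "i < Suc K" for f i
        using that vs(4) by (simp add: nenv_def vs_def q_def del: upt_Suc)
      have e1: "evn I0 (g f) ?h (hterm C (map NVar vs)) = hval c (map f vs)" for f
      proof -
        have "map (evn I0 (g f) ?h) (map NVar vs) = map f vs" using d[of f] by (simp add: comp_def)
        then show ?thesis unfolding hterm_simps(1) C\<tau>[OF g(2)] by (simp only:)
      qed
      have e2: "evn I0 (g f) ?h (shn k l 1 t) = evn I0 (ntl (nenv (map f vs))) (senv Xs) t" for f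
        unfolding shn_eval[OF t l(2)]
      proof (rule ev_coinc)
        show "\<forall>i\<in>fvNn t. g f (k + 1 + i) = ntl (nenv (map f vs)) i"
        proof
          fix i assume "i \<in> fvNn t"
          then have "Suc i < Suc K" using K by simp
          then show "g f (k + 1 + i) = ntl (nenv (map f vs)) i" using g(3)[of "Suc i" f] dn[of "Suc i" f] by (simp add: ntl_def)
        qed
      qed simp
      have e3: "evf I0 (g f) ?h \<theta> = P (nenv (map f vs)) (senv Xs)" if "\<forall>v\<in>set vs. f v \<le> \<tau>" for f
      proof -
        have "evf I0 (g f) ?h \<theta> = evf I0 (mixe k xs (nenv (map f vs))) ?h \<theta>"
        proof (rule evf_coinc)
          show "\<forall>i\<in>fvN \<theta>. g f i = mixe k xs (nenv (map f vs)) i"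
          proof
            fix i assume "i \<in> fvN \<theta>"
            then have "i < K" using K by simp
            then show "g f i = mixe k xs (nenv (map f vs)) i"
              using g(2)[of f] g(3)[of "i - k" f] dn[of "i - k" f] by (cases "i < k") (simp_all add: mixe_def)
          qed
        qed simp
        also have "\<dots> = P (nenv (map f vs)) (senv Xs)"
        proof (rule Prep, rule allI)
          fix i show "nenv (map f vs) i \<le> \<tau>"
            using that dn[of i f] vs by (cases "i < Suc K") (auto simp: nenv_def q_def)
        qed
        finally show ?thesis .
      qed
      have e4: "evn I0 (g f) ?h (NVar k) = map f vs ! 0" for f
        using g(3)[of 0 f] vs(4) by (simp add: vs_def q_def del: upt_Suc)
      have \<phi>: "evf I0 (g f) ?h \<phi>1 \<longleftrightarrow> p = hval c (map f vs) \<and> map f vs ! 0 < evn I0 (ntl (nenv (map f vs))) (senv Xs) t \<and> P (nenv (map f vs)) (senv Xs)"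
        if "\<forall>v\<in>set vs. f v \<le> \<tau>" for f
        unfolding \<phi>1_def evf_conn evf.simps e1 e2 e3[OF that] e4 using g(1) by simp
      have "evf I0 ((nenv xs)(k := p)) ?h \<Theta> = evf I0 \<nu> ?h \<psi>0" unfolding \<nu>_def by (rule is_substD(1)[OF \<Theta>])
      also have "\<dots> \<longleftrightarrow> p = b0 \<or> (\<exists>f. (\<forall>v\<in>set vs. f v \<le> \<tau>) \<and> evf I0 (g f) ?h \<phi>1)"
        unfolding \<psi>0_def evf_conn evf.simps exb_iff[OF vs(1,2)] T\<tau>[OF \<nu>(2)] top\<tau>[OF \<nu>(2)] g_def using \<nu>(1) by simp
      also have "\<dots> \<longleftrightarrow> p = b0 \<or> Q p"
      proof -
        have "(\<exists>f. (\<forall>v\<in>set vs. f v \<le> \<tau>) \<and> evf I0 (g f) ?h \<phi>1) \<longleftrightarrow> Q p"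
        proof
          assume "\<exists>f. (\<forall>v\<in>set vs. f v \<le> \<tau>) \<and> evf I0 (g f) ?h \<phi>1"
          then obtain f where f: "\<forall>v\<in>set vs. f v \<le> \<tau>" "evf I0 (g f) ?h \<phi>1" by blast
          show "Q p" unfolding Q_def
            by (rule exI[of _ "map f vs"]) (use f(1) f(2)[unfolded \<phi>[OF f(1)]] vs(4) in simp)
        next
          assume "Q p"
          then obtain ds where ds: "length ds = Suc K" "\<forall>d\<in>set ds. d \<le> \<tau>" "p = hval c ds"
            "ds ! 0 < evn I0 (ntl (nenv ds)) (senv Xs) t" "P (nenv ds) (senv Xs)" unfolding Q_def by blast
          define f where "f = (\<lambda>v. ds ! (v - k))"
          have m: "map f vs = ds" by (rule nth_equalityI) (use ds(1) vs(4) in \<open>simp_all add: f_def vs_def q_def del: upt_Suc\<close>)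
          have "\<forall>v\<in>set vs. f v \<le> \<tau>"
          proof
            fix v assume "v \<in> set vs"
            then have "f v \<in> set (map f vs)" by simp
            then show "f v \<le> \<tau>" using ds(2) m by simp
          qed
          then show "\<exists>f. (\<forall>v\<in>set vs. f v \<le> \<tau>) \<and> evf I0 (g f) ?h \<phi>1"
            using \<phi>[of f] ds m by (intro exI[of _ f]) simp
        qed
        then show ?thesis by simp
      qed
      finally show ?thesis .
    qed
    define ns where "ns = map na [0..<K]"
    define s0 where "s0 = hval c (0 # ns)"
    have sn: "hval c (n # ns) = s0 + n" for n by (simp add: s0_def)
    have le0: "s0 + n \<le> b0" if "n \<le> \<tau>" for n
      unfolding sn[symmetric] b0_def
    proof (rule hval_mono)
      show "\<forall>i<length (n # ns). (n # ns) ! i \<le> replicate (Suc K) \<tau> ! i"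
      proof (intro allI impI)
        fix i assume "i < length (n # ns)"
        then show "(n # ns) ! i \<le> replicate (Suc K) \<tau> ! i"
          using that na\<tau> by (cases i) (simp_all add: ns_def)
      qed
    qed (simp add: ns_def)
    have row: "s0 + n \<in> A \<longleftrightarrow> P (n ## na) (senv Xs)" if n: "n < tv" for n
    proof -
      \<comment> \<open>Below the added top element, so membership is decided by the row condition
        alone.\<close>
      have lt: "s0 + n < b0" using le0[OF tv\<tau>] n by simp
      have nb: "\<forall>d\<in>set (n # ns). d \<le> \<tau>" using n tv\<tau> na\<tau> by (auto simp: ns_def)
      have tn: "evn I0 (ntl (nenv (n # ns))) (senv Xs) t = tv" unfolding tv_def
      proof (rule ev_coinc)
        show "\<forall>i\<in>fvNn t. ntl (nenv (n # ns)) i = na i" using K by (simp add: ntl_def nenv_def ns_def)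
      qed simp
      have Pn: "P (nenv (n # ns)) (senv Xs) = P (n ## na) (senv Xs)"
      proof -
        have 1: "\<forall>i. nenv (n # ns) i \<le> \<tau>"
        proof
          fix i show "nenv (n # ns) i \<le> \<tau>"
          proof (cases "i < length (n # ns)")
            case True
            then have "(n # ns) ! i \<le> \<tau>" using nb nth_mem by blast
            then show ?thesis using True by (simp add: nenv_def)
          qed (simp add: nenv_def)
        qed
        have 2: "\<forall>i. (n ## na) i \<le> \<tau>"
        proof
          fix i show "(n ## na) i \<le> \<tau>" using nb na\<tau> by (cases i) simp_all
        qed
        have "evf I0 (mixe k xs (nenv (n # ns))) ?h \<theta> = evf I0 (mixe k xs (n ## na)) ?h \<theta>"
        proof (rule evf_coinc)
          show "\<forall>i\<in>fvN \<theta>. mixe k xs (nenv (n # ns)) i = mixe k xs (n ## na) i"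
          proof
            fix i assume "i \<in> fvN \<theta>"
            then have "i < K" using K by simp
            then have "i - k < K" by simp
            then show "mixe k xs (nenv (n # ns)) i = mixe k xs (n ## na) i"
              by (cases "i - k") (simp_all add: mixe_def nenv_def ns_def)
          qed
        qed simp
        then show ?thesis using Prep[OF 1] Prep[OF 2] by simp
      qed
      have "s0 + n \<in> A \<longleftrightarrow> Q (s0 + n)" unfolding A_def mem_Collect_eq \<Theta>p using lt by auto
      also have "\<dots> \<longleftrightarrow> P (n ## na) (senv Xs)"
      proof
        assume "Q (s0 + n)"
        then obtain ds where ds: "length ds = Suc K" "\<forall>d\<in>set ds. d \<le> \<tau>" "s0 + n = hval c ds" "P (nenv ds) (senv Xs)"
          unfolding Q_def by blast
        \<comment> \<open>By injectivity of the coding, no other row can contain this code.\<close>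
        have "ds = n # ns"
        proof (rule hval_inj)
          show "length ds = length (n # ns)" using ds(1) by (simp add: ns_def)
          show "hval c ds = hval c (n # ns)" using ds(3) sn by simp
        qed (use ds(2) nb in \<open>auto simp: c_def less_Suc_eq_le\<close>)
        then show "P (n ## na) (senv Xs)" using ds(4) Pn by simp
      next
        assume "P (n ## na) (senv Xs)"
        then show "Q (s0 + n)" unfolding Q_def using nb tn Pn n sn
          by (intro exI[of _ "n # ns"]) (simp add: ns_def)
      qed
      finally show ?thesis .
    qed
    let ?N = "card {n. n < tv \<and> P (n ## na) (senv Xs)}"
    \<comment> \<open>Below the end of the row lie the elements below its start and a shifted copy
      of the counted values.\<close>
    have cnt: "card {p\<in>A. p < s0 + tv} = card {p\<in>A. p < s0} + ?N"
    proof -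
      have "{p\<in>A. p < s0 + tv} = {p\<in>A. p < s0} \<union> (\<lambda>n. s0 + n) ` {n. n < tv \<and> P (n ## na) (senv Xs)}" (is "?L = ?R")
      proof (rule set_eqI)
        fix p show "p \<in> ?L \<longleftrightarrow> p \<in> ?R"
        proof (cases "p < s0")
          case True then show ?thesis by auto
        next
          case False
          then obtain n where n: "p = s0 + n" using le_Suc_ex not_less by blast
          then show ?thesis using row[of n] by auto
        qed
      qed
      moreover have "card ({p\<in>A. p < s0} \<union> (\<lambda>n. s0 + n) ` {n. n < tv \<and> P (n ## na) (senv Xs)}) =
          card {p\<in>A. p < s0} + card ((\<lambda>n. s0 + n) ` {n. n < tv \<and> P (n ## na) (senv Xs)})"
        by (rule card_Un_disjoint) auto
      moreover have "card ((\<lambda>n. s0 + n) ` {n. n < tv \<and> P (n ## na) (senv Xs)}) = ?N"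
        by (rule card_image) simp
      ultimately show ?thesis by simp
    qed
    \<comment> \<open>Membership of the top element forces the length of \<open>A\<close> above
      \<open>b0\<close>, so the table has both rows that are read.\<close>
    have "b0 \<in> A" unfolding A_def mem_Collect_eq \<Theta>p by simp
    moreover have "finite A" unfolding A_def by simp
    ultimately have bA: "b0 < slen A" using slen_props(1) by blast
    have mk: "\<forall>i<k. mixe k xs na i = xs ! i" by simp
    let ?e = "mixe k xs na"
    have S: "evn I0 ?e ?h' S = s0"
    proof -
      have "map (evn I0 ?e ?h') (Zero # map (\<lambda>i. NVar (k + i)) [0..<K]) = 0 # ns" by (simp add: ns_def comp_def)
      then show ?thesis unfolding S_def hterm_simps(1) C\<tau>[OF mk] s0_def by (simp only:)
    qed
    have TV: "evn I0 ?e ?h' TV = tv" unfolding TV_def shn_eval[OF t l(2)] tv_def by simp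
    have U: "evn I0 ?e ?h' U = evn I0 na (senv Xs) u" unfolding U_def shn_eval[OF u l(2)] by simp
    have Y: "?h' (Suc (Suc l + 2 * length pr)) = ctab m A" unfolding h' by simp
    have pr: "evn I0 na' sa' (pairt a a') = npair (evn I0 na' sa' a) (evn I0 na' sa' a')" for na' sa' a a'
      by (simp add: pairt_def mpair_def)
    have y: "evn I0 (?e(x := y1, Suc x := y2)) ?h' S = s0" "evn I0 (?e(x := y1, Suc x := y2)) ?h' TV = tv"
       "evn I0 (?e(x := y1, Suc x := y2)) ?h' U = evn I0 na (senv Xs) u" for y1 y2
      using fr S TV U by simp_all
    have \<chi>: "evf I0 (?e(x := y1, Suc x := y2)) ?h' \<chi> \<longleftrightarrow> y1 = mod_fn m s0 A \<and> y2 = mod_fn m (s0 + tv) A \<and>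
       (y1 + evn I0 na (senv Xs) u = y2 \<or> y1 + evn I0 na (senv Xs) u = y2 + m)" for y1 y2
    proof -
      have "s0 + tv \<le> slen A" "s0 \<le> slen A" using le0[OF tv\<tau>] bA by simp_all
      then show ?thesis unfolding \<chi>_def evf_conn evf.simps pr evn.simps evs.simps y Y
        by (simp add: ctab_mem y)
    qed
    have ml: "mod_fn m z A < m" for z using m by (simp add: mod_fn_def)
    have "evf I0 ?e ?h' \<psi> \<longleftrightarrow> evn I0 na (senv Xs) u < m \<and> (\<exists>y1<m. \<exists>y2<m. evf I0 (?e(x := y1, Suc x := y2)) ?h' \<chi>)"
      unfolding \<psi>_def using U by simp
    also have "\<dots> \<longleftrightarrow> evn I0 na (senv Xs) u < m \<and> (mod_fn m s0 A + evn I0 na (senv Xs) u = mod_fn m (s0 + tv) A \<or>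
       mod_fn m s0 A + evn I0 na (senv Xs) u = mod_fn m (s0 + tv) A + m)"
      unfolding \<chi> using ml by blast
    also have "\<dots> \<longleftrightarrow> ?N mod m = evn I0 na (senv Xs) u"
      unfolding mod_fn_def cnt by (rule mod_count[symmetric]) (use m in simp)
    finally show "evf I0 ?e ?h' \<psi> = (card {n. n < evn I0 na (senv Xs) t \<and> P (n ## na) (senv Xs)} mod m = evn I0 na (senv Xs) u)"
      unfolding tv_def .
  qed
  then show ?thesis using okp' okt' by blast
qed

text \<open>A program is only ever extended: appended steps write to new variables, so formulas
  found for other subformulas stay correct. The bound \<open>T\<close> is arbitrary in the
  induction, since a quantifier asks for its body under the larger bound
  \<open>tops l T t\<close>.\<close>

theorem MR_prog:
  assumes m: "m \<ge> 2"
  shows "MR m P \<Longrightarrow> okp k l (Suc l) pr \<Longrightarrow> inT k l T \<Longrightarrow>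
    \<exists>ext \<theta>. okp k l (Suc l) (pr @ ext) \<and> okt l (pr @ ext) \<theta> \<and> repr m k l T (pr @ ext) \<theta> P"
proof (induction arbitrary: pr T rule: MR.induct)
  case (MR_eq s t)
  have "okt l pr (Eq1 (shn k l 0 s) (shn k l 0 t))" using shn_simps(1) shn_simps(2)[of k l 0] by (fastforce simp: okt_def)
  moreover have "repr m k l T pr (Eq1 (shn k l 0 s) (shn k l 0 t)) (\<lambda>na sa. evn I0 na sa s = evn I0 na sa t)"
    using MR_eq by (simp add: repr_def inenv_def shn_eval)
  ultimately show ?case using MR_eq by (intro exI[of _ "[]"]) auto
next
  case (MR_le s t)
  have "okt l pr (Le (shn k l 0 s) (shn k l 0 t))" using shn_simps(1) shn_simps(2)[of k l 0] by (fastforce simp: okt_def)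
  moreover have "repr m k l T pr (Le (shn k l 0 s) (shn k l 0 t)) (\<lambda>na sa. evn I0 na sa s \<le> evn I0 na sa t)"
    using MR_le by (simp add: repr_def inenv_def shn_eval)
  ultimately show ?case using MR_le by (intro exI[of _ "[]"]) auto
next
  case (MR_mem s X)
  let ?\<theta> = "if X < l then Mem (shn k l 0 s) (SVar X) else Bot"
  have "okt l pr ?\<theta>" using shn_simps(1) shn_simps(2)[of k l 0] by (fastforce simp: okt_def)
  moreover have "repr m k l T pr ?\<theta> (\<lambda>na sa. evn I0 na sa s \<in> sa X)"
    using MR_mem by (auto simp add: repr_def inenv_def shn_eval henv_lower(1) senv_def)
  ultimately show ?case using MR_mem by (intro exI[of _ "[]"]) auto
next
  case (MR_imp P Q)
  obtain e1 \<theta>1 where 1: "okp k l (Suc l) (pr @ e1)" "okt l (pr @ e1) \<theta>1" "repr m k l T (pr @ e1) \<theta>1 P"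
    using MR_imp.IH(1)[OF MR_imp.prems] by blast
  obtain e2 \<theta>2 where 2: "okp k l (Suc l) ((pr @ e1) @ e2)" "okt l ((pr @ e1) @ e2) \<theta>2" "repr m k l T ((pr @ e1) @ e2) \<theta>2 Q"
    using MR_imp.IH(2)[OF 1(1) MR_imp.prems(2)] by blast
  note r = repr_append[OF 1(3,2), of e2]
  have "okt l (pr @ (e1 @ e2)) (Imp \<theta>1 \<theta>2)" using r(2) 2(2) by (simp add: okt_def)
  moreover have "repr m k l T (pr @ (e1 @ e2)) (Imp \<theta>1 \<theta>2) (\<lambda>na sa. P na sa \<longrightarrow> Q na sa)"
    using r(1) 2(3) by (simp add: repr_def)
  ultimately show ?case using 2(1) by (metis append.assoc)
next
  case (MR_all t P)
  obtain e \<theta> where 1: "okp k l (Suc l) (pr @ e)" "okt l (pr @ e) \<theta>" "repr m k l (tops l T t) (pr @ e) \<theta> P"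
    using MR_all.IH[OF MR_all.prems(1) tops_inT[OF MR_all.prems(2)]] by blast
  then show ?case using repr_all[OF 1(3,2) MR_all.hyps(1)] by blast
next
  case (MR_mod t u P)
  obtain e \<theta> where 1: "okp k l (Suc l) (pr @ e)" "okt l (pr @ e) \<theta>" "repr m k l (tops l T t) (pr @ e) \<theta> P"
    using MR_mod.IH[OF MR_mod.prems(1) tops_inT[OF MR_mod.prems(2)]] by blast
  obtain s \<psi> where "okp k l (Suc l) ((pr @ e) @ [s])" "okt l ((pr @ e) @ [s]) \<psi>"
    "repr m k l T ((pr @ e) @ [s]) \<psi> (\<lambda>na sa. card {n. n < evn I0 na sa t \<and> P (n ## na) sa} mod m = evn I0 na sa u)"
    using repr_mod[OF 1(3,2) MR_mod.hyps(1,2) m 1(1) MR_mod.prems(2)] by blast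
  then show ?case by (intro exI[of _ "e @ [s]"] exI[of _ \<psi>]) simp
next
  case (MR_cong P Q)
  obtain e \<theta> where 1: "okp k l (Suc l) (pr @ e)" "okt l (pr @ e) \<theta>" "repr m k l T (pr @ e) \<theta> P"
    using MR_cong.IH[OF MR_cong.prems] by blast
  have "repr m k l T (pr @ e) \<theta> Q" using 1(3) MR_cong.hyps(2) fin_senv by (simp add: repr_def inenv_def)
  then show ?case using 1 by blast
qed

section \<open>Ultrapowers and witnessing\<close>

subsection \<open>Ultrafilters\<close>

definition ultra :: "'a set set \<Rightarrow> bool" where
  "ultra U \<longleftrightarrow> {} \<notin> U \<and> (\<forall>A\<in>U. \<forall>B. A \<subseteq> B \<longrightarrow> B \<in> U) \<and> (\<forall>A\<in>U. \<forall>B\<in>U. A \<inter> B \<in> U) \<and> (\<forall>A. A \<in> U \<or> - A \<in> U)"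

definition fip :: "'a set set \<Rightarrow> bool" where
  "fip S \<longleftrightarrow> (\<forall>F\<subseteq>S. finite F \<longrightarrow> \<Inter>F \<noteq> {})"

lemma ultra_ex:
  assumes "fip S" shows "\<exists>U. ultra U \<and> S \<subseteq> U"
proof -
  let ?A = "{T. S \<subseteq> T \<and> fip T}"
  have "\<exists>M\<in>?A. \<forall>X\<in>?A. M \<subseteq> X \<longrightarrow> X = M"
  proof (rule subset_Zorn_nonempty)
    show "?A \<noteq> {}" using assms by blast
    fix C assume C: "C \<noteq> {}" "subset.chain ?A C"
    have sub: "\<exists>T\<in>C. F \<subseteq> T" if "finite F" "F \<subseteq> \<Union>C" for F
      using that
    proof (induction F)
      case empty then show ?case using C(1) by blast
    next
      case (insert a F)
      then obtain T T' where T: "T \<in> C" "F \<subseteq> T" "T' \<in> C" "a \<in> T'" by auto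
      have "T \<subseteq> T' \<or> T' \<subseteq> T" using C(2) T(1,3) by (simp add: subset_chain_def)
      then show ?case using T by blast
    qed
    have "fip (\<Union>C)" unfolding fip_def
    proof (intro allI impI)
      fix F assume "F \<subseteq> \<Union>C" "finite F"
      then obtain T where T: "T \<in> C" "F \<subseteq> T" using sub by blast
      then have "fip T" using C(2) by (auto simp: subset_chain_def)
      then show "\<Inter>F \<noteq> {}" using T \<open>finite F\<close> unfolding fip_def by blast
    qed
    moreover have "S \<subseteq> \<Union>C"
    proof -
      obtain T where "T \<in> C" using C(1) by blast
      moreover have "S \<subseteq> T" using C(2) calculation by (auto simp: subset_chain_def)
      ultimately show ?thesis by blast
    qed
    ultimately show "\<Union>C \<in> ?A" by blast
  qed
  then obtain U where U0: "U \<in> ?A" "\<forall>X\<in>?A. U \<subseteq> X \<longrightarrow> X = U" by (rule bexE)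
  then have U: "S \<subseteq> U" "fip U" by simp_all
  have mx: "X = U" if "S \<subseteq> X" "fip X" "U \<subseteq> X" for X using U0(2) that by simp
  \<comment> \<open>The use of maximality: whatever contains a finite intersection of members is a
    member. Closure under supersets and intersections and the decision between a set and its
    complement follow.\<close>
  have add: "B \<in> U" if F: "F \<subseteq> U" "finite F" "\<Inter>F \<subseteq> B" for F B
  proof -
    have "fip (insert B U)" unfolding fip_def
    proof (intro allI impI)
      fix G assume G: "G \<subseteq> insert B U" "finite G"
      have "(G - {B}) \<union> F \<subseteq> U" "finite ((G - {B}) \<union> F)" using G F by auto
      then have "\<Inter>((G - {B}) \<union> F) \<noteq> {}" using U(2) unfolding fip_def by blast
      moreover have "\<Inter>((G - {B}) \<union> F) \<subseteq> \<Inter>G" using F(3) by auto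
      ultimately show "\<Inter>G \<noteq> {}" by blast
    qed
    then have "insert B U = U" by (intro mx) (use U in auto)
    then show ?thesis by blast
  qed
  have "{} \<notin> U"
  proof
    assume "{} \<in> U"
    then have "\<Inter>{{}} \<noteq> ({} :: 'a set)" using U(2) unfolding fip_def by (metis empty_subsetI finite.simps insert_subset)
    then show False by simp
  qed
  note u1 = this
  have u2: "B \<in> U" if "A \<in> U" "A \<subseteq> B" for A B using add[of "{A}" B] that by simp
  have u3: "A \<inter> B \<in> U" if "A \<in> U" "B \<in> U" for A B using add[of "{A, B}" "A \<inter> B"] that by simp
  have u4: "- A \<in> U" if n: "A \<notin> U" for A
  proof -
    have "insert A U \<noteq> U" using n by blast
    then have "\<not> fip (insert A U)" using mx[of "insert A U"] U(1) by auto
    then obtain G where G: "G \<subseteq> insert A U" "finite G" "\<Inter>G = {}" unfolding fip_def by auto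
    have "\<Inter>(G - {A}) \<subseteq> - A" using G(3) by auto
    moreover have "G - {A} \<subseteq> U" using G(1) by auto
    ultimately show ?thesis using add[of "G - {A}" "- A"] G(2) by simp
  qed
  have u5: "A \<in> U \<or> - A \<in> U" for A using u4[of A] by blast
  have "ultra U" unfolding ultra_def by (intro conjI ballI allI impI u1 u5; (rule u2 u3; assumption))
  then show ?thesis using U(1) by (intro exI[of _ U] conjI)
qed

text \<open>Without a finite subcover, \<open>X0\<close> and the complements of the sets in
  \<open>QQ\<close> have the finite intersection property, and an ultrafilter containing them all
  contradicts the hypothesis.\<close>

lemma ultra_compact:
  assumes "\<And>U. ultra U \<Longrightarrow> X0 \<in> U \<Longrightarrow> \<exists>Q\<in>QQ. Q \<in> U"
  shows "\<exists>F\<subseteq>QQ. finite F \<and> X0 \<subseteq> \<Union>F"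
proof (rule ccontr)
  assume n: "\<not> ?thesis"
  have "fip (insert X0 (uminus ` QQ))" unfolding fip_def
  proof (intro allI impI)
    fix G assume G: "G \<subseteq> insert X0 (uminus ` QQ)" "finite G"
    have "uminus ` (G - {X0}) \<subseteq> QQ" using G(1) by auto
    moreover have "finite (uminus ` (G - {X0}))" using G(2) by simp
    ultimately have "\<not> X0 \<subseteq> \<Union>(uminus ` (G - {X0}))" using n by simp
    then obtain x where x: "x \<in> X0" "x \<notin> \<Union>(uminus ` (G - {X0}))" unfolding subset_iff by auto
    have "x \<in> \<Inter>G"
    proof
      fix A assume "A \<in> G"
      then show "x \<in> A" using x by (cases "A = X0") auto
    qed
    then show "\<Inter>G \<noteq> {}" by auto
  qed
  from ultra_ex[OF this] obtain U where U: "ultra U" "insert X0 (uminus ` QQ) \<subseteq> U" by (elim exE conjE)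
  have "X0 \<in> U" using U(2) by simp
  from assms[OF U(1) this] obtain Q where Q: "Q \<in> QQ" "Q \<in> U" by (elim bexE)
  have "- Q \<in> U" using U(2) Q(1) by auto
  moreover have "\<forall>A\<in>U. \<forall>B\<in>U. A \<inter> B \<in> U" using U(1) unfolding ultra_def by (elim conjE)
  ultimately have "Q \<inter> - Q \<in> U" using Q(2) by blast
  then show False using U(1) unfolding ultra_def by simp
qed

subsection \<open>Soundness\<close>

text \<open>Equality may be interpreted by relations other than identity; that they are reflexive
  and respected by all formulas is therefore assumed, as is closure of the number domain under
  terms.\<close>

lemma soundness:
  assumes T: "pureT T" "models M T"
    and cl: "\<And>na sa u. valid_env M na sa \<Longrightarrow> pureN u \<Longrightarrow> mev M na sa u \<in> mN M"
    and r: "\<And>a. meq1 M a a" "\<And>a. meq2 M a a"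
    and c1: "\<And>\<phi> na sa x a b. pureF \<phi> \<Longrightarrow> meq1 M a b \<Longrightarrow> msat M (na(x:=a)) sa \<phi> \<Longrightarrow> msat M (na(x:=b)) sa \<phi>"
    and c2: "\<And>\<phi> na sa x a b. pureF \<phi> \<Longrightarrow> meq2 M a b \<Longrightarrow> msat M na (sa(x:=a)) \<phi> \<Longrightarrow> msat M na (sa(x:=b)) \<phi>"
  shows "prv T \<phi> \<Longrightarrow> valid_env M na sa \<Longrightarrow> msat M na sa \<phi>"
proof (induction arbitrary: na sa rule: prv.induct)
  case (Ax \<phi>) then show ?case using T(2) unfolding models_def by blast
next
  case (Q1N \<phi> u x)
  then show ?case using cl[OF Q1N.prems Q1N.hyps(2)] msat_sbN[OF Q1N.hyps, of M na sa] by simp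
next
  case (Q1S \<phi> Y X)
  have "sa Y \<in> mS M" using Q1S.prems unfolding valid_env_def by blast
  then show ?case using msat_sbS[OF Q1S.hyps, of M na sa] by simp
next
  case (Q2N \<phi> \<psi> x)
  then show ?case using msat_upd(1)[OF Q2N.hyps(1,3), of M na _ sa] by (simp del: fun_upd_apply)
next
  case (Q2S \<phi> \<psi> x)
  then show ?case using msat_upd(2)[OF Q2S.hyps(1,3), of M na sa] by (simp del: fun_upd_apply)
next
  case (E2N \<phi> y x)
  then show ?case using msat_sbN[OF E2N.hyps(1) _ E2N.hyps(2), of M na sa] c1[OF E2N.hyps(1), of "na x" "na y" na x sa] by simp
next
  case (E2S \<phi> y x)
  then show ?case using msat_sbS[OF E2S.hyps, of M na sa] c2[OF E2S.hyps(1), of "sa x" "sa y" na sa x] by simp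
next
  case (MP \<phi> \<psi>)
  then show ?case by simp
next
  case (GenN \<phi> x)
  have "valid_env M (na(x:=n)) sa" if "n \<in> mN M" for n using GenN.prems that by (simp add: valid_env_def)
  then show ?case unfolding msat.simps by (intro ballI GenN.IH)
next
  case (GenS \<phi> x)
  have "valid_env M na (sa(x:=n))" if "n \<in> mS M" for n using GenS.prems that by (simp add: valid_env_def)
  then show ?case unfolding msat.simps by (intro ballI GenS.IH)
qed (simp_all add: r)

subsection \<open>Further closure properties\<close>

text \<open>Bounded minimization stays in the class because being the least solution is a bounded
  condition. The default 0 lies below every bound.\<close>

lemma GN_least:
  assumes f: "GN m f" and Q: "MR m (\<lambda>na sa. Q (na 0) (ntl na) sa)"
  shows "GN m (\<lambda>na sa. if \<exists>n \<le> f na sa. Q n na sa then LEAST n. Q n na sa else 0)" (is "GN m ?w")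
proof -
  obtain b where b: "pureN b" "\<And>na sa. fin sa \<Longrightarrow> f na sa \<le> evn I0 na sa b" using GN_bound[OF f] by blast
  have wf: "?w na sa \<le> f na sa" for na sa
  proof (cases "\<exists>n \<le> f na sa. Q n na sa")
    case True
    then obtain n where "n \<le> f na sa" "Q n na sa" by blast
    have "(LEAST n. Q n na sa) \<le> f na sa"
      by (rule order_trans[OF Least_le[of "\<lambda>n. Q n na sa", OF \<open>Q n na sa\<close>] \<open>n \<le> f na sa\<close>])
    then show ?thesis using True by (simp only: if_True)
  next
    case False
    then show ?thesis by (simp only: if_False)
  qed
  have "MR m (\<lambda>na sa. (\<not> (\<exists>n \<le> f (ntl na) sa. Q n (ntl na) sa) \<and> na 0 = 0) \<or>
     ((na 0 \<le> f (ntl na) sa \<and> Q (na 0) (ntl na) sa) \<and> (\<forall>n < na 0. \<not> Q n (ntl na) sa)))"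
    by (intro MR_or MR_and MR_not MR_exI MR_alllI MR_eqI MR_leI GN_var GN_const GN_tl[OF f] MR_skip[of m Q] Q)
  moreover have "(na 0 = ?w (ntl na) sa) \<longleftrightarrow> (\<not> (\<exists>n \<le> f (ntl na) sa. Q n (ntl na) sa) \<and> na 0 = 0) \<or>
     ((na 0 \<le> f (ntl na) sa \<and> Q (na 0) (ntl na) sa) \<and> (\<forall>n < na 0. \<not> Q n (ntl na) sa))" for na sa
  proof (cases "\<exists>n \<le> f (ntl na) sa. Q n (ntl na) sa")
    case True
    then obtain n where n: "n \<le> f (ntl na) sa" "Q n (ntl na) sa" by blast
    let ?l = "LEAST n. Q n (ntl na) sa"
    have l1: "Q ?l (ntl na) sa" by (rule LeastI[of "\<lambda>n. Q n (ntl na) sa", OF n(2)])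
    have l2: "?l \<le> f (ntl na) sa" by (rule order_trans[OF Least_le[of "\<lambda>n. Q n (ntl na) sa", OF n(2)] n(1)])
    have l3: "\<not> Q i (ntl na) sa" if "i < ?l" for i by (rule not_less_Least[OF that])
    have "na 0 = ?l \<longleftrightarrow> (na 0 \<le> f (ntl na) sa \<and> Q (na 0) (ntl na) sa) \<and> (\<forall>n < na 0. \<not> Q n (ntl na) sa)"
    proof
      assume e: "na 0 = ?l"
      show "(na 0 \<le> f (ntl na) sa \<and> Q (na 0) (ntl na) sa) \<and> (\<forall>n < na 0. \<not> Q n (ntl na) sa)"
        unfolding e by (intro conjI allI impI l1 l2 l3)
    next
      assume h: "(na 0 \<le> f (ntl na) sa \<and> Q (na 0) (ntl na) sa) \<and> (\<forall>n < na 0. \<not> Q n (ntl na) sa)"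
      have "?l = na 0"
      proof (rule Least_equality)
        show "Q (na 0) (ntl na) sa" using h by blast
        fix y assume "Q y (ntl na) sa"
        then have "\<not> y < na 0" using h by blast
        then show "na 0 \<le> y" by simp
      qed
      then show "na 0 = ?l" by (rule sym)
    qed
    then show ?thesis using True by (simp only: if_True simp_thms)
  next
    case False
    moreover have "\<not> (na 0 \<le> f (ntl na) sa \<and> Q (na 0) (ntl na) sa)" using False by blast
    ultimately show ?thesis by (simp only: if_False simp_thms)
  qed
  ultimately have "MR m (\<lambda>na sa. na 0 = ?w (ntl na) sa)" by (rule MR_cong)
  moreover have "?w na sa \<le> evn I0 na sa b" if "fin sa" for na sa using order_trans[OF wf b(2)[OF that]] .
  ultimately show ?thesis unfolding GN_def using b(1) by blast
qed

lemma GS_cong: assumes "GS m G" "\<And>na sa. fin sa \<Longrightarrow> F na sa = G na sa" shows "GS m F"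
proof -
  obtain t where t: "pureN t" "\<forall>na sa. fin sa \<longrightarrow> finite (G na sa) \<and> slen (G na sa) \<le> evn I0 na sa t" and
    g: "MR m (\<lambda>na sa. na 0 \<in> G (ntl na) sa)" using assms(1) unfolding GS_def by blast
  have "MR m (\<lambda>na sa. na 0 \<in> F (ntl na) sa)" by (rule MR_cong[OF g]) (simp add: assms(2))
  moreover have "\<forall>na sa. fin sa \<longrightarrow> finite (F na sa) \<and> slen (F na sa) \<le> evn I0 na sa t" using t(2) assms(2) by simp
  ultimately show ?thesis unfolding GS_def using t(1) by blast
qed

lemma GN_cong: assumes "GN m G" "\<And>na sa. fin sa \<Longrightarrow> F na sa = G na sa" shows "GN m F"
proof -
  obtain t where t: "pureN t" "\<forall>na sa. fin sa \<longrightarrow> G na sa \<le> evn I0 na sa t" and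
    g: "MR m (\<lambda>na sa. na 0 = G (ntl na) sa)" using assms(1) unfolding GN_def by blast
  have "MR m (\<lambda>na sa. na 0 = F (ntl na) sa)" by (rule MR_cong[OF g]) (simp add: assms(2))
  moreover have "\<forall>na sa. fin sa \<longrightarrow> F na sa \<le> evn I0 na sa t" using t(2) assms(2) by simp
  ultimately show ?thesis unfolding GN_def using t(1) by blast
qed

lemma GS_if: assumes Q: "MR m Q" and F: "GS m F" and G: "GS m G" shows "GS m (\<lambda>na sa. if Q na sa then F na sa else G na sa)"
proof -
  obtain t where t: "pureN t" "\<And>na sa. fin sa \<Longrightarrow> slen (F na sa) \<le> evn I0 na sa t" using GS_bound[OF F] by blast
  obtain u where u: "pureN u" "\<And>na sa. fin sa \<Longrightarrow> slen (G na sa) \<le> evn I0 na sa u" using GS_bound[OF G] by blast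
  have "MR m (\<lambda>na sa. (Q (ntl na) sa \<and> na 0 \<in> F (ntl na) sa) \<or> (\<not> Q (ntl na) sa \<and> na 0 \<in> G (ntl na) sa))"
    by (intro MR_or MR_and MR_not MR_tl[OF Q] MR_memI GN_var GS_tl F G)
  then have "MR m (\<lambda>na sa. na 0 \<in> (if Q (ntl na) sa then F (ntl na) sa else G (ntl na) sa))" by (rule MR_cong) simp
  moreover have "finite (if Q na sa then F na sa else G na sa) \<and> slen (if Q na sa then F na sa else G na sa) \<le> evn I0 na sa (Plus t u)"
    if "fin sa" for na sa
    using t(2)[OF that, of na] u(2)[OF that, of na] GS_fin[OF F that, of na] GS_fin[OF G that, of na] by simp
  ultimately show ?thesis unfolding GS_def using t(1) u(1) by (intro conjI exI[of _ "Plus t u"]) simp_all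
qed

lemma GN_if: assumes Q: "MR m Q" and F: "GN m F" and G: "GN m G" shows "GN m (\<lambda>na sa. if Q na sa then F na sa else G na sa)"
proof -
  obtain t where t: "pureN t" "\<And>na sa. fin sa \<Longrightarrow> F na sa \<le> evn I0 na sa t" using GN_bound[OF F] by blast
  obtain u where u: "pureN u" "\<And>na sa. fin sa \<Longrightarrow> G na sa \<le> evn I0 na sa u" using GN_bound[OF G] by blast
  have "MR m (\<lambda>na sa. (Q (ntl na) sa \<and> na 0 = F (ntl na) sa) \<or> (\<not> Q (ntl na) sa \<and> na 0 = G (ntl na) sa))"
    by (intro MR_or MR_and MR_not MR_tl[OF Q] MR_eqI GN_var GN_tl F G)
  then have "MR m (\<lambda>na sa. na 0 = (if Q (ntl na) sa then F (ntl na) sa else G (ntl na) sa))" by (rule MR_cong) simp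
  moreover have "(if Q na sa then F na sa else G na sa) \<le> evn I0 na sa (Plus t u)"
    if "fin sa" for na sa
    using t(2)[OF that, of na] u(2)[OF that, of na] by simp
  ultimately show ?thesis unfolding GN_def using t(1) u(1) by (intro conjI exI[of _ "Plus t u"]) simp_all
qed

lemma GN_modfn: assumes m: "m \<ge> 1" and f: "GN m f" and X: "GS m X" shows "GN m (\<lambda>na sa. mod_fn m (f na sa) (X na sa))"
proof -
  have c: "mod_fn m z A = card {n. n < z \<and> n \<in> A} mod m" for z A by (simp add: mod_fn_def conj_commute)
  have "MR m (\<lambda>na sa. card {n. n < f (ntl na) sa \<and> n \<in> X (ntl na) sa} mod m = na 0)"
    by (rule MR_modI[OF GN_tl[OF f] GN_var MR_memI[OF GN_var GS_tl[OF GS_tl[OF X]]]])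
  then have "MR m (\<lambda>na sa. na 0 = mod_fn m (f (ntl na) sa) (X (ntl na) sa))" unfolding c by (rule MR_cong) (rule eq_commute)
  moreover have "mod_fn m z A \<le> m" for z A using m mod_less_divisor[of m] by (simp add: mod_fn_def less_imp_le)
  ultimately show ?thesis unfolding GN_def by (intro conjI exI[of _ "numeral_t m"]) simp_all
qed

lemma GN_modc: assumes f: "GN m f" and p: "(p :: nat) \<ge> 1" shows "GN m (\<lambda>na sa. f na sa mod p)"
proof -
  obtain b where b: "pureN b" "\<And>na sa. fin sa \<Longrightarrow> f na sa \<le> evn I0 na sa b" using GN_bound[OF f] by blast
  have "MR m (\<lambda>na sa. na 0 < p \<and> (\<exists>q \<le> f (ntl na) sa. f (ntl na) sa = q * p + na 0))"
  proof (rule MR_and)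
    show "MR m (\<lambda>na sa. na 0 < p)" by (rule MR_lessI[OF GN_var GN_const])
    have v: "GN m (\<lambda>na sa. ntl na 0)" unfolding ntl_def by (rule GN_var)
    have "MR m (\<lambda>na sa. f (ntl (ntl na)) sa = na 0 * p + ntl na 0)"
      by (rule MR_eqI[OF GN_tl[OF GN_tl[OF f]] GN_add[OF GN_mult[OF GN_var GN_const] v]])
    then show "MR m (\<lambda>na sa. \<exists>q \<le> f (ntl na) sa. f (ntl na) sa = q * p + na 0)" by (rule MR_exI[OF GN_tl[OF f]])
  qed
  moreover have "(y = x mod p) \<longleftrightarrow> y < p \<and> (\<exists>q \<le> x. x = q * p + y)" for x y :: nat
  proof
    assume y: "y = x mod p"
    then have "x = (x div p) * p + y" by simp
    moreover have "y < p" using y p by simp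
    ultimately show "y < p \<and> (\<exists>q \<le> x. x = q * p + y)" using div_le_dividend by blast
  next
    assume "y < p \<and> (\<exists>q \<le> x. x = q * p + y)"
    then obtain q where "y < p" "x = q * p + y" by blast
    then show "y = x mod p" by simp
  qed
  ultimately have "MR m (\<lambda>na sa. na 0 = f (ntl na) sa mod p)" by (rule MR_cong)
  moreover have "f na sa mod p \<le> evn I0 na sa b" if "fin sa" for na sa
    using order_trans[OF mod_less_eq_dividend b(2)[OF that]] .
  ultimately show ?thesis unfolding GN_def using b(1) by blast
qed

lemma mod_fn_dvd: "p dvd m \<Longrightarrow> mod_fn p z X = mod_fn m z X mod p"
  by (simp add: mod_fn_def mod_mod_cancel)

text \<open>The class of modulus \<open>m\<close> computes the counting tables for every divisor
  \<open>p\<close>: an entry modulo \<open>p\<close> is the remainder of the count modulo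
  \<open>m\<close>.\<close>

lemma GS_ctab: assumes m: "m \<ge> 1" and p: "p dvd m" "p \<ge> 1" and X: "GS m X" shows "GS m (\<lambda>na sa. ctab p (X na sa))"
proof -
  obtain t where t: "pureN t" "\<And>na sa. fin sa \<Longrightarrow> slen (X na sa) \<le> evn I0 na sa t" using GS_bound[OF X] by blast
  have np: "GN m (\<lambda>na sa. npair (f na sa) (g na sa))" if "GN m f" "GN m g" for f g
    unfolding mpair_def Std_simps by (intro GN_add GN_mult GN_const that)
  have v: "GN m (\<lambda>na sa. ntl na 0)" unfolding ntl_def by (rule GN_var)
  have "MR m (\<lambda>na sa. \<exists>z \<le> slen (X (ntl na) sa). na 0 = npair z (mod_fn m z (X (ntl na) sa) mod p))"
    by (intro MR_exI MR_eqI np GN_modc GN_modfn m p(2) GN_slen GN_var v GS_tl[OF X] GS_tl[OF GS_tl[OF X]])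
  moreover have "w \<in> ctab p A \<longleftrightarrow> (\<exists>z \<le> slen A. w = npair z (mod_fn m z A mod p))" for w A
    unfolding ctab_def mod_fn_dvd[OF p(1)] by auto
  ultimately have "MR m (\<lambda>na sa. na 0 \<in> ctab p (X (ntl na) sa))" by (rule MR_cong)
  moreover have "slen (ctab p (X na sa)) \<le> evn I0 na sa (Plus (pairt t (numeral_t p)) One)" if "fin sa" for na sa
  proof (rule slen_props(3)[OF finite_ctab])
    fix w assume "w \<in> ctab p (X na sa)"
    then obtain z where z: "z \<le> slen (X na sa)" "w = npair z (mod_fn p z (X na sa))" by (auto simp: ctab_def)
    have "mod_fn p z (X na sa) \<le> p" using p(2) mod_less_divisor[of p] by (simp add: mod_fn_def less_imp_le)
    moreover have "z \<le> evn I0 na sa t" using z(1) t(2)[OF that] by (rule order_trans)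
    ultimately show "w < evn I0 na sa (Plus (pairt t (numeral_t p)) One)"
      unfolding z(2) by (auto simp: mpair_def pairt_def less_Suc_eq_le intro!: add_mono mult_le_mono)
  qed
  ultimately show ?thesis unfolding GS_def using t(1) finite_ctab
    by (intro conjI exI[of _ "Plus (pairt t (numeral_t p)) One"]) (simp_all)
qed

lemma MR_form_subst:
  assumes "sigB0 \<phi>" "pureF \<phi>" "\<forall>i. GN m (fa i)" "\<forall>i. GS m (Fa i)"
  shows "MR m (\<lambda>na sa. evf I0 (\<lambda>i. fa i na sa) (\<lambda>i. Fa i na sa) \<phi>)"
  by (rule MR_subst[OF MR_form[OF assms(1,2)] assms(3,4)])

lemma MR_form_subst1:
  assumes "sigB0 \<phi>" "pureF \<phi>" "\<forall>i. GN m (fa i)" "\<forall>i. GS m (Fa i)"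
  shows "MR m (\<lambda>na sa. evf I0 ((\<lambda>i. fa i (ntl na) sa)(x := na 0)) (\<lambda>i. Fa i (ntl na) sa) \<phi>)"
proof -
  let ?\<sigma> = "\<lambda>i na sa. ((\<lambda>i. fa i (ntl na) sa)(x := na 0)) i"
  have "GN m (?\<sigma> i)" for i by (cases "i = x") (simp_all add: GN_var GN_tl[OF assms(3)[rule_format]])
  then have "\<forall>i. GN m (?\<sigma> i)" by blast
  moreover have "\<forall>i. GS m (\<lambda>na sa. Fa i (ntl na) sa)" by (rule allI, rule GS_tl, rule assms(4)[rule_format])
  ultimately show ?thesis by (rule MR_form_subst[OF assms(1,2)])
qed

subsection \<open>The restricted ultrapower\<close>

text \<open>Indices are whole standard assignments, so the projections are functions of the class
  and act as the generic arguments. Assignments with infinite sets are among them; the locale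
  \<open>upow\<close> makes them negligible.\<close>

type_synonym ix = "(nat \<Rightarrow> nat) \<times> (nat \<Rightarrow> nat set)"

abbreviation tset :: "((nat \<Rightarrow> nat) \<Rightarrow> (nat \<Rightarrow> nat set) \<Rightarrow> bool) \<Rightarrow> ix set" where "tset P \<equiv> {d. P (fst d) (snd d)}"

definition MU :: "nat \<Rightarrow> ix set set \<Rightarrow> ((nat \<Rightarrow> nat) \<Rightarrow> (nat \<Rightarrow> nat set) \<Rightarrow> nat, (nat \<Rightarrow> nat) \<Rightarrow> (nat \<Rightarrow> nat set) \<Rightarrow> nat set) mdl" where
  "MU m U = \<lparr>mN = {f. GN m f}, mS = {F. GS m F}, mz = (\<lambda>na sa. 0), mo = (\<lambda>na sa. 1),
    ma = (\<lambda>f g na sa. f na sa + g na sa), mm = (\<lambda>f g na sa. f na sa * g na sa), mlen = (\<lambda>F na sa. slen (F na sa)),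
    mle = (\<lambda>f g. tset (\<lambda>na sa. f na sa \<le> g na sa) \<in> U), mmem = (\<lambda>f F. tset (\<lambda>na sa. f na sa \<in> F na sa) \<in> U),
    meq1 = (\<lambda>f g. tset (\<lambda>na sa. f na sa = g na sa) \<in> U), meq2 = (\<lambda>F G. tset (\<lambda>na sa. F na sa = G na sa) \<in> U)\<rparr>"

lemma MU_simps [simp]:
  "mN (MU m U) = {f. GN m f}" "mS (MU m U) = {F. GS m F}" "mle (MU m U) f g \<longleftrightarrow> tset (\<lambda>na sa. f na sa \<le> g na sa) \<in> U"
  "mmem (MU m U) f F \<longleftrightarrow> tset (\<lambda>na sa. f na sa \<in> F na sa) \<in> U" "meq1 (MU m U) f g \<longleftrightarrow> tset (\<lambda>na sa. f na sa = g na sa) \<in> U"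
  "meq2 (MU m U) F G \<longleftrightarrow> tset (\<lambda>na sa. F na sa = G na sa) \<in> U"
  by (simp_all add: MU_def)

lemma mev_MU: "pureN t \<Longrightarrow> mev (MU m U) fa Fa t = (\<lambda>na sa. evn I0 (\<lambda>i. fa i na sa) (\<lambda>i. Fa i na sa) t)"
  "pureS S \<Longrightarrow> mevs (MU m U) fa Fa S = (\<lambda>na sa. evs I0 (\<lambda>i. fa i na sa) (\<lambda>i. Fa i na sa) S)"
  by (induction t and S rule: nterm.induct sterm.induct) (auto simp: MU_def)

lemma valid_MU: "valid_env (MU m U) fa Fa \<longleftrightarrow> (\<forall>i. GN m (fa i)) \<and> (\<forall>i. GS m (Fa i))"
  by (simp add: valid_env_def)

text \<open>One theory for both characterizations: for \<open>m\<close> at least 2 it contains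
  V^0(m), and every finite part of VACC lies in it for a suitable \<open>m\<close>.\<close>

definition Tm :: "nat \<Rightarrow> form set" where "Tm m = V0 \<union> {MODax p | p. p dvd m \<and> p \<ge> 2}"

locale upow =
  fixes m :: nat and U :: "ix set set"
  assumes U: "ultra U" and D: "{d. fin (snd d)} \<in> U" and m: "m \<ge> 1"
begin

lemma U_mono: "A \<in> U \<Longrightarrow> A \<subseteq> B \<Longrightarrow> B \<in> U" using U unfolding ultra_def by blast
lemma U_int: "A \<in> U \<Longrightarrow> B \<in> U \<Longrightarrow> A \<inter> B \<in> U" using U unfolding ultra_def by blast
lemma U_compl: "A \<in> U \<or> - A \<in> U" using U unfolding ultra_def by blast
lemma U_empty: "{} \<notin> U" using U unfolding ultra_def by blast

lemma U_all: "(\<And>na sa. fin sa \<Longrightarrow> P na sa) \<Longrightarrow> tset P \<in> U"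
  by (rule U_mono[OF D]) auto

lemma U_imp: "tset (\<lambda>na sa. P na sa \<longrightarrow> Q na sa) \<in> U \<longleftrightarrow> (tset P \<in> U \<longrightarrow> tset Q \<in> U)"
proof
  assume "tset (\<lambda>na sa. P na sa \<longrightarrow> Q na sa) \<in> U"
  then show "tset P \<in> U \<longrightarrow> tset Q \<in> U" using U_mono[OF U_int, of _ "tset P" "tset Q"] by fastforce
next
  assume h: "tset P \<in> U \<longrightarrow> tset Q \<in> U"
  show "tset (\<lambda>na sa. P na sa \<longrightarrow> Q na sa) \<in> U"
  proof (cases "tset P \<in> U")
    case True
    then show ?thesis using h U_mono[of "tset Q" "tset (\<lambda>na sa. P na sa \<longrightarrow> Q na sa)"] by auto
  next
    case False
    then have "- tset P \<in> U" using U_compl by blast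
    then show ?thesis by (rule U_mono) auto
  qed
qed

lemma U_cong: assumes "tset E \<in> U" "\<And>na sa. E na sa \<Longrightarrow> P na sa = Q na sa" shows "tset P \<in> U \<longleftrightarrow> tset Q \<in> U"
proof -
  have "tset P \<in> U \<Longrightarrow> tset Q \<in> U" if "\<And>na sa. E na sa \<Longrightarrow> P na sa = Q na sa" for P Q
  proof -
    assume "tset P \<in> U"
    from U_int[OF this assms(1)] show "tset Q \<in> U" by (rule U_mono) (use that in auto)
  qed
  from this[of P Q] this[of Q P] show ?thesis using assms(2) by auto
qed

abbreviation "M \<equiv> MU m U"

text \<open>Valid for all formulas, unbounded quantifiers included: the parameters agree on a set of
  \<open>U\<close>, and a quantified element is the same on both sides. The equality axioms of the
  calculus are sound for this reason.\<close>

lemma congruence: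
  assumes E: "tset E \<in> U" 
  shows "pureF \<phi> \<Longrightarrow> (\<And>na sa i. E na sa \<Longrightarrow> fa i na sa = fa' i na sa) \<Longrightarrow> (\<And>na sa i. E na sa \<Longrightarrow> Fa i na sa = Fa' i na sa) \<Longrightarrow>
    msat M fa Fa \<phi> \<longleftrightarrow> msat M fa' Fa' \<phi>"
proof (induction \<phi> arbitrary: fa fa' Fa Fa')
  case (Eq1 s t)
  then show ?case by (simp add: mev_MU) (rule U_cong[OF E], simp)
next
  case (Le s t)
  then show ?case by (simp add: mev_MU) (rule U_cong[OF E], simp)
next
  case (Mem s t)
  then show ?case by (simp add: mev_MU) (rule U_cong[OF E], simp)
next
  case (Eq2 s t)
  then show ?case by (simp add: mev_MU) (rule U_cong[OF E], simp)
next
  case (Imp a b)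
  have "msat M fa Fa a \<longleftrightarrow> msat M fa' Fa' a" "msat M fa Fa b \<longleftrightarrow> msat M fa' Fa' b"
    by (rule Imp.IH; use Imp.prems in simp)+
  then show ?case by simp
next
  case (AllN x a)
  have "msat M (fa(x := n)) Fa a \<longleftrightarrow> msat M (fa'(x := n)) Fa' a" for n
    by (rule AllN.IH) (use AllN.prems in auto)
  then show ?case by simp
next
  case (AllS x a)
  have "msat M fa (Fa(x := n)) a \<longleftrightarrow> msat M fa' (Fa'(x := n)) a" for n
    by (rule AllS.IH) (use AllS.prems in auto)
  then show ?case by simp
qed simp

lemma upd_app: "(\<lambda>i. (fa(x := f)) i na sa) = (\<lambda>i. fa i na sa)(x := f na sa)"
  by (auto simp: fun_eq_iff)

text \<open>The quantifier step of Los' theorem. The least counterexample is a class function that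
  stays below \<open>t\<close> everywhere, by its default 0 where there is none, and it falsifies
  \<open>P\<close> wherever a counterexample exists.\<close>

lemma U_bounded:
  assumes t: "GN m t" and P: "MR m (\<lambda>na sa. P (na 0) (ntl na) sa)"
  shows "(\<forall>f. GN m f \<longrightarrow> tset (\<lambda>na sa. f na sa \<le> t na sa) \<in> U \<longrightarrow> tset (\<lambda>na sa. P (f na sa) na sa) \<in> U) \<longleftrightarrow>
    tset (\<lambda>na sa. \<forall>n \<le> t na sa. P n na sa) \<in> U" (is "?L \<longleftrightarrow> ?R")
proof
  let ?w = "\<lambda>na sa. if \<exists>n \<le> t na sa. \<not> P n na sa then LEAST n. \<not> P n na sa else 0"
  have w: "GN m ?w" by (rule GN_least[OF t MR_not[OF P]])
  have *: "\<not> P (LEAST n. \<not> P n na sa) na sa \<and> (LEAST n. \<not> P n na sa) \<le> t na sa" if ex: "\<exists>n \<le> t na sa. \<not> P n na sa" for na sa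
  proof -
    obtain n where n: "n \<le> t na sa" "\<not> P n na sa" using ex by blast
    show ?thesis
      by (rule conjI[OF LeastI[of "\<lambda>n. \<not> P n na sa", OF n(2)]
        order_trans[OF Least_le[of "\<lambda>n. \<not> P n na sa", OF n(2)] n(1)]])
  qed
  have le: "?w na sa \<le> t na sa" for na sa
  proof (cases "\<exists>n \<le> t na sa. \<not> P n na sa")
    case True
    show ?thesis unfolding if_P[OF True] using *[OF True] by (rule conjunct2)
  next
    case False
    show ?thesis unfolding if_not_P[OF False] by (rule le0)
  qed
  have bad: "\<not> P (?w na sa) na sa" if h: "\<exists>n \<le> t na sa. \<not> P n na sa" for na sa
    unfolding if_P[OF h] using *[OF h] by (rule conjunct1)
  assume h: ?L
  have "tset (\<lambda>na sa. ?w na sa \<le> t na sa) \<in> U" by (rule U_all) (rule le)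
  from h[rule_format, OF w this] show ?R
  proof (rule U_mono)
    show "tset (\<lambda>na sa. P (?w na sa) na sa) \<subseteq> tset (\<lambda>na sa. \<forall>n \<le> t na sa. P n na sa)"
    proof
      fix d assume d: "d \<in> tset (\<lambda>na sa. P (?w na sa) na sa)"
      have "\<not> (\<exists>n \<le> t (fst d) (snd d). \<not> P n (fst d) (snd d))"
        by (rule notI, erule notE[OF bad]) (use d in \<open>rule CollectD\<close>)
      then show "d \<in> tset (\<lambda>na sa. \<forall>n \<le> t na sa. P n na sa)" by blast
    qed
  qed
next
  assume h: ?R
  show ?L
  proof (intro allI impI)
    fix f assume "tset (\<lambda>na sa. f na sa \<le> t na sa) \<in> U"
    from U_int[OF this h] show "tset (\<lambda>na sa. P (f na sa) na sa) \<in> U" by (rule U_mono) blast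
  qed
qed

theorem los:
  "sigB0 \<phi> \<Longrightarrow> pureF \<phi> \<Longrightarrow> \<forall>i. GN m (fa i) \<Longrightarrow> \<forall>i. GS m (Fa i) \<Longrightarrow>
   msat M fa Fa \<phi> \<longleftrightarrow> tset (\<lambda>na sa. evf I0 (\<lambda>i. fa i na sa) (\<lambda>i. Fa i na sa) \<phi>) \<in> U"
proof (induction arbitrary: fa Fa rule: sigB0.induct)
  case 1 then show ?case by (simp add: U_empty)
next
  case (2 s t) then show ?case by (simp add: mev_MU)
next
  case (3 s t) then show ?case by (simp add: mev_MU)
next
  case (4 s t) then show ?case by (simp add: mev_MU)
next
  case (5 s t) then show ?case by (simp add: mev_MU)
next
  case (6 a b)
  then show ?case
    using U_imp[of "\<lambda>na sa. evf I0 (\<lambda>i. fa i na sa) (\<lambda>i. Fa i na sa) a" "\<lambda>na sa. evf I0 (\<lambda>i. fa i na sa) (\<lambda>i. Fa i na sa) b"]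
    by simp
next
  case (7 \<phi> x t)
  have p: "pureN t" "pureF \<phi>" using 7 by auto
  let ?t = "\<lambda>na sa. evn I0 (\<lambda>i. fa i na sa) (\<lambda>i. Fa i na sa) t"
  let ?\<phi> = "\<lambda>n na sa. evf I0 ((\<lambda>i. fa i na sa)(x := n)) (\<lambda>i. Fa i na sa) \<phi>"
  have IH: "msat M (fa(x := f)) Fa \<phi> \<longleftrightarrow> tset (\<lambda>na sa. ?\<phi> (f na sa) na sa) \<in> U" if "GN m f" for f
    unfolding upd_app[symmetric] by (rule 7) (use 7 p that in auto)
  have gt: "GN m ?t" using GN_evn[OF 7(5,6) p(1)] .
  have "msat M fa Fa (AllLe x t \<phi>) \<longleftrightarrow> (\<forall>f. GN m f \<longrightarrow> tset (\<lambda>na sa. f na sa \<le> ?t na sa) \<in> U \<longrightarrow> tset (\<lambda>na sa. ?\<phi> (f na sa) na sa) \<in> U)"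
    unfolding msat_bounded(1)[OF 7(2) p(1)] mev_MU(1)[OF p(1)] using IH by simp
  also have "\<dots> \<longleftrightarrow> tset (\<lambda>na sa. \<forall>n \<le> ?t na sa. ?\<phi> n na sa) \<in> U"
    by (rule U_bounded[OF gt MR_form_subst1[OF 7(1) p(2) 7(5,6)]])
  finally show ?case unfolding evf_bounded(1)[OF 7(2)] .
qed

lemma fin_Fa: "\<forall>i. GS m (Fa i) \<Longrightarrow> fin sa \<Longrightarrow> fin (\<lambda>i. Fa i na sa)"
  using GS_fin by blast

lemma models_basic: "models M basic_axioms" unfolding models_def valid_MU
proof (intro ballI allI impI)
  fix \<phi> and fa :: "nat \<Rightarrow> (nat \<Rightarrow> nat) \<Rightarrow> (nat \<Rightarrow> nat set) \<Rightarrow> nat"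
    and Fa :: "nat \<Rightarrow> (nat \<Rightarrow> nat) \<Rightarrow> (nat \<Rightarrow> nat set) \<Rightarrow> nat set"
  assume b: "\<phi> \<in> basic_axioms" and v: "(\<forall>i. GN m (fa i)) \<and> (\<forall>i. GS m (Fa i))"
  have "sigB0 \<phi>" using b unfolding basic_axioms_def by (elim insertE emptyE) simp_all
  moreover have p: "pureF \<phi>" using b pureT_V0m(1) by (auto simp: V0_def)
  moreover have "tset (\<lambda>na sa. evf I0 (\<lambda>i. fa i na sa) (\<lambda>i. Fa i na sa) \<phi>) \<in> U"
    by (rule U_all) (use msat_Std_basic[OF b fin_Fa] v msat_Std[OF p] in blast)
  ultimately show "msat M fa Fa \<phi>" using los[of \<phi> fa Fa] v by blast
qed

text \<open>The axiom starts with a string quantifier, so Los' theorem does not apply to it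
  directly. Forming the set separately at each assignment gives a class function, and for this
  function the remaining Sigma^B_0 formula is true at every finite assignment.\<close>

lemma models_comp: "models M comp_axioms" unfolding models_def valid_MU
proof (intro ballI allI impI)
  fix \<phi> and fa :: "nat \<Rightarrow> (nat \<Rightarrow> nat) \<Rightarrow> (nat \<Rightarrow> nat set) \<Rightarrow> nat"
    and Fa :: "nat \<Rightarrow> (nat \<Rightarrow> nat) \<Rightarrow> (nat \<Rightarrow> nat set) \<Rightarrow> nat set"
  assume b: "\<phi> \<in> comp_axioms" and v: "(\<forall>i. GN m (fa i)) \<and> (\<forall>i. GS m (Fa i))"
  obtain X a z \<psi> where h: "\<phi> = ExSb X (NVar a) (AllLt z (NVar a) (Iff (Mem (NVar z) (SVar X)) \<psi>))"
    "sigB0 \<psi>" "pureF \<psi>" "X \<notin> fvS \<psi>" "z \<noteq> a" using b unfolding comp_axioms_def by blast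
  define G where "G = (\<lambda>na sa. {n. n < fa a na sa \<and> evf I0 ((\<lambda>i. fa i na sa)(z := n)) (\<lambda>i. Fa i na sa) \<psi>})"
  have G: "GS m G" unfolding G_def by (rule GS_compr[OF _ MR_form_subst1[OF h(2,3)]]) (use v in auto)
  let ?\<chi> = "And (Le (Len (SVar X)) (NVar a)) (AllLt z (NVar a) (Iff (Mem (NVar z) (SVar X)) \<psi>))"
  have "tset (\<lambda>na sa. evf I0 (\<lambda>i. fa i na sa) (\<lambda>i. (Fa(X := G)) i na sa) ?\<chi>) \<in> U"
  proof (rule U_all)
    fix na :: "nat \<Rightarrow> nat" and sa :: "nat \<Rightarrow> nat set" assume "fin sa"
    have "slen (G na sa) \<le> fa a na sa" by (rule slen_props(3)) (auto simp: G_def)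
    then show "evf I0 (\<lambda>i. fa i na sa) (\<lambda>i. (Fa(X := G)) i na sa) ?\<chi>"
      unfolding upd_app using h(5) by (simp add: evf_upd(2)[OF h(4)] del: fun_upd_apply) (simp add: G_def)
  qed
  then have "msat M fa (Fa(X := G)) ?\<chi>" using los[of ?\<chi> fa "Fa(X := G)"] v G h by simp
  then show "msat M fa Fa \<phi>" unfolding h(1) using G by (simp del: MU_simps(3-6)) (auto)
qed

lemma models_mod: assumes p: "p dvd m" "p \<ge> 2" shows "models M {MODax p}" unfolding models_def valid_MU
proof (intro ballI allI impI)
  fix \<phi> and fa :: "nat \<Rightarrow> (nat \<Rightarrow> nat) \<Rightarrow> (nat \<Rightarrow> nat set) \<Rightarrow> nat"
    and Fa :: "nat \<Rightarrow> (nat \<Rightarrow> nat) \<Rightarrow> (nat \<Rightarrow> nat set) \<Rightarrow> nat set"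
  assume b: "\<phi> \<in> {MODax p}" and v: "(\<forall>i. GN m (fa i)) \<and> (\<forall>i. GS m (Fa i))"
  have ns: "normal Std" by (simp add: normal_def)
  have "msat M fa (Fa(0 := X, 1 := \<lambda>na sa. ctab p (X na sa))) (pm p 0 1)" if X: "GS m X" for X
  proof -
    let ?Y = "\<lambda>na sa. ctab p (X na sa)"
    have Y: "GS m ?Y" by (rule GS_ctab[OF m p(1) _ X]) (use p in simp)
    have "tset (\<lambda>na sa. evf I0 (\<lambda>i. fa i na sa) (\<lambda>i. (Fa(0 := X, 1 := ?Y)) i na sa) (pm p 0 1)) \<in> U"
    proof (rule U_all)
      fix na :: "nat \<Rightarrow> nat" and sa :: "nat \<Rightarrow> nat set"
      have "msat Std (\<lambda>i. fa i na sa) (\<lambda>i. (Fa(0 := X, 1 := ?Y)) i na sa) (pm p 0 1)"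
        unfolding msat_pm[OF ns] using ctab_modP[OF p(2), of "X na sa"] by simp
      then show "evf I0 (\<lambda>i. fa i na sa) (\<lambda>i. (Fa(0 := X, 1 := ?Y)) i na sa) (pm p 0 1)"
        using msat_Std[of "pm p 0 1"] by simp
    qed
    moreover have "\<forall>i. GS m ((Fa(0 := X, 1 := ?Y)) i)" using v X Y by simp
    ultimately show ?thesis using los[of "pm p 0 1" fa "Fa(0 := X, 1 := ?Y)"] v by simp
  qed
  moreover have "GS m (\<lambda>na sa. ctab p (X na sa))" if "GS m X" for X by (rule GS_ctab[OF m p(1) _ that]) (use p in simp)
  ultimately show "msat M fa Fa \<phi>" using b unfolding MODax_def phiMOD_pm by auto
qed

lemma models_Tm: "models M (Tm m)"
  using models_basic models_comp models_mod unfolding models_def Tm_def V0_def by blast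

lemma sound: assumes "prv (Tm m) \<phi>" "valid_env M fa Fa" shows "msat M fa Fa \<phi>"
proof (rule soundness[OF _ models_Tm _ _ _ _ _ assms])
  show "pureT (Tm m)" using pureT_V0m unfolding Tm_def by blast
  fix na sa u assume "valid_env M na sa" "pureN u"
  then show "mev M na sa u \<in> mN M" unfolding valid_MU mev_MU(1)[OF \<open>pureN u\<close>] using GN_evn[of m na sa u] by simp
next
  fix \<phi> na sa x a b assume p: "pureF \<phi>" and e: "meq1 M a b" and s: "msat M (na(x := a)) sa \<phi>"
  have E: "tset (\<lambda>na sa. a na sa = b na sa) \<in> U" using e by simp
  have "msat M (na(x := a)) sa \<phi> \<longleftrightarrow> msat M (na(x := b)) sa \<phi>" by (rule congruence[OF E p]) simp_all
  then show "msat M (na(x := b)) sa \<phi>" using s by simp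
next
  fix \<phi> na sa x a b assume p: "pureF \<phi>" and e: "meq2 M a b" and s: "msat M na (sa(x := a)) \<phi>"
  have E: "tset (\<lambda>na sa. a na sa = b na sa) \<in> U" using e by simp
  have "msat M na (sa(x := a)) \<phi> \<longleftrightarrow> msat M na (sa(x := b)) \<phi>" by (rule congruence[OF E p]) simp_all
  then show "msat M na (sa(x := b)) \<phi>" using s by simp
qed (simp_all add: U_mono[OF D])

text \<open>A true existential formula is already made true by a condition of the class.\<close>

definition forced :: "(nat \<Rightarrow> (nat \<Rightarrow> nat) \<Rightarrow> (nat \<Rightarrow> nat set) \<Rightarrow> nat) \<Rightarrow> (nat \<Rightarrow> (nat \<Rightarrow> nat) \<Rightarrow> (nat \<Rightarrow> nat set) \<Rightarrow> nat set) \<Rightarrow> form \<Rightarrow> bool" where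
  "forced fa Fa \<phi> \<longleftrightarrow> (\<exists>Q. MR m Q \<and> tset Q \<in> U \<and> (\<forall>na sa. fin sa \<longrightarrow> Q na sa \<longrightarrow> evf I0 (\<lambda>i. fa i na sa) (\<lambda>i. Fa i na sa) \<phi>))"

lemma forced_B0: "sigB0 \<phi> \<Longrightarrow> pureF \<phi> \<Longrightarrow> \<forall>i. GN m (fa i) \<Longrightarrow> \<forall>i. GS m (Fa i) \<Longrightarrow> msat M fa Fa \<phi> \<Longrightarrow> forced fa Fa \<phi>"
  unfolding forced_def using MR_form_subst[of \<phi> m fa Fa] los[of \<phi> fa Fa] by blast

lemma forced_ExS: assumes "GS m G" "forced fa (Fa(X := G)) \<phi>" shows "forced fa Fa (ExS X \<phi>)"
proof -
  obtain Q where Q: "MR m Q" "tset Q \<in> U" "\<And>na sa. fin sa \<Longrightarrow> Q na sa \<Longrightarrow> evf I0 (\<lambda>i. fa i na sa) (\<lambda>i. (Fa(X := G)) i na sa) \<phi>"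
    using assms(2) unfolding forced_def by blast
  have "evf I0 (\<lambda>i. fa i na sa) (\<lambda>i. Fa i na sa) (ExS X \<phi>)" if "fin sa" "Q na sa" for na sa
    using Q(3)[OF that] GS_fin[OF assms(1) that(1)] unfolding upd_app evf_conn by blast
  then show ?thesis unfolding forced_def using Q(1,2) by blast
qed

text \<open>Needed for bounded string quantifiers, where the length bound is conjoined to the rest
  of the formula.\<close>

lemma forced_And: assumes "forced fa Fa a" "forced fa Fa b" shows "forced fa Fa (And a b)"
proof -
  obtain Q where Q: "MR m Q" "tset Q \<in> U" "\<And>na sa. fin sa \<Longrightarrow> Q na sa \<Longrightarrow> evf I0 (\<lambda>i. fa i na sa) (\<lambda>i. Fa i na sa) a"
    using assms(1) unfolding forced_def by blast
  obtain R where R: "MR m R" "tset R \<in> U" "\<And>na sa. fin sa \<Longrightarrow> R na sa \<Longrightarrow> evf I0 (\<lambda>i. fa i na sa) (\<lambda>i. Fa i na sa) b"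
    using assms(2) unfolding forced_def by blast
  have "tset (\<lambda>na sa. Q na sa \<and> R na sa) \<in> U" using U_int[OF Q(2) R(2)] by (simp add: Int_def)
  then show ?thesis unfolding forced_def using MR_and[OF Q(1) R(1)] Q(3) R(3)
    by (intro exI[of _ "\<lambda>na sa. Q na sa \<and> R na sa"]) simp
qed

lemma forced_sig11: "sig11 \<phi> \<Longrightarrow> pureF \<phi> \<Longrightarrow> \<forall>i. GN m (fa i) \<Longrightarrow> \<forall>i. GS m (Fa i) \<Longrightarrow> msat M fa Fa \<phi> \<Longrightarrow> forced fa Fa \<phi>"
proof (induction arbitrary: Fa rule: sig11.induct)
  case (1 \<phi>) then show ?case by (rule forced_B0)
next
  case (2 \<phi> X)
  then obtain G where G: "GS m G" "msat M fa (Fa(X := G)) \<phi>" by auto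
  have v: "\<forall>i. GS m ((Fa(X := G)) i)" using 2 G by simp
  have p: "pureF \<phi>" using 2 by simp
  have "forced fa (Fa(X := G)) \<phi>" by (rule 2(2)[OF p 2(4) v G(2)])
  then show ?case by (rule forced_ExS[OF G(1)])
qed

lemma forced_sigB1: "sigB1 \<phi> \<Longrightarrow> pureF \<phi> \<Longrightarrow> \<forall>i. GN m (fa i) \<Longrightarrow> \<forall>i. GS m (Fa i) \<Longrightarrow> msat M fa Fa \<phi> \<Longrightarrow> forced fa Fa \<phi>"
proof (induction arbitrary: Fa rule: sigB1.induct)
  case (1 \<phi>) then show ?case by (rule forced_B0)
next
  case (2 \<phi> X t)
  then obtain G where G: "GS m G" "msat M fa (Fa(X := G)) \<phi>" "msat M fa (Fa(X := G)) (Le (Len (SVar X)) t)" by (auto simp del: msat.simps)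
  have v: "\<forall>i. GS m ((Fa(X := G)) i)" using 2 G by simp
  have p: "pureF \<phi>" "pureF (Le (Len (SVar X)) t)" using 2 by (simp_all add: ExSb_def)
  have "forced fa (Fa(X := G)) \<phi>" by (rule 2(3)[OF p(1) 2(5) v G(2)])
  moreover have "forced fa (Fa(X := G)) (Le (Len (SVar X)) t)" by (rule forced_B0[OF sigB0.intros(3) p(2) 2(5) v G(3)])
  ultimately show ?case unfolding ExSb_def by (intro forced_ExS[OF G(1)] forced_And)
qed

end

subsection \<open>The function classes\<close>

definition rtm :: "nat \<Rightarrow> nat \<Rightarrow> nterm \<Rightarrow> nterm" where
  "rtm k l t = subn (\<lambda>i. if i < k then NVar i else Zero) (trl l t)"

lemma rtm_inT: "inT k l (rtm k l t)"
  unfolding inT_def rtm_def fvN_sub fvS_sub using trl_simps(2,3)[of l t]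
  by (auto simp: pure_sub split: if_splits)

lemma rtm_eval:
  assumes "pureN t" "length xs = k" "length Xs = l"
  shows "evn I0 (nenv xs) (senv Xs) (rtm k l t) = evn I0 (nenv xs) (senv Xs) t"
proof -
  have "scut l (senv Xs) = senv Xs" using assms(3) by (auto simp: scut_def senv_def fun_eq_iff)
  moreover have "(\<lambda>i. evn I0 (nenv xs) (senv Xs) (if i < k then NVar i else Zero)) = nenv xs"
    using assms(2) by (auto simp: nenv_def fun_eq_iff)
  ultimately show ?thesis unfolding rtm_def ev_sub using trl_simps(1)[OF assms(1), of I0 "nenv xs" "senv Xs" l] by simp
qed

text \<open>Relations in AC^0(m) take the value as last argument, graphs in the class have it at
  index 0; this lemma and \<open>MR_lastD\<close> convert.\<close>

lemma MR_lastI: "MR m (\<lambda>na sa. R (na k) (lenv k na) sa) \<Longrightarrow> MR m (\<lambda>na sa. R (na 0) (lenv k (ntl na)) sa)"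
proof -
  assume h: "MR m (\<lambda>na sa. R (na k) (lenv k na) sa)"
  let ?\<sigma> = "\<lambda>i. if i = k then NVar 0 else NVar (Suc i)"
  have "MR m (\<lambda>na sa. R (evn I0 na sa (?\<sigma> k)) (lenv k (\<lambda>i. evn I0 na sa (?\<sigma> i))) sa)"
    using MR_subt[OF h, of ?\<sigma>] by simp
  moreover have "lenv k (\<lambda>i. evn I0 na sa (?\<sigma> i)) = lenv k (ntl na)" for na sa
    by (rule lenv_cong) (auto simp: ntl_def)
  ultimately show ?thesis by simp
qed

lemma MR_lastD: "MR m (\<lambda>na sa. R (na 0) (lenv k (ntl na)) sa) \<Longrightarrow> MR m (\<lambda>na sa. R (na k) (lenv k na) sa)"
proof -
  assume h: "MR m (\<lambda>na sa. R (na 0) (lenv k (ntl na)) sa)"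
  let ?\<sigma> = "\<lambda>i. if i = 0 then NVar k else NVar (i - 1)"
  have "MR m (\<lambda>na sa. R (evn I0 na sa (?\<sigma> 0)) (lenv k (ntl (\<lambda>i. evn I0 na sa (?\<sigma> i)))) sa)"
    using MR_subt[OF h, of ?\<sigma>] by simp
  moreover have "ntl (\<lambda>i. evn I0 na sa (?\<sigma> i)) = na" for na sa
    by (auto simp: ntl_def fun_eq_iff)
  ultimately show ?thesis by simp
qed

text \<open>One direction composes the function with the projections. In the other, the bounding
  term is restricted to the arguments by \<open>rtm\<close> and made a polynomial by
  \<open>ptm\<close>, and the bit graph gets its chain from \<open>MR_AC0m\<close>.\<close>

theorem FAC0S_GS: "FAC0S m k l F \<longleftrightarrow> GS m (\<lambda>na sa. F (lenv k na) (lenv l sa))"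
proof
  assume "FAC0S m k l F"
  then have h: "pbS k l F" "AC0m m (Suc k) l (\<lambda>ys Xs. last ys \<in> F (butlast ys) Xs)" by (simp_all add: FAC0S_def)
  have "MR m (\<lambda>na sa. na k \<in> F (lenv k na) (lenv l sa))" using AC0m_MR[OF h(2)] by simp
  from MR_lastI[of m "\<lambda>n ns sa. n \<in> F ns (lenv l sa)" k, OF this] have "goodF m (k, l, F)" using h(1) by (simp add: goodF_def)
  from GS_app[OF this, of "\<lambda>i na sa. na i" "\<lambda>i na sa. sa i"] show "GS m (\<lambda>na sa. F (lenv k na) (lenv l sa))"
    by (simp add: GN_var GS_var)
next
  assume h: "GS m (\<lambda>na sa. F (lenv k na) (lenv l sa))"
  obtain t where t: "pureN t" "\<And>na sa. fin sa \<Longrightarrow> slen (F (lenv k na) (lenv l sa)) \<le> evn I0 na sa t" using GS_bound[OF h] by blast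
  have "pbS k l F" unfolding pbS_def
  proof (intro exI[of _ "ptm k (rtm k l t)"] conjI allI impI ptm_simps(1))
    fix xs :: "nat list" and Xs :: "nat set list"
    assume x: "length xs = k" "length Xs = l" "\<forall>X\<in>set Xs. finite X"
    show "finite (F xs Xs)" using GS_fin[OF h fin_senv[OF x(3)], of "nenv xs"] x by (simp add: lenv_nenv)
    have "slen (F xs Xs) \<le> evn I0 (nenv xs) (senv Xs) t" using t(2)[OF fin_senv[OF x(3)], of "nenv xs"] x by (simp add: lenv_nenv)
    also have "\<dots> = evn I0 (nenv (xs @ map slen Xs)) (senv []) (ptm k (rtm k l t))"
      using ptm_simps(2)[of "rtm k l t" k l xs Xs "senv []"] rtm_inT[of k l t] rtm_eval[OF t(1) x(1,2)] x by (simp add: inT_def)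
    finally show "slen (F xs Xs) \<le> evn I0 (nenv (xs @ map slen Xs)) (senv []) (ptm k (rtm k l t))" .
  qed
  moreover have "MR m (\<lambda>na sa. na k \<in> F (lenv k na) (lenv l sa))"
    by (rule MR_lastD[of m "\<lambda>n ns sa. n \<in> F ns (lenv l sa)"]) (use h in \<open>simp add: GS_def\<close>)
  then have "AC0m m (Suc k) l (\<lambda>ys Xs. last ys \<in> F (butlast ys) Xs)" by (intro MR_AC0m) simp
  ultimately show "FAC0S m k l F" by (simp add: FAC0S_def)
qed

theorem FAC0N_GN: "FAC0N m k l f \<longleftrightarrow> GN m (\<lambda>na sa. f (lenv k na) (lenv l sa))"
proof
  assume "FAC0N m k l f"
  then have h: "pbN k l f" "AC0m m (Suc k) l (\<lambda>ys Xs. last ys = f (butlast ys) Xs)" by (simp_all add: FAC0N_def)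
  have "MR m (\<lambda>na sa. na k = f (lenv k na) (lenv l sa))" using AC0m_MR[OF h(2)] by simp
  from MR_lastI[of m "\<lambda>n ns sa. n = f ns (lenv l sa)" k, OF this]
  have "MR m (\<lambda>na sa. na 0 = f (lenv k (ntl na)) (lenv l sa))" .
  moreover obtain t where t: "polyterm t" "\<And>xs Xs. length xs = k \<Longrightarrow> length Xs = l \<Longrightarrow> \<forall>X\<in>set Xs. finite X \<Longrightarrow>
        f xs Xs \<le> evn I0 (nenv (xs @ map slen Xs)) (senv []) t"
    using h(1) unfolding pbN_def by blast
  let ?\<sigma> = "\<lambda>i. if i < k then NVar i else Len (SVar (i - k))"
  have "f (lenv k na) (lenv l sa) \<le> evn I0 na sa (subn ?\<sigma> t)" if "fin sa" for na sa
  proof -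
    have "f (lenv k na) (lenv l sa) \<le> evn I0 (nenv (lenv k na @ map slen (lenv l sa))) (senv []) t"
      by (rule t(2)) (use that in auto)
    also have "\<dots> \<le> evn I0 (\<lambda>i. evn I0 na sa (?\<sigma> i)) (senv []) t"
    proof (rule evn_mono)
      show "\<forall>i. nenv (lenv k na @ map slen (lenv l sa)) i \<le> evn I0 na sa (?\<sigma> i)"
        by (auto simp: nenv_def nth_append)
    qed (use poly_pure t(1) in blast)
    also have "\<dots> = evn I0 na sa (subn ?\<sigma> t)" using poly_sa[OF t(1)] by simp
    finally show ?thesis .
  qed
  moreover have "pureN (subn ?\<sigma> t)" by (rule pure_sub(1)) (use poly_pure[OF t(1)] in simp_all)
  ultimately show "GN m (\<lambda>na sa. f (lenv k na) (lenv l sa))" unfolding GN_def by blast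
next
  assume h: "GN m (\<lambda>na sa. f (lenv k na) (lenv l sa))"
  obtain t where t: "pureN t" "\<And>na sa. fin sa \<Longrightarrow> f (lenv k na) (lenv l sa) \<le> evn I0 na sa t" using GN_bound[OF h] by blast
  have "pbN k l f" unfolding pbN_def
  proof (intro exI[of _ "ptm k (rtm k l t)"] conjI allI impI ptm_simps(1))
    fix xs :: "nat list" and Xs :: "nat set list"
    assume x: "length xs = k" "length Xs = l" "\<forall>X\<in>set Xs. finite X"
    have "f xs Xs \<le> evn I0 (nenv xs) (senv Xs) t" using t(2)[OF fin_senv[OF x(3)], of "nenv xs"] x by (simp add: lenv_nenv)
    also have "\<dots> = evn I0 (nenv (xs @ map slen Xs)) (senv []) (ptm k (rtm k l t))"
      using ptm_simps(2)[of "rtm k l t" k l xs Xs "senv []"] rtm_inT[of k l t] rtm_eval[OF t(1) x(1,2)] x by (simp add: inT_def)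
    finally show "f xs Xs \<le> evn I0 (nenv (xs @ map slen Xs)) (senv []) (ptm k (rtm k l t))" .
  qed
  moreover have "MR m (\<lambda>na sa. na k = f (lenv k na) (lenv l sa))"
    by (rule MR_lastD[of m "\<lambda>n ns sa. n = f ns (lenv l sa)"]) (use h in \<open>simp add: GN_def\<close>)
  then have "AC0m m (Suc k) l (\<lambda>ys Xs. last ys = f (butlast ys) Xs)" by (intro MR_AC0m) simp
  ultimately show "FAC0N m k l f" by (simp add: FAC0N_def)
qed

subsection \<open>Definability\<close>

text \<open>A term above every number argument, hence a bound for parameters that are copies of
  arguments.\<close>

definition argsum :: "nat \<Rightarrow> nterm" where "argsum k = foldr (\<lambda>i. Plus (NVar i)) [0..<k] Zero"

lemma argsum: "inT k l (argsum k)" "i < k \<Longrightarrow> na i \<le> evn I na sa (argsum k)"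
proof -
  have *: "pureN (foldr (\<lambda>i. Plus (NVar i)) is Zero) \<and> fvNn (foldr (\<lambda>i. Plus (NVar i)) is Zero) = set is \<and>
    fvSn (foldr (\<lambda>i. Plus (NVar i)) is Zero) = {} \<and>
    (\<forall>i\<in>set is. na i \<le> evn I na sa (foldr (\<lambda>i. Plus (NVar i)) is Zero))" for "is" na
    by (induction "is") auto
  show "inT k l (argsum k)" "i < k \<Longrightarrow> na i \<le> evn I na sa (argsum k)"
    using *[of "[0..<k]"] by (auto simp: argsum_def inT_def)
qed

lemma nenv_app: "length xs = k \<Longrightarrow> nenv (xs @ [y]) = (nenv xs)(k := y)" "length Xs = l \<Longrightarrow> senv (Xs @ [Y]) = (senv Xs)(l := Y)"
  by (auto simp: nenv_def senv_def fun_eq_iff nth_append)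

lemma finite_set_eqI:
  assumes "finite A" "finite B" "slen B \<le> (b :: nat)"
  shows "slen A \<le> b \<and> (\<forall>x<b. x \<in> A \<longleftrightarrow> x \<in> B) \<longleftrightarrow> A = B"
proof
  assume h: "slen A \<le> b \<and> (\<forall>x<b. x \<in> A \<longleftrightarrow> x \<in> B)"
  have "x < b" if "x \<in> A \<or> x \<in> B" for x
    using that slen_props(1)[OF assms(1), of x] slen_props(1)[OF assms(2), of x] assms(3) h by linarith
  then show "A = B" using h by blast
qed (use assms in simp)

theorem GS_program:
  assumes m: "m \<ge> 2" and F: "GS m (\<lambda>na sa. F (lenv k na) (lenv l sa))"
  shows "\<exists>t \<theta> pr. okF k l t \<theta> pr \<and> (\<forall>xs Xs Y. inenv k l xs Xs \<longrightarrow> finite Y \<longrightarrow>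
     (msat Std (nenv xs) ((henv m k xs Xs l pr)(l := Y)) (compf k l t \<theta>) \<longleftrightarrow> Y = F xs Xs))"
proof -
  obtain b where b: "pureN b" "\<And>na sa. fin sa \<Longrightarrow> slen (F (lenv k na) (lenv l sa)) \<le> evn I0 na sa b" using GS_bound[OF F] by blast
  define t where "t = rtm k l b"
  have t: "inT k l t" unfolding t_def by (rule rtm_inT)
  \<comment> \<open>Two kinds of values are fed to the formula: the tested element, below
    \<open>t\<close>, and the arguments.\<close>
  define T where "T = Plus t (argsum k)"
  have T: "inT k l T" using t argsum(1)[of k l] by (simp add: T_def inT_def)
  let ?P = "\<lambda>na sa. na 0 \<in> F (lenv k (ntl na)) (lenv l sa)"
  have "MR m ?P" using F by (simp add: GS_def)
  from MR_prog[OF m this, of k l "[]" T] obtain pr \<theta> where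
    pr: "okp k l (Suc l) pr" "okt l pr \<theta>" "repr m k l T pr \<theta> ?P" using T by auto
  \<comment> \<open>\<theta> expects the tested element at \<open>k\<close> and a second copy of the
    arguments from \<open>k + 1\<close> on; the copy is redirected to the arguments
    themselves.\<close>
  define \<sigma> where "\<sigma> i = (if i < k then NVar i else if i = k then NVar k else if i - k - 1 < k then NVar (i - k - 1) else Zero)" for i
  have s: "pureN (\<sigma> i)" "fvSn (\<sigma> i) = {}" "fvNn (\<sigma> i) \<subseteq> {..k}" for i by (auto simp: \<sigma>_def)
  obtain \<theta>' where th: "is_subst \<theta> \<sigma> \<theta>'" using subst_ex pr(2) unfolding okt_def by blast
  have 1: "sigB0 \<theta>'" by (rule is_substD(2)[OF th])
  have 2: "pureF \<theta>'" by (rule is_substD(3)[OF th]) (use pr(2) s(1) in \<open>simp_all add: okt_def\<close>)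
  have 3: "fvN \<theta>' \<subseteq> {..k}" using is_substD(4)[OF th] s(3) by fast
  have "fvS \<theta>' \<subseteq> fvS \<theta>" by (rule is_substD(5)[OF th]) (simp add: s(2))
  then have 4: "fvS \<theta>' \<subseteq> {..<Suc l + 2 * length pr} - {l}" using pr(2) unfolding okt_def by (elim conjE) (rule order_trans)
  have ok: "okF k l t \<theta>' pr" unfolding okF_def using pr(1) t 1 2 3 4 by simp
  have "msat Std (nenv xs) ((henv m k xs Xs l pr)(l := Y)) (compf k l t \<theta>') \<longleftrightarrow> Y = F xs Xs"
    if x: "inenv k l xs Xs" and Y: "finite Y" for xs Xs Y
  proof -
    let ?h = "henv m k xs Xs l pr"
    have l: "length xs = k" "length Xs = l" "\<forall>X\<in>set Xs. finite X" using x by (simp_all add: inenv_def)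
    have lx: "lenv k (nenv xs) = xs" "lenv l (senv Xs) = Xs" using l by (simp_all add: lenv_nenv)
    let ?b = "evn I0 (nenv xs) (senv Xs) t"
    have fF: "finite (F xs Xs)" using GS_fin[OF F fin_senv[OF l(3)], of "nenv xs"] lx by simp
    have bF: "slen (F xs Xs) \<le> ?b"
      using b(2)[OF fin_senv[OF l(3)], of "nenv xs"] lx rtm_eval[OF b(1) l(1,2)] by (simp add: t_def)
    have et: "evn I0 (nenv xs) (?h(l := Y)) t = ?b"
      by (rule ev_coinc(1)) (use t l henv_lower(1)[OF l(2)] in \<open>auto simp: inT_def senv_def\<close>)
    have ev: "evf I0 ((nenv xs)(k := p)) (?h(l := Y)) \<theta>' \<longleftrightarrow> p \<in> F xs Xs" if p: "p < ?b" for p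
    proof -
      have "evf I0 ((nenv xs)(k := p)) (?h(l := Y)) \<theta>' = evf I0 ((nenv xs)(k := p)) ?h \<theta>'"
        by (rule evf_coinc) (use 4 in auto)
      also have "\<dots> = evf I0 (\<lambda>i. evn I0 ((nenv xs)(k := p)) ?h (\<sigma> i)) ?h \<theta>" by (rule is_substD(1)[OF th])
      also have "(\<lambda>i. evn I0 ((nenv xs)(k := p)) ?h (\<sigma> i)) = mixe k xs (p ## nenv xs)"
      proof
        fix i show "evn I0 ((nenv xs)(k := p)) ?h (\<sigma> i) = mixe k xs (p ## nenv xs) i"
        proof (cases "i \<le> k")
          case True then show ?thesis using l(1) by (auto simp: \<sigma>_def mixe_def nenv_def)
        next
          case False
          then obtain j where "i = Suc (k + j)" using less_imp_Suc_add[of k i] by auto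
          then show ?thesis using l(1) by (auto simp: \<sigma>_def nenv_def)
        qed
      qed
      also have "evf I0 (mixe k xs (p ## nenv xs)) ?h \<theta> = ?P (p ## nenv xs) (senv Xs)"
      proof (rule pr(3)[unfolded repr_def, rule_format, OF x])
        have "nenv xs i \<le> evn I0 (nenv xs) (senv Xs) (argsum k)" for i
          using argsum(2)[of i k "nenv xs"] l(1) by (cases "i < k") (auto simp: nenv_def)
        then have "nenv xs i \<le> evn I0 (nenv xs) (senv Xs) T" for i unfolding T_def evn.simps by (rule trans_le_add2)
        then show "(p ## nenv xs) i \<le> evn I0 (nenv xs) (senv Xs) T" for i
          using p by (cases i) (simp_all add: T_def)
      qed
      also have "?P (p ## nenv xs) (senv Xs) \<longleftrightarrow> p \<in> F xs Xs" using lx by simp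
      finally show ?thesis .
    qed
    have kt: "k \<notin> fvNn t" using t by (auto simp: inT_def)
    have pc: "pureF (compf k l t \<theta>')" using 2 t by (simp add: compf_def inT_def)
    have "msat Std (nenv xs) (?h(l := Y)) (compf k l t \<theta>') \<longleftrightarrow> slen Y \<le> ?b \<and> (\<forall>p<?b. p \<in> Y \<longleftrightarrow> p \<in> F xs Xs)"
      unfolding msat_Std[OF pc] unfolding compf_def evf_conn evf_bounded[OF kt] evf.simps evn.simps evs.simps et using ev by simp
    then show ?thesis using finite_set_eqI[OF Y fF bF] by simp
  qed
  then show ?thesis using ok by (intro exI[of _ t] exI[of _ \<theta>'] exI[of _ pr] conjI allI impI)
qed

text \<open>The computed strings are the solution of \<open>gam\<close> to which
  \<open>def_sol\<close> and \<open>def_iff\<close> refer.\<close>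

lemma henv_sol:
  assumes m: "m \<ge> 2" and ok: "okF k l t \<theta> pr" and x: "inenv k l xs Xs"
  shows "\<forall>i. senv Xs i \<in> mS Std" "\<forall>i. i \<notin> blk (Suc l) pr \<longrightarrow> henv m k xs Xs l pr i = senv Xs i"
    "\<forall>i. henv m k xs Xs l pr i \<in> mS Std" "msat Std (nenv xs) (henv m k xs Xs l pr) (gam m k (Suc l) pr)"
proof -
  have f: "fin (senv Xs)" by (rule fin_senv) (use x in \<open>simp add: inenv_def\<close>)
  show "\<forall>i. senv Xs i \<in> mS Std" using f by simp
  show "\<forall>i. henv m k xs Xs l pr i \<in> mS Std" unfolding henv_def using run_fin[OF f, of m k "nenv xs" "Suc l" pr] by simp
  show "\<forall>i. i \<notin> blk (Suc l) pr \<longrightarrow> henv m k xs Xs l pr i = senv Xs i" unfolding henv_def by (intro allI impI run_out)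
  have "okp k l (Suc l) pr" using ok unfolding okF_def by (elim conjE)
  then show "msat Std (nenv xs) (henv m k xs Xs l pr) (gam m k (Suc l) pr)"
    unfolding henv_def by (rule run_gam[OF m _ lessI f])
qed

theorem GS_definable:
  assumes m: "m \<ge> 2" and F: "GS m (\<lambda>na sa. F (lenv k na) (lenv l sa))"
  shows "definableS sigB1 (V0m m) k l F" "definableS sig11 (V0m m) k l F"
proof -
  obtain t \<theta> pr where ok: "okF k l t \<theta> pr" and
    c: "\<And>xs Xs Y. inenv k l xs Xs \<Longrightarrow> finite Y \<Longrightarrow>
     msat Std (nenv xs) ((henv m k xs Xs l pr)(l := Y)) (compf k l t \<theta>) \<longleftrightarrow> Y = F xs Xs" using GS_program[OF assms] by blast
  interpret v0 Std m by (rule v0_Std[OF m])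
  note d = def_simps[OF ok, of m]
  have ev: "evf I0 (nenv xs) (senv (Xs @ [Y])) (defS m k l t \<theta> pr) \<longleftrightarrow> Y = F xs Xs"
    "evf I0 (nenv xs) (senv (Xs @ [Y])) (defSU m k l t \<theta> pr) \<longleftrightarrow> Y = F xs Xs"
    if x: "inenv k l xs Xs" and Y: "finite Y" for xs Xs Y
  proof -
    have l: "length Xs = l" using x by (simp add: inenv_def)
    have YS: "Y \<in> mS Std" using Y by simp
    note s = def_sol(1,2)[OF ok henv_sol[OF m ok x] YS]
    show "evf I0 (nenv xs) (senv (Xs @ [Y])) (defS m k l t \<theta> pr) \<longleftrightarrow> Y = F xs Xs"
      unfolding msat_Std[OF d(1), symmetric] nenv_app(2)[OF l] s(1) by (rule c[OF x Y])
    show "evf I0 (nenv xs) (senv (Xs @ [Y])) (defSU m k l t \<theta> pr) \<longleftrightarrow> Y = F xs Xs"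
      unfolding msat_Std[OF d(5), symmetric] nenv_app(2)[OF l] s(2) by (rule c[OF x Y])
  qed
  show "definableS sigB1 (V0m m) k l F" unfolding definableS_def
    by (rule exI[of _ "defS m k l t \<theta> pr"], intro conjI d(1-4) def_prv(1)[OF ok m] allI impI, rule ev(1)[symmetric])
      (simp_all add: inenv_def)
  show "definableS sig11 (V0m m) k l F" unfolding definableS_def
    by (rule exI[of _ "defSU m k l t \<theta> pr"], intro conjI d(5-8) def_prv(2)[OF ok m] allI impI, rule ev(2)[symmetric])
      (simp_all add: inenv_def)
qed

theorem GN_definable:
  assumes m: "m \<ge> 2" and f: "GN m (\<lambda>na sa. f (lenv k na) (lenv l sa))"
  shows "definableN sigB1 (V0m m) k l f" "definableN sig11 (V0m m) k l f"
proof -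
  \<comment> \<open>A number is represented by the initial segment below it, whose length is that
    number.\<close>
  let ?F = "\<lambda>xs Xs. {n. n < f xs Xs}"
  have "GS m (\<lambda>na sa. {n. n < f (lenv k na) (lenv l sa) \<and> True})" by (rule GS_compr[OF f MR_const])
  then have "GS m (\<lambda>na sa. ?F (lenv k na) (lenv l sa))" by simp
  from GS_program[OF m this] obtain t \<theta> pr where ok: "okF k l t \<theta> pr" and
    c: "\<And>xs Xs Y. inenv k l xs Xs \<Longrightarrow> finite Y \<Longrightarrow>
     msat Std (nenv xs) ((henv m k xs Xs l pr)(l := Y)) (compf k l t \<theta>) \<longleftrightarrow> Y = ?F xs Xs" by blast
  interpret v0 Std m by (rule v0_Std[OF m])
  note d = def_simps[OF ok, of m]
  have sl: "slen {n. n < y} = y" for y :: nat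
  proof (rule antisym)
    show "slen {n. n < y} \<le> y" by (rule slen_props(3)) auto
    show "y \<le> slen {n. n < y}"
    proof (cases y)
      case (Suc z)
      then show ?thesis using slen_props(1)[of "{n. n < y}" z] by simp
    qed simp
  qed
  have ev: "evf I0 (nenv (xs @ [y])) (senv Xs) (defN m k l t \<theta> pr) \<longleftrightarrow> y = f xs Xs"
    "evf I0 (nenv (xs @ [y])) (senv Xs) (defNU m k l t \<theta> pr) \<longleftrightarrow> y = f xs Xs"
    if x: "inenv k l xs Xs" for xs Xs y
  proof -
    have l: "length xs = k" using x by (simp add: inenv_def)
    note s = def_iff[OF ok henv_sol[OF m ok x], of y]
    have e: "(\<exists>Y\<in>mS Std. msat Std (nenv xs) ((henv m k xs Xs l pr)(l := Y)) (compf k l t \<theta>) \<and> y = mlen Std Y) \<longleftrightarrow> y = f xs Xs"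
    proof -
      have "(\<exists>Y\<in>mS Std. msat Std (nenv xs) ((henv m k xs Xs l pr)(l := Y)) (compf k l t \<theta>) \<and> y = mlen Std Y) \<longleftrightarrow>
        (\<exists>Y. finite Y \<and> Y = ?F xs Xs \<and> y = slen Y)" using c[OF x] by auto
      then show ?thesis by (simp add: sl)
    qed
    show "evf I0 (nenv (xs @ [y])) (senv Xs) (defN m k l t \<theta> pr) \<longleftrightarrow> y = f xs Xs"
      unfolding msat_Std[OF d(9), symmetric] nenv_app(1)[OF l] s(1) by (rule e)
    show "evf I0 (nenv (xs @ [y])) (senv Xs) (defNU m k l t \<theta> pr) \<longleftrightarrow> y = f xs Xs"
      unfolding msat_Std[OF d(13), symmetric] nenv_app(1)[OF l] s(2) by (rule e)
  qed
  show "definableN sigB1 (V0m m) k l f" unfolding definableN_def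
    by (rule exI[of _ "defN m k l t \<theta> pr"], intro conjI d(9-12) def_prv(3)[OF ok m] allI impI, rule ev(1)[symmetric])
      (simp_all add: inenv_def)
  show "definableN sig11 (V0m m) k l f" unfolding definableN_def
    by (rule exI[of _ "defNU m k l t \<theta> pr"], intro conjI d(13-16) def_prv(4)[OF ok m] allI impI, rule ev(2)[symmetric])
      (simp_all add: inenv_def)
qed

subsection \<open>Witnessing\<close>

text \<open>Stated for an abstract class \<open>C\<close> to serve numbers and strings alike. The
  sets on which local answers are correct are given by conditions in \<open>MR\<close>, so the case
  distinction that glues them stays in \<open>C\<close>.\<close>

lemma patch:
  assumes m: "m \<ge> 1" and C_if: "\<And>Q G H. MR m Q \<Longrightarrow> C G \<Longrightarrow> C H \<Longrightarrow> C (\<lambda>na sa. if Q na sa then G na sa else H na sa)" and G0: "C G0"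
    and loc: "\<And>U. upow m U \<Longrightarrow> \<exists>Q G. MR m Q \<and> C G \<and> tset Q \<in> U \<and> (\<forall>na sa. fin sa \<longrightarrow> Q na sa \<longrightarrow> G na sa = f na sa)"
  shows "\<exists>G. C G \<and> (\<forall>na sa. fin sa \<longrightarrow> G na sa = f na sa)"
proof -
  define ok where "ok Q \<longleftrightarrow> MR m Q \<and> (\<exists>G. C G \<and> (\<forall>na sa. fin sa \<longrightarrow> Q na sa \<longrightarrow> G na sa = f na sa))" for Q
  define QQ where "QQ = {tset Q | Q. ok Q}"
  have "\<exists>A\<in>QQ. A \<in> U" if "ultra U" "{d. fin (snd d)} \<in> U" for U
  proof -
    have "upow m U" using that m by unfold_locales
    from loc[OF this] obtain Q G where "MR m Q" "C G" "tset Q \<in> U" "\<forall>na sa. fin sa \<longrightarrow> Q na sa \<longrightarrow> G na sa = f na sa" by blast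
    moreover have "ok Q" unfolding ok_def using calculation by (intro conjI exI[of _ G])
    ultimately show ?thesis unfolding QQ_def by blast
  qed
  from ultra_compact[of "{d. fin (snd d)}" QQ, OF this] obtain A where A: "A \<subseteq> QQ" "finite A" "{d. fin (snd d)} \<subseteq> \<Union>A" by blast
  have "\<exists>Q. ok Q \<and> \<Union>A \<subseteq> tset Q" using A(2,1)
  proof (induction A rule: finite_induct)
    case empty
    have "ok (\<lambda>na sa. False)" unfolding ok_def using MR_const G0 by (intro conjI exI[of _ G0]) simp_all
    then show ?case by (intro exI[of _ "\<lambda>na sa. False"]) simp
  next
    case (insert B A)
    then obtain Q where Q: "ok Q" "\<Union>A \<subseteq> tset Q" by blast
    obtain R where R: "ok R" "B = tset R" using insert.prems unfolding QQ_def by blast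
    obtain G where G: "C G" "\<forall>na sa. fin sa \<longrightarrow> Q na sa \<longrightarrow> G na sa = f na sa" using Q(1) unfolding ok_def by blast
    obtain H where H: "C H" "\<forall>na sa. fin sa \<longrightarrow> R na sa \<longrightarrow> H na sa = f na sa" using R(1) unfolding ok_def by blast
    have q: "MR m Q" "MR m R" using Q(1) R(1) by (simp_all add: ok_def)
    have "ok (\<lambda>na sa. Q na sa \<or> R na sa)" unfolding ok_def
      using MR_or[OF q] C_if[OF q(1) G(1) H(1)] G(2) H(2)
      by (intro conjI exI[of _ "\<lambda>na sa. if Q na sa then G na sa else H na sa"]) simp_all
    moreover have "\<Union>(insert B A) \<subseteq> tset (\<lambda>na sa. Q na sa \<or> R na sa)" using Q(2) R(2) by auto
    ultimately show ?case by (intro exI conjI)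
  qed
  then obtain Q where Q: "ok Q" "\<Union>A \<subseteq> tset Q" by blast
  obtain G where G: "C G" "\<forall>na sa. fin sa \<longrightarrow> Q na sa \<longrightarrow> G na sa = f na sa" using Q(1) unfolding ok_def by blast
  have "G na sa = f na sa" if "fin sa" for na sa
  proof -
    have "(na, sa) \<in> {d. fin (snd d)}" using that by simp
    then have "(na, sa) \<in> tset Q" using A(3) Q(2) by blast
    then show ?thesis using G(2) that by simp
  qed
  then show ?thesis using G(1) by blast
qed

lemma (in upow) forced_pos:
  "sigB1 \<phi> \<or> sig11 \<phi> \<Longrightarrow> pureF \<phi> \<Longrightarrow> \<forall>i. GN m (fa i) \<Longrightarrow> \<forall>i. GS m (Fa i) \<Longrightarrow> msat (MU m U) fa Fa \<phi> \<Longrightarrow> forced fa Fa \<phi>"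
  by (erule disjE) (rule forced_sigB1 forced_sig11; assumption)+

text \<open>A provable universal statement holds in the ultrapower and may be instantiated at the
  projections.\<close>

lemma (in upow) generic_closed:
  assumes "prv (Tm m) (closeN k (closeS l \<phi>))"
  shows "msat (MU m U) (\<lambda>i na sa. na i) (\<lambda>i na sa. sa i) \<phi>"
proof -
  have v: "\<forall>i. (\<lambda>na sa. na i) \<in> mN (MU m U)" "\<forall>i. (\<lambda>na sa. sa i) \<in> mS (MU m U)" by (simp_all add: GN_var GS_var)
  have "valid_env (MU m U) (\<lambda>i na sa. na i) (\<lambda>i na sa. sa i)" unfolding valid_MU by (simp add: GN_var GS_var)
  from sound[OF assms this] have "msat (MU m U) (\<lambda>i na sa. na i) (\<lambda>i na sa. sa i) (closeS l \<phi>)"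
    unfolding closeN_def by (rule msat_foldrN) (use v in simp_all)
  then show ?thesis unfolding closeS_def by (rule msat_foldrS) (use v in simp_all)
qed

text \<open>Where the forcing condition holds, \<phi> is true of \<open>G\<close> in the standard
  structure, and since \<phi> singles out the value of \<open>F\<close> there, \<open>G\<close>
  agrees with \<open>F\<close>.\<close>

theorem witness_S:
  assumes m: "m \<ge> 1" and \<phi>: "sigB1 \<phi> \<or> sig11 \<phi>" "pureF \<phi>" "fvN \<phi> \<subseteq> {..<k}" "fvS \<phi> \<subseteq> {..<Suc l}"
    and F: "\<And>xs Xs Y. length xs = k \<Longrightarrow> length Xs = l \<Longrightarrow> \<forall>X\<in>set Xs. finite X \<Longrightarrow> finite Y \<Longrightarrow>
        evf I0 (nenv xs) (senv (Xs @ [Y])) \<phi> \<Longrightarrow> Y = F xs Xs"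
    and p: "prv (Tm m) (closeN k (closeS l (ExUS l \<phi>)))"
  shows "GS m (\<lambda>na sa. F (lenv k na) (lenv l sa))"
proof -
  have "\<exists>G. GS m G \<and> (\<forall>na sa. fin sa \<longrightarrow> G na sa = F (lenv k na) (lenv l sa))"
  proof (rule patch[where C="GS m" and ?G0.0="\<lambda>na sa. {}", OF m GS_if GS_empty])
    fix U assume "upow m U"
    then interpret upow m U .
    let ?fa = "\<lambda>i (na :: nat \<Rightarrow> nat) (sa :: nat \<Rightarrow> nat set). na i" and ?Fa = "\<lambda>i (na :: nat \<Rightarrow> nat) (sa :: nat \<Rightarrow> nat set). sa i"
    have "msat (MU m U) ?fa ?Fa (ExS l \<phi>)" using generic_closed[OF p] unfolding ExUS_def Let_def msat_conn by (rule conjunct1)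
    then obtain G where G: "GS m G" "msat (MU m U) ?fa (?Fa(l := G)) \<phi>" unfolding msat_conn by (elim bexE) simp
    have v: "\<forall>i. GN m (?fa i)" "\<forall>i. GS m ((?Fa(l := G)) i)" using G(1) by (simp_all add: GN_var GS_var)
    obtain Q where Q: "MR m Q" "tset Q \<in> U"
      "\<And>na sa. fin sa \<Longrightarrow> Q na sa \<Longrightarrow> evf I0 (\<lambda>i. ?fa i na sa) (\<lambda>i. (?Fa(l := G)) i na sa) \<phi>"
      using forced_pos[OF \<phi>(1,2) v G(2)] unfolding forced_def by (elim exE conjE) simp
    have "G na sa = F (lenv k na) (lenv l sa)" if f: "fin sa" and q: "Q na sa" for na sa
    proof (rule F)
      show "finite (G na sa)" by (rule GS_fin[OF G(1) f])
      have "evf I0 (nenv (lenv k na)) (senv (lenv l sa @ [G na sa])) \<phi> = evf I0 (\<lambda>i. ?fa i na sa) (\<lambda>i. (?Fa(l := G)) i na sa) \<phi>"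
      proof (rule evf_coinc)
        show "\<forall>x\<in>fvN \<phi>. nenv (lenv k na) x = na x"
          by (intro ballI nenv_lenv(1) lessThan_iff[THEN iffD1] subsetD[OF \<phi>(3)])
        show "\<forall>X\<in>fvS \<phi>. senv (lenv l sa @ [G na sa]) X = (?Fa(l := G)) X na sa"
        proof
          fix X assume "X \<in> fvS \<phi>"
          then have "X < Suc l" using \<phi>(4) by blast
          then show "senv (lenv l sa @ [G na sa]) X = (?Fa(l := G)) X na sa"
            unfolding nenv_app(2)[OF lenv_simps(1)] by (auto simp: less_Suc_eq nenv_lenv(2))
        qed
      qed
      then show "evf I0 (nenv (lenv k na)) (senv (lenv l sa @ [G na sa])) \<phi>" using Q(3)[OF f q] by (rule iffD2)
    qed (use f in auto)
    then show "\<exists>Q G. MR m Q \<and> GS m G \<and> tset Q \<in> U \<and> (\<forall>na sa. fin sa \<longrightarrow> Q na sa \<longrightarrow> G na sa = F (lenv k na) (lenv l sa))"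
      using Q(1,2) G(1) by (intro exI[of _ Q] exI[of _ G] conjI allI impI)
  qed
  then obtain G where "GS m G" "\<And>na sa. fin sa \<Longrightarrow> F (lenv k na) (lenv l sa) = G na sa" by (elim exE conjE) simp
  then show ?thesis by (rule GS_cong)
qed

theorem witness_N:
  assumes m: "m \<ge> 1" and \<phi>: "sigB1 \<phi> \<or> sig11 \<phi>" "pureF \<phi>" "fvN \<phi> \<subseteq> {..<Suc k}" "fvS \<phi> \<subseteq> {..<l}"
    and F: "\<And>xs Xs y. length xs = k \<Longrightarrow> length Xs = l \<Longrightarrow> \<forall>X\<in>set Xs. finite X \<Longrightarrow>
        evf I0 (nenv (xs @ [y])) (senv Xs) \<phi> \<Longrightarrow> y = f xs Xs"
    and p: "prv (Tm m) (closeN k (closeS l (ExUN k \<phi>)))"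
  shows "GN m (\<lambda>na sa. f (lenv k na) (lenv l sa))"
proof -
  have "\<exists>g. GN m g \<and> (\<forall>na sa. fin sa \<longrightarrow> g na sa = f (lenv k na) (lenv l sa))"
  proof (rule patch[where C="GN m" and ?G0.0="\<lambda>na sa. 0", OF m GN_if GN_const])
    fix U assume "upow m U"
    then interpret upow m U .
    let ?fa = "\<lambda>i (na :: nat \<Rightarrow> nat) (sa :: nat \<Rightarrow> nat set). na i" and ?Fa = "\<lambda>i (na :: nat \<Rightarrow> nat) (sa :: nat \<Rightarrow> nat set). sa i"
    have "msat (MU m U) ?fa ?Fa (ExN k \<phi>)" using generic_closed[OF p] unfolding ExUN_def Let_def msat_conn by (rule conjunct1)
    then obtain g where g: "GN m g" "msat (MU m U) (?fa(k := g)) ?Fa \<phi>" unfolding msat_conn by (elim bexE) simp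
    have v: "\<forall>i. GN m ((?fa(k := g)) i)" "\<forall>i. GS m (?Fa i)" using g(1) by (simp_all add: GN_var GS_var)
    obtain Q where Q: "MR m Q" "tset Q \<in> U"
      "\<And>na sa. fin sa \<Longrightarrow> Q na sa \<Longrightarrow> evf I0 (\<lambda>i. (?fa(k := g)) i na sa) (\<lambda>i. ?Fa i na sa) \<phi>"
      using forced_pos[OF \<phi>(1,2) v g(2)] unfolding forced_def by (elim exE conjE) simp
    have "g na sa = f (lenv k na) (lenv l sa)" if fs: "fin sa" and q: "Q na sa" for na sa
    proof (rule F)
      have "evf I0 (nenv (lenv k na @ [g na sa])) (senv (lenv l sa)) \<phi> = evf I0 (\<lambda>i. (?fa(k := g)) i na sa) (\<lambda>i. ?Fa i na sa) \<phi>"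
      proof (rule evf_coinc)
        show "\<forall>x\<in>fvS \<phi>. senv (lenv l sa) x = sa x"
          by (intro ballI nenv_lenv(2) lessThan_iff[THEN iffD1] subsetD[OF \<phi>(4)])
        show "\<forall>x\<in>fvN \<phi>. nenv (lenv k na @ [g na sa]) x = (?fa(k := g)) x na sa"
        proof
          fix x assume "x \<in> fvN \<phi>"
          then have "x < Suc k" using \<phi>(3) by blast
          then show "nenv (lenv k na @ [g na sa]) x = (?fa(k := g)) x na sa"
            unfolding nenv_app(1)[OF lenv_simps(1)] by (auto simp: less_Suc_eq nenv_lenv(1))
        qed
      qed
      then show "evf I0 (nenv (lenv k na @ [g na sa])) (senv (lenv l sa)) \<phi>" using Q(3)[OF fs q] by (rule iffD2)
    qed (use fs in auto)
    then show "\<exists>Q g. MR m Q \<and> GN m g \<and> tset Q \<in> U \<and> (\<forall>na sa. fin sa \<longrightarrow> Q na sa \<longrightarrow> g na sa = f (lenv k na) (lenv l sa))"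
      using Q(1,2) g(1) by (intro exI[of _ Q] exI[of _ g] conjI allI impI)
  qed
  then obtain g where "GN m g" "\<And>na sa. fin sa \<Longrightarrow> f (lenv k na) (lenv l sa) = g na sa" by (elim exE conjE) simp
  then show ?thesis by (rule GN_cong)
qed

subsection \<open>The characterizations\<close>

lemma definable_mono:
  "definableS cls T k l F \<Longrightarrow> T \<subseteq> T' \<Longrightarrow> definableS cls T' k l F"
  "definableN cls T k l f \<Longrightarrow> T \<subseteq> T' \<Longrightarrow> definableN cls T' k l f"
proof -
  show "definableS cls T k l F \<Longrightarrow> T \<subseteq> T' \<Longrightarrow> definableS cls T' k l F"
    unfolding definableS_def by (elim exE conjE, rule exI, intro conjI, assumption+, rule prv_mono)
  show "definableN cls T k l f \<Longrightarrow> T \<subseteq> T' \<Longrightarrow> definableN cls T' k l f"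
    unfolding definableN_def by (elim exE conjE, rule exI, intro conjI, assumption+, rule prv_mono)
qed

lemma theory_mono: "m \<ge> 2 \<Longrightarrow> V0m m \<subseteq> Tm m" "m \<ge> 2 \<Longrightarrow> V0m m \<subseteq> VACC"
  by (auto simp: V0m_def Tm_def VACC_def)

lemma VACC_modulus:
  assumes "prv VACC \<phi>" shows "\<exists>m\<ge>2. prv (Tm m) \<phi>"
proof -
  obtain T where T: "T \<subseteq> VACC" "finite T" "prv T \<phi>" using prv_finite[OF assms] by blast
  have "\<forall>\<psi>\<in>T. \<exists>p\<ge>2. \<psi> \<in> V0 \<or> \<psi> = MODax p" using T(1) unfolding VACC_def by blast
  then obtain p where p: "\<And>\<psi>. \<psi> \<in> T \<Longrightarrow> p \<psi> \<ge> 2 \<and> (\<psi> \<in> V0 \<or> \<psi> = MODax (p \<psi>))" by metis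
  \<comment> \<open>The factor 2 keeps the modulus at least 2 when the product is empty. An axiom of
    V^0 in \<open>T\<close> may contribute an arbitrary factor from 2 on, which only makes the
    modulus a larger multiple.\<close>
  let ?m = "2 * prod p T"
  have "prod p T \<noteq> 0"
  proof
    assume "prod p T = 0"
    then obtain \<psi> where "\<psi> \<in> T" "p \<psi> = 0" using prod_zero_iff[OF T(2), of p] by blast
    then show False using p[of \<psi>] by simp
  qed
  then have "?m \<ge> 2" by simp
  moreover have "T \<subseteq> Tm ?m"
  proof
    fix \<psi> assume \<psi>: "\<psi> \<in> T"
    have "p \<psi> dvd ?m" by (rule dvd_mult) (rule dvd_prodI[OF T(2) \<psi>])
    then show "\<psi> \<in> Tm ?m" using p[OF \<psi>] unfolding Tm_def by blast
  qed
  ultimately show ?thesis using prv_mono[OF T(3)] by blast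
qed

text \<open>\<open>P\<close> records which moduli may come out: only \<open>m\<close> itself for
  V^0(m), any modulus for VACC. Assumption \<open>red\<close> moves a proof into a single theory
  \<open>Tm m\<close>.\<close>

lemma definable_FAC0:
  assumes cls: "\<And>\<phi>. cls \<phi> \<Longrightarrow> sigB1 \<phi> \<or> sig11 \<phi>" and red: "\<And>\<phi>. prv T \<phi> \<Longrightarrow> \<exists>m. P m \<and> m \<ge> 2 \<and> prv (Tm m) \<phi>"
  shows "definableS cls T k l F \<Longrightarrow> \<exists>m. P m \<and> m \<ge> 2 \<and> FAC0S m k l F"
    "definableN cls T k l f \<Longrightarrow> \<exists>m. P m \<and> m \<ge> 2 \<and> FAC0N m k l f"
proof -
  assume "definableS cls T k l F"
  then obtain \<phi> where \<phi>: "cls \<phi>" "pureF \<phi>" "fvN \<phi> \<subseteq> {..<k}" "fvS \<phi> \<subseteq> {..<Suc l}"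
    "\<forall>xs Xs Y. length xs = k \<longrightarrow> length Xs = l \<longrightarrow> (\<forall>X\<in>set Xs. finite X) \<longrightarrow> finite Y \<longrightarrow>
        (Y = F xs Xs \<longleftrightarrow> evf I0 (nenv xs) (senv (Xs @ [Y])) \<phi>)" "prv T (closeN k (closeS l (ExUS l \<phi>)))"
    unfolding definableS_def by (elim exE conjE)
  obtain m where m: "P m" "m \<ge> 2" "prv (Tm m) (closeN k (closeS l (ExUS l \<phi>)))" using red[OF \<phi>(6)] by (elim exE conjE)
  have "GS m (\<lambda>na sa. F (lenv k na) (lenv l sa))"
    by (rule witness_S[OF _ cls[OF \<phi>(1)] \<phi>(2-4) _ m(3)]) (use m(2) \<phi>(5) in simp_all)
  then show "\<exists>m. P m \<and> m \<ge> 2 \<and> FAC0S m k l F" using m(1,2) unfolding FAC0S_GS by (intro exI[of _ m] conjI)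
next
  assume "definableN cls T k l f"
  then obtain \<phi> where \<phi>: "cls \<phi>" "pureF \<phi>" "fvN \<phi> \<subseteq> {..<Suc k}" "fvS \<phi> \<subseteq> {..<l}"
    "\<forall>xs Xs y. length xs = k \<longrightarrow> length Xs = l \<longrightarrow> (\<forall>X\<in>set Xs. finite X) \<longrightarrow>
        (y = f xs Xs \<longleftrightarrow> evf I0 (nenv (xs @ [y])) (senv Xs) \<phi>)" "prv T (closeN k (closeS l (ExUN k \<phi>)))"
    unfolding definableN_def by (elim exE conjE)
  obtain m where m: "P m" "m \<ge> 2" "prv (Tm m) (closeN k (closeS l (ExUN k \<phi>)))" using red[OF \<phi>(6)] by (elim exE conjE)
  have "GN m (\<lambda>na sa. f (lenv k na) (lenv l sa))"
    by (rule witness_N[OF _ cls[OF \<phi>(1)] \<phi>(2-4) _ m(3)]) (use m(2) \<phi>(5) in simp_all)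
  then show "\<exists>m. P m \<and> m \<ge> 2 \<and> FAC0N m k l f" using m(1,2) unfolding FAC0N_GN by (intro exI[of _ m] conjI)
qed

lemma V0m_iff:
  assumes m: "m \<ge> 2" and cls: "cls = sigB1 \<or> cls = sig11"
  shows "definableS cls (V0m m) k l F \<longleftrightarrow> FAC0S m k l F" "definableN cls (V0m m) k l f \<longleftrightarrow> FAC0N m k l f"
proof -
  have c: "sigB1 \<phi> \<or> sig11 \<phi>" if "cls \<phi>" for \<phi> using cls that by blast
  have r: "\<exists>n. n = m \<and> n \<ge> 2 \<and> prv (Tm n) \<phi>" if "prv (V0m m) \<phi>" for \<phi>
    using prv_mono[OF that theory_mono(1)[OF m]] m by simp
  note d = definable_FAC0[where P = "\<lambda>n. n = m" and T = "V0m m" and cls = cls, OF c r]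
  show "definableS cls (V0m m) k l F \<longleftrightarrow> FAC0S m k l F"
    using d(1)[of k l F] GS_definable[OF m, of F k l] cls unfolding FAC0S_GS by auto
  show "definableN cls (V0m m) k l f \<longleftrightarrow> FAC0N m k l f"
    using d(2)[of k l f] GN_definable[OF m, of f k l] cls unfolding FAC0N_GN by auto
qed

lemma VACC_iff:
  assumes cls: "cls = sigB1 \<or> cls = sig11"
  shows "definableS cls VACC k l F \<longleftrightarrow> FACCS k l F" "definableN cls VACC k l f \<longleftrightarrow> FACCN k l f"
proof -
  have c: "sigB1 \<phi> \<or> sig11 \<phi>" if "cls \<phi>" for \<phi> using cls that by blast
  have r: "\<exists>m. True \<and> m \<ge> 2 \<and> prv (Tm m) \<phi>" if "prv VACC \<phi>" for \<phi> using VACC_modulus[OF that] by simp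
  note d = definable_FAC0[where P = "\<lambda>_. True" and T = VACC and cls = cls, OF c r]
  show "definableS cls VACC k l F \<longleftrightarrow> FACCS k l F"
    unfolding FACCS_def using d(1)[of k l F] V0m_iff(1)[OF _ cls, of _ k l F] definable_mono(1)[OF _ theory_mono(2), of cls _ k l F]
    by blast
  show "definableN cls VACC k l f \<longleftrightarrow> FACCN k l f"
    unfolding FACCN_def using d(2)[of k l f] V0m_iff(2)[OF _ cls, of _ k l f] definable_mono(2)[OF _ theory_mono(2), of cls _ k l f]
    by blast
qed

theorem mainTheorem11:
  shows "(\<forall>m\<ge>2. \<forall>k l.
            (\<forall>F. (definableS sig11 (V0m m) k l F \<longleftrightarrow> FAC0S m k l F) \<and>
                 (definableS sigB1 (V0m m) k l F \<longleftrightarrow> FAC0S m k l F)) \<and>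
            (\<forall>f. (definableN sig11 (V0m m) k l f \<longleftrightarrow> FAC0N m k l f) \<and>
                 (definableN sigB1 (V0m m) k l f \<longleftrightarrow> FAC0N m k l f))) \<and>
         (\<forall>k l.
            (\<forall>F. (definableS sig11 VACC k l F \<longleftrightarrow> FACCS k l F) \<and>
                 (definableS sigB1 VACC k l F \<longleftrightarrow> FACCS k l F)) \<and>
            (\<forall>f. (definableN sig11 VACC k l f \<longleftrightarrow> FACCN k l f) \<and>
                 (definableN sigB1 VACC k l f \<longleftrightarrow> FACCN k l f)))"
  using V0m_iff VACC_iff by simp

end
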